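(* Let $d\ge2$, let $\varphi\in L^2(\nu)$ satisfy Assumption (A) (stated in the context), and for even $\ell\ge2$ let $$X_\ell=\int_{\mathbb S^d}\varphi(T_\ell(x))\,dx,\qquad \tilde X_\ell=\frac{X_\ell-\mathbb E[X_\ell]}{\sqrt{\operatorname{Var}(X_\ell)}}.$$ Then for every $k\in\mathbb N$ and $n\ge1$ there exists $\tilde C_{n,k,d}>0$ such that $$\sup_{\ell\ \mathrm{even}}\mathbb E\big[|D^{(k)}\tilde X_\ell|^n_{H^{\otimes k}}\big]\le\tilde C_{n,k,d}\quad\text{and}\quad \sup_{\ell\ \mathrm{even}}\mathbb E\big[|D^{(k)}L\tilde X_\ell|^n_{H^{\otimes k}}\big]\le\tilde C_{n,k,d}.$$
   Context: Random hyperspherical harmonics. $\mathbb S^d\subset\mathbb R^{d+1}$ is the unit sphere, $dx$ its Lebesgue (surface) measure, with total mass $\mu_d=2\pi^{(d+1)/2}/\Gamma(\frac{d+1}{2})$. For $\ell\ge1$, $n_{\ell;d}=\frac{2\ell+d-1}{\ell}\binom{\ell+d-2}{\ell-1}$ is the dimension of the eigenspace of the Laplacian $\Delta_{\mathbb S^d}$ with eigenvalue $-\ell(\ell+d-1)$, $(Y_{\ell,m;d})_{m=1}^{n_{\ell;d}}$ is a real-valued $L^2(\mathbb S^d)$-orthonormal basis of it, and $G_{\ell;d}$ is the $\ell$-th Gegenbauer polynomial normalized by $G_{\ell;d}(1)=1$, i.e. the polynomial of degree $\ell$ with $\frac{\mu_d}{n_{\ell;d}}\sum_{m}Y_{\ell,m;d}(x)Y_{\ell,m;d}(y)=G_{\ell;d}(\langle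 x,y\rangle)$ for $x,y\in\mathbb S^d$. $T_\ell$ is the centered Gaussian field on $\mathbb S^d$ with covariance $\mathbb E[T_\ell(x)T_\ell(y)]=G_{\ell;d}(\langle x,y\rangle)$, realized as $T_\ell(x)=\int_{\mathbb S^d}\sqrt{\tfrac{n_{\ell;d}}{\mu_d}}\,G_{\ell;d}(\langle x,y\rangle)\,W(dy)$, where $W$ is a Gaussian white noise on $\mathbb S^d$: centered Gaussian with $\mathbb E[W(A)W(B)]=\mathrm{Leb}(A\cap B)$. Malliavin calculus on the sphere. Let $H=L^2(\mathbb S^d,dx)$ and $T(g)=\int g\,dW$, $g\in H$. For $F=f(T(g_1),\dots,T(g_m))$ with $f$ smooth with derivatives of polynomial growth, $D^{(k)}F=\sum_{i_1,\dots,i_k=1}^m\frac{\partial^kf}{\partial x_{i_1}\cdots\partial x_{i_k}}(T(g_1),\dots,T(g_m))\,g_{i_1}\otimes\cdots\otimes g_{i_k}\in L^2(\Omega;H^{\otimes k})$; $D^{(k)}$ is extended by closure, $D^{(0)}F=F$ with $|\cdot|_{H^{\otimes0}}$ the absolute value, and $|\cdot|_{H^{\otimes k}}$ is the norm of $H^{\otimes k}$. For $F$ square integrable and measurable with respect to $\sigma(T(g):g\in H)$, with Wiener chaos decomposition $F=\sum_{q\ge0}J_q(F)$ ($J_q$ the projection on the $q$-th Wiener chaos, i.e. the closed span in $L^2$ of $\{H_q(T(g)):\|g\|_H=1\}$), the Ornstein–Uhlenbeck operator is $LF=-\sum_{q\ge1}qJ_q(F)$, defined when $\sum_qq^2\mathbb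 E[J_q(F)^2]<\infty$. One-dimensional Malliavin calculus. $\nu$ is the standard Gaussian law on $\mathbb R$, $Z\sim\nu$. $H_q(x)=(-1)^qe^{x^2/2}\frac{d^q}{dx^q}e^{-x^2/2}$ is the $q$-th Hermite polynomial, $H_0=1$. For $\varphi\in L^2(\nu)$, $b_q=\mathbb E[\varphi(Z)H_q(Z)]$, so $\varphi(Z)=\sum_{q\ge0}\frac{b_q}{q!}H_q(Z)$ in $L^2(\mathbb P)$. $\varphi(Z)\in Dom(L)$ means $\sum_q q^2\frac{b_q^2}{q!}<\infty$, and then $L\varphi(Z)=-\sum_q q\frac{b_q}{q!}H_q(Z)$. For $k\in\mathbb N$, $p\ge1$, $\mathbb D^{k,p}$ is the closure of $\{f(Z): f\in C^\infty \text{ with } f \text{ and all its derivatives of polynomial growth}\}$ with respect to the norm $\big(\sum_{j=0}^k\mathbb E|f^{(j)}(Z)|^p\big)^{1/p}$, and $D^k$ is the closed extension of $f(Z)\mapsto f^{(k)}(Z)$. Assumption (A) on $\varphi\in L^2(\nu)$: (i) $b_2\ne0$; (ii) $\varphi(Z)\in Dom(L)$ and $\varphi(Z),L\varphi(Z)\in\bigcap_{k\ge0}\bigcap_{p\ge2}\mathbb D^{k,p}$, i.e. for every $k\in\mathbb N$, $p\ge2$ the derivatives $D^k\varphi(Z)=\sum_{q\ge k}\frac{b_q}{(q-k)!}H_{q-k}(Z)$ and $D^kL\varphi(Z)=-\sum_{q\ge k}q\frac{b_q}{(q-k)!}H_{q-k}(Z)$ exist and belong to $L^p(\mathbb P)$;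 (iii) the function $\widetilde\varphi\in L^2(\nu)$, $\widetilde\varphi(z)=\sum_{q\ge2}\frac{|b_q|}{q!}H_q(z)$, has the same properties: $\widetilde\varphi(Z)\in Dom(L)$ and $\widetilde\varphi(Z),L\widetilde\varphi(Z)\in\bigcap_{k\ge0}\bigcap_{p\ge2}\mathbb D^{k,p}$. *)

theory Defs
  imports "HOL-Probability.Probability" "HOL-Computational_Algebra.Polynomial"
begin

section \<open>Square integrable functions\<close>

text \<open>Elements of $L^2$ are represented by functions, to be read up to null sets.\<close>

definition L2 :: "'b measure \<Rightarrow> ('b \<Rightarrow> real) \<Rightarrow> bool" where
  "L2 M f \<longleftrightarrow> f \<in> borel_measurable M \<and> integrable M (\<lambda>x. (f x)\<^sup>2)"

definition Lp_tendsto :: "'b measure \<Rightarrow> real \<Rightarrow> (nat \<Rightarrow> 'b \<Rightarrow> real) \<Rightarrow> ('b \<Rightarrow> real) \<Rightarrow> bool" where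
  "Lp_tendsto M p u f \<longleftrightarrow>
     (\<lambda>N. \<integral>\<^sup>+ x. ennreal (\<bar>u N x - f x\<bar> powr p) \<partial>M) \<longlonglongrightarrow> 0"

section \<open>The sphere and Gegenbauer polynomials\<close>

text \<open>
  Surface measure of the unit sphere of a Euclidean space of dimension $D$ (so $d = D - 1$):
  the image of $D$ times Lebesgue measure on the unit ball under radial projection, as in polar
  coordinates, where $\mathrm{Leb}\{r x : 0 < r < 1, x \in A\} = |A| \int_0^1 r^{D-1} dr$.
\<close>

definition sphere_measure :: "'a::euclidean_space measure" where
  "sphere_measure =
     scale_measure (ennreal (real DIM('a)))
       (distr (restrict_space lborel (ball 0 1 - {0})) (restrict_space borel (sphere 0 1)) sgn)"

definition sphere_mass :: "nat \<Rightarrow> real" where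
  "sphere_mass d = 2 * pi powr ((real d + 1) / 2) / Gamma ((real d + 1) / 2)"

lemma space_sphere_measure [simp]: "space (sphere_measure :: 'a::euclidean_space measure) = sphere 0 1"
  by (simp add: sphere_measure_def space_scale_measure space_restrict_space)

lemma sets_sphere_measure: "sets (sphere_measure :: 'a::euclidean_space measure) = sets (restrict_space borel (sphere 0 1))"
  by (simp add: sphere_measure_def)

lemma emeasure_sphere_measure_space:
  assumes "DIM('a::euclidean_space) = d + 1"
  shows "emeasure (sphere_measure :: 'a measure) (sphere 0 1) = ennreal (sphere_mass d)"
proof -
  let ?R = "restrict_space lborel (ball 0 1 - {0}) :: 'a measure"
  have meas: "sgn \<in> measurable ?R (restrict_space borel (sphere (0::'a) 1))"
  proof (rule measurable_restrict_space2)
    show "sgn \<in> space ?R \<rightarrow> sphere (0::'a) 1"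
      by (auto simp: space_restrict_space norm_sgn)
    have "(\<lambda>x::'a. x /\<^sub>R norm x) \<in> borel_measurable ?R"
      by (intro measurable_restrict_space1) auto
    moreover have "(\<lambda>x::'a. x /\<^sub>R norm x) = sgn"
      by (rule ext) (simp add: sgn_div_norm)
    ultimately show "(sgn :: 'a \<Rightarrow> 'a) \<in> borel_measurable ?R" by simp
  qed
  have "emeasure (distr ?R (restrict_space borel (sphere 0 1)) sgn) (sphere 0 1)
      = emeasure ?R (space ?R)"
    using meas by (subst emeasure_distr)
      (auto simp: space_restrict_space norm_sgn sets_restrict_space intro!: arg_cong[where f="emeasure ?R"])
  also have "\<dots> = emeasure lborel (ball (0::'a) 1 - {0})"
    by (subst emeasure_restrict_space) (auto simp: space_restrict_space)
  also have "\<dots> = emeasure lborel (ball (0::'a) 1)"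
    by (rule emeasure_Diff_null_set) (auto simp: null_sets_def)
  also have "\<dots> = ennreal (unit_ball_vol (real DIM('a)))"
    by (subst emeasure_ball) auto
  finally have "emeasure (sphere_measure :: 'a measure) (sphere 0 1)
      = ennreal (real DIM('a)) * ennreal (unit_ball_vol (real DIM('a)))"
    by (simp add: sphere_measure_def)
  also have "\<dots> = ennreal (real DIM('a) * unit_ball_vol (real DIM('a)))"
    by (simp add: ennreal_mult)
  also have "real DIM('a) * unit_ball_vol (real DIM('a)) = sphere_mass d"
  proof -
    define a where "a = (real d + 1) / 2"
    have D: "real DIM('a) = 2 * a" using assms by (simp add: a_def)
    have a: "a > 0" by (simp add: a_def)
    have G: "Gamma (a + 1) = a * Gamma a" "Gamma a > 0"
      using a by (auto intro!: Gamma_plus1 Gamma_real_pos elim!: nonpos_Ints_cases)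
    have "2 * a * unit_ball_vol (2 * a) = 2 * pi powr a / Gamma a"
      using a G by (simp add: unit_ball_vol_def)
    then show ?thesis
      unfolding D by (simp add: sphere_mass_def a_def)
  qed
  finally show ?thesis .
qed

text \<open>Classical Gegenbauer polynomials $C^{(\alpha)}_\ell$, given by their three-term recurrence.\<close>

fun gegenbauer :: "real \<Rightarrow> nat \<Rightarrow> real poly" where
  "gegenbauer \<alpha> 0 = 1"
| "gegenbauer \<alpha> (Suc 0) = [:0, 2 * \<alpha>:]"
| "gegenbauer \<alpha> (Suc (Suc n)) =
     smult (1 / (real n + 2))
       (smult (2 * (real n + 1 + \<alpha>)) ([:0, 1:] * gegenbauer \<alpha> (Suc n))
        - smult (real n + 2 * \<alpha>) (gegenbauer \<alpha> n))"

definition gegenbauer_sphere :: "nat \<Rightarrow> nat \<Rightarrow> real poly" where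
  "gegenbauer_sphere d l =
     (let C = gegenbauer ((real d - 1) / 2) l in smult (1 / poly C 1) C)"

lemma poly_gegenbauer_1: "poly (gegenbauer \<alpha> l) 1 = pochhammer (2 * \<alpha>) l / fact l"
proof (induction \<alpha> l rule: gegenbauer.induct)
  case (3 \<alpha> n)
  define p where "p = pochhammer (2 * \<alpha>) n / fact n"
  define r where "r = real n"
  have r: "r + 1 \<noteq> 0" "r + 2 \<noteq> 0" by (simp_all add: r_def add_nonneg_eq_0_iff)
  have s1: "pochhammer (2 * \<alpha>) (Suc n) / fact (Suc n) = (2 * \<alpha> + r) / (r + 1) * p"
    by (simp add: pochhammer_Suc p_def r_def ac_simps)
  have s2: "pochhammer (2 * \<alpha>) (Suc (Suc n)) / fact (Suc (Suc n)) =
      (2 * \<alpha> + r + 1) / (r + 2) * ((2 * \<alpha> + r) / (r + 1) * p)"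
    by (simp add: pochhammer_Suc p_def r_def ac_simps)
  have "poly (gegenbauer \<alpha> (Suc (Suc n))) 1 =
      1 / (r + 2) * (2 * (r + 1 + \<alpha>) * ((2 * \<alpha> + r) / (r + 1) * p) - (r + 2 * \<alpha>) * p)"
    using 3 s1 by (simp add: r_def p_def)
  also have "\<dots> = (2 * \<alpha> + r + 1) / (r + 2) * ((2 * \<alpha> + r) / (r + 1) * p)"
  proof -
    have "2 * (r + 1 + \<alpha>) * ((2 * \<alpha> + r) / (r + 1) * p) - (r + 2 * \<alpha>) * p =
        (2 * \<alpha> + r + 1) * ((2 * \<alpha> + r) / (r + 1) * p)"
      using r(1) by (simp add: divide_simps) algebra
    then show ?thesis by simp
  qed
  finally show ?case using s2 by simp
qed (auto simp: pochhammer_Suc)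

lemma poly_gegenbauer_sphere_1:
  assumes "d \<ge> 2"
  shows "poly (gegenbauer_sphere d l) 1 = 1"
proof -
  have "pochhammer (2 * ((real d - 1) / 2)) l > 0"
    using assms by (intro pochhammer_pos) simp
  then have "poly (gegenbauer ((real d - 1) / 2) l) 1 > 0"
    unfolding poly_gegenbauer_1 by (intro divide_pos_pos) auto
  then show ?thesis
    by (simp add: gegenbauer_sphere_def Let_def)
qed

definition harmonic_dim :: "nat \<Rightarrow> nat \<Rightarrow> real" where
  "harmonic_dim d l =
     (2 * real l + real d - 1) / real l * real ((l + d - 2) choose (l - 1))"

definition harmonic_kernel :: "nat \<Rightarrow> nat \<Rightarrow> 'a::euclidean_space \<Rightarrow> 'a \<Rightarrow> real" where
  "harmonic_kernel d l x y =
     sqrt (harmonic_dim d l / sphere_mass d) * poly (gegenbauer_sphere d l) (x \<bullet> y)"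

section \<open>Gaussian white noise and the Wiener integral\<close>

definition centered_gaussian :: "'w measure \<Rightarrow> ('w \<Rightarrow> real) \<Rightarrow> bool" where
  "centered_gaussian M X \<longleftrightarrow> X \<in> borel_measurable M \<and>
     ((AE \<omega> in M. X \<omega> = 0) \<or> (\<exists>s>0. distributed M lborel X (normal_density 0 s)))"

definition white_noise :: "'w measure \<Rightarrow> ('a::euclidean_space set \<Rightarrow> 'w \<Rightarrow> real) \<Rightarrow> bool" where
  "white_noise M W \<longleftrightarrow>
     (\<forall>\<A> c. finite \<A> \<and> \<A> \<subseteq> sets sphere_measure \<longrightarrow>
        centered_gaussian M (\<lambda>\<omega>. \<Sum>A\<in>\<A>. c A * W A \<omega>)) \<and>
     (\<forall>A\<in>sets sphere_measure. \<forall>B\<in>sets sphere_measure.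
        (\<integral>\<omega>. W A \<omega> * W B \<omega> \<partial>M) = measure sphere_measure (A \<inter> B))"

definition simple_wiener ::
  "('a::euclidean_space set \<Rightarrow> 'w \<Rightarrow> real) \<Rightarrow> ('a \<Rightarrow> real) \<Rightarrow> 'w \<Rightarrow> real" where
  "simple_wiener W s \<omega> = (\<Sum>v\<in>s ` sphere 0 1. v * W (s -` {v} \<inter> sphere 0 1) \<omega>)"

text \<open>
  $T(g) = \int g\,dW$ for $g \in H = L^2(\mathbb S^d)$, by $L^2$-extension from simple functions.
  The choice operator picks one member of the resulting class of almost surely equal random
  variables.
\<close>

definition wiener ::
  "'w measure \<Rightarrow> ('a::euclidean_space set \<Rightarrow> 'w \<Rightarrow> real) \<Rightarrow> ('a \<Rightarrow> real) \<Rightarrow> 'w \<Rightarrow> real" where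
  "wiener M W g =
     (SOME X. L2 M X \<and>
        (\<exists>s. (\<forall>N. simple_function sphere_measure (s N)) \<and>
             Lp_tendsto sphere_measure 2 s g \<and>
             Lp_tendsto M 2 (\<lambda>N. simple_wiener W (s N)) X))"

text \<open>
  The random field $T_\ell$. Each $T_\ell(x)$ is only determined almost surely, so joint measurability
  is required for the integral of $\varphi(T_\ell(x))$ over the sphere to be meaningful; by Fubini,
  that integral does not depend on the version, up to null sets.
\<close>

definition harmonic_field ::
  "'w measure \<Rightarrow> ('a::euclidean_space set \<Rightarrow> 'w \<Rightarrow> real) \<Rightarrow> nat \<Rightarrow> nat \<Rightarrow> ('a \<Rightarrow> 'w \<Rightarrow> real) \<Rightarrow> bool" where
  "harmonic_field M W d l T \<longleftrightarrow>
     (\<lambda>(x, \<omega>). T x \<omega>) \<in> borel_measurable (sphere_measure \<Otimes>\<^sub>M M) \<and>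
     (\<forall>x\<in>sphere 0 1. AE \<omega> in M. T x \<omega> = wiener M W (harmonic_kernel d l x) \<omega>)"

definition sphere_functional ::
  "(real \<Rightarrow> real) \<Rightarrow> ('a::euclidean_space \<Rightarrow> 'w \<Rightarrow> real) \<Rightarrow> 'w \<Rightarrow> real" where
  "sphere_functional \<phi> T \<omega> = (\<integral>x. \<phi> (T x \<omega>) \<partial>sphere_measure)"

definition standardized :: "'w measure \<Rightarrow> ('w \<Rightarrow> real) \<Rightarrow> 'w \<Rightarrow> real" where
  "standardized M X \<omega> =
     (X \<omega> - prob_space.expectation M X) / sqrt (prob_space.variance M X)"

section \<open>Malliavin derivatives\<close>

definition partial_deriv :: "nat \<Rightarrow> ((nat \<Rightarrow> real) \<Rightarrow> real) \<Rightarrow> (nat \<Rightarrow> real) \<Rightarrow> real" where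
  "partial_deriv i f x = deriv (\<lambda>t. f (x(i := t))) (x i)"

definition partial_derivs :: "nat list \<Rightarrow> ((nat \<Rightarrow> real) \<Rightarrow> real) \<Rightarrow> (nat \<Rightarrow> real) \<Rightarrow> real" where
  "partial_derivs is f = foldr partial_deriv is f"

text \<open>
  Functions on $\mathbb R^m$ are represented by functions on \<^typ>\<open>nat \<Rightarrow> real\<close> that depend on the
  first $m$ coordinates only; for these, continuity in the product topology is continuity on
  $\mathbb R^m$.
\<close>

definition smooth_poly_growth :: "nat \<Rightarrow> ((nat \<Rightarrow> real) \<Rightarrow> real) \<Rightarrow> bool" where
  "smooth_poly_growth m f \<longleftrightarrow>
     (\<forall>x y. (\<forall>i<m. x i = y i) \<longrightarrow> f x = f y) \<and>
     (\<forall>is. set is \<subseteq> {..<m} \<longrightarrow>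
        continuous_on UNIV (partial_derivs is f) \<and>
        (\<forall>i<m. \<forall>x. (\<lambda>t. partial_derivs is f (x(i := t))) differentiable (at (x i))) \<and>
        (\<exists>C N. \<forall>x. \<bar>partial_derivs is f x\<bar> \<le> C * (1 + (\<Sum>i<m. \<bar>x i\<bar>)) ^ N))"

definition smooth_functional ::
  "'w measure \<Rightarrow> ('a::euclidean_space set \<Rightarrow> 'w \<Rightarrow> real) \<Rightarrow> (nat \<Rightarrow> 'a \<Rightarrow> real) \<Rightarrow>
   ((nat \<Rightarrow> real) \<Rightarrow> real) \<Rightarrow> 'w \<Rightarrow> real" where
  "smooth_functional M W g f \<omega> = f (\<lambda>i. wiener M W (g i) \<omega>)"

text \<open>
  $H^{\otimes k}$ is realized as $L^2((\mathbb S^d)^k)$, with $g_1 \otimes \cdots \otimes g_k$ the function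
  $y \mapsto g_1(y_1) \cdots g_k(y_k)$, and $L^2(\Omega; H^{\otimes k})$ as $L^2(\Omega \times (\mathbb S^d)^k)$.
  For $k = 0$ the product measure is a unit point mass, so that the norm is the absolute value.
\<close>

definition sphere_power :: "nat \<Rightarrow> (nat \<Rightarrow> 'a::euclidean_space) measure" where
  "sphere_power k = PiM {..<k} (\<lambda>_. sphere_measure)"

definition tensor_norm :: "nat \<Rightarrow> ((nat \<Rightarrow> 'a::euclidean_space) \<Rightarrow> real) \<Rightarrow> real" where
  "tensor_norm k h = sqrt (\<integral>y. (h y)\<^sup>2 \<partial>sphere_power k)"

definition smooth_functional_deriv ::
  "'w measure \<Rightarrow> ('a::euclidean_space set \<Rightarrow> 'w \<Rightarrow> real) \<Rightarrow> nat \<Rightarrow> nat \<Rightarrow> (nat \<Rightarrow> 'a \<Rightarrow> real) \<Rightarrow>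
   ((nat \<Rightarrow> real) \<Rightarrow> real) \<Rightarrow> 'w \<times> (nat \<Rightarrow> 'a) \<Rightarrow> real" where
  "smooth_functional_deriv M W k m g f = (\<lambda>(\<omega>, y).
     \<Sum>i\<in>{..<k} \<rightarrow>\<^sub>E {..<m}.
       partial_derivs (map i [0..<k]) f (\<lambda>j. wiener M W (g j) \<omega>) * (\<Prod>j<k. g (i j) (y j)))"

text \<open>The graph of the closure of $D^{(k)}$ as an operator from $L^2(\Omega)$ to $L^2(\Omega; H^{\otimes k})$.\<close>

definition has_malliavin_deriv ::
  "'w measure \<Rightarrow> ('a::euclidean_space set \<Rightarrow> 'w \<Rightarrow> real) \<Rightarrow> nat \<Rightarrow> ('w \<Rightarrow> real) \<Rightarrow>
   ('w \<times> (nat \<Rightarrow> 'a) \<Rightarrow> real) \<Rightarrow> bool" where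
  "has_malliavin_deriv M W k F DF \<longleftrightarrow>
     L2 M F \<and> L2 (M \<Otimes>\<^sub>M sphere_power k) DF \<and>
     (\<exists>m g f. (\<forall>N. smooth_poly_growth (m N) (f N)) \<and>
        (\<forall>N i. i < m N \<longrightarrow> L2 sphere_measure (g N i)) \<and>
        Lp_tendsto M 2 (\<lambda>N. smooth_functional M W (g N) (f N)) F \<and>
        Lp_tendsto (M \<Otimes>\<^sub>M sphere_power k) 2
          (\<lambda>N. smooth_functional_deriv M W k (m N) (g N) (f N)) DF)"

definition malliavin_dom ::
  "'w measure \<Rightarrow> ('a::euclidean_space set \<Rightarrow> 'w \<Rightarrow> real) \<Rightarrow> nat \<Rightarrow> ('w \<Rightarrow> real) \<Rightarrow> bool" where
  "malliavin_dom M W k F \<longleftrightarrow> (\<exists>DF. has_malliavin_deriv M W k F DF)"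

definition malliavin_deriv ::
  "'w measure \<Rightarrow> ('a::euclidean_space set \<Rightarrow> 'w \<Rightarrow> real) \<Rightarrow> nat \<Rightarrow> ('w \<Rightarrow> real) \<Rightarrow>
   'w \<times> (nat \<Rightarrow> 'a) \<Rightarrow> real" where
  "malliavin_deriv M W k F = (SOME DF. has_malliavin_deriv M W k F DF)"

text \<open>$\mathbb E\big[|D^{(k)} F|^n_{H^{\otimes k}}\big]$, possibly infinite.\<close>

definition malliavin_moment ::
  "'w measure \<Rightarrow> ('a::euclidean_space set \<Rightarrow> 'w \<Rightarrow> real) \<Rightarrow> nat \<Rightarrow> nat \<Rightarrow> ('w \<Rightarrow> real) \<Rightarrow> ennreal" where
  "malliavin_moment M W k n F =
     (\<integral>\<^sup>+ \<omega>. ennreal (tensor_norm k (\<lambda>y. malliavin_deriv M W k F (\<omega>, y)) ^ n) \<partial>M)"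

section \<open>Wiener chaos and the Ornstein--Uhlenbeck operator\<close>

definition hermite :: "nat \<Rightarrow> real \<Rightarrow> real" where
  "hermite q x = (-1) ^ q * exp (x\<^sup>2 / 2) * (deriv ^^ q) (\<lambda>t. exp (- (t\<^sup>2 / 2))) x"

definition wiener_chaos ::
  "'w measure \<Rightarrow> ('a::euclidean_space set \<Rightarrow> 'w \<Rightarrow> real) \<Rightarrow> nat \<Rightarrow> ('w \<Rightarrow> real) \<Rightarrow> bool" where
  "wiener_chaos M W q F \<longleftrightarrow> L2 M F \<and>
     (\<exists>(m :: nat \<Rightarrow> nat) c g. (\<forall>N i. i < m N \<longrightarrow>
          L2 sphere_measure (g N i) \<and> (\<integral>y. (g N i y)\<^sup>2 \<partial>sphere_measure) = 1) \<and>
        Lp_tendsto M 2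
          (\<lambda>N \<omega>. \<Sum>i<m N. c N i * hermite q (wiener M W (g N i) \<omega>)) F)"

definition chaos_proj ::
  "'w measure \<Rightarrow> ('a::euclidean_space set \<Rightarrow> 'w \<Rightarrow> real) \<Rightarrow> nat \<Rightarrow> ('w \<Rightarrow> real) \<Rightarrow> 'w \<Rightarrow> real" where
  "chaos_proj M W q F =
     (SOME G. wiener_chaos M W q G \<and>
        (\<forall>K. wiener_chaos M W q K \<longrightarrow> (\<integral>\<omega>. (F \<omega> - G \<omega>) * K \<omega> \<partial>M) = 0))"

definition wiener_sigma ::
  "'w measure \<Rightarrow> ('a::euclidean_space set \<Rightarrow> 'w \<Rightarrow> real) \<Rightarrow> 'w measure" where
  "wiener_sigma M W =
     sigma (space M) {wiener M W g -` B \<inter> space M | g B. L2 sphere_measure g \<and> B \<in> sets borel}"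

text \<open>Measurability with respect to $\sigma(T(g) : g \in H)$ is understood up to null sets.\<close>

definition ou_dom ::
  "'w measure \<Rightarrow> ('a::euclidean_space set \<Rightarrow> 'w \<Rightarrow> real) \<Rightarrow> ('w \<Rightarrow> real) \<Rightarrow> bool" where
  "ou_dom M W F \<longleftrightarrow> L2 M F \<and>
     (\<exists>F'\<in>borel_measurable (wiener_sigma M W). AE \<omega> in M. F \<omega> = F' \<omega>) \<and>
     summable (\<lambda>q. (real q)\<^sup>2 * (\<integral>\<omega>. (chaos_proj M W q F \<omega>)\<^sup>2 \<partial>M))"

definition ou_operator ::
  "'w measure \<Rightarrow> ('a::euclidean_space set \<Rightarrow> 'w \<Rightarrow> real) \<Rightarrow> ('w \<Rightarrow> real) \<Rightarrow> 'w \<Rightarrow> real" where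
  "ou_operator M W F =
     (SOME G. L2 M G \<and>
        Lp_tendsto M 2 (\<lambda>N \<omega>. - (\<Sum>q=1..N. real q * chaos_proj M W q F \<omega>)) G)"

section \<open>One-dimensional Malliavin calculus\<close>

text \<open>
  Everything depends on $Z$ only through its law $\nu$, so random variables $\varphi(Z)$ are identified
  with functions $\varphi$ on the probability space $(\mathbb R, \nu)$.
\<close>

abbreviation gauss :: "real measure" where
  "gauss \<equiv> std_normal_distribution"

definition hermite_coeff :: "(real \<Rightarrow> real) \<Rightarrow> nat \<Rightarrow> real" where
  "hermite_coeff \<phi> q = (\<integral>z. \<phi> z * hermite q z \<partial>gauss)"

text \<open>The $L^2(\nu)$-sum $\sum_q \frac{c_q}{q!} H_q$, provided that it converges.\<close>

definition hermite_series :: "(nat \<Rightarrow> real) \<Rightarrow> real \<Rightarrow> real" where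
  "hermite_series c =
     (SOME \<psi>. L2 gauss \<psi> \<and> Lp_tendsto gauss 2 (\<lambda>N z. \<Sum>q\<le>N. c q / fact q * hermite q z) \<psi>)"

definition gauss_ou_dom :: "(real \<Rightarrow> real) \<Rightarrow> bool" where
  "gauss_ou_dom \<phi> \<longleftrightarrow> L2 gauss \<phi> \<and>
     summable (\<lambda>q. (real q)\<^sup>2 * (hermite_coeff \<phi> q)\<^sup>2 / fact q)"

definition gauss_ou :: "(real \<Rightarrow> real) \<Rightarrow> real \<Rightarrow> real" where
  "gauss_ou \<phi> = hermite_series (\<lambda>q. - (real q * hermite_coeff \<phi> q))"

definition smooth_poly_growth_1 :: "(real \<Rightarrow> real) \<Rightarrow> bool" where
  "smooth_poly_growth_1 f \<longleftrightarrow>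
     (\<forall>j. (\<forall>x. (deriv ^^ j) f differentiable (at x)) \<and>
          (\<exists>C N. \<forall>x. \<bar>(deriv ^^ j) f x\<bar> \<le> C * (1 + \<bar>x\<bar>) ^ N))"

text \<open>
  $\varphi \in \mathbb D^{k,p}$; here \<open>\<psi> j\<close> is $D^j \varphi$, the $L^p(\nu)$-limit of the $j$-th derivatives of
  the approximating sequence.
\<close>

definition gauss_sobolev :: "nat \<Rightarrow> real \<Rightarrow> (real \<Rightarrow> real) \<Rightarrow> bool" where
  "gauss_sobolev k p \<phi> \<longleftrightarrow>
     (\<exists>f \<psi>. (\<forall>N. smooth_poly_growth_1 (f N)) \<and> \<psi> 0 = \<phi> \<and>
        (\<forall>j\<le>k. \<psi> j \<in> borel_measurable gauss \<and>
               Lp_tendsto gauss p (\<lambda>N. (deriv ^^ j) (f N)) (\<psi> j)))"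

definition gauss_regular :: "(real \<Rightarrow> real) \<Rightarrow> bool" where
  "gauss_regular \<phi> \<longleftrightarrow> gauss_ou_dom \<phi> \<and>
     (\<forall>k p. p \<ge> 2 \<longrightarrow> gauss_sobolev k p \<phi> \<and> gauss_sobolev k p (gauss_ou \<phi>))"

definition assumption_A :: "(real \<Rightarrow> real) \<Rightarrow> bool" where
  "assumption_A \<phi> \<longleftrightarrow>
     hermite_coeff \<phi> 2 \<noteq> 0 \<and>
     gauss_regular \<phi> \<and>
     gauss_regular (hermite_series (\<lambda>q. if q \<ge> 2 then \<bar>hermite_coeff \<phi> q\<bar> else 0))"

end

theory Submission
 imports Defs
begin

text \<open>
  On one eigenspace $T_\ell(x) = \sum_i a_i(x) \xi_i$ with finitely many independent standard Gaussians, so all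
  derivatives of $X_\ell$ are explicit: $|D^{(k)} X_\ell|^2$ is the double integral over the sphere of
  $\varphi^{(k)}(T_\ell(x)) \varphi^{(k)}(T_\ell(y)) \rho(x,y)^k$, where $\rho$ is the covariance. With
  $A = \int \rho(x,y)^2\,dy$, which does not depend on $x$, the second chaos gives
  $\mathrm{Var}(X_\ell) \ge \frac{b_2^2}{2} \mu_d A$, and it remains to bound the moments of $|D^{(k)} X_\ell|^2$ by $A$.
  For $k \ge 2$ this is immediate from $|\rho| \le 1$. For $k = 1$ and $k = 0$ the integrand is written as a
  divergence $z \chi'(z) - \chi''(z)$ (the constant in $\varphi'$ is harmless as $\int a_i = 0$), and Gaussian
  integration by parts bounds the moments of order $k$ by those of order $k + 1$. Assumption (A) enters through the
  decay of the Hermite coefficients: since $\widetilde\varphi$ lies in every $L^p$ and has nonnegative coefficients,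
  its Laplace transform gives $|b_q| R^q = O(\sqrt{q!})$ for every $R$.
\<close>

text \<open>Two obstacles shape the proof. The abstract objects are given by choice:
  \<open>wiener\<close>, \<open>malliavin_deriv\<close>, \<open>chaos_proj\<close> and
  \<open>ou_operator\<close> each pick one representative. Before a formula can be attached to them,
  almost sure uniqueness is needed. For the derivative this is closability, obtained from the
  adjoint of the iterated derivative. The other obstacle is uniformity in the degree. The variance
  is only known to dominate a multiple of A, so every order has to produce the factor A itself, that
  is, two factors \<rho> under the double integral. Orders 0 and 1 have too few. Integration by
  parts supplies the missing ones, at the price of a derivative of the integrand and of inverting
  the Ornstein-Uhlenbeck operator. On Hermite coefficients these are a shift and a division by q,
  which superexponential decay tolerates. Estimates are made for polynomial truncations, whose
  moments are all finite; this is what allows half of a left side to be absorbed. Fatou's lemma then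
  passes to the limit. All constants depend on coefficients only, and their homogeneity lets
  standardization cancel the powers of A.\<close>

lemmas bi_int_add = Bochner_Integration.integrable_add
 and bi_int_bound = Bochner_Integration.integrable_bound
 and bi_int_cong = Bochner_Integration.integrable_cong
 and bi_int_diff = Bochner_Integration.integrable_diff
 and bi_int_sum = Bochner_Integration.integrable_sum
 and bi_add = Bochner_Integration.integral_add
 and bi_cong = Bochner_Integration.integral_cong
 and bi_diff = Bochner_Integration.integral_diff
 and bi_sum = Bochner_Integration.integral_sum

abbreviation contU :: "('b::topological_space => 'c::topological_space) => bool" where
 "contU == continuous_on UNIV"

abbreviation "spg == smooth_poly_growth"

section \<open>Square integrable functions\<close>

lemma L2_measurable [measurable_dest]: "L2 M f ==> f \<in> borel_measurable M"
 by (simp add: L2_def)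

lemma L2_integrable_square: "L2 M f ==> integrable M (%x. (f x)\<^sup>2)"
 by (simp add: L2_def)

lemma L2_mult_integrable:
 assumes "L2 M f" "L2 M g"
 shows "integrable M (%x. f x * g x)"
proof (rule bi_int_bound)
 show "integrable M (%x. (f x)\<^sup>2 + (g x)\<^sup>2)"
  using assms by (auto simp: L2_def)
 show "AE x in M. norm (f x * g x) \<le> norm ((f x)\<^sup>2 + (g x)\<^sup>2)"
 proof (rule AE_I2)
  fix x
  have "2 * \<bar>f x * g x\<bar> \<le> (f x)\<^sup>2 + (g x)\<^sup>2"
   using sum_squares_bound[of "\<bar>f x\<bar>" "\<bar>g x\<bar>"] by (simp add: abs_mult)
  then show "norm (f x * g x) \<le> norm ((f x)\<^sup>2 + (g x)\<^sup>2)"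
   by simp
 qed
qed (use assms in \<open>auto simp: L2_def\<close>)

lemma L2_add: "L2 M f ==> L2 M g ==> L2 M (%x. f x + g x)"
 using L2_mult_integrable[of M f g] by (auto simp: L2_def power2_sum mult.assoc)

lemma L2_cmult: "L2 M f ==> L2 M (%x. c * f x)"
 by (auto simp: L2_def power_mult_distrib)

lemma L2_diff: "L2 M f ==> L2 M g ==> L2 M (%x. f x - g x)"
 using L2_add[of M f "%x. -1 * g x"] L2_cmult[of M g "-1"] by simp

lemma L2_zero: "L2 M (%x. 0)"
 by (simp add: L2_def)

lemma L2_sum: "(\<And>i. i \<in> I ==> L2 M (f i)) ==> L2 M (%x. \<Sum>i\<in>I. f i x)"
 by (induction I rule: infinite_finite_induct) (auto simp: L2_zero intro: L2_add)

lemma L2_cong_AE: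
 assumes "L2 M f" "AE x in M. f x = g x" "g \<in> borel_measurable M"
 shows "L2 M g"
proof -
 have "integrable M (%x. (f x)\<^sup>2) = integrable M (%x. (g x)\<^sup>2)"
  using assms by (intro integrable_cong_AE) (auto simp: L2_def)
 then show ?thesis using assms by (simp add: L2_def)
qed

lemma L2_Cauchy_Schwarz:
 assumes "L2 M f" "L2 M g"
 shows "(LINT x|M. f x * g x)\<^sup>2 \<le> (LINT x|M. (f x)\<^sup>2) * (LINT x|M. (g x)\<^sup>2)"
proof -
 define a b c where "a = (LINT x|M. (f x)\<^sup>2)" and "b = (LINT x|M. f x * g x)" and "c = (LINT x|M. (g x)\<^sup>2)"
 have int: "integrable M (%x. (f x)\<^sup>2)" "integrable M (%x. f x * g x)" "integrable M (%x. (g x)\<^sup>2)"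
  using assms L2_mult_integrable by (auto simp: L2_def)
 have quad: "0 \<le> s\<^sup>2 * a - 2 * s * t * b + t\<^sup>2 * c" for s t
 proof -
  have "0 \<le> (LINT x|M. (s * f x - t * g x)\<^sup>2)" by simp
  also have "(%x. (s * f x - t * g x)\<^sup>2) =
    (%x. s\<^sup>2 * (f x)\<^sup>2 - (2 * s * t) * (f x * g x) + t\<^sup>2 * (g x)\<^sup>2)"
   by (rule ext) (simp add: power2_eq_square algebra_simps)
  finally show ?thesis using int by (simp add: a_def b_def c_def)
 qed
 have nn: "a \<ge> 0" "c \<ge> 0" by (simp_all add: a_def c_def)
 have "b\<^sup>2 \<le> a * c"
 proof (cases "c = 0")
  case True
  have "0 \<le> b\<^sup>2 * a - 2 * b * t * b" for t using quad[of b t] True by simp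
  \<comment> \<open>For \<open>c = 0\<close> the form is linear in t; at \<open>t = a + 1\<close> it
    equals minus \<open>b\<^sup>2 * (a + 2)\<close>.\<close>
  from this[of "a + 1"] have "b\<^sup>2 * (a + 2) \<le> 0" by (simp add: power2_eq_square algebra_simps)
  then show ?thesis using nn True by (simp add: mult_le_0_iff power2_less_eq_zero_iff)
 next
  case False
  then have "c > 0" using nn by simp
  have "0 \<le> c\<^sup>2 * a - 2 * c * b * b + b\<^sup>2 * c" by (rule quad)
  then have "0 \<le> c * (a * c - b\<^sup>2)" by (simp add: power2_eq_square algebra_simps)
  then show ?thesis using \<open>c > 0\<close> by (simp add: zero_le_mult_iff)
 qed
 then show ?thesis by (simp add: a_def b_def c_def)
qed

lemma Lp_tendsto_2_iff:
 assumes "\<And>N. L2 M (u N)" "L2 M f"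
 shows "Lp_tendsto M 2 u f \<longleftrightarrow> (%N. \<integral>x. (u N x - f x)\<^sup>2 \<partial>M) \<longlonglongrightarrow> 0"
proof -
 have "(\<integral>\<^sup>+ x. ennreal (\<bar>u N x - f x\<bar> powr 2) \<partial>M) = ennreal (LINT x|M. (u N x - f x)\<^sup>2)" for N
 proof -
  have "\<bar>u N x - f x\<bar> powr 2 = (u N x - f x)\<^sup>2" for x
   by (cases "u N x = f x") (auto simp: powr_numeral)
  then show ?thesis
   using L2_diff[OF assms(1)[of N] assms(2)] by (simp add: L2_def nn_integral_eq_integral)
 qed
 then show ?thesis
  unfolding Lp_tendsto_def by (simp add: ennreal_tendsto_0_iff)
qed

text \<open>Expanding u v around f g leaves three error terms, each with a factor tending to zero in
  \<open>L2\<close>; Cauchy-Schwarz (\<open>aux\<close>) handles them.\<close>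

lemma L2_tendsto_inner:
 assumes u: "\<And>N. L2 M (u N)" "L2 M f" "Lp_tendsto M 2 u f"
  and v: "\<And>N. L2 M (v N)" "L2 M g" "Lp_tendsto M 2 v g"
 shows "(%N. \<integral>x. u N x * v N x \<partial>M) \<longlonglongrightarrow> (LINT x|M. f x * g x)"
proof -
 have du: "(%N. \<integral>x. (u N x - f x)\<^sup>2 \<partial>M) \<longlonglongrightarrow> 0" and dv: "(%N. \<integral>x. (v N x - g x)\<^sup>2 \<partial>M) \<longlonglongrightarrow> 0"
  using assms Lp_tendsto_2_iff by blast+
 have aux: "(%N. \<integral>x. a N x * b N x \<partial>M) \<longlonglongrightarrow> 0"
  if "\<And>N. L2 M (a N)" "\<And>N. L2 M (b N)" "(%N. \<integral>x. (a N x)\<^sup>2 \<partial>M) \<longlonglongrightarrow> 0"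
   "(%N. \<integral>x. (b N x)\<^sup>2 \<partial>M) \<longlonglongrightarrow> c" for a b c
 proof -
  have "(%N. (LINT x|M. (a N x)\<^sup>2) * (LINT x|M. (b N x)\<^sup>2)) \<longlonglongrightarrow> 0 * c"
   by (intro tendsto_mult that)
  then have "(%N. sqrt ((LINT x|M. (a N x)\<^sup>2) * (LINT x|M. (b N x)\<^sup>2))) \<longlonglongrightarrow> 0"
   using tendsto_real_sqrt by fastforce
  then show ?thesis
  proof (rule Lim_null_comparison[rotated], intro always_eventually allI)
   fix N
   show "norm (LINT x|M. a N x * b N x) \<le> sqrt ((LINT x|M. (a N x)\<^sup>2) * (LINT x|M. (b N x)\<^sup>2))"
    using L2_Cauchy_Schwarz[OF that(1)[of N] that(2)[of N]] by (simp add: real_le_rsqrt)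
  qed
 qed
 have 1: "(%N. \<integral>x. (u N x - f x) * (v N x - g x) \<partial>M) \<longlonglongrightarrow> 0"
  by (rule aux[OF _ _ du dv]) (auto intro: L2_diff u v)
 have 2: "(%N. \<integral>x. (u N x - f x) * g x \<partial>M) \<longlonglongrightarrow> 0"
  by (rule aux[OF _ _ du]) (auto intro: L2_diff u v)
 have 3: "(%N. \<integral>x. (v N x - g x) * f x \<partial>M) \<longlonglongrightarrow> 0"
  by (rule aux[OF _ _ dv]) (auto intro: L2_diff u v)
 have "(LINT x|M. u N x * v N x) = (LINT x|M. (u N x - f x) * (v N x - g x))
   + (LINT x|M. (u N x - f x) * g x) + (LINT x|M. (v N x - g x) * f x) + (LINT x|M. f x * g x)" for N
 proof -
  have i: "integrable M (%x. (u N x - f x) * (v N x - g x))" "integrable M (%x. (u N x - f x) * g x)"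
   "integrable M (%x. (v N x - g x) * f x)" "integrable M (%x. f x * g x)"
   by (intro L2_mult_integrable L2_diff u v)+
  have "(%x. u N x * v N x) = (%x. ((u N x - f x) * (v N x - g x) + (u N x - f x) * g x + (v N x - g x) * f x) + f x * g x)"
   by (auto simp: algebra_simps)
  then show ?thesis using i by simp
 qed
 then show ?thesis using tendsto_add[OF tendsto_add[OF tendsto_add[OF 1 2] 3] tendsto_const] by simp
qed

lemma Lp_tendsto_const: "Lp_tendsto M 2 (%N. f) f"
 by (simp add: Lp_tendsto_def)

lemma L2_tendsto_sub:
 assumes u: "\<And>N. L2 M (u N)" "L2 M f" "Lp_tendsto M 2 u f"
  and v: "\<And>N. L2 M (v N)" "L2 M g" "Lp_tendsto M 2 v g"
 shows "Lp_tendsto M 2 (%N x. u N x - v N x) (%x. f x - g x)"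
proof -
 have "(%N. \<integral>x. (u N x - f x)\<^sup>2 \<partial>M) \<longlonglongrightarrow> 0" "(%N. \<integral>x. (v N x - g x)\<^sup>2 \<partial>M) \<longlonglongrightarrow> 0"
  using assms Lp_tendsto_2_iff by blast+
 from tendsto_mult_right_zero[OF tendsto_add_zero[OF this], of 2]
 have lim: "(%N. 2 * ((LINT x|M. (u N x - f x)\<^sup>2) + (LINT x|M. (v N x - g x)\<^sup>2))) \<longlonglongrightarrow> 0" .
 have le: "(LINT x|M. ((u N x - v N x) - (f x - g x))\<^sup>2)
   \<le> 2 * ((LINT x|M. (u N x - f x)\<^sup>2) + (LINT x|M. (v N x - g x)\<^sup>2))" for N
 proof -
  have i: "integrable M (%x. (u N x - f x)\<^sup>2)" "integrable M (%x. (v N x - g x)\<^sup>2)"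
   "integrable M (%x. ((u N x - v N x) - (f x - g x))\<^sup>2)"
   by (intro L2_integrable_square L2_diff u v)+
  have "(LINT x|M. ((u N x - v N x) - (f x - g x))\<^sup>2) \<le> (LINT x|M. 2 * ((u N x - f x)\<^sup>2 + (v N x - g x)\<^sup>2))"
  proof (rule integral_mono)
   fix x
   have "2 * ((u N x - f x)\<^sup>2 + (v N x - g x)\<^sup>2) - ((u N x - v N x) - (f x - g x))\<^sup>2
     = ((u N x - f x) + (v N x - g x))\<^sup>2"
    by (simp add: power2_eq_square algebra_simps)
   then show "((u N x - v N x) - (f x - g x))\<^sup>2 \<le> 2 * ((u N x - f x)\<^sup>2 + (v N x - g x)\<^sup>2)"
    by (metis diff_ge_0_iff_ge zero_le_power2)
  qed (use i in auto)
  then show ?thesis using i by simp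
 qed
 have "(%N. \<integral>x. ((u N x - v N x) - (f x - g x))\<^sup>2 \<partial>M) \<longlonglongrightarrow> 0"
  by (rule tendsto_sandwich[OF _ _ tendsto_const lim]) (simp, intro always_eventually allI le)
 then show ?thesis
  by (subst Lp_tendsto_2_iff) (auto intro: L2_diff u v)
qed

lemma L2_tendsto_cmult:
 assumes u: "\<And>N. L2 M (u N)" "L2 M f" "Lp_tendsto M 2 u f"
 shows "Lp_tendsto M 2 (%N x. c * u N x) (%x. c * f x)"
proof -
 have "(%N. \<integral>x. (u N x - f x)\<^sup>2 \<partial>M) \<longlonglongrightarrow> 0" using assms Lp_tendsto_2_iff by blast
 then have "(%N. c\<^sup>2 * (LINT x|M. (u N x - f x)\<^sup>2)) \<longlonglongrightarrow> 0" by (rule tendsto_mult_right_zero)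
 moreover have "(c * u N x - c * f x)\<^sup>2 = c\<^sup>2 * (u N x - f x)\<^sup>2" for N x
  by (simp add: power2_eq_square algebra_simps)
 ultimately show ?thesis
  by (subst Lp_tendsto_2_iff) (auto intro: L2_cmult u)
qed

lemma L2_tendsto_add:
 assumes u: "\<And>N. L2 M (u N)" "L2 M f" "Lp_tendsto M 2 u f"
  and v: "\<And>N. L2 M (v N)" "L2 M g" "Lp_tendsto M 2 v g"
 shows "Lp_tendsto M 2 (%N x. u N x + v N x) (%x. f x + g x)"
 using L2_tendsto_sub[OF u L2_cmult[OF v(1), of "-1"] L2_cmult[OF v(2), of "-1"] L2_tendsto_cmult[OF v, of "-1"]]
 by simp

lemma L2_tendsto_sum:
 assumes "\<And>i N. i \<in> I ==> L2 M (u i N)" "\<And>i. i \<in> I ==> L2 M (f i)"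
  "\<And>i. i \<in> I ==> Lp_tendsto M 2 (u i) (f i)"
 shows "Lp_tendsto M 2 (%N x. \<Sum>i\<in>I. u i N x) (%x. \<Sum>i\<in>I. f i x)"
 using assms
proof (induction I rule: infinite_finite_induct)
 case (insert i I)
 have "Lp_tendsto M 2 (%N x. u i N x + (\<Sum>i\<in>I. u i N x)) (%x. f i x + (\<Sum>i\<in>I. f i x))"
  by (rule L2_tendsto_add) (use insert in \<open>auto intro: L2_sum\<close>)
 then show ?case using insert by simp
qed (auto intro: Lp_tendsto_const)

lemma L2_norm_zero_AE:
 assumes "L2 M f" "(LINT x|M. (f x)\<^sup>2) = 0"
 shows "AE x in M. f x = 0"
 using assms integral_nonneg_eq_0_iff_AE[of M "%x. (f x)\<^sup>2"] by (auto simp: L2_def)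

lemma Lp_tendsto_cong:
 assumes "\<And>N. AE x in M. u N x = v N x" "AE x in M. f x = g x"
 shows "Lp_tendsto M p u f \<longleftrightarrow> Lp_tendsto M p v g"
proof -
 have "(\<integral>\<^sup>+ x. ennreal (\<bar>u N x - f x\<bar> powr p) \<partial>M) = (\<integral>\<^sup>+ x. ennreal (\<bar>v N x - g x\<bar> powr p) \<partial>M)" for N
  using assms(1)[of N] assms(2) by (intro nn_integral_cong_AE) auto
 then show ?thesis by (simp add: Lp_tendsto_def)
qed

lemma L2_limit_unique:
 assumes u: "\<And>N. L2 M (u N)" and f: "L2 M f" "Lp_tendsto M 2 u f" and g: "L2 M g" "Lp_tendsto M 2 u g"
 shows "AE x in M. f x = g x"
proof -
 have "Lp_tendsto M 2 (%N x. u N x - u N x) (%x. f x - g x)"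
  by (rule L2_tendsto_sub) (use assms in auto)
 then have "Lp_tendsto M 2 (%N x. 0) (%x. f x - g x)" by simp
 then have "(%N::nat. \<integral>x. (0 - (f x - g x))\<^sup>2 \<partial>M) \<longlonglongrightarrow> 0"
  using Lp_tendsto_2_iff[OF L2_zero L2_diff[OF f(1) g(1)]] by blast
 then have "(LINT x|M. (f x - g x)\<^sup>2) = 0"
  by (simp add: LIMSEQ_const_iff power2_commute)
 from L2_norm_zero_AE[OF L2_diff[OF f(1) g(1)] this] show ?thesis by simp
qed

lemma L2_tendsto_AE_subseq:
 assumes "\<And>N. L2 M (u N)" "L2 M f" "Lp_tendsto M 2 u f"
 shows "\<exists>r. strict_mono r \<and> (AE x in M. (%n. u (r n) x) \<longlonglongrightarrow> f x)"
proof -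
 have lim: "(%N. \<integral>x. (u N x - f x)\<^sup>2 \<partial>M) \<longlonglongrightarrow> 0" using assms Lp_tendsto_2_iff by blast
 have "\<exists>r. strict_mono r \<and> (AE x in M. (%n. (u (r n) x - f x)\<^sup>2) \<longlonglongrightarrow> 0)"
  by (rule tendsto_L1_AE_subseq) (use lim L2_diff assms in \<open>auto simp: L2_def\<close>)
 then obtain r where r: "strict_mono r" "AE x in M. (%n. (u (r n) x - f x)\<^sup>2) \<longlonglongrightarrow> 0" by auto
 have "AE x in M. (%n. u (r n) x) \<longlonglongrightarrow> f x"
  using r(2)
 proof eventually_elim
  case (elim x)
  then have "(%n. sqrt ((u (r n) x - f x)\<^sup>2)) \<longlonglongrightarrow> 0" using tendsto_real_sqrt by fastforce
  then show ?case by (simp add: LIM_zero_iff tendsto_rabs_zero_iff)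
 qed
 with r(1) show ?thesis by blast
qed

text \<open>Riesz-Fischer: a subsequence with rapidly decreasing increments converges almost
  everywhere, and Fatou's lemma turns the Cauchy bounds into bounds for the distance to its
  limit.\<close>

lemma L2_complete:
 assumes u: "\<And>N. L2 M (u N)"
  and cauchy: "\<And>e. e > 0 ==> \<exists>N0. \<forall>m\<ge>N0. \<forall>n\<ge>N0. (LINT x|M. (u m x - u n x)\<^sup>2) < e"
 shows "\<exists>f. L2 M f \<and> Lp_tendsto M 2 u f"
proof -
 define d where "d m n = (LINT x|M. (u m x - u n x)\<^sup>2)" for m n
 have [measurable]: "u N \<in> borel_measurable M" for N using u by (simp add: L2_def)
 have nn: "(\<integral>\<^sup>+x. ennreal ((u m x - u n x)\<^sup>2) \<partial>M) = ennreal (d m n)" for m n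
  unfolding d_def by (rule nn_integral_eq_integral) (use L2_diff[OF u u] in \<open>auto simp: L2_def\<close>)
 have "\<exists>N0. \<forall>m\<ge>N0. \<forall>n\<ge>N0. d m n < (1/4)^k" for k :: nat
  using cauchy[of "(1/4)^k"] by (simp add: d_def)
 then obtain B where B: "\<And>k m n. m \<ge> B k ==> n \<ge> B k ==> d m n < (1/4)^k" by metis
 \<comment> \<open>Partial sums of B dominate all earlier values of B, so one index r n is good for
   every accuracy k \<le> n.\<close>
 define r where "r k = (\<Sum>j\<le>k. B j)" for k :: nat
 have rB: "r n \<ge> B k" if "n \<ge> k" for n k
 proof -
  have "B k \<le> (\<Sum>j\<le>n. B j)" by (rule member_le_sum) (use that in auto)
  then show ?thesis by (simp add: r_def)
 qed
 have "(\<integral>\<^sup>+x. (\<Sum>k. ennreal (2^k * (u (r (Suc k)) x - u (r k) x)\<^sup>2)) \<partial>M)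
   = (\<Sum>k. (\<integral>\<^sup>+x. ennreal (2^k * (u (r (Suc k)) x - u (r k) x)\<^sup>2) \<partial>M))"
  by (rule nn_integral_suminf) measurable
 also have "... \<le> (\<Sum>k. ennreal ((1/2)^k))"
 proof (rule suminf_le)
  fix k :: nat
  have "(\<integral>\<^sup>+x. ennreal (2^k * (u (r (Suc k)) x - u (r k) x)\<^sup>2) \<partial>M) = ennreal (2^k) * ennreal (d (r (Suc k)) (r k))"
   by (subst nn[symmetric]) (simp add: ennreal_mult nn_integral_cmult)
  also have "... = ennreal (2^k * d (r (Suc k)) (r k))" by (simp add: ennreal_mult d_def)
  also have "... \<le> ennreal (2^k * (1/4)^k)"
   using B[OF rB[of k "Suc k"] rB[of k k]] by (intro ennreal_leI mult_left_mono) auto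
  also have "(2::real)^k * (1/4)^k = (1/2)^k" by (simp add: power_mult_distrib[symmetric])
  finally show "(\<integral>\<^sup>+x. ennreal (2^k * (u (r (Suc k)) x - u (r k) x)\<^sup>2) \<partial>M) \<le> ennreal ((1/2)^k)" .
 qed auto
 also have "... = ennreal (\<Sum>k. (1/2)^k)"
  by (rule suminf_ennreal2) auto
 also have "... < \<infinity>" by simp
 finally have "(\<integral>\<^sup>+x. (\<Sum>k. ennreal (2^k * (u (r (Suc k)) x - u (r k) x)\<^sup>2)) \<partial>M) \<noteq> \<infinity>" by simp
 then have ae: "AE x in M. (\<Sum>k. ennreal (2^k * (u (r (Suc k)) x - u (r k) x)\<^sup>2)) \<noteq> \<infinity>"
  by (intro nn_integral_PInf_AE) measurable
 have conv: "AE x in M. convergent (%k. u (r k) x)"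
  using ae
 proof eventually_elim
  case (elim x)
  \<comment> \<open>The weight 2^k still leaves a summable expectation. Once \<open>a\<close> is
    bounded at x, the increments there decay like (1 / sqrt 2)^k.\<close>
  define a where "a k = 2^k * (u (r (Suc k)) x - u (r k) x)\<^sup>2" for k
  have "summable a"
   by (rule summable_suminf_not_top) (use elim in \<open>auto simp: a_def\<close>)
  then have "a \<longlonglongrightarrow> 0" by (rule summable_LIMSEQ_zero)
  then have "Bseq a" by (rule convergent_imp_Bseq[OF convergentI])
  then obtain K where K: "K > 0" "\<And>k. norm (a k) \<le> K" by (auto elim: BseqE)
  have bd: "norm (u (r (Suc k)) x - u (r k) x) \<le> sqrt K * (sqrt (1/2))^k" for k
  proof -
   have "(u (r (Suc k)) x - u (r k) x)\<^sup>2 = a k * (1/2)^k"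
    by (simp add: a_def power_one_over)
   also have "... \<le> K * (1/2)^k" using K(2)[of k] by (intro mult_right_mono) auto
   finally have "sqrt ((u (r (Suc k)) x - u (r k) x)\<^sup>2) \<le> sqrt (K * (1/2)^k)"
    by (rule real_sqrt_le_mono)
   moreover have "sqrt (K * (1/2)^k) = sqrt K * (sqrt (1/2))^k"
    by (simp only: real_sqrt_mult real_sqrt_power)
   ultimately show ?thesis by simp
  qed
  have "summable (%k. u (r (Suc k)) x - u (r k) x)"
   by (rule summable_comparison_test'[OF _ bd]) (auto intro!: summable_mult summable_geometric)
  then have "convergent (%n. \<Sum>k<n. u (r (Suc k)) x - u (r k) x)"
   by (simp add: summable_iff_convergent)
  then have "convergent (%n. u (r n) x - u (r 0) x)" using sum_lessThan_telescope[of "%k. u (r k) x"] by simp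
  then show ?case by (simp add: convergent_diff_const_right_iff)
 qed
 define f where "f x = lim (%k. u (r k) x)" for x
 have [measurable]: "f \<in> borel_measurable M"
  unfolding f_def by (rule borel_measurable_lim_metric) measurable
 have lim: "AE x in M. (%k. u (r k) x) \<longlonglongrightarrow> f x"
  using conv by eventually_elim (simp add: f_def convergent_LIMSEQ_iff)
 have bound: "(\<integral>\<^sup>+x. ennreal ((u m x - f x)\<^sup>2) \<partial>M) \<le> ennreal ((1/4)^k)" if "m \<ge> B k" for m k
 proof -
  have "(\<integral>\<^sup>+x. ennreal ((u m x - f x)\<^sup>2) \<partial>M) = (\<integral>\<^sup>+x. liminf (%n. ennreal ((u m x - u (r n) x)\<^sup>2)) \<partial>M)"
  proof (rule nn_integral_cong_AE)
   show "AE x in M. ennreal ((u m x - f x)\<^sup>2) = liminf (%n. ennreal ((u m x - u (r n) x)\<^sup>2))"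
    using lim
   proof eventually_elim
    case (elim x)
    then have "(%n. ennreal ((u m x - u (r n) x)\<^sup>2)) \<longlonglongrightarrow> ennreal ((u m x - f x)\<^sup>2)"
     by (intro tendsto_intros)
    then show ?case by (rule lim_imp_Liminf[OF trivial_limit_sequentially, symmetric])
   qed
  qed
  also have "... \<le> liminf (%n. \<integral>\<^sup>+x. ennreal ((u m x - u (r n) x)\<^sup>2) \<partial>M)"
   by (rule nn_integral_liminf) measurable
  also have "... = liminf (%n. ennreal (d m (r n)))" by (simp add: nn)
  also have "... \<le> liminf (%n. ennreal ((1/4)^k))"
  proof (rule Liminf_mono)
   show "eventually (%n. ennreal (d m (r n)) \<le> ennreal ((1/4)^k)) sequentially"
    using eventually_ge_at_top[of k]
    by eventually_elim (use B[OF that rB] in \<open>auto intro!: ennreal_leI less_imp_le\<close>)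
  qed
  also have "... = ennreal ((1/4)^k)" by (simp add: Liminf_const)
  finally show ?thesis .
 qed
 have "L2 M (%x. u (B 0) x - f x)"
  unfolding L2_def
 proof (intro conjI integrableI_bounded)
  have "(\<integral>\<^sup>+x. ennreal (norm ((u (B 0) x - f x)\<^sup>2)) \<partial>M) \<le> 1"
   using bound[of 0 "B 0"] by simp
  also have "... < \<infinity>" by simp
  finally show "(\<integral>\<^sup>+x. ennreal (norm ((u (B 0) x - f x)\<^sup>2)) \<partial>M) < \<infinity>" .
 qed measurable
 from L2_diff[OF u[of "B 0"] this] have f: "L2 M f" by simp
 have "(%N. \<integral>x. (u N x - f x)\<^sup>2 \<partial>M) \<longlonglongrightarrow> 0"
 proof (rule LIMSEQ_I)
  fix e :: real assume "e > 0"
  then obtain k where k: "(1/4::real)^k < e" using real_arch_pow_inv[of e "1/4"] by auto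
  have "norm ((LINT x|M. (u N x - f x)\<^sup>2) - 0) < e" if "N \<ge> B k" for N
  proof -
   have "ennreal (LINT x|M. (u N x - f x)\<^sup>2) = (\<integral>\<^sup>+x. ennreal ((u N x - f x)\<^sup>2) \<partial>M)"
    by (rule nn_integral_eq_integral[symmetric]) (use L2_diff[OF u f] in \<open>auto simp: L2_def\<close>)
   also have "... \<le> ennreal ((1/4)^k)" by (rule bound[OF that])
   finally have "(LINT x|M. (u N x - f x)\<^sup>2) \<le> (1/4)^k" by (simp add: ennreal_le_iff)
   then show ?thesis using k by simp
  qed
  then show "\<exists>no. \<forall>n\<ge>no. norm ((LINT x|M. (u n x - f x)\<^sup>2) - 0) < e" by blast
 qed
 then have "Lp_tendsto M 2 u f" using Lp_tendsto_2_iff[of M u f] u f by simp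
 with f show ?thesis by blast
qed

lemma L2_tendsto_imp_Cauchy:
 assumes "\<And>N. L2 M (u N)" "L2 M f" "Lp_tendsto M 2 u f" "e > 0"
 shows "\<exists>N0. \<forall>m\<ge>N0. \<forall>n\<ge>N0. (LINT x|M. (u m x - u n x)\<^sup>2) < e"
proof -
 have "(%N. \<integral>x. (u N x - f x)\<^sup>2 \<partial>M) \<longlonglongrightarrow> 0" using assms Lp_tendsto_2_iff by blast
 then have "eventually (%N. (LINT x|M. (u N x - f x)\<^sup>2) < e / 4) sequentially"
  using assms(4) by (intro order_tendstoD) auto
 then obtain N0 where N0: "\<And>N. N \<ge> N0 ==> (LINT x|M. (u N x - f x)\<^sup>2) < e / 4"
  by (auto simp: eventually_sequentially)
 have "(LINT x|M. (u m x - u n x)\<^sup>2) < e" if "m \<ge> N0" "n \<ge> N0" for m n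
 proof -
  have i: "integrable M (%x. (u m x - f x)\<^sup>2)" "integrable M (%x. (u n x - f x)\<^sup>2)"
   "integrable M (%x. (u m x - u n x)\<^sup>2)"
   by (intro L2_integrable_square L2_diff assms)+
  have "(LINT x|M. (u m x - u n x)\<^sup>2) \<le> (LINT x|M. 2 * ((u m x - f x)\<^sup>2 + (u n x - f x)\<^sup>2))"
  proof (rule integral_mono)
   fix x
   have "2 * ((u m x - f x)\<^sup>2 + (u n x - f x)\<^sup>2) - (u m x - u n x)\<^sup>2 = ((u m x - f x) + (u n x - f x))\<^sup>2"
    by (simp add: power2_eq_square algebra_simps)
   then show "(u m x - u n x)\<^sup>2 \<le> 2 * ((u m x - f x)\<^sup>2 + (u n x - f x)\<^sup>2)"
    by (metis diff_ge_0_iff_ge zero_le_power2)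
  qed (use i in auto)
  also have "... = 2 * ((LINT x|M. (u m x - f x)\<^sup>2) + (LINT x|M. (u n x - f x)\<^sup>2))" using i by simp
  also have "... < e" using N0[OF that(1)] N0[OF that(2)] by simp
  finally show ?thesis .
 qed
 then show ?thesis by blast
qed

lemma L2_tendsto_zero_of_norm:
 assumes "\<And>N. L2 M (u N)" "L2 M f" "\<And>N. (LINT x|M. (u N x - f x)\<^sup>2) \<le> b N" "b \<longlonglongrightarrow> 0"
 shows "Lp_tendsto M 2 u f"
proof -
 have "(%N. \<integral>x. (u N x - f x)\<^sup>2 \<partial>M) \<longlonglongrightarrow> 0"
  by (rule tendsto_sandwich[OF _ _ tendsto_const assms(4)]) (simp, intro always_eventually allI assms(3))
 then show ?thesis using assms Lp_tendsto_2_iff[of M u f] by simp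
qed

section \<open>The Wiener integral\<close>

locale white_noise_space = prob_space M for M :: "'w measure" +
 fixes W :: "'a::euclidean_space set => 'w => real" and d :: nat
 assumes wn: "white_noise M W" and dim: "DIM('a) = d + 1"
begin

abbreviation S :: "'a measure" where "S \<equiv> sphere_measure"

abbreviation wi :: "('a => real) => 'w => real" where "wi == wiener M W"

lemma finite_S: "finite_measure S"
 by standard (simp add: emeasure_sphere_measure_space[OF dim])

end

lemma centered_gaussian_square_integrable:
 assumes "prob_space M" "centered_gaussian M X"
 shows "L2 M X"
proof -
 interpret prob_space M by fact
 have [measurable]: "X \<in> borel_measurable M" using assms by (simp add: centered_gaussian_def)
 consider "AE om in M. X om = 0" | s where "s > 0" "distributed M lborel X (normal_density 0 s)"
  using assms by (auto simp: centered_gaussian_def)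
 then show ?thesis
 proof cases
  case 1
  then have "AE om in M. 0 = X om" by auto
  from L2_cong_AE[OF L2_zero this] show ?thesis by simp
 next
  case 2
  have "integrable lborel (%x. normal_density 0 s x * x\<^sup>2)"
   using integrable_normal_moment[OF 2(1), of 0 2] by simp
  then have "integrable M (%om. (X om)\<^sup>2)"
   using distributed_integrable[OF 2(2), of "%x. x\<^sup>2"] by simp
  then show ?thesis by (simp add: L2_def)
 qed
qed

lemma centered_gaussian_char:
 assumes "prob_space M" "centered_gaussian M X"
 shows "(CLINT om|M. iexp (t * X om)) = exp (- (t\<^sup>2 * (LINT om|M. (X om)\<^sup>2)) / 2)"
proof -
 interpret prob_space M by fact
 have [measurable]: "X \<in> borel_measurable M" using assms by (simp add: centered_gaussian_def)
 consider "AE om in M. X om = 0" | s where "s > 0" "distributed M lborel X (normal_density 0 s)"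
  using assms by (auto simp: centered_gaussian_def)
 then show ?thesis
 proof cases
  case 1
  have "(LINT om|M. (X om)\<^sup>2) = (LINT om|M. 0)"
   using 1 by (intro integral_cong_AE) auto
  moreover have "(CLINT om|M. iexp (t * X om)) = (CLINT om|M. 1)"
   using 1 by (intro integral_cong_AE) auto
  ultimately show ?thesis by (simp add: prob_space)
 next
  case 2
  have v: "(LINT om|M. (X om)\<^sup>2) = s\<^sup>2"
   using normal_distributed_variance[OF 2] normal_distributed_expectation[OF 2] by simp
  have "distributed M lborel (%om. X om / s) std_normal_density"
   using 2 normal_standard_normal_convert[of s X 0] by simp
  then have "distr M lborel (%om. X om / s) = std_normal_distribution"
   by (rule distributed_distr_eq_density)
  moreover have "distr M borel (%om. X om / s) = distr M lborel (%om. X om / s)"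
   by (rule distr_cong) auto
  ultimately have D: "distr M borel (%om. X om / s) = std_normal_distribution" by simp
  have "(CLINT om|M. iexp (t * X om)) = (CLINT om|M. iexp (t * s * (X om / s)))"
   using 2 by simp
  also have "... = (CLINT z|distr M borel (%om. X om / s). iexp (t * s * z))"
   by (subst integral_distr) auto
  also have "... = char std_normal_distribution (t * s)"
   by (simp add: D char_def)
  finally show ?thesis
   by (simp add: char_std_normal_distribution v power_mult_distrib)
 qed
qed

context white_noise_space
begin

sublocale S: finite_measure S by (rule finite_S)

lemma W_sum_gaussian:
 "finite \<A> ==> \<A> \<subseteq> sets S ==> centered_gaussian M (%om. \<Sum>A\<in>\<A>. c A * W A om)"
 using wn by (auto simp: white_noise_def)

lemma W_L2: "A \<in> sets S ==> L2 M (W A)"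
 using centered_gaussian_square_integrable[OF prob_space_axioms W_sum_gaussian[of "{A}" "%_. 1"]] by simp

lemma W_inner: "A \<in> sets S ==> B \<in> sets S ==> (LINT om|M. W A om * W B om) = measure S (A \<inter> B)"
 using wn by (auto simp: white_noise_def)

lemma simple_L2:
 assumes "simple_function S s" shows "L2 S s"
proof -
 have "finite (s ` space S)" using assms by (simp add: simple_function_def)
 then have "\<exists>B. \<forall>x\<in>space S. norm ((s x)\<^sup>2) \<le> B"
  by (intro exI[of _ "Max ((%v. norm (v\<^sup>2)) ` s ` space S)"]) auto
 then obtain B where "\<forall>x\<in>space S. norm ((s x)\<^sup>2) \<le> B" by blast
 moreover have "s \<in> borel_measurable S" using assms by (rule borel_measurable_simple_function)
 ultimately show ?thesis
  unfolding L2_def by (intro conjI S.integrable_const_bound[of _ B] AE_I2) auto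
qed

lemma simple_level_sets: "simple_function S s ==> s -` {v} \<inter> sphere 0 1 \<in> sets S"
 by (metis simple_functionD(2) space_sphere_measure)

lemma simple_wiener_L2:
 assumes "simple_function S s" shows "L2 M (simple_wiener W s)"
 unfolding simple_wiener_def
 by (intro L2_sum L2_cmult W_L2 simple_level_sets[OF assms])

text \<open>Pairing the level sets of the two functions, white noise turns each pair into the
  measure of an intersection. This isometry carries the whole extension to
  \<open>L2\<close>.\<close>

lemma simple_wiener_inner:
 assumes s: "simple_function S s" and s': "simple_function S s'"
 shows "(LINT om|M. simple_wiener W s om * simple_wiener W s' om) = (LINT x|S. s x * s' x)"
proof -
 define A where "A v = s -` {v} \<inter> sphere 0 1" for v
 define A' where "A' v = s' -` {v} \<inter> sphere 0 1" for v
 have fin: "finite (s ` sphere 0 1)" "finite (s' ` sphere 0 1)"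
  using s s' simple_functionD(1)[of S] by auto
 have [measurable]: "A v \<in> sets S" "A' v \<in> sets S" for v
  using simple_level_sets s s' by (auto simp: A_def A'_def)
 have rep: "s x = (\<Sum>v\<in>s ` sphere 0 1. v * indicator (A v) x)" if "x \<in> sphere 0 1" for x
 proof -
  have "(\<Sum>v\<in>s ` sphere 0 1. v * indicator (A v) x) = (\<Sum>v\<in>s ` sphere 0 1. if v = s x then v else 0)"
   by (intro sum.cong) (use that in \<open>auto simp: A_def indicator_def\<close>)
  also have "... = s x" using fin that by (simp add: sum.delta')
  finally show ?thesis by simp
 qed
 have rep': "s' x = (\<Sum>v\<in>s' ` sphere 0 1. v * indicator (A' v) x)" if "x \<in> sphere 0 1" for x
 proof -
  have "(\<Sum>v\<in>s' ` sphere 0 1. v * indicator (A' v) x) = (\<Sum>v\<in>s' ` sphere 0 1. if v = s' x then v else 0)"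
   by (intro sum.cong) (use that in \<open>auto simp: A'_def indicator_def\<close>)
  also have "... = s' x" using fin that by (simp add: sum.delta')
  finally show ?thesis by simp
 qed
 have "(LINT om|M. simple_wiener W s om * simple_wiener W s' om)
   = (LINT om|M. (\<Sum>v\<in>s ` sphere 0 1. \<Sum>v'\<in>s' ` sphere 0 1. v * v' * (W (A v) om * W (A' v') om)))"
  by (simp add: simple_wiener_def A_def A'_def sum_product mult_ac)
 also have "... = (\<Sum>v\<in>s ` sphere 0 1. \<Sum>v'\<in>s' ` sphere 0 1. v * v' * measure S (A v \<inter> A' v'))"
  by (simp add: W_inner L2_mult_integrable W_L2 integrable_sum)
 also have "... = (LINT x|S. (\<Sum>v\<in>s ` sphere 0 1. \<Sum>v'\<in>s' ` sphere 0 1. v * v' * (indicator (A v) x * indicator (A' v') x)))"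
 proof -
  have e: "indicator (A v) x * indicator (A' v') x = (indicator (A v \<inter> A' v') x :: real)" for v v' x
   by (auto simp: indicator_def)
  have "A v \<inter> A' v' \<inter> sphere 0 1 = A v \<inter> A' v'" for v v' by (auto simp: A_def)
  moreover have "integrable S (indicator (A v \<inter> A' v') :: 'a => real)" for v v'
   by (rule integrable_real_indicator) (auto simp: S.emeasure_finite less_top[symmetric])
  ultimately show ?thesis
   unfolding e by simp
 qed
 also have "... = (LINT x|S. s x * s' x)"
 proof (rule bi_cong[OF refl])
  fix x :: 'a assume "x \<in> space S"
  then have "x \<in> sphere 0 1" by simp
  have "s x * s' x = (\<Sum>v\<in>s ` sphere 0 1. v * indicator (A v) x) * (\<Sum>v\<in>s' ` sphere 0 1. v * indicator (A' v) x)"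
   using rep[OF \<open>x \<in> sphere 0 1\<close>] rep'[OF \<open>x \<in> sphere 0 1\<close>] by presburger
  then show "(\<Sum>v\<in>s ` sphere 0 1. \<Sum>v'\<in>s' ` sphere 0 1. v * v' * (indicator (A v) x * indicator (A' v') x)) = s x * s' x"
   by (simp only: sum_product) (intro sum.cong refl, simp add: mult_ac)
 qed
 finally show ?thesis .
qed

lemma simple_wiener_gaussian:
 assumes "simple_function S s"
 shows "centered_gaussian M (simple_wiener W s)"
proof -
 define A where "A v = s -` {v} \<inter> sphere 0 1" for v
 define V where "V = s ` sphere 0 1"
 \<comment> \<open>\<open>white_noise\<close> takes combinations indexed by sets, so the
   coefficients have to be recovered from the level sets. Distinct values have disjoint nonempty
   level sets, and \<open>inv_into V A\<close> reads the value off.\<close>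
 have inj: "inj_on A V"
  by (rule inj_onI) (auto simp: A_def V_def)
 have fin: "finite V" using simple_functionD(1)[OF assms] by (simp add: V_def)
 have "A ` V \<subseteq> sets S" using simple_level_sets[OF assms] by (auto simp: A_def)
 from W_sum_gaussian[OF finite_imageI[OF fin] this, of "inv_into V A"]
 have "centered_gaussian M (%om. \<Sum>v\<in>V. inv_into V A (A v) * W (A v) om)"
  by (simp add: sum.reindex[OF inj])
 also have "(%om. \<Sum>v\<in>V. inv_into V A (A v) * W (A v) om) = simple_wiener W s"
  using inv_into_f_f[OF inj] by (auto simp: simple_wiener_def V_def[symmetric] A_def[symmetric])
 finally show ?thesis .
qed

lemma simple_dense:
 assumes "L2 S g"
 shows "\<exists>s. (\<forall>N. simple_function S (s N)) \<and> Lp_tendsto S 2 s g"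
proof -
 obtain s where s: "\<And>i. simple_function S (s i)" "\<And>x. x \<in> space S ==> (%i. s i x) \<longlonglongrightarrow> g x"
  "\<And>i x. x \<in> space S ==> dist (s i x) 0 \<le> 2 * dist (g x) 0"
  using borel_measurable_implies_sequence_metric[OF L2_measurable[OF assms], of 0] by blast
 have "(%i. \<integral>x. (s i x - g x)\<^sup>2 \<partial>S) \<longlonglongrightarrow> (LINT x|S. 0)"
 proof (rule integral_dominated_convergence[where w="%x. 9 * (g x)\<^sup>2"])
  show "AE x in S. (%i. (s i x - g x)\<^sup>2) \<longlonglongrightarrow> 0"
   using s(2) by (intro AE_I2) (auto intro!: tendsto_eq_intros)
  show "AE x in S. norm ((s i x - g x)\<^sup>2) \<le> 9 * (g x)\<^sup>2" for i
  proof (rule AE_I2)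
   fix x assume "x \<in> space S"
   then have "\<bar>s i x - g x\<bar> \<le> 3 * \<bar>g x\<bar>" using s(3)[of x i] by simp
   then have "\<bar>s i x - g x\<bar>\<^sup>2 \<le> (3 * \<bar>g x\<bar>)\<^sup>2" by (rule power_mono) simp
   then show "norm ((s i x - g x)\<^sup>2) \<le> 9 * (g x)\<^sup>2" by (simp add: power_mult_distrib)
  qed
  show "(%x. (s i x - g x)\<^sup>2) \<in> borel_measurable S" for i
   using borel_measurable_simple_function[OF s(1)[of i]] assms by (auto simp: L2_def)
 qed (use assms in \<open>auto simp: L2_def\<close>)
 then have "Lp_tendsto S 2 s g"
  using Lp_tendsto_2_iff[of S s g] simple_L2[OF s(1)] assms by simp
 with s(1) show ?thesis by blast
qed

text \<open>Existence behind the choice in \<open>wiener\<close>: the isometry carries the Cauchy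
  property of simple approximants from the sphere to the probability space, and completeness gives a
  limit.\<close>

lemma wiener_spec:
 assumes g: "L2 S g"
 shows "L2 M (wi g) \<and> (\<exists>s. (\<forall>N. simple_function S (s N)) \<and> Lp_tendsto S 2 s g \<and>
  Lp_tendsto M 2 (%N. simple_wiener W (s N)) (wi g))"
proof -
 obtain s where s: "\<And>N. simple_function S (s N)" "Lp_tendsto S 2 s g" using simple_dense[OF g] by blast
 have *: "(LINT om|M. (simple_wiener W (s m) om - simple_wiener W (s n) om)\<^sup>2) = (LINT x|S. (s m x - s n x)\<^sup>2)" for m n
 proof -
  have "(LINT om|M. (simple_wiener W (s m) om - simple_wiener W (s n) om)\<^sup>2) =
   (LINT om|M. simple_wiener W (s m) om * simple_wiener W (s m) om - 2 * (simple_wiener W (s m) om * simple_wiener W (s n) om)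
    + simple_wiener W (s n) om * simple_wiener W (s n) om)"
   by (rule bi_cong) (auto simp: power2_eq_square algebra_simps)
  also have "... = (LINT x|S. s m x * s m x) - 2 * (LINT x|S. s m x * s n x) + (LINT x|S. s n x * s n x)"
   by (simp add: simple_wiener_inner s L2_mult_integrable simple_wiener_L2)
  also have "... = (LINT x|S. s m x * s m x - 2 * (s m x * s n x) + s n x * s n x)"
   by (simp add: L2_mult_integrable simple_L2 s)
  also have "... = (LINT x|S. (s m x - s n x)\<^sup>2)"
   by (rule bi_cong) (auto simp: power2_eq_square algebra_simps)
  finally show ?thesis .
 qed
 have "\<exists>X. L2 M X \<and> Lp_tendsto M 2 (%N. simple_wiener W (s N)) X"
 proof (rule L2_complete)
  show "L2 M (simple_wiener W (s N))" for N by (rule simple_wiener_L2[OF s(1)])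
  show "\<exists>N0. \<forall>m\<ge>N0. \<forall>n\<ge>N0. (LINT om|M. (simple_wiener W (s m) om - simple_wiener W (s n) om)\<^sup>2) < e"
   if "e > 0" for e
   unfolding * by (rule L2_tendsto_imp_Cauchy[OF simple_L2[OF s(1)] g s(2) that])
 qed
 then have "\<exists>X. L2 M X \<and>
    (\<exists>s. (\<forall>N. simple_function S (s N)) \<and> Lp_tendsto S 2 s g \<and>
      Lp_tendsto M 2 (%N. simple_wiener W (s N)) X)"
  using s by blast
 from someI_ex[OF this] show ?thesis unfolding wiener_def .
qed

lemma wiener_L2 [intro]: "L2 S g ==> L2 M (wi g)"
 using wiener_spec by blast

lemma wiener_inner:
 assumes g: "L2 S g" and h: "L2 S h"
 shows "(LINT om|M. wi g om * wi h om) = (LINT x|S. g x * h x)"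
proof -
 obtain s where s: "\<And>N. simple_function S (s N)" "Lp_tendsto S 2 s g"
  "Lp_tendsto M 2 (%N. simple_wiener W (s N)) (wi g)" using wiener_spec[OF g] by blast
 obtain s' where s': "\<And>N. simple_function S (s' N)" "Lp_tendsto S 2 s' h"
  "Lp_tendsto M 2 (%N. simple_wiener W (s' N)) (wi h)" using wiener_spec[OF h] by blast
 have "(%N. \<integral>om. simple_wiener W (s N) om * simple_wiener W (s' N) om \<partial>M) \<longlonglongrightarrow> (LINT om|M. wi g om * wi h om)"
  by (intro L2_tendsto_inner simple_wiener_L2 wiener_L2 s s' g h)
 moreover have "(%N. \<integral>x. s N x * s' N x \<partial>S) \<longlonglongrightarrow> (LINT x|S. g x * h x)"
  by (intro L2_tendsto_inner simple_L2 s s' g h)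
 ultimately show ?thesis
  by (auto simp: simple_wiener_inner s s' intro: LIMSEQ_unique)
qed

text \<open>Gaussian characteristic functions survive the limit: an almost surely convergent
  subsequence with dominated convergence on one side, convergence of the variances on the
  other.\<close>

lemma wiener_char:
 assumes g: "L2 S g"
 shows "(CLINT om|M. iexp (t * wi g om)) = exp (- (t\<^sup>2 * (LINT x|S. (g x)\<^sup>2)) / 2)"
proof -
 obtain s where s: "\<And>N. simple_function S (s N)" "Lp_tendsto S 2 s g"
  "Lp_tendsto M 2 (%N. simple_wiener W (s N)) (wi g)" using wiener_spec[OF g] by blast
 obtain r where r: "strict_mono r" "AE om in M. (%n. simple_wiener W (s (r n)) om) \<longlonglongrightarrow> wi g om"
  using L2_tendsto_AE_subseq[OF simple_wiener_L2[OF s(1)] wiener_L2[OF g] s(3)] by blast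
 have [measurable]: "wi g \<in> borel_measurable M" "simple_wiener W (s n) \<in> borel_measurable M" for n
  using wiener_L2[OF g] simple_wiener_L2[OF s(1)] by (auto simp: L2_def)
 have 1: "(%n. CLINT om|M. iexp (t * simple_wiener W (s (r n)) om)) \<longlonglongrightarrow> (CLINT om|M. iexp (t * wi g om))"
 proof (rule integral_dominated_convergence[where w="%_. 1"])
  show "AE om in M. (%n. iexp (t * simple_wiener W (s (r n)) om)) \<longlonglongrightarrow> iexp (t * wi g om)"
   using r(2) by eventually_elim (intro tendsto_intros)
 qed auto
 have "(%N. \<integral>x. s N x * s N x \<partial>S) \<longlonglongrightarrow> (LINT x|S. g x * g x)"
  by (intro L2_tendsto_inner simple_L2 s g)
 from LIMSEQ_subseq_LIMSEQ[OF this r(1)]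
 have "(%n. \<integral>x. (s (r n) x)\<^sup>2 \<partial>S) \<longlonglongrightarrow> (LINT x|S. (g x)\<^sup>2)" by (simp add: o_def power2_eq_square)
 then have "(%n. complex_of_real (exp (- (t\<^sup>2 * (LINT x|S. (s (r n) x)\<^sup>2)) / 2))) \<longlonglongrightarrow> complex_of_real (exp (- (t\<^sup>2 * (LINT x|S. (g x)\<^sup>2)) / 2))"
  by (intro tendsto_intros) auto
 moreover have "(CLINT om|M. iexp (t * simple_wiener W (s n) om)) = exp (- (t\<^sup>2 * (LINT x|S. (s n x)\<^sup>2)) / 2)" for n
  using centered_gaussian_char[OF prob_space_axioms simple_wiener_gaussian[OF s(1)], of t n]
   simple_wiener_inner[OF s(1)[of n] s(1)[of n]] by (simp add: power2_eq_square)
 ultimately show ?thesis using LIMSEQ_unique[OF 1] by simp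
qed

lemma square_diff_sum:
 fixes a :: real
 shows "(a - (\<Sum>i\<in>I. c i * b i))\<^sup>2 = a * a - 2 * (\<Sum>i\<in>I. c i * (a * b i)) + (\<Sum>i\<in>I. \<Sum>j\<in>I. c i * c j * (b i * b j))"
proof -
 define s where "s = (\<Sum>i\<in>I. c i * b i)"
 have 1: "(\<Sum>i\<in>I. c i * (a * b i)) = a * s" by (simp add: s_def sum_distrib_left mult_ac)
 have 2: "(\<Sum>i\<in>I. \<Sum>j\<in>I. c i * c j * (b i * b j)) = s * s"
  unfolding s_def sum_product by (intro sum.cong refl) (simp add: mult_ac)
 show ?thesis unfolding 1 2 s_def[symmetric] by (simp add: power2_eq_square algebra_simps)
qed

text \<open>Chosen representatives are linear only almost surely. By the isometry the second moment
  of the difference equals the squared norm of g minus the combination, which is zero.\<close>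

lemma wiener_lincomb:
 assumes g: "L2 S g" and f: "\<And>i. i \<in> I ==> L2 S (f i)" and "finite I"
  and eq: "AE x in S. g x = (\<Sum>i\<in>I. c i * f i x)"
 shows "AE om in M. wi g om = (\<Sum>i\<in>I. c i * wi (f i) om)"
proof -
 let ?w = "wi"
 have L: "L2 M (%om. ?w g om - (\<Sum>i\<in>I. c i * ?w (f i) om))"
  by (intro L2_diff L2_sum L2_cmult wiener_L2 g f)
 have i1: "integrable M (%om. ?w g om * ?w g om)" "integrable S (%x. g x * g x)"
  by (intro L2_mult_integrable wiener_L2 g)+
 have i2: "integrable M (%om. ?w g om * ?w (f i) om)" "integrable S (%x. g x * f i x)" if "i \<in> I" for i
  by (intro L2_mult_integrable wiener_L2 g f that)+
 have i3: "integrable M (%om. ?w (f i) om * ?w (f j) om)" "integrable S (%x. f i x * f j x)" if "i \<in> I" "j \<in> I" for i j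
  by (intro L2_mult_integrable wiener_L2 g f that)+
 have "(LINT om|M. (?w g om - (\<Sum>i\<in>I. c i * ?w (f i) om))\<^sup>2)
  = (LINT om|M. ?w g om * ?w g om - 2 * (\<Sum>i\<in>I. c i * (?w g om * ?w (f i) om))
    + (\<Sum>i\<in>I. \<Sum>j\<in>I. c i * c j * (?w (f i) om * ?w (f j) om)))"
  by (simp only: square_diff_sum)
 also have "... = (LINT x|S. g x * g x) - 2 * (\<Sum>i\<in>I. c i * (LINT x|S. g x * f i x))
   + (\<Sum>i\<in>I. \<Sum>j\<in>I. c i * c j * (LINT x|S. f i x * f j x))"
  using i1 i2 i3 by (simp add: wiener_inner g f)
 also have "... = (LINT x|S. g x * g x - 2 * (\<Sum>i\<in>I. c i * (g x * f i x)) + (\<Sum>i\<in>I. \<Sum>j\<in>I. c i * c j * (f i x * f j x)))"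
  using i1 i2 i3 by simp
 also have "... = (LINT x|S. (g x - (\<Sum>i\<in>I. c i * f i x))\<^sup>2)"
  by (simp only: square_diff_sum)
 also have "... = (LINT x|S. 0)"
 proof (rule integral_cong_AE)
  show "(%x. (g x - (\<Sum>i\<in>I. c i * f i x))\<^sup>2) \<in> borel_measurable S"
   by (intro borel_measurable_power L2_measurable[OF L2_diff] L2_sum L2_cmult g f)
  show "AE x in S. (g x - (\<Sum>i\<in>I. c i * f i x))\<^sup>2 = 0"
   using eq by eventually_elim simp
 qed simp
 finally have "(LINT om|M. (?w g om - (\<Sum>i\<in>I. c i * ?w (f i) om))\<^sup>2) = 0" by simp
 from L2_norm_zero_AE[OF L this] show ?thesis by simp
qed

end

section \<open>Laws of Gaussian vectors\<close>

text \<open>Uniqueness of characteristic functions for a signed weight. Positive and negative part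
  have equal mass; normalized by it, they push forward under V to two probability laws with the same
  characteristic function.\<close>

lemma signed_char_unique:
 fixes V w :: "'w => real"
 assumes "prob_space M" and [measurable]: "V \<in> borel_measurable M" and w: "integrable M w"
  and c: "\<And>t. (LINT om|M. w om * cos (t * V om)) = 0" and s: "\<And>t. (LINT om|M. w om * sin (t * V om)) = 0"
  and A: "A \<in> sets borel"
 shows "(LINT om|M. w om * indicator A (V om)) = 0"
proof -
 interpret prob_space M by fact
 define p where "p om = max 0 (w om)" for om
 define n where "n om = max 0 (- w om)" for om
 have [measurable]: "w \<in> borel_measurable M" using w by auto
 have [measurable]: "p \<in> borel_measurable M" "n \<in> borel_measurable M" by (auto simp: p_def[abs_def] n_def[abs_def])
 have pn: "integrable M p" "integrable M n"
  using w by (auto simp: p_def[abs_def] n_def[abs_def])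
 have w_eq: "w om = p om - n om" for om by (auto simp: p_def n_def)
 have nn: "p om \<ge> 0" "n om \<ge> 0" for om by (auto simp: p_def n_def)
 have bmult: "integrable M (%om. f om * g om)" if "integrable M f" "g \<in> borel_measurable M" "\<And>om. \<bar>g om\<bar> \<le> 1" for f g :: "'w => real"
 proof (rule bi_int_bound[OF that(1)])
  show "AE om in M. norm (f om * g om) \<le> norm (f om)"
   using that(3) by (intro AE_I2) (auto simp: abs_mult mult_left_le)
 qed (use that in auto)
 define m where "m = (LINT om|M. p om)"
 have eqc: "(LINT om|M. p om * cos (t * V om)) = (LINT om|M. n om * cos (t * V om))" for t
  using c[of t] bmult[OF pn(1), of "%om. cos (t * V om)"] bmult[OF pn(2), of "%om. cos (t * V om)"]
  by (simp add: w_eq left_diff_distrib)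
 have eqs: "(LINT om|M. p om * sin (t * V om)) = (LINT om|M. n om * sin (t * V om))" for t
  using s[of t] bmult[OF pn(1), of "%om. sin (t * V om)"] bmult[OF pn(2), of "%om. sin (t * V om)"]
  by (simp add: w_eq left_diff_distrib)
 have m': "m = (LINT om|M. n om)" using eqc[of 0] by (simp add: m_def)
 have "m \<ge> 0" by (simp add: m_def nn)
 show ?thesis
 proof (cases "m = 0")
  case True
  then have "AE om in M. p om = 0" "AE om in M. n om = 0"
   using integral_nonneg_eq_0_iff_AE[OF pn(1)] integral_nonneg_eq_0_iff_AE[OF pn(2)] m' nn by (auto simp: m_def)
  then have "AE om in M. w om * indicator A (V om) = 0" by eventually_elim (simp add: w_eq)
  then show ?thesis using integral_cong_AE[of _ M "%_. 0"] by (simp add: integral_eq_zero_AE)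
 next
  case False
  with \<open>m \<ge> 0\<close> have m: "m > 0" by simp
  define D where "D f = distr (density M (%om. ennreal (f om / m))) borel V" for f
  have D: "real_distribution (D f)" if f: "integrable M f" "\<And>om. f om \<ge> 0" "(LINT om|M. f om) = m" for f
  proof -
   have [measurable]: "f \<in> borel_measurable M" using f by auto
   have "(\<integral>\<^sup>+om. ennreal (f om / m) \<partial>M) = ennreal (LINT om|M. f om / m)"
    by (rule nn_integral_eq_integral) (use f m in auto)
   then have "prob_space (density M (%om. ennreal (f om / m)))"
    using f m by (intro prob_spaceI) (simp add: emeasure_density cong: nn_integral_cong)
   then have "prob_space (D f)" unfolding D_def by (rule prob_space.prob_space_distr) simp
   then show ?thesis by (auto simp: real_distribution_def real_distribution_axioms_def D_def)
  qed
  have chD: "char (D f) t = Complex ((LINT om|M. f om * cos (t * V om)) / m) ((LINT om|M. f om * sin (t * V om)) / m)"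
   if f: "integrable M f" "\<And>om. f om \<ge> 0" for f t
  proof -
   have [measurable]: "f \<in> borel_measurable M" using f by auto
   have i: "integrable M (%om. f om * cos (t * V om))" "integrable M (%om. f om * sin (t * V om))"
    by (intro bmult f; simp)+
   have "char (D f) t = (CLINT om|M. (f om / m) *\<^sub>R iexp (t * V om))"
    unfolding char_def D_def using f m by (subst integral_distr) (auto simp: integral_density)
   also have "... = (CLINT om|M. complex_of_real (f om * cos (t * V om) / m) + \<i> * complex_of_real (f om * sin (t * V om) / m))"
    by (rule bi_cong)
     (auto simp: complex_eq_iff Re_exp Im_exp)
   also have "... = complex_of_real (LINT om|M. f om * cos (t * V om) / m) + \<i> * complex_of_real (LINT om|M. f om * sin (t * V om) / m)"
   proof -
    have i': "integrable M (%om. f om * cos (t * V om) / m)" "integrable M (%om. f om * sin (t * V om) / m)"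
     using i by simp_all
    show ?thesis
     by (subst bi_add[OF integrable_of_real[OF i'(1)] integrable_mult_right[OF integrable_of_real[OF i'(2)]]])
      (simp only: integral_mult_right_zero integral_complex_of_real)
   qed
   finally show ?thesis by (simp add: complex_eq_iff)
  qed
  have "D p = D n"
   by (rule Levy_uniqueness)
    (use D[OF pn(1)] D[OF pn(2)] nn m' eqc eqs pn in \<open>auto simp: m_def chD fun_eq_iff\<close>)
  then have *: "measure (D p) A = measure (D n) A" by simp
  have mD: "measure (D f) A = (LINT om|M. f om * indicator A (V om)) / m"
   if f: "integrable M f" "\<And>om. f om \<ge> 0" for f
  proof -
   have [measurable]: "f \<in> borel_measurable M" using f by auto
   have "measure (D f) A = (LINT z|(D f). indicator A z)" using A by (simp add: D_def)
   also have "... = (LINT om|M. (f om / m) *\<^sub>R indicator A (V om))"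
    unfolding D_def using f m A by (subst integral_distr) (auto simp: integral_density)
   finally show ?thesis by simp
  qed
  have "(LINT om|M. p om * indicator A (V om)) = (LINT om|M. n om * indicator A (V om))"
   using * mD[OF pn(1)] mD[OF pn(2)] nn m by simp
  then show ?thesis
   using bmult[OF pn(1), of "%om. indicator A (V om)"] bmult[OF pn(2), of "%om. indicator A (V om)"] A
   by (simp add: w_eq left_diff_distrib)
 qed
qed

lemma prob_space_gauss: "prob_space gauss"
 using prob_space_normal_density by simp

lemma integral_gauss_cos: "(LINT z|gauss. cos (t * z)) = exp (- t\<^sup>2 / 2)"
 and integral_gauss_sin: "(LINT z|gauss. sin (t * z)) = 0"
proof -
 interpret prob_space gauss by (rule prob_space_gauss)
 have i: "complex_integrable gauss (%z. iexp (t * z))"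
  by (rule integrable_const_bound[of _ 1]) auto
 have c: "(CLINT z|gauss. iexp (t * z)) = complex_of_real (exp (- t\<^sup>2 / 2))"
  using char_std_normal_distribution by (simp add: char_def fun_eq_iff)
 show "(LINT z|gauss. cos (t * z)) = exp (- t\<^sup>2 / 2)"
  using arg_cong[OF c, of Re] integral_Re[OF i] by (simp add: Re_exp)
 show "(LINT z|gauss. sin (t * z)) = 0"
  using arg_cong[OF c, of Im] integral_Im[OF i] by (simp add: Im_exp)
qed

text \<open>Induction on the coordinates, using the one-dimensional uniqueness once per coordinate.
  The weight w absorbs the indicators already treated, which is why it is general: the hypotheses on
  trigonometric integrals are inherited by w times an indicator.\<close>

lemma gauss_product_weights:
 fixes V :: "'i => 'w => real" and w :: "'w => real"
 assumes "prob_space M" "finite J"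
  and "\<And>j. j \<in> J ==> V j \<in> borel_measurable M" and "\<And>j. j \<in> J ==> distr M borel (V j) = gauss"
  and "\<And>j. j \<in> J ==> A j \<in> sets borel"
  and "integrable M w"
  and "\<And>c. (LINT om|M. w om * cos (\<Sum>j\<in>J. c j * V j om)) = (LINT om|M. w om) * exp (- (\<Sum>j\<in>J. (c j)\<^sup>2) / 2)"
  and "\<And>c. (LINT om|M. w om * sin (\<Sum>j\<in>J. c j * V j om)) = 0"
 shows "(LINT om|M. w om * (\<Prod>j\<in>J. indicator (A j) (V j om))) = (LINT om|M. w om) * (\<Prod>j\<in>J. measure gauss (A j))"
 using assms(2-)
proof (induction J arbitrary: w rule: finite_induct)
 case empty
 then show ?case by simp
next
 case (insert i J w)
 interpret prob_space M by fact
 have [measurable]: "V i \<in> borel_measurable M" "\<And>j. j \<in> J ==> V j \<in> borel_measurable M" "A i \<in> sets borel"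
  using insert.prems by auto
 have w: "integrable M w" by fact
 then have [measurable]: "w \<in> borel_measurable M" by auto
 have bmult: "integrable M (%om. f om * g om)" if "integrable M f" "g \<in> borel_measurable M" "\<And>om. \<bar>g om\<bar> \<le> 1" for f g :: "'w => real"
 proof (rule bi_int_bound[OF that(1)])
  show "AE om in M. norm (f om * g om) \<le> norm (f om)"
   using that(3) by (intro AE_I2) (auto simp: abs_mult mult_left_le)
 qed (use that in auto)
 have V_c: "(LINT om|M. cos (t * V i om)) = exp (- t\<^sup>2 / 2)" for t
  using integral_gauss_cos[of t] integral_distr[of "V i" M borel "%z. cos (t * z)"] insert.prems(2)[of i] by simp
 have V_s: "(LINT om|M. sin (t * V i om)) = 0" for t
  using integral_gauss_sin[of t] integral_distr[of "V i" M borel "%z. sin (t * z)"] insert.prems(2)[of i] by simp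
 define E where "E = (LINT om|M. w om)"
 define \<Sigma> where "\<Sigma> c om = (\<Sum>j\<in>J. c j * V j om)" for c om
 define q where "q c = exp (- (\<Sum>j\<in>J. (c j)\<^sup>2) / 2)" for c :: "'i => real"
 have [measurable]: "\<Sigma> c \<in> borel_measurable M" for c unfolding \<Sigma>_def[abs_def] by measurable
 have ext: "(\<Sum>j\<in>insert i J. (c(i:=t)) j * V j om) = t * V i om + \<Sigma> c om" for c t om
 proof -
  have "(\<Sum>j\<in>J. (c(i:=t)) j * V j om) = \<Sigma> c om"
   unfolding \<Sigma>_def using insert.hyps by (intro sum.cong) auto
  then show ?thesis using insert.hyps by simp
 qed
 have extq: "exp (- (\<Sum>j\<in>insert i J. ((c(i:=t)) j)\<^sup>2) / 2) = exp (- t\<^sup>2 / 2) * q c" for c and t :: real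
 proof -
  have "(\<Sum>j\<in>J. ((c(i:=t)) j)\<^sup>2) = (\<Sum>j\<in>J. (c j)\<^sup>2)"
   using insert.hyps by (intro sum.cong) auto
  then show ?thesis using insert.hyps by (simp add: q_def exp_add[symmetric] add_divide_distrib diff_divide_distrib)
 qed
 have cw: "(LINT om|M. w om * cos (t * V i om + \<Sigma> c om)) = E * (exp (- t\<^sup>2 / 2) * q c)" for t c
  using insert.prems(5)[of "c(i:=t)"] unfolding ext extq E_def by simp
 have sw: "(LINT om|M. w om * sin (t * V i om + \<Sigma> c om)) = 0" for t c
  using insert.prems(6)[of "c(i:=t)"] unfolding ext by simp
 have neg\<Sigma>: "\<Sigma> (%j. - c j) om = - \<Sigma> c om" "q (%j. - c j) = q c" for c om
  by (auto simp: \<Sigma>_def q_def sum_negf)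
 have cw': "(LINT om|M. w om * cos (t * V i om - \<Sigma> c om)) = E * (exp (- t\<^sup>2 / 2) * q c)" for t c
  using cw[of t "%j. - c j"] by (simp add: neg\<Sigma>)
 have sw': "(LINT om|M. w om * sin (t * V i om - \<Sigma> c om)) = 0" for t c
  using sw[of t "%j. - c j"] by (simp add: neg\<Sigma>)
 have iw: "integrable M (%om. w om * cos (t * V i om + \<Sigma> c om))" "integrable M (%om. w om * sin (t * V i om + \<Sigma> c om))"
   "integrable M (%om. w om * cos (t * V i om - \<Sigma> c om))" "integrable M (%om. w om * sin (t * V i om - \<Sigma> c om))" for t c
  by (intro bmult w; simp)+
 have q0: "q (%_. 0) = 1" "\<Sigma> (%_. 0) om = 0" for om by (auto simp: q_def \<Sigma>_def)
 have icw: "integrable M (%om. w om * cos (\<Sigma> c om))" "integrable M (%om. w om * sin (\<Sigma> c om))" for c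
  using iw[of 0 c] by simp_all
 \<comment> \<open>The weight is uncorrelated with events of \<open>V i\<close>: w - E has vanishing
   trigonometric integrals against \<open>V i\<close>.\<close>
 have wi: "(LINT om|M. (w om - E) * indicator (A i) (V i om)) = 0"
 proof (rule signed_char_unique[OF \<open>prob_space M\<close>])
  have i1: "integrable M (%om. cos (t * V i om))" "integrable M (%om. sin (t * V i om))" for t
   by (rule integrable_const_bound[of _ 1]; simp)+
  show "(LINT om|M. (w om - E) * cos (t * V i om)) = 0" for t
   using iw[of t "%_. 0"] i1[of t] cw[of t "%_. 0"] V_c[of t] by (simp add: left_diff_distrib q0)
  show "(LINT om|M. (w om - E) * sin (t * V i om)) = 0" for t
   using iw[of t "%_. 0"] i1[of t] sw[of t "%_. 0"] V_s[of t] by (simp add: left_diff_distrib q0)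
 qed (use w in auto)
 define w' where "w' om = w om * indicator (A i) (V i om)" for om
 have w': "integrable M w'" unfolding w'_def[abs_def] by (intro bmult w) auto
 have [measurable]: "w' \<in> borel_measurable M" using w' by auto
 have iind: "integrable M (%om. indicator (A i) (V i om) :: real)"
  by (rule integrable_const_bound[of _ 1]) (auto simp: indicator_def)
 have "(LINT om|M. indicator (A i) (V i om)) = (\<integral>z. indicator (A i) z \<partial>distr M borel (V i) :: real)"
  by (subst integral_distr) auto
 then have pA: "(LINT om|M. indicator (A i) (V i om)) = measure gauss (A i)"
  using insert.prems(2)[of i] by simp
 have Ew': "(LINT om|M. w' om) = E * measure gauss (A i)"
  using wi iind w' by (simp add: left_diff_distrib w'_def[abs_def] pA)
 have "(LINT om|M. w' om * (\<Prod>j\<in>J. indicator (A j) (V j om))) = (LINT om|M. w' om) * (\<Prod>j\<in>J. measure gauss (A j))"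
 proof (rule insert.IH)
  fix c
  have "(LINT om|M. (w om * cos (\<Sigma> c om) - q c * w om) * indicator (A i) (V i om)) = 0"
  proof (rule signed_char_unique[OF \<open>prob_space M\<close>])
   fix t
   \<comment> \<open>Product formulas for cosine and sine split the integrand into the frequencies t
     V + \<Sigma> and t V - \<Sigma>, where the hypothesis applies; \<open>cw'\<close> and
     \<open>sw'\<close> are its instances for the negated coefficients.\<close>
   have "(LINT om|M. (w om * cos (\<Sigma> c om) - q c * w om) * cos (t * V i om))
     = (LINT om|M. ((w om * cos (t * V i om + \<Sigma> c om)) + (w om * cos (t * V i om - \<Sigma> c om))) / 2 - q c * (w om * cos (t * V i om + \<Sigma> (%_. 0) om)))"
    by (rule bi_cong) (auto simp: cos_add cos_diff q0 algebra_simps)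
   also have "... = 0" using iw[of t c] iw[of t "%_. 0"] cw[of t "%_. 0"] by (simp add: cw cw' q0)
   finally show "(LINT om|M. (w om * cos (\<Sigma> c om) - q c * w om) * cos (t * V i om)) = 0" .
   have "(LINT om|M. (w om * cos (\<Sigma> c om) - q c * w om) * sin (t * V i om))
     = (LINT om|M. ((w om * sin (t * V i om + \<Sigma> c om)) + (w om * sin (t * V i om - \<Sigma> c om))) / 2 - q c * (w om * sin (t * V i om + \<Sigma> (%_. 0) om)))"
    by (rule bi_cong) (auto simp: sin_add sin_diff q0 algebra_simps)
   also have "... = 0" using iw[of t c] iw[of t "%_. 0"] sw[of t "%_. 0"] by (simp add: sw sw' q0)
   finally show "(LINT om|M. (w om * cos (\<Sigma> c om) - q c * w om) * sin (t * V i om)) = 0" .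
  qed (use icw w in auto)
  moreover have "integrable M (%om. w om * cos (\<Sigma> c om) * indicator (A i) (V i om))" "integrable M (%om. q c * (w om * indicator (A i) (V i om)))"
   using w' by (auto intro!: bmult icw simp: w'_def[abs_def])
  ultimately have "(LINT om|M. w om * cos (\<Sigma> c om) * indicator (A i) (V i om)) = q c * (LINT om|M. w' om)"
   by (simp add: left_diff_distrib w'_def[abs_def] mult.assoc)
  then show "(LINT om|M. w' om * cos (\<Sum>j\<in>J. c j * V j om)) = (LINT om|M. w' om) * exp (- (\<Sum>j\<in>J. (c j)\<^sup>2) / 2)"
   by (simp add: w'_def \<Sigma>_def q_def mult_ac)
  have "(LINT om|M. (w om * sin (\<Sigma> c om)) * indicator (A i) (V i om)) = 0"
  proof (rule signed_char_unique[OF \<open>prob_space M\<close>])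
   fix t
   have "(LINT om|M. (w om * sin (\<Sigma> c om)) * cos (t * V i om))
     = (LINT om|M. ((w om * sin (t * V i om + \<Sigma> c om)) - (w om * sin (t * V i om - \<Sigma> c om))) / 2)"
    by (rule bi_cong) (auto simp: sin_add sin_diff algebra_simps)
   also have "... = 0" using iw[of t c] by (simp add: sw sw')
   finally show "(LINT om|M. (w om * sin (\<Sigma> c om)) * cos (t * V i om)) = 0" .
   have "(LINT om|M. (w om * sin (\<Sigma> c om)) * sin (t * V i om))
     = (LINT om|M. ((w om * cos (t * V i om - \<Sigma> c om)) - (w om * cos (t * V i om + \<Sigma> c om))) / 2)"
    by (rule bi_cong) (auto simp: cos_add cos_diff algebra_simps)
   also have "... = 0" using iw[of t c] by (simp add: cw cw')
   finally show "(LINT om|M. (w om * sin (\<Sigma> c om)) * sin (t * V i om)) = 0" .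
  qed (use icw in auto)
  then show "(LINT om|M. w' om * sin (\<Sum>j\<in>J. c j * V j om)) = 0"
   by (simp add: w'_def \<Sigma>_def mult_ac)
 qed (use insert.prems(1-3) w' in auto)
 then show ?case
  using insert.hyps by (simp add: w'_def E_def[symmetric] Ew'[unfolded w'_def] mult_ac)
qed

context white_noise_space
begin

lemma wiener_cos_sin:
 assumes g: "L2 S g"
 shows "(LINT om|M. cos (t * wi g om)) = exp (- (t\<^sup>2 * (LINT x|S. (g x)\<^sup>2)) / 2)"
  and "(LINT om|M. sin (t * wi g om)) = 0"
proof -
 have [measurable]: "wi g \<in> borel_measurable M" using wiener_L2[OF g] by (rule L2_measurable)
 have i: "complex_integrable M (%om. iexp (t * wi g om))"
  by (rule integrable_const_bound[of _ 1]) auto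
 note c = wiener_char[OF g, of t]
 show "(LINT om|M. cos (t * wi g om)) = exp (- (t\<^sup>2 * (LINT x|S. (g x)\<^sup>2)) / 2)"
  using arg_cong[OF c, of Re] integral_Re[OF i] by (simp add: Re_exp)
 show "(LINT om|M. sin (t * wi g om)) = 0"
  using arg_cong[OF c, of Im] integral_Im[OF i] by (simp add: Im_exp)
qed

lemma wiener_unit_law:
 assumes g: "L2 S g" "(LINT x|S. (g x)\<^sup>2) = 1"
 shows "distr M borel (wi g) = gauss"
proof (rule Levy_uniqueness)
 have [measurable]: "wi g \<in> borel_measurable M" using wiener_L2[OF g(1)] by (rule L2_measurable)
 show "real_distribution (distr M borel (wi g))"
  by (rule real_distribution_distr) simp
 show "real_distribution gauss" by (rule real_dist_normal_dist)
 show "char (distr M borel (wi g)) = char gauss"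
  unfolding char_std_normal_distribution
 proof
  fix t
  show "char (distr M borel (wi g)) t = complex_of_real (exp (- t\<^sup>2 / 2))"
   unfolding char_def using wiener_char[OF g(1), of t] g(2) by (subst integral_distr) auto
 qed
qed

text \<open>A linear combination of the coordinates is almost surely a Wiener integral whose
  variance is the sum of squared coefficients, so the joint trigonometric integrals are those of
  independent standard Gaussians.\<close>

lemma orthonormal_law:
 fixes I :: "'i set"
 assumes "finite I" and e: "\<And>i. i \<in> I ==> L2 S (e i)"
  and on: "\<And>i j. i \<in> I ==> j \<in> I ==> (LINT x|S. e i x * e j x) = (if i = j then 1 else 0)"
 shows "distr M (PiM I (%_. borel)) (%om. \<lambda>i\<in>I. wi (e i) om) = PiM I (%_. gauss)"
proof -
 interpret G: product_sigma_finite "%_::'i. gauss"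
  using prob_space_gauss by (simp add: product_sigma_finite_def prob_space_imp_sigma_finite)
 have [measurable]: "wi (e i) \<in> borel_measurable M" if "i \<in> I" for i
  using wiener_L2[OF e[OF that]] by (rule L2_measurable)
 have unit: "(LINT x|S. (e i x)\<^sup>2) = 1" if "i \<in> I" for i
  using on[OF that that] by (simp add: power2_eq_square)
 have comb: "L2 S (%x. \<Sum>i\<in>I. c i * e i x)" for c by (intro L2_sum L2_cmult e)
 have norm: "(LINT x|S. (\<Sum>i\<in>I. c i * e i x)\<^sup>2) = (\<Sum>i\<in>I. (c i)\<^sup>2)" for c
 proof -
  have "(LINT x|S. (\<Sum>i\<in>I. c i * e i x)\<^sup>2) = (LINT x|S. (\<Sum>i\<in>I. \<Sum>j\<in>I. c i * c j * (e i x * e j x)))"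
   by (rule bi_cong) (auto simp: power2_eq_square sum_product intro!: sum.cong)
  also have "... = (\<Sum>i\<in>I. \<Sum>j\<in>I. c i * c j * (if i = j then 1 else 0))"
   by (simp add: L2_mult_integrable e on)
  also have "... = (\<Sum>i\<in>I. (c i)\<^sup>2)"
   using \<open>finite I\<close> by (simp add: power2_eq_square sum.delta if_distrib[of "%x. _ * x"] cong: if_cong)
  finally show ?thesis .
 qed
 have lin: "AE om in M. wi (%x. \<Sum>i\<in>I. c i * e i x) om = (\<Sum>i\<in>I. c i * wi (e i) om)" for c
  by (rule wiener_lincomb[OF comb e \<open>finite I\<close>]) auto
 show ?thesis
 proof (rule G.PiM_eqI[OF \<open>finite I\<close>])
  show "sets (distr M (PiM I (%_. borel)) (%om. \<lambda>i\<in>I. wi (e i) om)) = sets (PiM I (%_. gauss))"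
   by (simp cong: sets_PiM_cong)
 next
  fix A :: "'i => real set" assume A: "\<And>i. i \<in> I ==> A i \<in> sets gauss"
  have A': "\<And>i. i \<in> I ==> A i \<in> sets borel" using A by simp
  have "(LINT om|M. 1 * (\<Prod>j\<in>I. indicator (A j) (wi (e j) om))) = (LINT om|M. 1) * (\<Prod>j\<in>I. measure gauss (A j))"
  proof (rule gauss_product_weights[OF prob_space_axioms \<open>finite I\<close>])
   fix c
   have "(LINT om|M. cos (\<Sum>i\<in>I. c i * wi (e i) om)) = (LINT om|M. cos (1 * wi (%x. \<Sum>i\<in>I. c i * e i x) om))"
   proof (rule integral_cong_AE)
    show "AE om in M. cos (\<Sum>i\<in>I. c i * wi (e i) om) = cos (1 * wi (%x. \<Sum>i\<in>I. c i * e i x) om)"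
     using lin[of c] by eventually_elim simp
   qed (use wiener_L2[OF comb[of c]] in \<open>auto simp: L2_def\<close>)
   then show "(LINT om|M. 1 * cos (\<Sum>j\<in>I. c j * wi (e j) om)) = (LINT om|M. 1) * exp (- (\<Sum>j\<in>I. (c j)\<^sup>2) / 2)"
    using wiener_cos_sin(1)[OF comb[of c], of 1] by (simp add: norm prob_space)
   have "(LINT om|M. sin (\<Sum>i\<in>I. c i * wi (e i) om)) = (LINT om|M. sin (1 * wi (%x. \<Sum>i\<in>I. c i * e i x) om))"
   proof (rule integral_cong_AE)
    show "AE om in M. sin (\<Sum>i\<in>I. c i * wi (e i) om) = sin (1 * wi (%x. \<Sum>i\<in>I. c i * e i x) om)"
     using lin[of c] by eventually_elim simp
   qed (use wiener_L2[OF comb[of c]] in \<open>auto simp: L2_def\<close>)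
   then show "(LINT om|M. 1 * sin (\<Sum>j\<in>I. c j * wi (e j) om)) = 0"
    using wiener_cos_sin(2)[OF comb[of c], of 1] by simp
  qed (use e unit A' in \<open>auto intro: wiener_unit_law\<close>)
  then have *: "(LINT om|M. (\<Prod>j\<in>I. indicator (A j) (wi (e j) om))) = (\<Prod>j\<in>I. measure gauss (A j))"
   by (simp add: prob_space)
  define B where "B = (%om. \<lambda>i\<in>I. wi (e i) om) -` Pi\<^sub>E I A \<inter> space M"
  have [measurable]: "Pi\<^sub>E I A \<in> sets (PiM I (%_. borel))"
   using A' \<open>finite I\<close> by (rule sets_PiM_I_finite[rotated])
  have mB: "B \<in> sets M" unfolding B_def by measurable
  have "(LINT om|M. (\<Prod>j\<in>I. indicator (A j) (wi (e j) om))) = (\<integral>om. indicator B om \<partial>M :: real)"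
  proof (rule bi_cong[OF refl])
   fix om assume w: "om \<in> space M"
   show "(\<Prod>j\<in>I. indicator (A j) (wi (e j) om)) = (indicator B om :: real)"
   proof (cases "\<forall>j\<in>I. wi (e j) om \<in> A j")
    case True
    then show ?thesis using w by (auto simp: B_def indicator_def)
   next
    case False
    then obtain j where j: "j \<in> I" "wi (e j) om \<notin> A j" by auto
    then have "(\<Prod>j\<in>I. indicator (A j) (wi (e j) om) :: real) = 0"
     using \<open>finite I\<close> by (intro prod_zero) (auto simp: indicator_def)
    moreover have "om \<notin> B" using j by (auto simp: B_def PiE_iff)
    ultimately show ?thesis by simp
   qed
  qed
  also have "... = measure M B" using mB by simp
  finally have "measure M B = (\<Prod>j\<in>I. measure gauss (A j))" using * by simp
  moreover have "emeasure (distr M (PiM I (%_. borel)) (%om. \<lambda>i\<in>I. wi (e i) om)) (Pi\<^sub>E I A) = emeasure M B"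
   unfolding B_def by (rule emeasure_distr) measurable
  moreover have "emeasure gauss (A j) = ennreal (measure gauss (A j))" for j
   using prob_space_gauss by (simp add: finite_measure.emeasure_eq_measure prob_space_def)
  ultimately show "emeasure (distr M (PiM I (%_. borel)) (%om. \<lambda>i\<in>I. wi (e i) om)) (Pi\<^sub>E I A) = (\<Prod>i\<in>I. emeasure gauss (A i))"
   by (simp add: emeasure_eq_measure prod_ennreal)
 qed
qed

end

text \<open>Dependent vectors are allowed, hence the free rank r and equalities almost everywhere.
  The last clause keeps a unit vector \<open>f 0\<close> as first basis element, so that pairing
  with it becomes reading off coordinate 0.\<close>

lemma gram_schmidt:
 fixes f :: "nat => 'a => real"
 assumes "\<And>i. i < n ==> L2 M (f i)"
 shows "\<exists>(r::nat) e B. (\<forall>i<r. L2 M (e i)) \<and>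
  (\<forall>i<r. \<forall>j<r. (LINT x|M. e i x * e j x) = (if i = j then 1 else 0)) \<and>
  (\<forall>k<n. AE x in M. f k x = (\<Sum>i<r. B k i * e i x)) \<and>
  (n > 0 \<longrightarrow> (LINT x|M. (f 0 x)\<^sup>2) = 1 \<longrightarrow> r > 0 \<and> e 0 = f 0)"
 using assms
proof (induction n)
 case 0
 show ?case by (rule exI[of _ 0], rule exI[of _ "%_ _. 0"], simp)
next
 case (Suc n)
 have "\<exists>(r::nat) e B. (\<forall>i<r. L2 M (e i)) \<and>
  (\<forall>i<r. \<forall>j<r. (LINT x|M. e i x * e j x) = (if i = j then 1 else 0)) \<and>
  (\<forall>k<n. AE x in M. f k x = (\<Sum>i<r. B k i * e i x)) \<and>
  (n > 0 \<longrightarrow> (LINT x|M. (f 0 x)\<^sup>2) = 1 \<longrightarrow> r > 0 \<and> e 0 = f 0)"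
  by (rule Suc.IH) (simp add: Suc.prems)
 then obtain r :: nat and e B where *: "\<forall>i<r. L2 M (e i)"
  "\<forall>i<r. \<forall>j<r. (LINT x|M. e i x * e j x) = (if i = j then 1 else (0::real))"
  "\<forall>k<n. AE x in M. f k x = (\<Sum>i<r. B k i * e i x)"
  "n > 0 \<longrightarrow> (LINT x|M. (f 0 x)\<^sup>2) = 1 \<longrightarrow> r > 0 \<and> e 0 = f 0"
  by (elim exE conjE)
 \<comment> \<open>For n = 0 the induction hypothesis may return any orthonormal family. It is
   discarded, so that the first vector receives index 0.\<close>
 define r' where "r' = (if n = 0 then 0 else r)"
 have r'_le: "r' \<le> r" by (simp add: r'_def)
 have e: "L2 M (e i)" if "i < r'" for i
  using *(1) that r'_le by simp
 have on: "(LINT x|M. e i x * e j x) = (if i = j then 1 else (0::real))" if "i < r'" "j < r'" for i j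
  using *(2) that r'_le by (meson less_le_trans)
 have B: "AE x in M. f k x = (\<Sum>i<r'. B k i * e i x)" if "k < n" for k
  using *(3) that by (simp add: r'_def)
 have z: "r' > 0 \<and> e 0 = f 0" if "n > 0" "(LINT x|M. (f 0 x)\<^sup>2) = 1"
  using *(4) that by (simp add: r'_def)
 define b where "b i = (LINT x|M. f n x * e i x)" for i
 define p where "p x = f n x - (\<Sum>i<r'. b i * e i x)" for x
 have fn: "L2 M (f n)" using Suc.prems by simp
 have p: "L2 M p" unfolding p_def[abs_def] by (intro L2_diff fn L2_sum L2_cmult) (simp add: e)
 have po: "(LINT x|M. p x * e j x) = 0" if "j < r'" for j
 proof -
  have "(LINT x|M. p x * e j x) = (LINT x|M. f n x * e j x - (\<Sum>i<r'. b i * (e i x * e j x)))"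
   by (rule bi_cong) (simp_all add: p_def left_diff_distrib sum_distrib_right mult.assoc)
  also have "... = b j - (\<Sum>i<r'. b i * (LINT x|M. e i x * e j x))"
  proof -
   have "integrable M (%x. e i x * e j x)" if "i < r'" for i
    by (intro L2_mult_integrable e \<open>j < r'\<close> that)
   then have I: "integrable M (%x. b i * (e i x * e j x))" if "i \<in> {..<r'}" for i
    using that by simp
   have "(LINT x|M. f n x * e j x - (\<Sum>i<r'. b i * (e i x * e j x)))
     = (LINT x|M. f n x * e j x) - (LINT x|M. (\<Sum>i<r'. b i * (e i x * e j x)))"
    by (intro bi_diff bi_int_sum I L2_mult_integrable fn e \<open>j < r'\<close>)
   also have "(LINT x|M. (\<Sum>i<r'. b i * (e i x * e j x))) = (\<Sum>i<r'. (LINT x|M. b i * (e i x * e j x)))"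
    by (rule bi_sum[OF I])
   finally show ?thesis by (simp add: b_def[of j])
  qed
  also have "... = b j - (\<Sum>i<r'. b i * (if i = j then 1 else 0))"
   using that by (simp add: on)
  also have "... = 0" using that by (simp add: if_distrib[of "%x. _ * x"] sum.delta cong: if_cong)
  finally show ?thesis .
 qed
 show ?case
 proof (cases "(LINT x|M. (p x)\<^sup>2) = 0")
  case True
  have n0: "\<not> (n = 0 \<and> (LINT x|M. (f 0 x)\<^sup>2) = 1)"
   using True by (auto simp: p_def[abs_def] r'_def)
  have ae: "AE x in M. p x = 0" by (rule L2_norm_zero_AE[OF p True])
  show ?thesis
  proof (intro exI[of _ r'] exI[of _ e] exI[of _ "B(n := b)"] conjI allI impI)
   fix k assume "k < Suc n"
   then consider "k < n" | "k = n" by linarith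
   then show "AE x in M. f k x = (\<Sum>i<r'. (B(n := b)) k i * e i x)"
   proof cases
    case 2
    then show ?thesis using ae by (auto simp: p_def)
   qed (use B in auto)
  next
   assume "(LINT x|M. (f 0 x)\<^sup>2) = 1"
   with n0 have "n > 0" by auto
   with z \<open>(LINT x|M. (f 0 x)\<^sup>2) = 1\<close> show "0 < r'" "e 0 = f 0" by blast+
  qed (use e on in auto)
 next
  case False
  define s where "s = sqrt (LINT x|M. (p x)\<^sup>2)"
  have "(LINT x|M. (p x)\<^sup>2) \<ge> 0" by simp
  then have "(LINT x|M. (p x)\<^sup>2) > 0" using False by linarith
  then have s: "s > 0" "s\<^sup>2 = (LINT x|M. (p x)\<^sup>2)" by (auto simp: s_def)
  define e' where "e' = e(r' := (%x. p x / s))"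
  have e'L2: "L2 M (e' i)" if "i < Suc r'" for i
   using that e L2_cmult[OF p, of "1 / s"] by (auto simp: e'_def less_Suc_eq)
  have on': "(LINT x|M. e' i x * e' j x) = (if i = j then 1 else 0)" if "i < Suc r'" "j < Suc r'" for i j
  proof -
   have "(LINT x|M. p x / s * (p x / s)) = 1"
   proof -
    have "(LINT x|M. p x / s * (p x / s)) = (LINT x|M. (p x)\<^sup>2 / s\<^sup>2)"
     by (simp add: power2_eq_square)
    also have "... = (LINT x|M. (p x)\<^sup>2) / s\<^sup>2" by simp
    finally show ?thesis using s(1) by (simp only: s(2)[symmetric]) simp
   qed
   moreover have "(LINT x|M. p x / s * e k x) = 0" "(LINT x|M. e k x * (p x / s)) = 0" if "k < r'" for k
    using po[OF that] by (simp_all add: mult.commute)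
   ultimately show ?thesis
    using that on by (auto simp: e'_def less_Suc_eq)
  qed
  have z': "e' 0 = f 0" if "(LINT x|M. (f 0 x)\<^sup>2) = 1"
  proof (cases "n = 0")
   case True
   then show ?thesis using that by (auto simp: e'_def r'_def p_def s_def)
  next
   case False
   then show ?thesis using z that by (auto simp: e'_def)
  qed
  show ?thesis
  proof (intro exI[of _ "Suc r'"] exI[of _ e'] exI[of _ "%k i. if k = n then (b(r' := s)) i else if i < r' then B k i else 0"] conjI allI impI)
   fix k assume "k < Suc n"
   then consider "k < n" | "k = n" by linarith
   then show "AE x in M. f k x = (\<Sum>i<Suc r'. (if k = n then (b(r' := s)) i else if i < r' then B k i else 0) * e' i x)"
   proof cases
    case 1
    then show ?thesis using B[OF 1] by (auto simp: e'_def elim!: eventually_mono intro!: sum.cong)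
   next
    case 2
    then show ?thesis using s(1) by (auto simp: e'_def p_def intro!: sum.cong)
   qed
  qed (use e'L2 on' z' in auto)
 qed
qed

section \<open>Gaussian integration by parts\<close>

text \<open>A growth class closed under sums and products and integrable under the Gaussian law. It
  contains polynomials as well as exp(t z), and so covers Hermite polynomials together with their
  generating function.\<close>

definition exp_bounded :: "(real => real) => bool" where
 "exp_bounded f \<longleftrightarrow> (\<exists>C K. \<forall>z. \<bar>f z\<bar> \<le> C * exp (K * \<bar>z\<bar>))"

lemma exp_bounded_nonneg:
 assumes "exp_bounded f" obtains C K where "C \<ge> 0" "K \<ge> 0" "\<And>z. \<bar>f z\<bar> \<le> C * exp (K * \<bar>z\<bar>)"
proof -
 obtain C K where *: "\<And>z. \<bar>f z\<bar> \<le> C * exp (K * \<bar>z\<bar>)" using assms by (auto simp: exp_bounded_def)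
 have C: "C \<ge> 0" using *[of 0] by simp
 have "\<bar>f z\<bar> \<le> C * exp (\<bar>K\<bar> * \<bar>z\<bar>)" for z
  by (rule order.trans[OF *[of z] mult_left_mono[OF _ C]]) (simp add: mult_right_mono)
 with C show ?thesis using that[of C "\<bar>K\<bar>"] by simp
qed

lemma power_le_fact_exp: "\<bar>z\<bar> ^ p \<le> fact p * exp \<bar>z :: real\<bar>"
proof -
 have "(\<Sum>n\<in>{p}. \<bar>z\<bar> ^ n /\<^sub>R fact n) \<le> exp \<bar>z\<bar>"
  unfolding exp_def by (intro sum_le_suminf summable_exp_generic) auto
 then show ?thesis by (simp add: field_simps)
qed

lemma exp_bounded_const: "exp_bounded (%z. c)"
 unfolding exp_bounded_def by (intro exI[of _ "\<bar>c\<bar>"] exI[of _ 0]) simp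

lemma exp_bounded_power: "exp_bounded (%z. z ^ p)"
 unfolding exp_bounded_def
 by (intro exI[of _ "fact p"] exI[of _ 1]) (use power_le_fact_exp in \<open>simp add: power_abs\<close>)

lemma exp_bounded_id: "exp_bounded (%z. z)"
 using exp_bounded_power[of 1] by simp

lemma exp_bounded_mult:
 assumes "exp_bounded f" "exp_bounded g" shows "exp_bounded (%z. f z * g z)"
proof -
 obtain C K where f: "C \<ge> 0" "K \<ge> 0" "\<And>z. \<bar>f z\<bar> \<le> C * exp (K * \<bar>z\<bar>)" using assms(1) by (rule exp_bounded_nonneg) blast
 obtain C' K' where g: "C' \<ge> 0" "K' \<ge> 0" "\<And>z. \<bar>g z\<bar> \<le> C' * exp (K' * \<bar>z\<bar>)" using assms(2) by (rule exp_bounded_nonneg) blast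
 have "\<bar>f z * g z\<bar> \<le> (C * C') * exp ((K + K') * \<bar>z\<bar>)" for z
 proof -
  have "\<bar>f z * g z\<bar> \<le> (C * exp (K * \<bar>z\<bar>)) * (C' * exp (K' * \<bar>z\<bar>))"
   unfolding abs_mult by (intro mult_mono f g) (use f in auto)
  also have "... = (C * C') * exp ((K + K') * \<bar>z\<bar>)" by (simp add: exp_add distrib_right)
  finally show ?thesis .
 qed
 then show ?thesis unfolding exp_bounded_def by blast
qed

lemma exp_bounded_add:
 assumes "exp_bounded f" "exp_bounded g" shows "exp_bounded (%z. f z + g z)"
proof -
 obtain C K where f: "C \<ge> 0" "K \<ge> 0" "\<And>z. \<bar>f z\<bar> \<le> C * exp (K * \<bar>z\<bar>)" using assms(1) by (rule exp_bounded_nonneg) blast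
 obtain C' K' where g: "C' \<ge> 0" "K' \<ge> 0" "\<And>z. \<bar>g z\<bar> \<le> C' * exp (K' * \<bar>z\<bar>)" using assms(2) by (rule exp_bounded_nonneg) blast
 have "\<bar>f z + g z\<bar> \<le> (C + C') * exp ((K + K') * \<bar>z\<bar>)" for z
 proof -
  have "\<bar>f z + g z\<bar> \<le> C * exp (K * \<bar>z\<bar>) + C' * exp (K' * \<bar>z\<bar>)"
   using f(3)[of z] g(3)[of z] by linarith
  also have "... \<le> C * exp ((K + K') * \<bar>z\<bar>) + C' * exp ((K + K') * \<bar>z\<bar>)"
   using f g by (intro add_mono mult_left_mono) (auto simp: mult_right_mono)
  finally show ?thesis by (simp add: distrib_right)
 qed
 then show ?thesis unfolding exp_bounded_def by blast
qed

lemma exp_bounded_sum: "(\<And>i. i \<in> I ==> exp_bounded (f i)) ==> exp_bounded (%z. \<Sum>i\<in>I. f i z)"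
 by (induction I rule: infinite_finite_induct) (auto intro: exp_bounded_const exp_bounded_add)

lemma exp_bounded_diff: "exp_bounded f ==> exp_bounded g ==> exp_bounded (%z. f z - g z)"
 using exp_bounded_add[of f "%z. -1 * g z"] exp_bounded_mult[OF exp_bounded_const[of "-1"], of g] by simp

lemma exp_bounded_pow: "exp_bounded f ==> exp_bounded (%z. f z ^ n)"
 by (induction n) (auto intro: exp_bounded_const exp_bounded_mult)

lemma exp_bounded_abs: "exp_bounded f ==> exp_bounded (%z. \<bar>f z\<bar>)"
 by (simp add: exp_bounded_def)

lemma exp_bounded_exp: "exp_bounded (%z. exp (t * z))"
 unfolding exp_bounded_def
 by (intro exI[of _ 1] exI[of _ "\<bar>t\<bar>"]) (auto simp: abs_mult[symmetric])

lemma exp_bounded_mono: "exp_bounded g ==> (\<And>z. \<bar>f z\<bar> \<le> g z) ==> exp_bounded f"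
 unfolding exp_bounded_def by (meson abs_ge_self order_trans)

lemma gauss_exp:
 "integrable gauss (%z. exp (t * z))" "(LINT z|gauss. exp (t * z)) = exp (t\<^sup>2 / 2)"
proof -
 have eq: "std_normal_density z * exp (t * z) = exp (t\<^sup>2 / 2) * normal_density t 1 z" for z
 proof -
  have "- z\<^sup>2 / 2 + t * z = t\<^sup>2 / 2 + - (z - t)\<^sup>2 / 2" by (simp add: power2_eq_square field_simps)
  then have "exp (- z\<^sup>2 / 2) * exp (t * z) = exp (t\<^sup>2 / 2) * exp (- (z - t)\<^sup>2 / 2)"
   by (metis exp_add)
  then show ?thesis by (simp add: normal_density_def)
 qed
 show "integrable gauss (%z. exp (t * z))"
  by (subst integrable_density) (auto simp: eq)
 show "(LINT z|gauss. exp (t * z)) = exp (t\<^sup>2 / 2)"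
  by (subst integral_density) (auto simp: eq)
qed

lemma exp_bounded_integrable:
 assumes "exp_bounded f" "f \<in> borel_measurable borel"
 shows "integrable gauss f"
proof -
 obtain C K where f: "C \<ge> 0" "K \<ge> 0" "\<And>z. \<bar>f z\<bar> \<le> C * exp (K * \<bar>z\<bar>)" using assms(1) by (rule exp_bounded_nonneg) blast
 show ?thesis
 proof (rule bi_int_bound)
  show "integrable gauss (%z. C * (exp (K * z) + exp ((-K) * z)))"
   by (intro integrable_mult_right bi_int_add gauss_exp(1))
  show "AE z in gauss. norm (f z) \<le> norm (C * (exp (K * z) + exp ((-K) * z)))"
  proof (rule AE_I2)
   fix z
   have "exp (K * \<bar>z\<bar>) \<le> exp (K * z) + exp ((-K) * z)" by (cases "z \<ge> 0") auto
   then have "C * exp (K * \<bar>z\<bar>) \<le> C * (exp (K * z) + exp ((-K) * z))"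
    by (rule mult_left_mono[OF _ f(1)])
   then show "norm (f z) \<le> norm (C * (exp (K * z) + exp ((-K) * z)))"
    using f(3)[of z] by (simp only: real_norm_def)
  qed
 qed (use assms in auto)
qed

text \<open>The derivative of density times u is density times (u' - z u). The density beats the
  exponential growth of u, so the boundary terms at both ends of the line vanish.\<close>

lemma gauss_ibp:
 assumes u: "\<And>z. (u has_real_derivative u' z) (at z)" and cont: "contU u'"
  and bd: "exp_bounded u" "exp_bounded u'"
 shows "(LINT z|gauss. u' z) = (LINT z|gauss. z * u z)"
proof -
 have contu: "contU u"
  using u by (meson DERIV_isCont continuous_at_imp_continuous_on)
 have [measurable]: "u \<in> borel_measurable borel" "u' \<in> borel_measurable borel"
  using contu cont by (auto intro: borel_measurable_continuous_onI)
 let ?\<rho> = std_normal_density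
 define F where "F z = ?\<rho> z * u z" for z
 define f where "f z = ?\<rho> z * (u' z - z * u z)" for z
 have d\<rho>: "(?\<rho> has_real_derivative - z * ?\<rho> z) (at z)" for z
  unfolding std_normal_density_def by (auto intro!: derivative_eq_intros simp: field_simps)
 have c\<rho>: "contU ?\<rho>" using d\<rho> by (meson DERIV_isCont continuous_at_imp_continuous_on)
 have ig: "integrable gauss (%z. u' z - z * u z)"
  by (intro exp_bounded_integrable exp_bounded_diff exp_bounded_mult exp_bounded_id bd) measurable
 have \<rho>_le: "?\<rho> z \<le> exp (- z\<^sup>2 / 2)" for z
 proof -
  have "1 \<le> sqrt (2 * pi)" using pi_gt3 by (intro real_le_rsqrt) auto
  then have "1 / sqrt (2 * pi) \<le> 1" by simp
  from mult_right_mono[OF this, of "exp (- z\<^sup>2 / 2)"] show ?thesis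
   unfolding std_normal_density_def by simp
 qed
 have lim: "(F \<longlongrightarrow> 0) A" if A: "filterlim (%z::real. \<bar>z\<bar>) at_top A" for A
 proof -
  obtain C K where f: "C \<ge> 0" "K \<ge> 0" "\<And>z. \<bar>u z\<bar> \<le> C * exp (K * \<bar>z\<bar>)" using bd(1) by (rule exp_bounded_nonneg) blast
  have "((%z. exp (- \<bar>z\<bar>)) \<longlongrightarrow> (0::real)) A"
   by (rule filterlim_compose[OF exp_at_bot]) (use A in \<open>simp add: filterlim_uminus_at_bot\<close>)
  then have l: "((%z. C * exp ((K+1)\<^sup>2 / 2) * exp (- \<bar>z\<bar>)) \<longlongrightarrow> (0::real)) A" by (rule tendsto_mult_right_zero)
  have "norm (F z) \<le> C * exp ((K+1)\<^sup>2 / 2) * exp (- \<bar>z\<bar>)" for z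
  proof -
   have "norm (F z) \<le> exp (- z\<^sup>2 / 2) * (C * exp (K * \<bar>z\<bar>))"
   proof -
    have "\<bar>F z\<bar> = ?\<rho> z * \<bar>u z\<bar>" by (simp add: F_def abs_mult)
    also have "... \<le> exp (- z\<^sup>2 / 2) * (C * exp (K * \<bar>z\<bar>))"
     by (intro mult_mono f \<rho>_le) auto
    finally show ?thesis by simp
   qed
   also have "... = C * (exp (- z\<^sup>2 / 2) * exp (K * \<bar>z\<bar>))" by simp
   also have "... = C * exp (K * \<bar>z\<bar> - z\<^sup>2 / 2)" unfolding exp_add[symmetric] by simp
   \<comment> \<open>Completing the square with K + 1 instead of K leaves a factor exp(-|z|), which
     supplies the decay.\<close>
   also have "... \<le> C * exp ((K+1)\<^sup>2 / 2 - \<bar>z\<bar>)"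
   proof -
    have "0 \<le> (\<bar>z\<bar> - (K + 1))\<^sup>2" by simp
    also have "... = z\<^sup>2 - 2 * (K * \<bar>z\<bar>) - 2 * \<bar>z\<bar> + (K+1)\<^sup>2"
     by (simp add: power2_diff algebra_simps)
    finally have "K * \<bar>z\<bar> - z\<^sup>2 / 2 \<le> (K+1)\<^sup>2 / 2 - \<bar>z\<bar>" by linarith
    then show ?thesis using f by (intro mult_left_mono) auto
   qed
   also have "exp ((K+1)\<^sup>2 / 2 - \<bar>z\<bar>) = exp ((K+1)\<^sup>2 / 2) * exp (- \<bar>z\<bar>)"
    unfolding exp_add[symmetric] by simp
   finally show ?thesis by simp
  qed
  then show ?thesis by (intro Lim_null_comparison[OF _ l] always_eventually allI)
 qed
 have ab: "filterlim (%z::real. \<bar>z\<bar>) at_top at_top" "filterlim (%z::real. \<bar>z\<bar>) at_top at_bot"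
 proof -
  have e: "(%z::real. \<bar>z\<bar>) = norm" by (rule ext) simp
  show "filterlim (%z::real. \<bar>z\<bar>) at_top at_top" "filterlim (%z::real. \<bar>z\<bar>) at_top at_bot"
   unfolding e
   by (rule filterlim_mono[OF filterlim_norm_at_top order_refl at_top_le_at_infinity]
    filterlim_mono[OF filterlim_norm_at_top order_refl at_bot_le_at_infinity])+
 qed
 have "(LBINT z=-\<infinity>..\<infinity>. f z) = 0 - 0"
 proof (rule interval_integral_FTC_integrable)
  show "(F has_vector_derivative f z) (at z)" for z
   unfolding F_def[abs_def] f_def has_real_derivative_iff_has_vector_derivative[symmetric]
   by (rule derivative_eq_intros d\<rho> u)+ (simp add: algebra_simps)
  show "isCont f z" for z
  proof -
   have "contU f" unfolding f_def[abs_def] by (intro continuous_intros c\<rho> contu cont)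
   then show ?thesis by (simp add: continuous_on_eq_continuous_at)
  qed
  show "set_integrable lborel (einterval (-\<infinity>) \<infinity>) f"
   using ig by (simp add: set_integrable_def integrable_density f_def)
  show "((F \<circ> real_of_ereal) \<longlongrightarrow> 0) (at_right (-\<infinity>))" "((F \<circ> real_of_ereal) \<longlongrightarrow> 0) (at_left \<infinity>)"
   by (simp_all add: ereal_tendsto_simps lim ab)
 qed simp
 then have "(LINT z|lborel. f z) = 0"
  by (simp add: interval_lebesgue_integral_def set_lebesgue_integral_def)
 then have "(LINT z|gauss. u' z - z * u z) = 0"
  by (subst integral_density) (auto simp: f_def)
 moreover have "integrable gauss u'" "integrable gauss (%z. z * u z)"
  by (intro exp_bounded_integrable exp_bounded_mult exp_bounded_id bd; measurable)+
 ultimately show ?thesis by simp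
qed

section \<open>Smooth functions of finitely many variables\<close>

lemma partial_derivs_Nil [simp]: "partial_derivs [] f = f"
 and partial_derivs_Cons [simp]: "partial_derivs (i # is) f = partial_deriv i (partial_derivs is f)"
 by (simp_all add: partial_derivs_def)

lemma partial_derivs_snoc: "partial_derivs (is @ [i]) f = partial_derivs is (partial_deriv i f)"
 by (simp add: partial_derivs_def)

lemma spg_dep: "spg m f ==> (\<And>i. i < m ==> x i = y i) ==> f x = f y"
 unfolding smooth_poly_growth_def by blast

lemma spg_all:
 assumes "spg m f" "set is \<subseteq> {..<m}"
 shows "contU (partial_derivs is f)"
  "i < m ==> (%t. partial_derivs is f (x(i := t))) differentiable (at (x i))"
  "\<exists>C N. \<forall>x. \<bar>partial_derivs is f x\<bar> \<le> C * (1 + (\<Sum>i<m. \<bar>x i\<bar>)) ^ N"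
 using assms unfolding smooth_poly_growth_def by blast+

lemma spg_continuous: "spg m f ==> contU f"
 using spg_all(1)[of m f "[]"] by simp

lemma spg_growth: "spg m f ==> \<exists>C N. \<forall>x. \<bar>f x\<bar> \<le> C * (1 + (\<Sum>i<m. \<bar>x i\<bar>)) ^ N"
 using spg_all(3)[of m f "[]"] by simp

lemma spg_has_partial:
 assumes "spg m f" "i < m"
 shows "((%t. f (x(i := t))) has_real_derivative partial_deriv i f (x(i := t))) (at t)"
proof -
 have "(%s. f ((x(i:=t))(i := s))) differentiable (at ((x(i:=t)) i))"
  using spg_all(2)[of m f "[]" i "x(i := t)"] assms by simp
 then obtain D where D: "((%s. f (x(i := s))) has_real_derivative D) (at t)"
  by (auto simp: real_differentiable_def)
 then have "partial_deriv i f (x(i := t)) = D"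
  by (simp add: partial_deriv_def DERIV_imp_deriv)
 with D show ?thesis by simp
qed

lemma spg_partial:
 assumes "spg m f" "i < m"
 shows "spg m (partial_deriv i f)"
 unfolding smooth_poly_growth_def
proof (intro conjI allI impI)
 fix x y :: "nat => real" assume xy: "\<forall>i<m. x i = y i"
 then have "f (x(i := t)) = f (y(i := t))" for t by (intro spg_dep[OF assms(1)]) auto
 then show "partial_deriv i f x = partial_deriv i f y"
  using xy assms(2) by (simp add: partial_deriv_def)
next
 fix "is" assume "set is \<subseteq> {..<m}"
 then have is': "set (is @ [i]) \<subseteq> {..<m}" using assms(2) by simp
 note * = spg_all[OF assms(1) is', unfolded partial_derivs_snoc]
 show "contU (partial_derivs is (partial_deriv i f))" by (rule *)
 show "(%t. partial_derivs is (partial_deriv i f) (x(j := t))) differentiable (at (x j))" if "j < m" for j x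
  by (rule *(2)[OF that])
 show "\<exists>C N. \<forall>x. \<bar>partial_derivs is (partial_deriv i f) x\<bar> \<le> C * (1 + (\<Sum>i<m. \<bar>x i\<bar>)) ^ N" by (rule *)
qed

lemma spg_partials: "spg m f ==> set is \<subseteq> {..<m} ==> spg m (partial_derivs is f)"
 by (induction "is") (auto intro: spg_partial)

text \<open>\<open>smooth_poly_growth\<close> quantifies over all iterated partial derivatives. It
  suffices to exhibit a class closed under a single partial derivative whose members have the
  required properties.\<close>

lemma spg_coinduct:
 assumes "P f"
  and dep: "\<And>f x y. P f ==> (\<forall>i<m. x i = y i) ==> f x = f y"
  and cont: "\<And>f. P f ==> contU f"
  and diff: "\<And>f i x. P f ==> i < m ==> (%t. f (x(i := t))) differentiable (at (x i))"
  and growth: "\<And>f. P f ==> \<exists>C N. \<forall>x. \<bar>f x\<bar> \<le> C * (1 + (\<Sum>i<m. \<bar>x i\<bar>)) ^ N"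
  and step: "\<And>f i. P f ==> i < m ==> P (partial_deriv i f)"
 shows "spg m f"
proof -
 have *: "P (partial_derivs is f)" if "set is \<subseteq> {..<m}" for "is"
  using that by (induction "is") (auto intro: step \<open>P f\<close>)
 show ?thesis
  unfolding smooth_poly_growth_def
 proof (intro conjI allI impI)
  show "f x = f y" if "\<forall>i<m. x i = y i" for x y by (rule dep[OF \<open>P f\<close> that])
 qed (auto intro: cont diff growth *)
qed

lemma poly_growth_add:
 assumes "\<exists>C N. \<forall>x. \<bar>f x\<bar> \<le> C * (1 + (\<Sum>i<m. \<bar>x i :: real\<bar>)) ^ N"
  "\<exists>C N. \<forall>x. \<bar>g x\<bar> \<le> C * (1 + (\<Sum>i<m. \<bar>x i :: real\<bar>)) ^ N"
 shows "\<exists>C N. \<forall>x. \<bar>f x + g x :: real\<bar> \<le> C * (1 + (\<Sum>i<m. \<bar>x i\<bar>)) ^ N"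
proof -
 obtain C N where f: "\<And>x. \<bar>f x\<bar> \<le> C * (1 + (\<Sum>i<m. \<bar>x i\<bar>)) ^ N" using assms(1) by blast
 obtain C' N' where g: "\<And>x. \<bar>g x\<bar> \<le> C' * (1 + (\<Sum>i<m. \<bar>x i\<bar>)) ^ N'" using assms(2) by blast
 have s: "1 + (\<Sum>i<m. \<bar>x i :: real\<bar>) \<ge> 1" for x by (simp add: sum_nonneg)
 have "\<bar>f x + g x\<bar> \<le> (\<bar>C\<bar> + \<bar>C'\<bar>) * (1 + (\<Sum>i<m. \<bar>x i\<bar>)) ^ (N + N')" for x
 proof -
  have p: "C * (1 + (\<Sum>i<m. \<bar>x i\<bar>)) ^ N \<le> \<bar>C\<bar> * (1 + (\<Sum>i<m. \<bar>x i\<bar>)) ^ (N + N')"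
   using s[of x] by (intro mult_mono power_increasing) auto
  have q: "C' * (1 + (\<Sum>i<m. \<bar>x i\<bar>)) ^ N' \<le> \<bar>C'\<bar> * (1 + (\<Sum>i<m. \<bar>x i\<bar>)) ^ (N + N')"
   using s[of x] by (intro mult_mono power_increasing) auto
  show ?thesis using f[of x] g[of x] p q by (simp add: distrib_right)
 qed
 then show ?thesis by blast
qed

lemma poly_growth_mult:
 assumes "\<exists>C N. \<forall>x. \<bar>f x\<bar> \<le> C * (1 + (\<Sum>i<m. \<bar>x i :: real\<bar>)) ^ N"
  "\<exists>C N. \<forall>x. \<bar>g x\<bar> \<le> C * (1 + (\<Sum>i<m. \<bar>x i :: real\<bar>)) ^ N"
 shows "\<exists>C N. \<forall>x. \<bar>f x * g x :: real\<bar> \<le> C * (1 + (\<Sum>i<m. \<bar>x i\<bar>)) ^ N"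
proof -
 obtain C N where f: "\<And>x. \<bar>f x\<bar> \<le> C * (1 + (\<Sum>i<m. \<bar>x i\<bar>)) ^ N" using assms(1) by blast
 obtain C' N' where g: "\<And>x. \<bar>g x\<bar> \<le> C' * (1 + (\<Sum>i<m. \<bar>x i\<bar>)) ^ N'" using assms(2) by blast
 have "\<bar>f x * g x\<bar> \<le> (C * C') * (1 + (\<Sum>i<m. \<bar>x i\<bar>)) ^ (N + N')" for x
 proof -
  have "\<bar>f x * g x\<bar> \<le> (C * (1 + (\<Sum>i<m. \<bar>x i\<bar>)) ^ N) * (C' * (1 + (\<Sum>i<m. \<bar>x i\<bar>)) ^ N')"
   unfolding abs_mult by (intro mult_mono f g abs_ge_zero order_trans[OF abs_ge_zero f])
  then show ?thesis by (simp add: power_add mult_ac)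
 qed
 then show ?thesis by blast
qed

inductive polyfun :: "nat => ((nat => real) => real) => bool" for m where
 polyfun_const: "polyfun m (%x. c)"
| polyfun_var: "i < m ==> polyfun m (%x. x i)"
| polyfun_add: "polyfun m f ==> polyfun m g ==> polyfun m (%x. f x + g x)"
| polyfun_mult: "polyfun m f ==> polyfun m g ==> polyfun m (%x. f x * g x)"

lemma polyfun_sum: "(\<And>i. i \<in> I ==> polyfun m (f i)) ==> polyfun m (%x. \<Sum>i\<in>I. f i x)"
 by (induction I rule: infinite_finite_induct) (auto intro: polyfun.intros)

lemma polyfun_pow: "polyfun m f ==> polyfun m (%x. f x ^ n)"
 by (induction n) (auto intro: polyfun.intros)

lemma polyfun_has_partial:
 assumes "polyfun m f"
 shows "\<exists>g. polyfun m g \<and> (\<forall>x t. ((%t. f (x(i := t))) has_real_derivative g (x(i := t))) (at t))"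
 using assms
proof induction
 case (polyfun_const c)
 show ?case by (intro exI[of _ "%_. 0"]) (auto intro: polyfun.intros)
next
 case (polyfun_var j)
 show ?case by (intro exI[of _ "%_. if i = j then 1 else 0"]) (auto intro!: polyfun.intros derivative_eq_intros)
next
 case (polyfun_add f g)
 then obtain f' g' where *: "polyfun m f'" "polyfun m g'"
  "\<And>x t. ((%t. f (x(i := t))) has_real_derivative f' (x(i := t))) (at t)"
  "\<And>x t. ((%t. g (x(i := t))) has_real_derivative g' (x(i := t))) (at t)" by blast
 show ?case
 proof (intro exI[of _ "%x. f' x + g' x"] conjI allI)
  show "polyfun m (%x. f' x + g' x)" using * by (auto intro: polyfun.intros)
  show "((%t. f (x(i := t)) + g (x(i := t))) has_real_derivative f' (x(i := t)) + g' (x(i := t))) (at t)" for x t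
   by (rule DERIV_add[OF *(3,4)])
 qed
next
 case (polyfun_mult f g)
 then obtain f' g' where *: "polyfun m f'" "polyfun m g'"
  "\<And>x t. ((%t. f (x(i := t))) has_real_derivative f' (x(i := t))) (at t)"
  "\<And>x t. ((%t. g (x(i := t))) has_real_derivative g' (x(i := t))) (at t)" by blast
 show ?case
 proof (intro exI[of _ "%x. f' x * g x + g' x * f x"] conjI allI)
  show "polyfun m (%x. f' x * g x + g' x * f x)" using * polyfun_mult by (auto intro!: polyfun.intros)
  show "((%t. f (x(i := t)) * g (x(i := t))) has_real_derivative f' (x(i := t)) * g (x(i := t)) + g' (x(i := t)) * f (x(i := t))) (at t)" for x t
   using DERIV_mult'[OF *(3)[of x t] *(4)[of x t]] by (simp add: mult_ac add_ac)
 qed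
qed

lemma polyfun_partial:
 assumes "polyfun m f"
 shows "polyfun m (partial_deriv i f)"
  and "((%t. f (x(i := t))) has_real_derivative partial_deriv i f (x(i := t))) (at t)"
proof -
 obtain g where g: "polyfun m g" "\<And>x t. ((%t. f (x(i := t))) has_real_derivative g (x(i := t))) (at t)"
  using polyfun_has_partial[OF assms] by blast
 have "partial_deriv i f = g"
 proof
  fix x show "partial_deriv i f x = g x"
   using DERIV_imp_deriv[OF g(2)[of x "x i"]] by (simp add: partial_deriv_def)
 qed
 with g show "polyfun m (partial_deriv i f)" "((%t. f (x(i := t))) has_real_derivative partial_deriv i f (x(i := t))) (at t)"
  by simp_all
qed

lemma partial_deriv_eqI:
 assumes "\<And>x. ((%t. f (x(i := t))) has_real_derivative g x) (at (x i))"
 shows "partial_deriv i f = g"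
 using DERIV_imp_deriv[OF assms] by (auto simp: partial_deriv_def)

lemma polyfun_spg:
 assumes "polyfun m f" shows "spg m f"
 using assms
proof (rule spg_coinduct[where P="polyfun m"])
 show "f x = f y" if "polyfun m f" "\<forall>i<m. x i = y i" for f x y
  using that by induction auto
 show "contU f" if "polyfun m f" for f
  using that by induction (auto intro!: continuous_intros continuous_on_product_coordinates)
 show "(%t. f (x(i := t))) differentiable (at (x i))" if "polyfun m f" for f i x
  using polyfun_partial(2)[OF that, of x i "x i"] by (auto simp: real_differentiable_def)
 show "\<exists>C N. \<forall>x. \<bar>f x\<bar> \<le> C * (1 + (\<Sum>i<m. \<bar>x i\<bar>)) ^ N" if "polyfun m f" for f
  using that
 proof induction
  case (polyfun_const c)
  show ?case by (intro exI[of _ "\<bar>c\<bar>"] exI[of _ 0]) simp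
 next
  case (polyfun_var i)
  have "\<bar>x i\<bar> \<le> 1 * (1 + (\<Sum>i<m. \<bar>x i\<bar>)) ^ 1" for x :: "nat => real"
   using member_le_sum[of i "{..<m}" "%i. \<bar>x i\<bar>"] polyfun_var by simp
  then show ?case by blast
 qed (auto intro: poly_growth_add poly_growth_mult)
 show "polyfun m (partial_deriv i f)" if "polyfun m f" for f i
  by (rule polyfun_partial(1)[OF that])
qed

lemma spg_zero: "spg m (%x. 0)"
 by (intro polyfun_spg polyfun_const)

lemma spg_lincomb:
 assumes "spg m f" "spg m g"
 shows "spg m (%x. a * f x + b * g x)"
proof (rule spg_coinduct[where P="%h. \<exists>f g. spg m f \<and> spg m g \<and> h = (%x. a * f x + b * g x)"])
 show "\<exists>f' g'. spg m f' \<and> spg m g' \<and> (%x. a * f x + b * g x) = (%x. a * f' x + b * g' x)"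
  using assms by blast
next
 fix h :: "(nat => real) => real"
 assume "\<exists>f g. spg m f \<and> spg m g \<and> h = (%x. a * f x + b * g x)"
 then obtain f g where f: "spg m f" and g: "spg m g" and h: "h = (%x. a * f x + b * g x)"
  by blast
 show "h x = h y" if "\<forall>i<m. x i = y i" for x y
  using spg_dep[OF f, of x y] spg_dep[OF g, of x y] that by (simp add: h)
 show "contU h"
  unfolding h by (intro continuous_intros spg_continuous[OF f] spg_continuous[OF g])
 show "\<exists>C N. \<forall>x. \<bar>h x\<bar> \<le> C * (1 + (\<Sum>i<m. \<bar>x i\<bar>)) ^ N"
  unfolding h by (intro poly_growth_add poly_growth_mult spg_growth[OF f] spg_growth[OF g] spg_growth[OF polyfun_spg[OF polyfun_const]])
 fix i :: nat assume i: "i < m"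
 have D: "((%t. h (x(i := t))) has_real_derivative a * partial_deriv i f x + b * partial_deriv i g x) (at (x i))" for x
  unfolding h using spg_has_partial[OF f i, of x "x i"] spg_has_partial[OF g i, of x "x i"]
  by (auto intro!: derivative_eq_intros)
 then show "(%t. h (x(i := t))) differentiable (at (x i))" for x
  by (auto simp: real_differentiable_def)
 have "partial_deriv i h = (%x. a * partial_deriv i f x + b * partial_deriv i g x)"
  by (rule partial_deriv_eqI) (rule D)
 then show "\<exists>f g. spg m f \<and> spg m g \<and> partial_deriv i h = (%x. a * f x + b * g x)"
  using spg_partial[OF f i] spg_partial[OF g i] by blast
qed

lemma spg_sum: "(\<And>i. i \<in> I ==> spg m (f i)) ==> spg m (%x. \<Sum>i\<in>I. c i * f i x)"
proof (induction I rule: infinite_finite_induct)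
 case (insert i I)
 then have "spg m (%x. c i * f i x + 1 * (\<Sum>i\<in>I. c i * f i x))"
  by (intro spg_lincomb) auto
 then show ?case using insert by simp
qed (auto intro: spg_zero)

text \<open>The summand g closes the class: a partial derivative of f times a coordinate is again of
  this shape, with f itself as a new additive term. The divergence of a smooth functional has this
  form.\<close>

lemma spg_mult_var_add:
 assumes "spg m f" "spg m g" "j < m"
 shows "spg m (%x. f x * x j + g x)"
proof (rule spg_coinduct[where P="%h. \<exists>f g. spg m f \<and> spg m g \<and> h = (%x. f x * x j + g x)"])
 show "\<exists>f' g'. spg m f' \<and> spg m g' \<and> (%x. f x * x j + g x) = (%x. f' x * x j + g' x)"
  using assms by blast
next
 fix h :: "(nat => real) => real"
 assume "\<exists>f g. spg m f \<and> spg m g \<and> h = (%x. f x * x j + g x)"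
 then obtain f g where f: "spg m f" and g: "spg m g" and h: "h = (%x. f x * x j + g x)"
  by blast
 show "h x = h y" if "\<forall>i<m. x i = y i" for x y
  using spg_dep[OF f, of x y] spg_dep[OF g, of x y] that assms(3) by (simp add: h)
 show "contU h"
  unfolding h by (intro continuous_intros spg_continuous[OF f] spg_continuous[OF g] continuous_on_product_coordinates)
 show "\<exists>C N. \<forall>x. \<bar>h x\<bar> \<le> C * (1 + (\<Sum>i<m. \<bar>x i\<bar>)) ^ N"
  unfolding h by (intro poly_growth_add poly_growth_mult spg_growth[OF f] spg_growth[OF g] spg_growth[OF polyfun_spg[OF polyfun_var[OF assms(3)]]])
 fix i :: nat assume i: "i < m"
 have D: "((%t. h (x(i := t))) has_real_derivative
  partial_deriv i f x * x j + ((if i = j then f x else 0) + partial_deriv i g x)) (at (x i))" for x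
  unfolding h using spg_has_partial[OF f i, of x "x i"] spg_has_partial[OF g i, of x "x i"]
  by (cases "i = j") (auto intro!: derivative_eq_intros)
 then show "(%t. h (x(i := t))) differentiable (at (x i))" for x
  by (auto simp: real_differentiable_def)
 have "partial_deriv i h = (%x. partial_deriv i f x * x j + ((if i = j then f x else 0) + partial_deriv i g x))"
  by (rule partial_deriv_eqI) (rule D)
 moreover have "spg m (%x. (if i = j then f x else 0) + partial_deriv i g x)"
  using spg_lincomb[OF f spg_partial[OF g i], of 1 1] spg_partial[OF g i] by (cases "i = j") simp_all
 ultimately show "\<exists>f g. spg m f \<and> spg m g \<and> partial_deriv i h = (%x. f x * x j + g x)"
  using spg_partial[OF f i] by blast
qed

text \<open>Only partial derivatives are given, so the chain rule moves the coordinates along the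
  line one at a time. In each step the displacement of the new coordinate is a second variable, and
  joint continuity of its partial derivative gives differentiability of the two-variable function F
  on the diagonal.\<close>

lemma spg_line:
 assumes f: "spg m f"
 shows "((%t. f (%i. x i + t * \<alpha> i)) has_real_derivative
  (\<Sum>i<m. \<alpha> i * partial_deriv i f (%i. x i + t * \<alpha> i))) (at t)"
proof -
 define y where "y k x t = (%i. if i < k then x i + t * \<alpha> i else x i)" for k x and t :: real
 have "((%t. f (y k x t)) has_real_derivative (\<Sum>i<k. \<alpha> i * partial_deriv i f (y k x t))) (at t)" if "k \<le> m" for k x t
  using that
 proof (induction k arbitrary: x t)
  case 0
  then show ?case by (simp add: y_def)
 next
  case (Suc k)
  then have k: "k < m" by simp
  define h where "h v = x(k := x k + v * \<alpha> k)" for v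
  define F where "F u v = f (y k (h v) u)" for u v
  have yk: "y k (h v) u = (y k x u)(k := x k + v * \<alpha> k)" for u v
   by (auto simp: y_def h_def)
  have yS: "y (Suc k) x t = y k (h t) t" for t
   by (auto simp: y_def h_def less_Suc_eq)
  define D2 where "D2 u v = \<alpha> k * partial_deriv k f (y k (h v) u)" for u v
  have cont_y: "contU (%p. y k (h (snd p)) (fst p))"
  proof (rule continuous_on_coordinatewise_then_product)
   show "contU (%p. y k (h (snd p)) (fst p) i)" for i
    by (cases "i < k"; cases "i = k") (auto simp: y_def h_def intro!: continuous_intros)
  qed
  have contD: "contU (%p. D2 (fst p) (snd p))"
   unfolding D2_def
   by (intro continuous_intros continuous_on_compose2[OF spg_continuous[OF spg_partial[OF f k]] cont_y]) auto
  have "((%(u, v). F u v) has_derivative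
   (%(tu, tv). (\<Sum>i<k. \<alpha> i * partial_deriv i f (y k (h t) t)) * tu + blinfun_apply (blinfun_scaleR_left (D2 t t)) tv)) (at (t, t) within UNIV \<times> UNIV)"
  proof (rule has_derivative_partialsI[where fy="%u v. blinfun_scaleR_left (D2 u v)"])
   show "((%u. F u t) has_derivative (%tu. (\<Sum>i<k. \<alpha> i * partial_deriv i f (y k (h t) t)) * tu)) (at t within UNIV)"
    using Suc.IH[of "h t" t] k unfolding F_def has_field_derivative_def by simp
   show "((%v. F u v) has_derivative blinfun_apply (blinfun_scaleR_left (D2 u v))) (at v within UNIV)" for u v
   proof -
    have "((%v. f ((y k x u)(k := x k + v * \<alpha> k))) has_real_derivative
      partial_deriv k f ((y k x u)(k := x k + v * \<alpha> k)) * \<alpha> k) (at v)"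
     by (rule DERIV_chain2[OF spg_has_partial[OF f k]]) (auto intro!: derivative_eq_intros)
    then show ?thesis
     unfolding F_def D2_def yk has_field_derivative_def
     by (rule has_derivative_eq_rhs) (auto simp: fun_eq_iff)
   qed
   show "continuous (at (t, t) within UNIV \<times> UNIV) (%(u, v). blinfun_scaleR_left (D2 u v))"
   proof -
    have "contU (%p. blinfun_scaleR_left (D2 (fst p) (snd p)))"
     by (intro continuous_intros contD)
    then have "continuous (at (t, t)) (%p. blinfun_scaleR_left (D2 (fst p) (snd p)))"
     by (simp add: continuous_on_eq_continuous_at)
    then show ?thesis by (simp add: case_prod_unfold)
   qed
  qed auto
  then have "((%p. F (fst p) (snd p)) has_derivative
   (%p. (\<Sum>i<k. \<alpha> i * partial_deriv i f (y k (h t) t)) * fst p + D2 t t * snd p)) (at (t, t))"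
   by (simp add: case_prod_unfold mult.commute)
  moreover have "((%t::real. (t, t)) has_derivative (%s. (s, s))) (at t)"
   by (auto intro!: derivative_eq_intros)
  ultimately have "((%p. F (fst p) (snd p)) \<circ> (%t. (t, t)) has_derivative
   (%p. (\<Sum>i<k. \<alpha> i * partial_deriv i f (y k (h t) t)) * fst p + D2 t t * snd p) \<circ> (%s. (s, s))) (at t)"
   by (intro diff_chain_at) auto
  then have "((%t. F t t) has_derivative (%s. (\<Sum>i<k. \<alpha> i * partial_deriv i f (y k (h t) t)) * s + D2 t t * s)) (at t)"
   by (simp add: o_def)
  then have "((%t. F t t) has_real_derivative (\<Sum>i<k. \<alpha> i * partial_deriv i f (y k (h t) t)) + D2 t t) (at t)"
   unfolding has_field_derivative_def by (simp only: distrib_right[symmetric])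
  then show ?case unfolding F_def D2_def yS by simp
 qed
 from this[of m x t] have *: "((%t. f (y m x t)) has_real_derivative (\<Sum>i<m. \<alpha> i * partial_deriv i f (y m x t))) (at t)"
  by simp
 have "f (y m x t) = f (%i. x i + t * \<alpha> i)" for t
  by (rule spg_dep[OF f]) (simp add: y_def)
 moreover have "partial_deriv i f (y m x t) = partial_deriv i f (%i. x i + t * \<alpha> i)" if "i < m" for i
  by (rule spg_dep[OF spg_partial[OF f that]]) (simp add: y_def)
 ultimately show ?thesis using * by simp
qed

section \<open>Moments\<close>

text \<open>Variables with moments of every order form an algebra, so integrability of any
  polynomial expression in Gaussians follows from closure rules.\<close>

definition all_moments :: "'w measure => ('w => real) => bool" where
 "all_moments M X \<longleftrightarrow> X \<in> borel_measurable M \<and> (\<forall>p::nat. integrable M (%om. \<bar>X om\<bar> ^ p))"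

lemma all_moments_measurable [measurable_dest]: "all_moments M X ==> X \<in> borel_measurable M"
 by (simp add: all_moments_def)

lemma all_moments_integrable_power: "all_moments M X ==> integrable M (%om. X om ^ p)"
 by (rule bi_int_bound[of M "%om. \<bar>X om\<bar> ^ p"]) (auto simp: all_moments_def power_abs)

lemma all_moments_integrable: "all_moments M X ==> integrable M X"
 using all_moments_integrable_power[of M X 1] by simp

lemma all_moments_L2: "all_moments M X ==> L2 M X"
 using all_moments_integrable_power[of M X 2] by (simp add: L2_def all_moments_def)

lemma all_moments_bound:
 assumes "all_moments M Y" "X \<in> borel_measurable M" "AE om in M. \<bar>X om\<bar> \<le> \<bar>Y om\<bar>"
 shows "all_moments M X"
 unfolding all_moments_def
proof (intro conjI allI)
 fix p :: nat
 show "integrable M (%om. \<bar>X om\<bar> ^ p)"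
 proof (rule bi_int_bound[of M "%om. \<bar>Y om\<bar> ^ p"])
  show "integrable M (%om. \<bar>Y om\<bar> ^ p)" using assms(1) by (simp add: all_moments_def)
  show "AE om in M. norm (\<bar>X om\<bar> ^ p) \<le> norm (\<bar>Y om\<bar> ^ p)"
   using assms(3)
  proof eventually_elim
   case (elim om)
   then have "\<bar>X om\<bar> ^ p \<le> \<bar>Y om\<bar> ^ p" by (rule power_mono) simp
   then show ?case by (simp add: power_abs)
  qed
 qed (use assms(2) in measurable)
qed fact

lemma all_moments_const: "finite_measure M ==> all_moments M (%_. c)"
 by (simp add: all_moments_def finite_measure.integrable_const)

lemma all_moments_mult:
 assumes X: "all_moments M X" and Y: "all_moments M Y" shows "all_moments M (%om. X om * Y om)"
 unfolding all_moments_def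
proof (intro conjI allI)
 note [measurable] = all_moments_measurable[OF X] all_moments_measurable[OF Y]
 show "(%om. X om * Y om) \<in> borel_measurable M" by measurable
 fix p :: nat
 show "integrable M (%om. \<bar>X om * Y om\<bar> ^ p)"
 proof (rule bi_int_bound)
  show "integrable M (%om. \<bar>X om\<bar> ^ (p * 2) + \<bar>Y om\<bar> ^ (p * 2))"
   using X Y by (auto simp: all_moments_def)
  show "AE om in M. norm (\<bar>X om * Y om\<bar> ^ p) \<le> norm (\<bar>X om\<bar> ^ (p * 2) + \<bar>Y om\<bar> ^ (p * 2))"
  proof (rule AE_I2)
   fix om
   define a b where "a = \<bar>X om\<bar> ^ p" and "b = \<bar>Y om\<bar> ^ p"
   have "a \<ge> 0" "b \<ge> 0" by (simp_all add: a_def b_def)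
   have "2 * a * b \<le> a\<^sup>2 + b\<^sup>2" by (rule sum_squares_bound)
   moreover have "a * b \<ge> 0" using \<open>a \<ge> 0\<close> \<open>b \<ge> 0\<close> by simp
   ultimately have "a * b \<le> a\<^sup>2 + b\<^sup>2" by simp
   then show "norm (\<bar>X om * Y om\<bar> ^ p) \<le> norm (\<bar>X om\<bar> ^ (p * 2) + \<bar>Y om\<bar> ^ (p * 2))"
    by (simp add: a_def b_def abs_mult power_mult_distrib power_mult)
  qed
 qed measurable
qed

lemma all_moments_add:
 assumes X: "all_moments M X" and Y: "all_moments M Y" shows "all_moments M (%om. X om + Y om)"
 unfolding all_moments_def
proof (intro conjI allI)
 note [measurable] = all_moments_measurable[OF X] all_moments_measurable[OF Y]
 show "(%om. X om + Y om) \<in> borel_measurable M" by measurable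
 fix p :: nat
 show "integrable M (%om. \<bar>X om + Y om\<bar> ^ p)"
 proof (rule bi_int_bound)
  show "integrable M (%om. 2 ^ p * (\<bar>X om\<bar> ^ p + \<bar>Y om\<bar> ^ p))"
   using X Y by (auto simp: all_moments_def)
  show "AE om in M. norm (\<bar>X om + Y om\<bar> ^ p) \<le> norm (2 ^ p * (\<bar>X om\<bar> ^ p + \<bar>Y om\<bar> ^ p))"
  proof (rule AE_I2)
   fix om
   define a b where "a = \<bar>X om\<bar>" and "b = \<bar>Y om\<bar>"
   have nn: "a \<ge> 0" "b \<ge> 0" by (simp_all add: a_def b_def)
   have "\<bar>X om + Y om\<bar> ^ p \<le> (2 * max a b) ^ p"
    by (intro power_mono) (auto simp: a_def b_def)
   also have "... = 2 ^ p * max a b ^ p" by (simp add: power_mult_distrib)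
   also have "... \<le> 2 ^ p * (a ^ p + b ^ p)"
    using nn by (intro mult_left_mono) (auto simp: max_def)
   finally show "norm (\<bar>X om + Y om\<bar> ^ p) \<le> norm (2 ^ p * (\<bar>X om\<bar> ^ p + \<bar>Y om\<bar> ^ p))"
    using nn by (simp add: a_def b_def)
  qed
 qed measurable
qed

lemma all_moments_cmult: "finite_measure M ==> all_moments M X ==> all_moments M (%om. c * X om)"
 by (intro all_moments_mult all_moments_const)

lemma all_moments_diff: "finite_measure M ==> all_moments M X ==> all_moments M Y ==> all_moments M (%om. X om - Y om)"
 using all_moments_add[of M X "%om. -1 * Y om"] all_moments_cmult[of M Y "-1"] by simp

lemma all_moments_sum: "finite_measure M ==> (\<And>i. i \<in> I ==> all_moments M (X i)) ==> all_moments M (%om. \<Sum>i\<in>I. X i om)"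
 by (induction I rule: infinite_finite_induct) (auto intro: all_moments_const all_moments_add)

lemma all_moments_pow: "finite_measure M ==> all_moments M X ==> all_moments M (%om. X om ^ n)"
 by (induction n) (auto intro: all_moments_const all_moments_mult)

lemma all_moments_abs: "all_moments M X ==> all_moments M (%om. \<bar>X om\<bar>)"
 by (auto simp: all_moments_def)

section \<open>Moments of Wiener integrals and of smooth functionals\<close>

context white_noise_space
begin

lemma finite_M: "finite_measure M" by (rule finite_measure_axioms)

lemma wiener_scaled:
 assumes h: "L2 S h"
 shows "AE om in M. wi (%x. c * h x) om = c * wi h om"
 using wiener_lincomb[OF L2_cmult[OF h, of c], of "{()}" "%_. h" "%_. c"] h by simp

lemma wiener_zero:
 assumes h: "L2 S h" "(LINT x|S. (h x)\<^sup>2) = 0"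
 shows "AE om in M. wi h om = 0"
 using L2_norm_zero_AE[OF wiener_L2[OF h(1)]] wiener_inner[OF h(1) h(1)] h(2) by (simp add: power2_eq_square)

lemma unit_rescale:
 assumes h: "L2 S h" "(LINT x|S. (h x)\<^sup>2) \<noteq> 0"
 obtains s h1 where "s > 0" "L2 S h1" "(LINT x|S. (h1 x)\<^sup>2) = 1" "h = (%x. s * h1 x)"
proof -
 have "(LINT x|S. (h x)\<^sup>2) \<ge> 0" by simp
 then have p: "(LINT x|S. (h x)\<^sup>2) > 0" using h(2) by linarith
 define s where "s = sqrt (LINT x|S. (h x)\<^sup>2)"
 have s: "s > 0" "s\<^sup>2 = (LINT x|S. (h x)\<^sup>2)" using p by (auto simp: s_def)
 have "(LINT x|S. ((1/s) * h x)\<^sup>2) = (1/s)\<^sup>2 * (LINT x|S. (h x)\<^sup>2)"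
  by (simp only: power_mult_distrib integral_mult_right_zero)
 also have "... = 1" using s(1) by (simp only: s(2)[symmetric]) (simp add: power_one_over)
 finally have 1: "(LINT x|S. ((1/s) * h x)\<^sup>2) = 1" .
 show ?thesis
  by (rule that[OF s(1) L2_cmult[OF h(1), of "1/s"] 1]) (use s(1) in auto)
qed

lemma wiener_all_moments:
 assumes h: "L2 S h"
 shows "all_moments M (wi h)"
proof (cases "(LINT x|S. (h x)\<^sup>2) = 0")
 case True
 show ?thesis
  by (rule all_moments_bound[OF all_moments_const[OF finite_M, of 0]])
   (use wiener_zero[OF h True] wiener_L2[OF h] in \<open>auto simp: L2_def\<close>)
next
 case False
 then obtain s h1 where s: "s > 0" "L2 S h1" "(LINT x|S. (h1 x)\<^sup>2) = 1" "h = (%x. s * h1 x)"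
  using unit_rescale[OF h] by blast
 have [measurable]: "wi h1 \<in> borel_measurable M" using wiener_L2[OF s(2)] by (rule L2_measurable)
 have "all_moments M (wi h1)"
  unfolding all_moments_def
 proof (intro conjI allI)
  fix p :: nat
  have "integrable (distr M borel (wi h1)) (%z. \<bar>z\<bar> ^ p)"
   unfolding wiener_unit_law[OF s(2,3)]
   by (intro exp_bounded_integrable exp_bounded_pow exp_bounded_abs exp_bounded_id) measurable
  then show "integrable M (%om. \<bar>wi h1 om\<bar> ^ p)"
   by (subst (asm) integrable_distr_eq) auto
 qed simp
 then have "all_moments M (%om. s * wi h1 om)" by (rule all_moments_cmult[OF finite_M])
 then show ?thesis
  by (rule all_moments_bound)
   (use wiener_scaled[OF s(2), of s] wiener_L2[OF h] s(4) in \<open>auto simp: L2_def\<close>)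
qed

lemma smooth_functional_measurable:
 assumes f: "spg m f" and g: "\<And>i. i < m ==> V i \<in> borel_measurable N"
 shows "(%om. f (%i. V i om)) \<in> borel_measurable N"
proof -
 have "(%om. f (%i. if i < m then V i om else 0)) \<in> borel_measurable N"
 proof (rule measurable_compose[OF _ borel_measurable_continuous_onI[OF spg_continuous[OF f]]])
  show "(%om i. if i < m then V i om else 0) \<in> borel_measurable N"
  proof (rule measurable_coordinatewise_then_product)
   show "(%om. if i < m then V i om else 0) \<in> borel_measurable N" for i
    using g[of i] by (cases "i < m") auto
  qed
 qed
 also have "(%om. f (%i. if i < m then V i om else 0)) = (%om. f (%i. V i om))"
  by (rule ext, rule spg_dep[OF f]) simp
 finally show ?thesis .
qed

lemma smooth_functional_all_moments:
 assumes f: "spg m f" and g: "\<And>i. i < m ==> L2 S (g i)"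
 shows "all_moments M (%om. f (%i. wi (g i) om))"
proof -
 obtain C N where C: "\<And>x. \<bar>f x\<bar> \<le> C * (1 + (\<Sum>i<m. \<bar>x i\<bar>)) ^ N" using spg_growth[OF f] by blast
 have *: "all_moments M (%om. C * (1 + (\<Sum>i<m. \<bar>wi (g i) om\<bar>)) ^ N)"
  by (intro all_moments_cmult all_moments_pow all_moments_add all_moments_const all_moments_sum all_moments_abs wiener_all_moments finite_M)
   (use g in auto)
 show ?thesis
 proof (rule all_moments_bound[OF *])
  show "(%om. f (%i. wi (g i) om)) \<in> borel_measurable M"
   by (rule smooth_functional_measurable[OF f]) (use g wiener_L2 in \<open>auto simp: L2_def\<close>)
  show "AE om in M. \<bar>f (%i. wi (g i) om)\<bar> \<le> \<bar>C * (1 + (\<Sum>i<m. \<bar>wi (g i) om\<bar>)) ^ N\<bar>"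
   by (intro AE_I2 order.trans[OF C abs_ge_self])
 qed
qed

end

lemma spg_exp_bounded:
 assumes f: "spg m f"
 shows "exp_bounded (%t. f (%i. x i + t * \<alpha> i))"
proof -
 obtain C N where C: "\<And>x. \<bar>f x\<bar> \<le> C * (1 + (\<Sum>i<m. \<bar>x i\<bar>)) ^ N" using spg_growth[OF f] by blast
 have "exp_bounded (%t. C * (1 + (\<Sum>i<m. \<bar>x i + t * \<alpha> i\<bar>)) ^ N)"
  by (intro exp_bounded_mult exp_bounded_const exp_bounded_pow exp_bounded_add exp_bounded_sum exp_bounded_abs exp_bounded_id)
 then show ?thesis by (rule exp_bounded_mono) (rule C)
qed

lemma gram_schmidt_obtain:
 fixes f :: "nat => 'a => real"
 assumes "\<And>i. i < n ==> L2 M (f i)"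
 obtains r :: nat and e B where "\<forall>i<r. L2 M (e i)"
  "\<forall>i<r. \<forall>j<r. (LINT x|M. e i x * e j x) = (if i = j then 1 else 0)"
  "\<forall>k<n. AE x in M. f k x = (\<Sum>i<r. B k i * e i x)"
  "n > 0 \<longrightarrow> (LINT x|M. (f 0 x)\<^sup>2) = 1 \<longrightarrow> r > 0 \<and> e 0 = f 0"
proof -
 have "\<exists>(r::nat) e B. (\<forall>i<r. L2 M (e i)) \<and>
  (\<forall>i<r. \<forall>j<r. (LINT x|M. e i x * e j x) = (if i = j then 1 else 0)) \<and>
  (\<forall>k<n. AE x in M. f k x = (\<Sum>i<r. B k i * e i x)) \<and>
  (n > 0 \<longrightarrow> (LINT x|M. (f 0 x)\<^sup>2) = 1 \<longrightarrow> r > 0 \<and> e 0 = f 0)"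
  by (rule gram_schmidt) (rule assms)
 then show ?thesis by (elim exE conjE) (rule that)
qed

lemma spg_line_continuous:
 assumes f: "spg m f"
 shows "contU (%t::real. f (%i. x i + t * \<alpha> i))"
 by (rule continuous_on_compose2[OF spg_continuous[OF f]])
  (auto intro!: continuous_on_coordinatewise_then_product continuous_intros)

section \<open>Integration by parts for Wiener integrals\<close>

context white_noise_space
begin

text \<open>In an orthonormal system that starts with h all Wiener integrals become combinations of
  independent standard Gaussians, and the pairing with h becomes the coefficient of coordinate 0.
  Fubini then reduces the claim to \<open>gauss_ibp\<close> in that coordinate.\<close>

lemma wiener_ibp_unit:
 assumes f: "spg m f" and G: "spg m' G"
  and g: "\<And>i. i < m ==> L2 S (g i)" and g': "\<And>i. i < m' ==> L2 S (g' i)"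
  and h: "L2 S h" "(LINT x|S. (h x)\<^sup>2) = 1"
 shows "(LINT om|M. (\<Sum>i<m. partial_deriv i f (%i. wi (g i) om) * (LINT x|S. g i x * h x)) * G (%i. wi (g' i) om))
  = (LINT om|M. f (%i. wi (g i) om) * (G (%i. wi (g' i) om) * wi h om
    - (\<Sum>i<m'. partial_deriv i G (%i. wi (g' i) om) * (LINT x|S. g' i x * h x))))"
proof -
 \<comment> \<open>Index 0 holds h, the next m indices hold g and the last m' hold g'; the offsets
   in \<open>b\<close> and \<open>b'\<close> undo this concatenation.\<close>
 define F where "F k = (if k = 0 then h else if k \<le> m then g (k - 1) else g' (k - 1 - m))" for k
 have FL: "L2 S (F k)" if "k < 1 + m + m'" for k
  using that g g' h by (auto simp: F_def)
 obtain r :: nat and e B where gs: "\<forall>i<r. L2 S (e i)"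
  "\<forall>i<r. \<forall>j<r. (LINT x|S. e i x * e j x) = (if i = j then 1 else (0::real))"
  "\<forall>k<1 + m + m'. AE x in S. F k x = (\<Sum>i<r. B k i * e i x)"
  "1 + m + m' > 0 \<longrightarrow> (LINT x|S. (F 0 x)\<^sup>2) = 1 \<longrightarrow> r > 0 \<and> e 0 = F 0"
  by (rule gram_schmidt_obtain[of "1 + m + m'" S F]) (rule FL)
 have e: "L2 S (e i)" if "i < r" for i using gs(1) that by blast
 have on: "(LINT x|S. e i x * e j x) = (if i = j then 1 else (0::real))" if "i < r" "j < r" for i j
  using gs(2) that by blast
 have B: "AE x in S. F k x = (\<Sum>i<r. B k i * e i x)" if "k < 1 + m + m'" for k
  using gs(3) that by blast
 have r: "r > 0" "e 0 = h" using gs(4) h(2) by (simp_all add: F_def)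
 define b where "b j = B (Suc j)" for j
 define b' where "b' j = B (Suc m + j)" for j
 have gb: "AE x in S. g j x = (\<Sum>i<r. b j i * e i x)" if "j < m" for j
  using B[of "Suc j"] that by (simp add: F_def b_def)
 have gb': "AE x in S. g' j x = (\<Sum>i<r. b' j i * e i x)" if "j < m'" for j
  using B[of "Suc m + j"] that by (simp add: F_def b'_def)
 have coeff: "(LINT x|S. v x * h x) = c 0" if v: "L2 S v" and ae: "AE x in S. v x = (\<Sum>i<r. c i * e i x)" for v c
 proof -
  have I: "integrable S (%x. c i * (e i x * e 0 x))" if "i \<in> {..<r}" for i
   using that r by (intro integrable_mult_right L2_mult_integrable e) auto
  have "(LINT x|S. v x * h x) = (LINT x|S. (\<Sum>i<r. c i * (e i x * e 0 x)))"
  proof (rule integral_cong_AE)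
   show "AE x in S. v x * h x = (\<Sum>i<r. c i * (e i x * e 0 x))"
    using ae by eventually_elim (simp add: r sum_distrib_right mult.assoc)
   show "(%x. v x * h x) \<in> borel_measurable S" using v h by (auto simp: L2_def)
   show "(%x. \<Sum>i<r. c i * (e i x * e 0 x)) \<in> borel_measurable S"
    using I by (intro borel_measurable_sum borel_measurable_integrable) auto
  qed
  also have "... = (\<Sum>i<r. (LINT x|S. c i * (e i x * e 0 x)))" by (rule bi_sum[OF I])
  also have "... = (\<Sum>i<r. c i * (if i = 0 then 1 else 0))"
   by (intro sum.cong refl) (use on[OF _ r(1)] in simp)
  also have "... = c 0" using r by (simp add: if_distrib[of "%x. _ * x"] sum.delta cong: if_cong)
  finally show ?thesis .
 qed
 have cg: "(LINT x|S. g j x * h x) = b j 0" if "j < m" for j by (rule coeff[OF g[OF that] gb[OF that]])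
 have cg': "(LINT x|S. g' j x * h x) = b' j 0" if "j < m'" for j by (rule coeff[OF g'[OF that] gb'[OF that]])
 define \<xi> where "\<xi> om = (\<lambda>i\<in>{..<r}. wi (e i) om)" for om
 define P where "P v = (%j. \<Sum>i<r. b j i * v i)" for v
 define P' where "P' v = (%j. \<Sum>i<r. b' j i * v i)" for v
 \<comment> \<open>Left side minus right side of the claim, expressed in the coordinates of the
   orthonormal system.\<close>
 define \<Phi> where "\<Phi> v = (\<Sum>i<m. partial_deriv i f (P v) * b i 0) * G (P' v)
   - f (P v) * (G (P' v) * v 0 - (\<Sum>i<m'. partial_deriv i G (P' v) * b' i 0))" for v
 let ?V = "%om i. wi (g i) om" and ?V' = "%om i. wi (g' i) om"
 define \<Psi> where "\<Psi> om = (\<Sum>i<m. partial_deriv i f (?V om) * (LINT x|S. g i x * h x)) * G (?V' om)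
   - f (?V om) * (G (?V' om) * wi h om - (\<Sum>i<m'. partial_deriv i G (?V' om) * (LINT x|S. g' i x * h x)))" for om
 note am = all_moments_mult all_moments_diff[OF finite_M] all_moments_sum[OF finite_M] all_moments_const[OF finite_M]
  smooth_functional_all_moments[OF f g] smooth_functional_all_moments[OF G g'] wiener_all_moments[OF h(1)]
  smooth_functional_all_moments[OF spg_partial[OF f] g] smooth_functional_all_moments[OF spg_partial[OF G] g']
 have i1: "integrable M (%om. (\<Sum>i<m. partial_deriv i f (?V om) * (LINT x|S. g i x * h x)) * G (?V' om))"
  by (rule all_moments_integrable) (intro am; simp)
 have i2: "integrable M (%om. f (?V om) * (G (?V' om) * wi h om - (\<Sum>i<m'. partial_deriv i G (?V' om) * (LINT x|S. g' i x * h x))))"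
  by (rule all_moments_integrable) (intro am; simp)
 have i\<Psi>: "integrable M \<Psi>" unfolding \<Psi>_def[abs_def] using i1 i2 by simp
 have ae: "AE om in M. \<Psi> om = \<Phi> (\<xi> om)"
 proof -
  have "AE om in M. \<forall>j\<in>{..<m}. ?V om j = P (\<xi> om) j"
  proof (rule AE_finite_allI)
   fix j assume "j \<in> {..<m}"
   then show "AE om in M. ?V om j = P (\<xi> om) j"
    using wiener_lincomb[OF g[of j], of "{..<r}" e "b j"] e gb by (simp add: P_def \<xi>_def)
  qed simp
  moreover have "AE om in M. \<forall>j\<in>{..<m'}. ?V' om j = P' (\<xi> om) j"
  proof (rule AE_finite_allI)
   fix j assume "j \<in> {..<m'}"
   then show "AE om in M. ?V' om j = P' (\<xi> om) j"
    using wiener_lincomb[OF g'[of j], of "{..<r}" e "b' j"] e gb' by (simp add: P'_def \<xi>_def)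
  qed simp
  ultimately show ?thesis
  proof eventually_elim
   case (elim om)
   have "f (?V om) = f (P (\<xi> om))" by (rule spg_dep[OF f]) (use elim in auto)
   moreover have "G (?V' om) = G (P' (\<xi> om))" by (rule spg_dep[OF G]) (use elim in auto)
   moreover have "partial_deriv i f (?V om) = partial_deriv i f (P (\<xi> om))" if "i < m" for i
    by (rule spg_dep[OF spg_partial[OF f that]]) (use elim in auto)
   moreover have "partial_deriv i G (?V' om) = partial_deriv i G (P' (\<xi> om))" if "i < m'" for i
    by (rule spg_dep[OF spg_partial[OF G that]]) (use elim in auto)
   moreover have "wi h om = \<xi> om 0" using r by (simp add: \<xi>_def)
   ultimately show ?case by (simp add: \<Psi>_def \<Phi>_def cg cg')
  qed
 qed
 let ?N = "PiM {..<r} (%_::nat. borel :: real measure)"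
 have [measurable]: "\<xi> \<in> measurable M ?N"
  unfolding \<xi>_def[abs_def] by (rule measurable_restrict) (use e wiener_L2 in \<open>auto simp: L2_def\<close>)
 have coord: "(%v. v i) \<in> borel_measurable ?N" if "i < r" for i
  using that by (intro measurable_component_singleton) simp
 have Pm: "(%v. P v j) \<in> borel_measurable ?N" "(%v. P' v j) \<in> borel_measurable ?N" for j
  unfolding P_def P'_def using coord by (auto intro!: borel_measurable_sum borel_measurable_times)
 have \<Phi>m: "\<Phi> \<in> borel_measurable ?N"
 proof -
  have 1: "(%v. f (P v)) \<in> borel_measurable ?N"
   using smooth_functional_measurable[OF f, of "%i v. P v i" ?N] Pm by simp
  have 2: "(%v. G (P' v)) \<in> borel_measurable ?N"
   using smooth_functional_measurable[OF G, of "%i v. P' v i" ?N] Pm by simp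
  have 3: "(%v. partial_deriv i f (P v)) \<in> borel_measurable ?N" if "i < m" for i
   using smooth_functional_measurable[OF spg_partial[OF f that], of "%i v. P v i" ?N] Pm by simp
  have 4: "(%v. partial_deriv i G (P' v)) \<in> borel_measurable ?N" if "i < m'" for i
   using smooth_functional_measurable[OF spg_partial[OF G that], of "%i v. P' v i" ?N] Pm by simp
  show ?thesis
   unfolding \<Phi>_def[abs_def] using 1 2 3 4 coord[OF r(1)] by (intro borel_measurable_diff borel_measurable_times borel_measurable_sum) auto
 qed
 have law: "distr M ?N \<xi> = PiM {..<r} (%_. gauss)"
  unfolding \<xi>_def[abs_def] by (rule orthonormal_law) (use e on in auto)
 have i\<Phi>: "integrable M (%om. \<Phi> (\<xi> om))"
  using i\<Psi> ae \<Phi>m by (subst integrable_cong_AE[of _ _ \<Psi>]) (auto elim: eventually_mono)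
 have "(LINT om|M. \<Psi> om) = (LINT om|M. \<Phi> (\<xi> om))"
  using i\<Psi> i\<Phi> ae by (intro integral_cong_AE) auto
 also have "... = (LINT v|(PiM {..<r} (%_. gauss)). \<Phi> v)"
  unfolding law[symmetric] using \<Phi>m by (subst integral_distr) auto
 also have "... = 0"
 proof -
  interpret Gp: product_sigma_finite "%_::nat. gauss"
   using prob_space_gauss by (simp add: product_sigma_finite_def prob_space_imp_sigma_finite)
  have int: "integrable (PiM {..<r} (%_. gauss)) \<Phi>"
   unfolding law[symmetric] using \<Phi>m i\<Phi> by (subst integrable_distr_eq) auto
  have ins: "{..<r} = insert 0 {1..<r}" using r by auto
  have "(LINT v|(PiM {..<r} (%_. gauss)). \<Phi> v) = (LINT x|(PiM {1..<r} (%_. gauss)). (LINT y|gauss. \<Phi> (x(0 := y))))"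
   unfolding ins by (rule Gp.product_integral_insert) (use int ins in auto)
  also have "... = (LINT x|(PiM {1..<r} (%_. gauss)). 0)"
  proof (rule bi_cong[OF refl])
   fix x :: "nat => real"
   \<comment> \<open>With coordinate 0 reset, every argument is affine in the integration variable
     y, and the integrand takes the form u' - y u for a product u.\<close>
   define x0 where "x0 = x(0 := 0)"
   have sp: "(\<Sum>i<r. c i * (x(0 := y)) i) = (\<Sum>i<r. c i * x0 i) + y * c 0" for c :: "nat => real" and y
    unfolding ins by (simp add: x0_def)
   have PP: "P (x(0 := y)) = (%j. P x0 j + y * b j 0)" "P' (x(0 := y)) = (%j. P' x0 j + y * b' j 0)" for y
    by (simp_all only: P_def P'_def sp)
   define u where "u y = f (%j. P x0 j + y * b j 0) * G (%j. P' x0 j + y * b' j 0)" for y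
   define u' where "u' y = (\<Sum>i<m. b i 0 * partial_deriv i f (%j. P x0 j + y * b j 0)) * G (%j. P' x0 j + y * b' j 0)
    + (\<Sum>i<m'. b' i 0 * partial_deriv i G (%j. P' x0 j + y * b' j 0)) * f (%j. P x0 j + y * b j 0)" for y
   have du: "(u has_real_derivative u' y) (at y)" for y
    unfolding u_def[abs_def] u'_def by (rule DERIV_mult[OF spg_line[OF f] spg_line[OF G]])
   have cu': "contU u'"
    unfolding u'_def[abs_def]
    by (intro continuous_intros spg_line_continuous[OF f] spg_line_continuous[OF G])
     (auto intro!: spg_line_continuous spg_partial f G)
   have bu: "exp_bounded u" "exp_bounded u'"
    unfolding u_def[abs_def] u'_def[abs_def]
    by (intro exp_bounded_mult exp_bounded_add exp_bounded_sum exp_bounded_const spg_exp_bounded[OF f] spg_exp_bounded[OF G]; (rule spg_exp_bounded, rule spg_partial, rule f G, simp)?)+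
   have eq: "\<Phi> (x(0 := y)) = u' y - y * u y" for y
    by (simp add: \<Phi>_def PP u_def u'_def algebra_simps sum_distrib_left sum_distrib_right)
   have [measurable]: "u \<in> borel_measurable borel" "u' \<in> borel_measurable borel"
    using cu' du by (auto intro!: borel_measurable_continuous_onI continuous_at_imp_continuous_on DERIV_isCont)
   have "(LINT y|gauss. u' y - y * u y) = (LINT y|gauss. u' y) - (LINT y|gauss. y * u y)"
    by (intro bi_diff exp_bounded_integrable exp_bounded_mult exp_bounded_id bu) measurable
   also have "... = 0" using gauss_ibp[OF du cu' bu] by simp
   finally show "(LINT y|gauss. \<Phi> (x(0 := y))) = 0" by (simp add: eq)
  qed
  finally show ?thesis by simp
 qed
 finally have "(LINT om|M. \<Psi> om) = 0" .
 then show ?thesis unfolding \<Psi>_def using i1 i2 by simp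
qed

text \<open>Both sides are linear in h, so h may be scaled to norm one; if h vanishes almost
  everywhere, both sides are zero.\<close>

theorem wiener_ibp:
 assumes f: "spg m f" and G: "spg m' G"
  and g: "\<And>i. i < m ==> L2 S (g i)" and g': "\<And>i. i < m' ==> L2 S (g' i)"
  and h: "L2 S h"
 shows "(LINT om|M. (\<Sum>i<m. partial_deriv i f (%i. wi (g i) om) * (LINT x|S. g i x * h x)) * G (%i. wi (g' i) om))
  = (LINT om|M. f (%i. wi (g i) om) * (G (%i. wi (g' i) om) * wi h om
    - (\<Sum>i<m'. partial_deriv i G (%i. wi (g' i) om) * (LINT x|S. g' i x * h x))))"
proof (cases "(LINT x|S. (h x)\<^sup>2) = 0")
 case True
 have h0: "AE x in S. h x = 0" by (rule L2_norm_zero_AE[OF h True])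
 have w0: "AE om in M. wi h om = 0" by (rule wiener_zero[OF h True])
 have z: "(LINT x|S. v x * h x) = 0" for v
  using h0 by (intro integral_eq_zero_AE) (auto elim: eventually_mono)
 show ?thesis
  using w0 unfolding z by (subst (2) integral_eq_zero_AE) (auto elim: eventually_mono)
next
 case False
 then obtain s h1 where s: "s > 0" "L2 S h1" "(LINT x|S. (h1 x)\<^sup>2) = 1" "h = (%x. s * h1 x)"
  using unit_rescale[OF h] by blast
 let ?V = "%om i. wi (g i) om" and ?V' = "%om i. wi (g' i) om"
 have c: "(LINT x|S. v x * h x) = s * (LINT x|S. v x * h1 x)" for v
  unfolding s(4) by (simp add: mult.left_commute)
 have "(LINT om|M. (\<Sum>i<m. partial_deriv i f (?V om) * (LINT x|S. g i x * h x)) * G (?V' om))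
  = s * (LINT om|M. (\<Sum>i<m. partial_deriv i f (?V om) * (LINT x|S. g i x * h1 x)) * G (?V' om))"
  unfolding c by (simp add: mult.left_commute[of _ s] sum_distrib_left[symmetric] mult.assoc)
 also have "... = s * (LINT om|M. f (?V om) * (G (?V' om) * wi h1 om
    - (\<Sum>i<m'. partial_deriv i G (?V' om) * (LINT x|S. g' i x * h1 x))))"
  by (subst wiener_ibp_unit[OF f G g g' s(2,3)]) auto
 also have "... = (LINT om|M. s * (f (?V om) * (G (?V' om) * wi h1 om
    - (\<Sum>i<m'. partial_deriv i G (?V' om) * (LINT x|S. g' i x * h1 x)))))"
  by (rule integral_mult_right_zero[symmetric])
 also have "... = (LINT om|M. f (?V om) * (G (?V' om) * wi h om
    - (\<Sum>i<m'. partial_deriv i G (?V' om) * (LINT x|S. g' i x * h x))))"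
 proof (rule integral_cong_AE)
  note am = all_moments_mult all_moments_diff[OF finite_M] all_moments_sum[OF finite_M] all_moments_const[OF finite_M]
   smooth_functional_all_moments[OF f g] smooth_functional_all_moments[OF G g'] wiener_all_moments
   smooth_functional_all_moments[OF spg_partial[OF f] g] smooth_functional_all_moments[OF spg_partial[OF G] g']
  show "(%om. s * (f (?V om) * (G (?V' om) * wi h1 om
    - (\<Sum>i<m'. partial_deriv i G (?V' om) * (LINT x|S. g' i x * h1 x))))) \<in> borel_measurable M"
   by (rule all_moments_measurable) (intro am s(2); simp)
  show "(%om. f (?V om) * (G (?V' om) * wi h om
    - (\<Sum>i<m'. partial_deriv i G (?V' om) * (LINT x|S. g' i x * h x)))) \<in> borel_measurable M"
   by (rule all_moments_measurable) (intro am h; simp)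
  have "AE om in M. wi h om = s * wi h1 om"
   using wiener_scaled[OF s(2), of s] by (simp add: s(4))
  then show "AE om in M. s * (f (?V om) * (G (?V' om) * wi h1 om
    - (\<Sum>i<m'. partial_deriv i G (?V' om) * (LINT x|S. g' i x * h1 x))))
   = f (?V om) * (G (?V' om) * wi h om - (\<Sum>i<m'. partial_deriv i G (?V' om) * (LINT x|S. g' i x * h x)))"
   unfolding c by eventually_elim (simp add: algebra_simps sum_distrib_left)
 qed
 finally show ?thesis .
qed

end

section \<open>Closability of the Malliavin derivatives\<close>

text \<open>Words are ordered indices with repetition, one per component of an iterated derivative.
  Lists suit the recursion on the order; \<open>sum_PiE_words\<close> translates from the index
  functions of \<open>smooth_functional_deriv\<close>.\<close>

definition words :: "nat => nat => nat list set" where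
 "words m k = {is. set is \<subseteq> {..<m} \<and> length is = k}"

lemma finite_words [simp]: "finite (words m k)"
 unfolding words_def by (rule finite_lists_length_eq) simp

lemma words_0 [simp]: "words m 0 = {[]}"
 by (auto simp: words_def)

lemma words_nth: "is \<in> words m k ==> j < k ==> is ! j < m"
 unfolding words_def using nth_mem by blast

lemma sum_words_Suc: "(\<Sum>is\<in>words m (Suc k). F is) = (\<Sum>i<m. \<Sum>is\<in>words m k. F (i # is))"
proof -
 have "words m (Suc k) = (%(i, is). i # is) ` ({..<m} \<times> words m k)"
  by (force simp: words_def length_Suc_conv)
 moreover have "inj_on (%(i, is). i # is) ({..<m} \<times> words m k)" by (auto simp: inj_on_def)
 ultimately have "(\<Sum>is\<in>words m (Suc k). F is) = (\<Sum>p\<in>{..<m} \<times> words m k. F ((%(i, is). i # is) p))"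
  by (simp add: sum.reindex)
 then show ?thesis by (simp add: sum.cartesian_product case_prod_unfold)
qed

lemma sum_PiE_words: "(\<Sum>i\<in>{..<k} \<rightarrow>\<^sub>E {..<m}. F (map i [0..<k])) = (\<Sum>is\<in>words m k. F is)"
proof (rule sum.reindex_bij_witness[where i="%is. \<lambda>j\<in>{..<k}. is ! j" and j="%i. map i [0..<k]"])
 fix i assume i: "i \<in> {..<k} \<rightarrow>\<^sub>E {..<m}"
 show "(\<lambda>j\<in>{..<k}. map i [0..<k] ! j) = i"
  using i by (auto simp: fun_eq_iff PiE_def extensional_def)
 show "map i [0..<k] \<in> words m k"
  using i by (auto simp: words_def PiE_def)
next
 fix "is" assume "is": "is \<in> words m k"
 show "map (\<lambda>j\<in>{..<k}. is ! j) [0..<k] = is"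
  using "is" by (auto simp: words_def intro!: nth_equalityI)
 show "(\<lambda>j\<in>{..<k}. is ! j) \<in> {..<k} \<rightarrow>\<^sub>E {..<m}"
  using words_nth[OF "is"] by auto
qed auto

lemma smooth_functional_deriv_words:
 "smooth_functional_deriv M W k m g f (om, y) =
  (\<Sum>is\<in>words m k. partial_derivs is f (%j. wiener M W (g j) om) * (\<Prod>j<k. g (is ! j) (y j)))"
proof -
 have "smooth_functional_deriv M W k m g f (om, y) =
  (\<Sum>i\<in>{..<k} \<rightarrow>\<^sub>E {..<m}. partial_derivs (map i [0..<k]) f (%j. wiener M W (g j) om) * (\<Prod>j<k. g (map i [0..<k] ! j) (y j)))"
  unfolding smooth_functional_deriv_def by (simp cong: sum.cong)
 also have "... = (\<Sum>is\<in>words m k. partial_derivs is f (%j. wiener M W (g j) om) * (\<Prod>j<k. g (is ! j) (y j)))"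
  by (rule sum_PiE_words)
 finally show ?thesis .
qed

lemma product_integral_mult:
 fixes u :: "'b => real" and v :: "'c => real"
 assumes "sigma_finite_measure M" "sigma_finite_measure N" and u: "integrable M u" and v: "integrable N v"
 shows "integrable (M \<Otimes>\<^sub>M N) (%p. u (fst p) * v (snd p))"
  and "(LINT p|(M \<Otimes>\<^sub>M N). u (fst p) * v (snd p)) = (LINT x|M. u x) * (LINT y|N. v y)"
proof -
 interpret pair_sigma_finite M N using assms by (simp add: pair_sigma_finite_def)
 have [measurable]: "u \<in> borel_measurable M" "v \<in> borel_measurable N" using u v by auto
 show i: "integrable (M \<Otimes>\<^sub>M N) (%p. u (fst p) * v (snd p))"
 proof (rule Fubini_integrable)
  show "integrable M (%x. \<integral>y. norm (u (fst (x, y)) * v (snd (x, y))) \<partial>N)"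
   using u v by (simp add: abs_mult)
  show "AE x in M. integrable N (%y. u (fst (x, y)) * v (snd (x, y)))"
   using v by simp
 qed measurable
 have "(LINT p|(M \<Otimes>\<^sub>M N). u (fst p) * v (snd p)) = (LINT x|M. (LINT y|N. u x * v y))"
  using integral_fst'[OF i] by simp
 also have "... = (LINT x|M. u x) * (LINT y|N. v y)" by simp
 finally show "(LINT p|(M \<Otimes>\<^sub>M N). u (fst p) * v (snd p)) = (LINT x|M. u x) * (LINT y|N. v y)" .
qed

context white_noise_space
begin

abbreviation Sk :: "nat => (nat => 'a) measure" where "Sk \<equiv> sphere_power"

sublocale Sp: product_sigma_finite "%_::nat. S"
 by (simp add: product_sigma_finite_def S.sigma_finite_measure)

lemma finite_Sk: "finite_measure (Sk k)"
proof -
 interpret finite_product_sigma_finite "%_::nat. S" "{..<k}" by standard simp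
 have "emeasure (PiM {..<k} (%_. S)) (Pi\<^sub>E {..<k} (%_. space S)) = (\<Prod>i<k. emeasure S (space S))"
  by (rule measure_times) (rule sets.top)
 also have "... = ennreal (measure S (space S) ^ k)"
  by (simp only: S.emeasure_eq_measure prod_constant card_lessThan ennreal_power measure_nonneg)
 finally show ?thesis
  unfolding sphere_power_def by (intro finite_measureI) (simp add: space_PiM)
qed

lemma sf_Sk: "sigma_finite_measure (Sk k)"
 using finite_Sk by (simp add: finite_measure_def)

lemma tensor_inner:
 assumes "\<And>j. j < k ==> L2 S (a j)" "\<And>j. j < k ==> L2 S (b j)"
 shows "integrable (Sk k) (%y. (\<Prod>j<k. a j (y j)) * (\<Prod>j<k. b j (y j)))"
  and "(LINT y|(Sk k). (\<Prod>j<k. a j (y j)) * (\<Prod>j<k. b j (y j))) = (\<Prod>j<k. (LINT x|S. a j x * b j x))"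
proof -
 have i: "integrable S (%x. a j x * b j x)" if "j \<in> {..<k}" for j
  using that by (intro L2_mult_integrable assms) auto
 show "integrable (Sk k) (%y. (\<Prod>j<k. a j (y j)) * (\<Prod>j<k. b j (y j)))"
  unfolding prod.distrib[symmetric] sphere_power_def
  by (rule Sp.product_integrable_prod[of "{..<k}" "%j x. a j x * b j x"]) (use i in auto)
 show "(LINT y|(Sk k). (\<Prod>j<k. a j (y j)) * (\<Prod>j<k. b j (y j))) = (\<Prod>j<k. (LINT x|S. a j x * b j x))"
  unfolding prod.distrib[symmetric] sphere_power_def
  by (rule Sp.product_integral_prod[of "{..<k}" "%j x. a j x * b j x"]) (use i in auto)
qed

lemma tensor_L2:
 assumes "\<And>j. j < k ==> L2 S (a j)"
 shows "L2 (Sk k) (%y. \<Prod>j<k. a j (y j))"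
proof -
 have [measurable]: "a j \<in> borel_measurable S" if "j \<in> {..<k}" for j using assms that by (auto simp: L2_def)
 have "(%y. \<Prod>j<k. a j (y j)) \<in> borel_measurable (Sk k)"
  unfolding sphere_power_def by measurable
 then show ?thesis
  using tensor_inner(1)[of k a a] assms by (simp add: L2_def power2_eq_square)
qed

lemma L2_product:
 assumes u: "L2 M u" and v: "L2 (Sk k) v"
 shows "L2 (M \<Otimes>\<^sub>M Sk k) (%p. u (fst p) * v (snd p))"
proof -
 have [measurable]: "u \<in> borel_measurable M" "v \<in> borel_measurable (Sk k)" using u v by (auto simp: L2_def)
 have "integrable (M \<Otimes>\<^sub>M Sk k) (%p. (u (fst p))\<^sup>2 * (v (snd p))\<^sup>2)"
  by (rule product_integral_mult(1)[OF sigma_finite_measure_axioms sf_Sk]) (use u v in \<open>auto simp: L2_def\<close>)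
 then show ?thesis by (simp add: L2_def power_mult_distrib)
qed

lemma smooth_functional_deriv_eq:
 "smooth_functional_deriv M W k m g f = (%p. \<Sum>is\<in>words m k. partial_derivs is f (%j. wi (g j) (fst p)) * (\<Prod>j<k. g (is ! j) (snd p j)))"
proof
 fix p :: "'w \<times> (nat => 'a)"
 show "smooth_functional_deriv M W k m g f p = (\<Sum>is\<in>words m k. partial_derivs is f (%j. wi (g j) (fst p)) * (\<Prod>j<k. g (is ! j) (snd p j)))"
  using smooth_functional_deriv_words[of M W k m g f "fst p" "snd p"] by (simp only: prod.collapse)
qed

lemma smooth_functional_deriv_L2:
 assumes f: "spg m f" and g: "\<And>i. i < m ==> L2 S (g i)"
 shows "L2 (M \<Otimes>\<^sub>M Sk k) (smooth_functional_deriv M W k m g f)"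
 unfolding smooth_functional_deriv_eq
proof (rule L2_sum)
 fix "is" assume w: "is \<in> words m k"
 show "L2 (M \<Otimes>\<^sub>M Sk k) (%p. partial_derivs is f (%j. wi (g j) (fst p)) * (\<Prod>j<k. g (is ! j) (snd p j)))"
 proof (rule L2_product)
  have "spg m (partial_derivs is f)" by (rule spg_partials[OF f]) (use w in \<open>auto simp: words_def\<close>)
  then show "L2 M (%om. partial_derivs is f (%j. wi (g j) om))"
   by (intro all_moments_L2 smooth_functional_all_moments g)
  show "L2 (Sk k) (%y. \<Prod>j<k. g (is ! j) (y j))"
   by (intro tensor_L2 g words_nth[OF w])
 qed
qed

text \<open>Duality between iterated derivative and iterated divergence: G' is the k-fold divergence
  of G tensored with the functions g' listed by the word J, tested against all smooth functionals at
  once.\<close>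

definition adjoint_pair ::
 "(nat => 'a => real) => nat => nat list => ((nat => real) => real) => ((nat => real) => real) => bool" where
 "adjoint_pair g' k J G G' \<longleftrightarrow> (\<forall>m f g. spg m f \<longrightarrow> (\<forall>i<m. L2 S (g i)) \<longrightarrow>
  (\<Sum>is\<in>words m k. (LINT om|M. partial_derivs is f (%i. wi (g i) om) * G (%i. wi (g' i) om))
    * (\<Prod>j<k. (LINT x|S. g (is ! j) x * g' (J ! j) x)))
  = (LINT om|M. f (%i. wi (g i) om) * G' (%i. wi (g' i) om)))"

text \<open>Induction on the word. One integration by parts in the direction of its first letter l
  replaces G by \<open>G1\<close>, the divergence of G times \<open>g' l\<close>, and leaves the
  shorter word L.\<close>

lemma iterated_ibp:
 assumes G: "spg m' G" and g': "\<And>i. i < m' ==> L2 S (g' i)" and J: "J \<in> words m' k"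
 shows "\<exists>G'. spg m' G' \<and> adjoint_pair g' k J G G'"
 using J G
proof (induction k arbitrary: J G)
 case 0
 have "adjoint_pair g' 0 J G G" by (simp add: adjoint_pair_def)
 with 0 show ?case by blast
next
 case (Suc k)
 then obtain l L where J: "J = l # L" "l < m'" "L \<in> words m' k"
  by (cases J) (auto simp: words_def)
 define c where "c i = (LINT x|S. g' i x * g' l x)" for i
 define G1 where "G1 v = G v * v l + (\<Sum>i<m'. (- c i) * partial_deriv i G v)" for v
 have G1: "spg m' G1"
  unfolding G1_def[abs_def] by (intro spg_mult_var_add spg_sum spg_partial Suc.prems J) auto
 obtain G' where G': "spg m' G'" "adjoint_pair g' k L G1 G'"
  using Suc.IH[OF J(3) G1] by blast
 have "adjoint_pair g' (Suc k) J G G'"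
  unfolding adjoint_pair_def
 proof (intro allI impI)
  fix m f and g :: "nat => 'a => real"
  assume f: "spg m f" and gg: "\<forall>i<m. L2 S (g i)"
  then have g: "\<And>i. i < m ==> L2 S (g i)" by blast
  let ?V = "%om i. wi (g i) om" and ?V' = "%om i. wi (g' i) om"
  have step: "(\<Sum>i<m. (LINT om|M. partial_deriv i (partial_derivs is f) (?V om) * G (?V' om)) * (LINT x|S. g i x * g' l x))
    = (LINT om|M. partial_derivs is f (?V om) * G1 (?V' om))" if w: "is \<in> words m k" for "is"
  proof -
   have F: "spg m (partial_derivs is f)" by (rule spg_partials[OF f]) (use w in \<open>auto simp: words_def\<close>)
   have I: "integrable M (%om. partial_deriv i (partial_derivs is f) (?V om) * G (?V' om) * (LINT x|S. g i x * g' l x))" if "i \<in> {..<m}" for i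
   proof -
    have "i < m" using that by simp
    have "all_moments M (%om. partial_deriv i (partial_derivs is f) (?V om))"
     by (rule smooth_functional_all_moments[OF spg_partial[OF F \<open>i < m\<close>] g])
    moreover have "all_moments M (%om. G (?V' om))"
     by (rule smooth_functional_all_moments[OF Suc.prems(2) g'])
    ultimately show ?thesis
     by (intro integrable_mult_left all_moments_integrable all_moments_mult)
   qed
   have "(\<Sum>i<m. (LINT om|M. partial_deriv i (partial_derivs is f) (?V om) * G (?V' om)) * (LINT x|S. g i x * g' l x))
    = (\<Sum>i<m. (LINT om|M. partial_deriv i (partial_derivs is f) (?V om) * G (?V' om) * (LINT x|S. g i x * g' l x)))"
    by (intro sum.cong refl integral_mult_left_zero[symmetric])
   also have "... = (LINT om|M. (\<Sum>i<m. partial_deriv i (partial_derivs is f) (?V om) * G (?V' om) * (LINT x|S. g i x * g' l x)))"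
    by (rule bi_sum[OF I, symmetric])
   also have "... = (LINT om|M. (\<Sum>i<m. partial_deriv i (partial_derivs is f) (?V om) * (LINT x|S. g i x * g' l x)) * G (?V' om))"
    by (rule bi_cong[OF refl], simp only: sum_distrib_right, intro sum.cong refl, simp only: mult_ac)
   also have "... = (LINT om|M. partial_derivs is f (?V om) * (G (?V' om) * wi (g' l) om
     - (\<Sum>i<m'. partial_deriv i G (?V' om) * (LINT x|S. g' i x * g' l x))))"
    by (rule wiener_ibp[OF F Suc.prems(2) g g' g'[OF J(2)]])
   also have "... = (LINT om|M. partial_derivs is f (?V om) * G1 (?V' om))"
    by (simp add: G1_def c_def sum_negf mult.commute)
   finally show ?thesis .
  qed
  have "(\<Sum>is\<in>words m (Suc k). (LINT om|M. partial_derivs is f (?V om) * G (?V' om))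
    * (\<Prod>j<Suc k. (LINT x|S. g (is ! j) x * g' (J ! j) x)))
   = (\<Sum>is\<in>words m k. (\<Sum>i<m. (LINT om|M. partial_deriv i (partial_derivs is f) (?V om) * G (?V' om)) * (LINT x|S. g i x * g' l x))
    * (\<Prod>j<k. (LINT x|S. g (is ! j) x * g' (L ! j) x)))"
   unfolding sum_words_Suc by (subst sum.swap) (simp add: J(1) prod.lessThan_Suc_shift sum_distrib_right mult.assoc del: prod.lessThan_Suc)
  also have "... = (\<Sum>is\<in>words m k. (LINT om|M. partial_derivs is f (?V om) * G1 (?V' om))
    * (\<Prod>j<k. (LINT x|S. g (is ! j) x * g' (L ! j) x)))"
   by (rule sum.cong[OF refl]) (simp only: step)
  also have "... = (LINT om|M. f (?V om) * G' (?V' om))"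
   using G'(2) f gg unfolding adjoint_pair_def by blast
  finally show "(\<Sum>is\<in>words m (Suc k). (LINT om|M. partial_derivs is f (?V om) * G (?V' om))
    * (\<Prod>j<Suc k. (LINT x|S. g (is ! j) x * g' (J ! j) x))) = (LINT om|M. f (?V om) * G' (?V' om))" .
 qed
 with G'(1) show ?case by blast
qed

text \<open>Summing the adjoints over all words gives one square integrable \<delta> representing
  the pairing with a fixed smooth derivative. The right side sees f only through the functional
  itself, so it passes to \<open>L2\<close> limits even though the derivative on the left is
  unbounded.\<close>

lemma deriv_pairing:
 assumes G: "spg m' G" and g': "\<And>i. i < m' ==> L2 S (g' i)"
 shows "\<exists>\<delta>. L2 M \<delta> \<and> (\<forall>m f g. spg m f \<longrightarrow> (\<forall>i<m. L2 S (g i)) \<longrightarrow>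
  (LINT p|(M \<Otimes>\<^sub>M Sk k). smooth_functional_deriv M W k m g f p * smooth_functional_deriv M W k m' g' G p)
   = (LINT om|M. smooth_functional M W g f om * \<delta> om))"
proof -
 have GJ: "spg m' (partial_derivs J G)" if "J \<in> words m' k" for J
  by (rule spg_partials[OF G]) (use that in \<open>auto simp: words_def\<close>)
 have "\<forall>J\<in>words m' k. \<exists>G'. spg m' G' \<and> adjoint_pair g' k J (partial_derivs J G) G'"
  by (intro ballI iterated_ibp GJ g')
 then obtain H where H: "\<And>J. J \<in> words m' k ==> spg m' (H J)"
  and HP: "\<And>J. J \<in> words m' k ==> adjoint_pair g' k J (partial_derivs J G) (H J)"
  by (subst (asm) bchoice_iff) blast
 let ?V' = "%om i. wi (g' i) om"
 define \<delta> where "\<delta> om = (\<Sum>J\<in>words m' k. H J (?V' om))" for om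
 have \<delta>L: "L2 M \<delta>"
  unfolding \<delta>_def[abs_def] by (rule L2_sum, rule all_moments_L2, rule smooth_functional_all_moments[OF H g'])
 moreover have "(LINT p|(M \<Otimes>\<^sub>M Sk k). smooth_functional_deriv M W k m g f p * smooth_functional_deriv M W k m' g' G p)
   = (LINT om|M. smooth_functional M W g f om * \<delta> om)"
  if f: "spg m f" and gg: "\<forall>i<m. L2 S (g i)" for m f g
 proof -
  have g: "\<And>i. i < m ==> L2 S (g i)" using gg by blast
  let ?V = "%om i. wi (g i) om"
  have fI: "spg m (partial_derivs is f)" if "is \<in> words m k" for "is"
   by (rule spg_partials[OF f]) (use that in \<open>auto simp: words_def\<close>)
  define u where "u is J om = partial_derivs is f (?V om) * partial_derivs J G (?V' om)" for "is" J om
  define v where "v is J y = (\<Prod>j<k. g (is ! j) (y j)) * (\<Prod>j<k. g' (J ! j) (y j))" for "is" J and y :: "nat => 'a"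
  have uI: "integrable M (u is J)" if "is \<in> words m k" "J \<in> words m' k" for "is" J
   unfolding u_def[abs_def]
   by (rule all_moments_integrable, rule all_moments_mult)
    (rule smooth_functional_all_moments[OF fI[OF that(1)] g] smooth_functional_all_moments[OF GJ[OF that(2)] g'], assumption)+
  have vI: "integrable (Sk k) (v is J)" "(LINT y|(Sk k). v is J y) = (\<Prod>j<k. (LINT x|S. g (is ! j) x * g' (J ! j) x))"
   if "is \<in> words m k" "J \<in> words m' k" for "is" J
   unfolding v_def[abs_def] by (rule tensor_inner; intro g g' words_nth[OF that(1)] words_nth[OF that(2)]; assumption)+
  have pI: "integrable (M \<Otimes>\<^sub>M Sk k) (%p. u is J (fst p) * v is J (snd p))" if "J \<in> words m' k" "is \<in> words m k" for "is" J
   by (rule product_integral_mult(1)[OF sigma_finite_measure_axioms sf_Sk uI vI(1)]) (use that in auto)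
  have "(LINT p|(M \<Otimes>\<^sub>M Sk k). smooth_functional_deriv M W k m g f p * smooth_functional_deriv M W k m' g' G p)
   = (LINT p|(M \<Otimes>\<^sub>M Sk k). (\<Sum>J\<in>words m' k. \<Sum>is\<in>words m k. u is J (fst p) * v is J (snd p)))"
   unfolding smooth_functional_deriv_eq sum_product u_def v_def
   by (rule bi_cong[OF refl], subst sum.swap) (intro sum.cong refl, simp add: mult_ac)
  also have "... = (\<Sum>J\<in>words m' k. \<integral>p. (\<Sum>is\<in>words m k. u is J (fst p) * v is J (snd p)) \<partial>(M \<Otimes>\<^sub>M Sk k))"
   by (rule bi_sum) (intro bi_int_sum pI)
  also have "... = (\<Sum>J\<in>words m' k. \<Sum>is\<in>words m k. \<integral>p. u is J (fst p) * v is J (snd p) \<partial>(M \<Otimes>\<^sub>M Sk k))"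
   by (intro sum.cong refl bi_sum pI)
  also have "... = (\<Sum>J\<in>words m' k. \<Sum>is\<in>words m k. (LINT om|M. u is J om) * (\<Prod>j<k. (LINT x|S. g (is ! j) x * g' (J ! j) x)))"
   by (intro sum.cong refl) (simp add: product_integral_mult(2)[OF sigma_finite_measure_axioms sf_Sk uI vI(1)] vI(2))
  also have "... = (\<Sum>J\<in>words m' k. \<integral>om. f (?V om) * H J (?V' om) \<partial>M)"
   unfolding u_def using HP f gg by (intro sum.cong refl) (unfold adjoint_pair_def, blast)
  also have "... = (LINT om|M. (\<Sum>J\<in>words m' k. f (?V om) * H J (?V' om)))"
   by (rule bi_sum[symmetric])
    (rule all_moments_integrable, rule all_moments_mult, (rule smooth_functional_all_moments[OF f g], assumption),
     rule smooth_functional_all_moments[OF H g'])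
  finally show ?thesis by (simp add: smooth_functional_def \<delta>_def sum_distrib_left)
 qed
 ultimately show ?thesis by blast
qed

text \<open>Closability. Paired with a smooth derivative, both approximating sequences have the same
  limit, determined by F through \<delta>. The test elements are the approximating derivatives of
  the two sequences themselves.\<close>

theorem malliavin_deriv_unique:
 assumes 1: "has_malliavin_deriv M W k F D1" and 2: "has_malliavin_deriv M W k F D2"
 shows "AE p in M \<Otimes>\<^sub>M Sk k. D1 p = D2 p"
proof -
 let ?N = "M \<Otimes>\<^sub>M Sk k"
 have F: "L2 M F" and D: "L2 ?N D1" "L2 ?N D2" using 1 2 by (auto simp: has_malliavin_deriv_def)
 obtain m g f where a: "\<And>N. spg (m N) (f N)" "\<And>N i. i < m N ==> L2 S (g N i)"
   "Lp_tendsto M 2 (%N. smooth_functional M W (g N) (f N)) F"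
   "Lp_tendsto ?N 2 (%N. smooth_functional_deriv M W k (m N) (g N) (f N)) D1"
  using 1 unfolding has_malliavin_deriv_def by blast
 obtain m' g' f' where b: "\<And>N. spg (m' N) (f' N)" "\<And>N i. i < m' N ==> L2 S (g' N i)"
   "Lp_tendsto M 2 (%N. smooth_functional M W (g' N) (f' N)) F"
   "Lp_tendsto ?N 2 (%N. smooth_functional_deriv M W k (m' N) (g' N) (f' N)) D2"
  using 2 unfolding has_malliavin_deriv_def by blast
 define A where "A N = smooth_functional M W (g N) (f N)" for N
 define B where "B N = smooth_functional M W (g' N) (f' N)" for N
 define DA where "DA N = smooth_functional_deriv M W k (m N) (g N) (f N)" for N
 define DB where "DB N = smooth_functional_deriv M W k (m' N) (g' N) (f' N)" for N
 have sL: "L2 M (smooth_functional M W g f)" if "spg m f" "\<And>i. i < m ==> L2 S (g i)" for m g f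
  unfolding smooth_functional_def by (rule all_moments_L2, rule smooth_functional_all_moments[OF that])
 have L1: "L2 M (A N)" for N unfolding A_def by (rule sL) (rule a, rule a)
 have L2: "L2 M (B N)" for N unfolding B_def by (rule sL) (rule b, rule b)
 have L3: "L2 ?N (DA N)" for N unfolding DA_def by (rule smooth_functional_deriv_L2) (rule a, rule a)
 have L4: "L2 ?N (DB N)" for N unfolding DB_def by (rule smooth_functional_deriv_L2) (rule b, rule b)
 note L = L1 L2 L3 L4
 have orth: "(LINT p|?N. (D1 p - D2 p) * \<Psi> p) = 0" if \<Psi>: "L2 ?N \<Psi>" and \<delta>: "L2 M \<delta>"
  and A: "\<And>N. (LINT p|?N. DA N p * \<Psi> p) = (LINT om|M. A N om * \<delta> om)"
  and B: "\<And>N. (LINT p|?N. DB N p * \<Psi> p) = (LINT om|M. B N om * \<delta> om)" for \<Psi> \<delta>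
 proof -
  have c1: "(%N. \<integral>p. DA N p * \<Psi> p \<partial>?N) \<longlonglongrightarrow> (LINT p|?N. D1 p * \<Psi> p)"
   by (rule L2_tendsto_inner) (use L D a \<Psi> Lp_tendsto_const in \<open>auto simp: DA_def\<close>)
  have c2: "(%N. \<integral>p. DB N p * \<Psi> p \<partial>?N) \<longlonglongrightarrow> (LINT p|?N. D2 p * \<Psi> p)"
   by (rule L2_tendsto_inner) (use L D b \<Psi> Lp_tendsto_const in \<open>auto simp: DB_def\<close>)
  have c3: "(%N. \<integral>om. A N om * \<delta> om \<partial>M) \<longlonglongrightarrow> (LINT om|M. F om * \<delta> om)"
   by (rule L2_tendsto_inner) (use L F a \<delta> Lp_tendsto_const in \<open>auto simp: A_def\<close>)
  have c4: "(%N. \<integral>om. B N om * \<delta> om \<partial>M) \<longlonglongrightarrow> (LINT om|M. F om * \<delta> om)"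
   by (rule L2_tendsto_inner) (use L F b \<delta> Lp_tendsto_const in \<open>auto simp: B_def\<close>)
  have "(LINT p|?N. D1 p * \<Psi> p) = (LINT p|?N. D2 p * \<Psi> p)"
   using LIMSEQ_unique[OF c1[unfolded A] c3] LIMSEQ_unique[OF c2[unfolded B] c4] by simp
  then show ?thesis
   by (simp add: left_diff_distrib L2_mult_integrable D \<Psi>)
 qed
 have oA: "(LINT p|?N. (D1 p - D2 p) * DA K p) = 0" for K
 proof -
  have "\<exists>\<delta>. L2 M \<delta> \<and> (\<forall>m f g. spg m f \<longrightarrow> (\<forall>i<m. L2 S (g i)) \<longrightarrow>
  (LINT p|?N. smooth_functional_deriv M W k m g f p * DA K p) = (LINT om|M. smooth_functional M W g f om * \<delta> om))"
   unfolding DA_def by (rule deriv_pairing) (rule a, rule a)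
  then obtain \<delta> where \<delta>: "L2 M \<delta>" and \<delta>': "\<And>m f g. spg m f ==> (\<forall>i<m. L2 S (g i)) ==>
  (LINT p|?N. smooth_functional_deriv M W k m g f p * DA K p) = (LINT om|M. smooth_functional M W g f om * \<delta> om)"
   by blast
  show ?thesis
  proof (rule orth[OF L3 \<delta>])
   show "(LINT p|?N. DA N p * DA K p) = (LINT om|M. A N om * \<delta> om)" for N
    unfolding DA_def[of N] A_def by (rule \<delta>') (use a in auto)
   show "(LINT p|?N. DB N p * DA K p) = (LINT om|M. B N om * \<delta> om)" for N
    unfolding DB_def[of N] B_def by (rule \<delta>') (use b in auto)
  qed
 qed
 have oB: "(LINT p|?N. (D1 p - D2 p) * DB K p) = 0" for K
 proof -
  have "\<exists>\<delta>. L2 M \<delta> \<and> (\<forall>m f g. spg m f \<longrightarrow> (\<forall>i<m. L2 S (g i)) \<longrightarrow>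
  (LINT p|?N. smooth_functional_deriv M W k m g f p * DB K p) = (LINT om|M. smooth_functional M W g f om * \<delta> om))"
   unfolding DB_def by (rule deriv_pairing) (rule b, rule b)
  then obtain \<delta> where \<delta>: "L2 M \<delta>" and \<delta>': "\<And>m f g. spg m f ==> (\<forall>i<m. L2 S (g i)) ==>
  (LINT p|?N. smooth_functional_deriv M W k m g f p * DB K p) = (LINT om|M. smooth_functional M W g f om * \<delta> om)"
   by blast
  show ?thesis
  proof (rule orth[OF L4 \<delta>])
   show "(LINT p|?N. DA N p * DB K p) = (LINT om|M. A N om * \<delta> om)" for N
    unfolding DA_def[of N] A_def by (rule \<delta>') (use a in auto)
   show "(LINT p|?N. DB N p * DB K p) = (LINT om|M. B N om * \<delta> om)" for N
    unfolding DB_def[of N] B_def by (rule \<delta>') (use b in auto)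
  qed
 qed
 \<comment> \<open>D1 - D2 is a limit of the differences DA K - DB K and orthogonal to each of them,
   hence orthogonal to itself.\<close>
 have "(%K. \<integral>p. (D1 p - D2 p) * (DA K p - DB K p) \<partial>?N) \<longlonglongrightarrow> (LINT p|?N. (D1 p - D2 p) * (D1 p - D2 p))"
  by (rule L2_tendsto_inner) (use L D a b Lp_tendsto_const in \<open>auto simp: DA_def DB_def intro!: L2_diff L2_tendsto_sub\<close>)
 moreover have "(LINT p|?N. (D1 p - D2 p) * (DA K p - DB K p)) = 0" for K
  using oA[of K] oB[of K] L2_mult_integrable[OF L2_diff[OF D] L(3)[of K]] L2_mult_integrable[OF L2_diff[OF D] L(4)[of K]]
  by (simp add: right_diff_distrib)
 ultimately have "(LINT p|?N. (D1 p - D2 p)\<^sup>2) = 0"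
  by (simp add: power2_eq_square LIMSEQ_const_iff)
 from L2_norm_zero_AE[OF L2_diff[OF D] this] show ?thesis by simp
qed

lemma has_malliavin_deriv_cong:
 assumes "has_malliavin_deriv M W k F D" "AE om in M. F om = F' om" "F' \<in> borel_measurable M"
 shows "has_malliavin_deriv M W k F' D"
proof -
 have "Lp_tendsto M 2 u F = Lp_tendsto M 2 u F'" for u
  by (rule Lp_tendsto_cong) (use assms(2) in auto)
 moreover have "L2 M F'" using assms by (auto simp: has_malliavin_deriv_def intro: L2_cong_AE)
 ultimately show ?thesis using assms(1) unfolding has_malliavin_deriv_def by simp
qed

text \<open>By uniqueness the chosen derivative agrees with any exhibited one almost everywhere on
  the product space. Slicing the null set gives equal tensor norms for almost every om, so moments
  may be computed from an explicit derivative.\<close>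

lemma malliavin_moment_eq:
 assumes "has_malliavin_deriv M W k F D"
 shows "malliavin_moment M W k n F = (\<integral>\<^sup>+om. ennreal (tensor_norm k (%y. D (om, y)) ^ n) \<partial>M)"
proof -
 interpret P: pair_sigma_finite M "Sk k"
  using sf_Sk sigma_finite_measure_axioms by (simp add: pair_sigma_finite_def)
 have D': "has_malliavin_deriv M W k F (malliavin_deriv M W k F)"
  unfolding malliavin_deriv_def by (rule someI[of _ D]) fact
 have "AE p in M \<Otimes>\<^sub>M Sk k. malliavin_deriv M W k F p = D p"
  by (rule malliavin_deriv_unique[OF D' assms])
 then have "AE om in M. AE y in Sk k. malliavin_deriv M W k F (om, y) = D (om, y)"
  by (rule P.AE_pair)
 moreover have "AE om in M. (%y. malliavin_deriv M W k F (om, y)) \<in> borel_measurable (Sk k)"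
   "AE om in M. (%y. D (om, y)) \<in> borel_measurable (Sk k)"
  using D' assms by (auto simp: has_malliavin_deriv_def L2_def)
 ultimately have "AE om in M. tensor_norm k (%y. malliavin_deriv M W k F (om, y)) = tensor_norm k (%y. D (om, y))"
 proof eventually_elim
  case (elim om)
  have "(LINT y|(Sk k). (malliavin_deriv M W k F (om, y))\<^sup>2) = (LINT y|(Sk k). (D (om, y))\<^sup>2)"
   by (rule integral_cong_AE) (use elim in \<open>auto elim: eventually_mono\<close>)
  then show ?case by (simp add: tensor_norm_def)
 qed
 then show ?thesis
  unfolding malliavin_moment_def by (intro nn_integral_cong_AE) (auto elim: eventually_mono)
qed

end

section \<open>Moments of the surface measure\<close>

lemma scale_measure_eq_density: "scale_measure r M = density M (%_. r)"
 by (rule measure_eqI) (auto simp: emeasure_density_const)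

lemma borel_measurable_sgn [measurable]: "(sgn :: 'a::euclidean_space => 'a) \<in> borel_measurable borel"
proof -
 have "(%x::'a. x /\<^sub>R norm x) \<in> borel_measurable borel" by measurable
 moreover have "(%x::'a. x /\<^sub>R norm x) = sgn" by (rule ext) (simp add: sgn_div_norm)
 ultimately show ?thesis by simp
qed

lemma integral_sphere_measure:
 fixes h :: "'a::euclidean_space => real"
 assumes h[measurable]: "h \<in> borel_measurable borel"
 shows "(LINT x|sphere_measure. h x) = real DIM('a) * (LINT z|lborel. indicator (ball 0 1) z * h (sgn z))"
proof -
 let ?R = "restrict_space lborel (ball 0 1 - {0}) :: 'a measure"
 have sm: "sgn \<in> measurable ?R (restrict_space borel (sphere (0::'a) 1))"
 proof (rule measurable_restrict_space2)
  show "sgn \<in> space ?R \<rightarrow> sphere (0::'a) 1" by (auto simp: space_restrict_space norm_sgn)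
  show "(sgn :: 'a => 'a) \<in> borel_measurable ?R" by (intro measurable_restrict_space1) simp
 qed
 have [measurable]: "(%z. h (sgn z)) \<in> borel_measurable borel"
  by (rule measurable_compose[OF _ h]) simp
 have hm: "h \<in> borel_measurable (restrict_space borel (sphere (0::'a) 1))"
  by (rule measurable_restrict_space1) simp
 have "(LINT x|sphere_measure. h x) = real DIM('a) * (LINT x|(distr ?R (restrict_space borel (sphere 0 1)) sgn). h x)"
  unfolding sphere_measure_def scale_measure_eq_density
  by (subst integral_density) (use hm in auto)
 also have "(LINT x|(distr ?R (restrict_space borel (sphere 0 1)) sgn). h x) = (LINT z|?R. h (sgn z))"
  by (rule integral_distr[OF sm hm])
 also have "... = (LINT z|lborel. indicator (ball 0 1 - {0}) z *\<^sub>R h (sgn z))"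
  by (rule integral_restrict_space) auto
 also have "... = (LINT z|lborel. indicator (ball 0 1) z * h (sgn z))"
 proof (rule integral_cong_AE)
  have "AE z in lborel. z \<noteq> (0::'a)" by (rule AE_lborel_singleton)
  then show "AE z in lborel. indicator (ball 0 1 - {0}) z *\<^sub>R h (sgn z) = indicator (ball 0 1) z * h (sgn z)"
   by eventually_elim (auto simp: indicator_def)
 qed (auto intro!: borel_measurable_times borel_measurable_indicator measurable_compose[OF borel_measurable_sgn h])
 finally show ?thesis .
qed

lemma integral_lborel_scale:
 fixes f :: "'a::euclidean_space => real"
 assumes [measurable]: "f \<in> borel_measurable borel" and "c > 0"
 shows "(LINT z|lborel. f z) = c ^ DIM('a) * (LINT z|lborel. f (c *\<^sub>R z))"
proof -
 have "(LINT z|lborel. f z) = (\<integral>z. f z \<partial>density (distr lborel borel (%x. 0 + c *\<^sub>R x)) (%_. \<bar>c\<bar> ^ DIM('a)))"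
  using lborel_affine[of c "0::'a"] assms(2) by simp
 also have "... = (\<integral>z. \<bar>c\<bar> ^ DIM('a) *\<^sub>R f z \<partial>distr lborel borel (%x. 0 + c *\<^sub>R x))"
  by (subst integral_density) auto
 also have "... = (LINT z|lborel. \<bar>c\<bar> ^ DIM('a) *\<^sub>R f (0 + c *\<^sub>R z))"
  by (subst integral_distr) auto
 finally show ?thesis using assms(2) by simp
qed

lemma integrable_ball_bounded:
 fixes f :: "'a::euclidean_space => real"
 assumes [measurable]: "f \<in> borel_measurable borel" "A \<in> sets borel" and A: "A \<subseteq> cball 0 r" and "\<And>z. z \<in> A ==> \<bar>f z\<bar> \<le> B"
 shows "integrable lborel (%z. indicator A z * f z)"
proof (rule bi_int_bound)
 have "emeasure lborel (cball (0::'a) r) < \<infinity>"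
  by (metis bounded_cball emeasure_bounded_finite)
 then show "integrable lborel (%z::'a. indicator (cball 0 r) z *\<^sub>R B)"
  by (intro integrable_scaleR_left integrable_real_indicator) auto
 show "AE z in lborel. norm (indicator A z * f z) \<le> norm (indicator (cball 0 r) z *\<^sub>R B)"
 proof (rule AE_I2)
  fix z show "norm (indicator A z * f z) \<le> norm (indicator (cball 0 r) z *\<^sub>R B)"
   using A assms(4)[of z] by (cases "z \<in> A") (auto simp: indicator_def)
 qed
qed measurable

text \<open>The quotient is a geometric sum with k terms, each tending to 1.\<close>

lemma one_minus_power_limit:
 fixes k :: nat
 assumes "c \<longlonglongrightarrow> (1::real)" "\<And>n. c n \<noteq> 1"
 shows "(%n. (1 - c n ^ k) / (1 - c n)) \<longlonglongrightarrow> real k"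
proof -
 have "(1 - x ^ k) / (1 - x) = (\<Sum>i<k. x ^ i)" if "x \<noteq> 1" for x :: real
  using that by (simp add: sum_gp_strict)
 then have "(%n. (1 - c n ^ k) / (1 - c n)) = (%n. \<Sum>i<k. c n ^ i)" using assms(2) by auto
 moreover have "(%n. \<Sum>i<k. c n ^ i) \<longlonglongrightarrow> (\<Sum>i<k. 1 ^ i)"
  by (intro tendsto_intros assms(1))
 ultimately show ?thesis by simp
qed

text \<open>
 Polar coordinates for a homogeneous function, by comparing \<open>h z\<close> with \<open>h (sgn z)\<close> on a thin
 annulus \<open>s \<le> norm z < 1\<close>: both integrals scale by a power of the radius.
\<close>

lemma integral_ball_homogeneous:
 fixes h :: "'a::euclidean_space => real"
 assumes cont: "contU h" and hom: "\<And>s z. s > 0 ==> h (s *\<^sub>R z) = s ^ n * h z"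
 shows "(LINT z|lborel. indicator (ball 0 1) z * h z) = (LINT x|sphere_measure. h x) / (real DIM('a) + real n)"
proof -
 let ?D = "DIM('a)"
 have h[measurable]: "h \<in> borel_measurable borel" using cont by (rule borel_measurable_continuous_onI)
 have hs[measurable]: "(%z. h (sgn z)) \<in> borel_measurable borel" by (rule measurable_compose[OF borel_measurable_sgn h])
 obtain B where B: "\<And>z. z \<in> cball 0 1 ==> \<bar>h z\<bar> \<le> B"
 proof -
  have "compact (h ` cball 0 1)" by (intro compact_continuous_image continuous_on_subset[OF cont]) auto
  then have "bounded (h ` cball 0 1)" by (rule compact_imp_bounded)
  then obtain a where "\<forall>x\<in>cball 0 1. \<bar>h x\<bar> \<le> a" by (auto simp: bounded_iff)
  then show ?thesis using that by blast
 qed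
 have sgn_le: "sgn z \<in> cball 0 1" for z :: 'a by (simp add: norm_sgn)
 define J where "J = (LINT z|lborel. indicator (ball 0 1) z * h (sgn z))"
 define K where "K = (LINT z|lborel. indicator (ball 0 1) z * h z)"
 define V where "V = (LINT z|lborel. indicator (ball 0 1 :: 'a set) z * (1::real))"
 have ind: "indicator (ball 0 s) (s *\<^sub>R z) = (indicator (ball 0 1) z :: real)" if "s > 0" for s and z :: 'a
  using that by (auto simp: indicator_def)
 have sc: "(LINT z|lborel. indicator (ball 0 s) z * h (sgn z)) = s ^ ?D * J"
  "(LINT z|lborel. indicator (ball 0 s) z * h z) = s ^ (?D + n) * K"
  "(LINT z|lborel. indicator (ball 0 s :: 'a set) z * (1::real)) = s ^ ?D * V" if s: "s > 0" for s
 proof -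
  show "(LINT z|lborel. indicator (ball 0 s) z * h (sgn z)) = s ^ ?D * J"
  proof -
   have "(%z. indicator (ball 0 s) z * h (sgn z)) \<in> borel_measurable borel"
    by (rule borel_measurable_times[OF borel_measurable_indicator[OF borel_open[OF open_ball]] hs])
   from integral_lborel_scale[OF this s] show ?thesis using s by (simp add: ind J_def sgn_scaleR)
  qed
  show "(LINT z|lborel. indicator (ball 0 s :: 'a set) z * (1::real)) = s ^ ?D * V"
   using s integral_lborel_scale[OF borel_measurable_times[OF borel_measurable_indicator[OF borel_open[OF open_ball]] borel_measurable_const], of s "0::'a" s "1::real"]
   by (simp add: ind V_def)
  show "(LINT z|lborel. indicator (ball 0 s) z * h z) = s ^ (?D + n) * K"
   using s integral_lborel_scale[OF borel_measurable_times[OF borel_measurable_indicator[OF borel_open[OF open_ball]] h], of s "0::'a" s]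
   by (simp add: ind K_def hom mult.left_commute power_add)
 qed
 have hz: "\<bar>h z - h (sgn z)\<bar> \<le> B * (1 - s ^ n)" if "s > 0" "s \<le> norm z" "norm z < 1" for s z
 proof -
  have "z \<noteq> 0" using that by auto
  then have "h z = norm z ^ n * h (sgn z)"
   using hom[of "norm z" "sgn z"] by (simp add: sgn_div_norm)
  then have "\<bar>h z - h (sgn z)\<bar> = \<bar>h (sgn z)\<bar> * (1 - norm z ^ n)"
  proof -
   have "h z - h (sgn z) = - (h (sgn z) * (1 - norm z ^ n))"
    using \<open>h z = norm z ^ n * h (sgn z)\<close> by (simp add: algebra_simps)
   moreover have "norm z ^ n \<le> 1" using that by (intro power_le_one) auto
   ultimately show ?thesis by (simp add: abs_mult)
  qed
  also have "... \<le> B * (1 - s ^ n)"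
  proof (rule mult_mono)
   show "\<bar>h (sgn z)\<bar> \<le> B" by (rule B[OF sgn_le])
   then show "0 \<le> B" by linarith
   show "1 - norm z ^ n \<le> 1 - s ^ n" using that by (simp add: power_mono)
   show "0 \<le> 1 - norm z ^ n" using that by (simp add: power_le_one)
  qed
  finally show ?thesis .
 qed
 have ann: "\<bar>(1 - s ^ (?D + n)) * K - (1 - s ^ ?D) * J\<bar> \<le> B * (1 - s ^ n) * ((1 - s ^ ?D) * V)" if s: "0 < s" "s < 1" for s
 proof -
  define A where "A = ball (0::'a) 1 - ball 0 s"
  have [measurable]: "A \<in> sets borel" by (auto simp: A_def)
  have A: "indicator A z = (indicator (ball 0 1) z - indicator (ball 0 s) z :: real)" for z
   using s by (auto simp: A_def indicator_def)
  have b1: "\<bar>h z\<bar> \<le> B" "\<bar>h (sgn z)\<bar> \<le> B" if "z \<in> ball 0 1" for z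
   using B[of z] B[OF sgn_le] that by auto
  have i: "integrable lborel (%z. indicator (ball 0 r) z * h z)" "integrable lborel (%z. indicator (ball 0 r) z * h (sgn z))"
   "integrable lborel (%z::'a. indicator (ball 0 r) z * (1::real))" if "r \<le> 1" for r
   by (rule integrable_ball_bounded[of _ _ 1 "max B 1"]; use that b1 in \<open>force simp: le_max_iff_disj\<close>)+
  have 1: "(LINT z|lborel. indicator A z * h z) = (1 - s ^ (?D + n)) * K"
   using i[of 1] i[of s] s sc(2)[of s] by (simp add: A left_diff_distrib K_def)
  have 2: "(LINT z|lborel. indicator A z * h (sgn z)) = (1 - s ^ ?D) * J"
   using i[of 1] i[of s] s sc(1)[of s] by (simp add: A left_diff_distrib J_def)
  have 3: "(LINT z|lborel. indicator A z * (1::real)) = (1 - s ^ ?D) * V"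
   using i[of 1] i[of s] s sc(3)[of s] by (simp add: A left_diff_distrib V_def)
  have iA: "integrable lborel (%z. indicator A z * h z)" "integrable lborel (%z. indicator A z * h (sgn z))"
   "integrable lborel (%z. indicator A z * (1::real))"
   using i[of 1] i[of s] s by (simp_all add: A left_diff_distrib)
  have "\<bar>(1 - s ^ (?D + n)) * K - (1 - s ^ ?D) * J\<bar> = \<bar>\<integral>z. indicator A z * (h z - h (sgn z)) \<partial>lborel\<bar>"
   using 1 2 iA by (simp add: right_diff_distrib)
  also have "... \<le> (LINT z|lborel. \<bar>indicator A z * (h z - h (sgn z))\<bar>)" by (rule integral_abs_bound)
  also have "... \<le> (LINT z|lborel. B * (1 - s ^ n) * (indicator A z * 1))"
  proof (rule integral_mono)
   show "integrable lborel (%z. \<bar>indicator A z * (h z - h (sgn z))\<bar>)"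
    using iA by (intro integrable_abs) (simp add: right_diff_distrib)
   show "integrable lborel (%z. B * (1 - s ^ n) * (indicator A z * 1))" using iA(3) by simp
   show "\<bar>indicator A z * (h z - h (sgn z))\<bar> \<le> B * (1 - s ^ n) * (indicator A z * 1)" for z
    using hz[OF s(1), of z] by (cases "z \<in> A") (auto simp: A_def)
  qed
  also have "... = B * (1 - s ^ n) * ((1 - s ^ ?D) * V)" by (simp only: integral_mult_right_zero 3)
  finally show ?thesis .
 qed
 \<comment> \<open>Radii tending to 1. Dividing \<open>ann\<close> by 1 - c turns the left side into
   (D + n) K - D J in the limit, while the extra factor 1 - c^n on the right still tends to
   0.\<close>
 define c where "c k = 1 - inverse (real (Suc (Suc k)))" for k
 have c: "0 < c k" "c k < 1" for k by (auto simp: c_def field_simps)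
 have c1: "c \<longlonglongrightarrow> 1"
 proof -
  have "(%k. 1 - inverse (real (Suc (Suc k)))) \<longlonglongrightarrow> 1 - 0"
   using LIMSEQ_Suc[OF LIMSEQ_inverse_real_of_nat] by (intro tendsto_diff) auto
  then show ?thesis by (simp add: c_def[abs_def])
 qed
 have q: "(%k. (1 - c k ^ m) / (1 - c k)) \<longlonglongrightarrow> real m" for m
  by (rule one_minus_power_limit[OF c1]) (use c in \<open>auto simp: less_imp_neq\<close>)
 have "(%k. \<bar>(1 - c k ^ (?D + n)) / (1 - c k) * K - (1 - c k ^ ?D) / (1 - c k) * J\<bar>) \<longlonglongrightarrow> \<bar>real (?D + n) * K - real ?D * J\<bar>"
  by (intro tendsto_intros q)
 moreover have "(%k. B * (1 - c k ^ n) * ((1 - c k ^ ?D) / (1 - c k) * V)) \<longlonglongrightarrow> B * (1 - 1 ^ n) * (real ?D * V)"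
  by (intro tendsto_intros q c1)
 moreover have "\<bar>(1 - c k ^ (?D + n)) / (1 - c k) * K - (1 - c k ^ ?D) / (1 - c k) * J\<bar>
   \<le> B * (1 - c k ^ n) * ((1 - c k ^ ?D) / (1 - c k) * V)" for k
 proof -
  have p: "1 - c k > 0" using c[of k] by simp
  have "\<bar>(1 - c k ^ (?D + n)) / (1 - c k) * K - (1 - c k ^ ?D) / (1 - c k) * J\<bar>
   = \<bar>(1 - c k ^ (?D + n)) * K - (1 - c k ^ ?D) * J\<bar> / (1 - c k)"
   using p by (simp add: diff_divide_distrib[symmetric] abs_divide)
  also have "... \<le> B * (1 - c k ^ n) * ((1 - c k ^ ?D) * V) / (1 - c k)"
   using p ann[OF c] by (intro divide_right_mono) auto
  finally show ?thesis by simp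
 qed
 ultimately have "\<bar>real (?D + n) * K - real ?D * J\<bar> \<le> B * (1 - 1 ^ n) * (real ?D * V)"
  by (intro LIMSEQ_le) auto
 then have "real (?D + n) * K = real ?D * J" by simp
 moreover have "(LINT x|sphere_measure. h x) = real ?D * J"
  unfolding J_def by (rule integral_sphere_measure) simp
 moreover have "real ?D + real n > 0" by (simp add: add_pos_nonneg)
 ultimately have "K = (LINT x|sphere_measure. h x) / (real ?D + real n)" by (simp add: field_simps)
 then show ?thesis by (simp only: K_def)
qed

text \<open>Translation invariance makes every difference quotient of f integrate to zero. The mean
  value theorem and the compact support dominate the quotients, so their limit g integrates to zero
  too.\<close>

lemma integral_directional_derivative:
 fixes f g :: "'a::euclidean_space => real"
 assumes fc: "contU f" and gc: "contU g"
  and der: "\<And>z t. ((%t. f (z + t *\<^sub>R x)) has_real_derivative g (z + t *\<^sub>R x)) (at t)"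
  and supp: "\<And>z. norm z \<ge> 1 ==> f z = 0" "\<And>z. norm z \<ge> 1 ==> g z = 0"
 shows "(LINT z|lborel. g z) = 0"
proof -
 have [measurable]: "f \<in> borel_measurable borel" "g \<in> borel_measurable borel"
  using fc gc by (auto intro: borel_measurable_continuous_onI)
 have bnd: "\<exists>B. \<forall>z. \<bar>u z\<bar> \<le> B" if "contU u" "\<And>z. norm z \<ge> 1 ==> u z = 0" for u :: "'a => real"
 proof -
  have "bounded (u ` cball 0 1)"
   by (intro compact_imp_bounded compact_continuous_image continuous_on_subset[OF that(1)]) auto
  then obtain B where "\<forall>x\<in>cball 0 1. \<bar>u x\<bar> \<le> B" by (auto simp: bounded_iff)
  then have B: "\<And>z. z \<in> cball 0 1 ==> \<bar>u z\<bar> \<le> B" by blast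
  have "B \<ge> 0" using B[of 0] by simp
  then have "\<bar>u z\<bar> \<le> B" for z using B[of z] that(2)[of z] by (cases "norm z \<le> 1") auto
  then show ?thesis by blast
 qed
 obtain Bf where Bf: "\<And>z. \<bar>f z\<bar> \<le> Bf" using bnd[OF fc supp(1)] by blast
 obtain B where B: "\<And>z. \<bar>g z\<bar> \<le> B" using bnd[OF gc supp(2)] by blast
 have if1: "integrable lborel f"
 proof -
  have "integrable lborel (%z. indicator (cball 0 1) z * f z)"
   by (rule integrable_ball_bounded[of _ _ 1 Bf]) (use Bf in auto)
  moreover have "(%z. indicator (cball 0 1) z * f z) = f"
   by (rule ext) (use supp(1) in \<open>force simp: indicator_def\<close>)
  ultimately show ?thesis by simp
 qed
 define q where "q k z = real (Suc k) * (f (z + inverse (real (Suc k)) *\<^sub>R x) - f z)" for k z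
 have [measurable]: "q k \<in> borel_measurable borel" for k unfolding q_def[abs_def] by measurable
 have tr: "(LINT z|lborel. f (z + c)) = (LINT z|lborel. f z)" "integrable lborel (%z. f (z + c))" for c
 proof -
  have "(LINT z|lborel. f z) = (LINT z|(distr lborel borel ((+) c)). f z)" by (simp add: lborel_distr_plus)
  also have "... = (LINT z|lborel. f (c + z))" by (subst integral_distr) auto
  finally show "(LINT z|lborel. f (z + c)) = (LINT z|lborel. f z)" by (simp add: add.commute)
  have "integrable (distr lborel borel ((+) c)) f" using if1 by (simp add: lborel_distr_plus)
  then show "integrable lborel (%z. f (z + c))" by (subst (asm) integrable_distr_eq) (auto simp: add.commute)
 qed
 have q0: "(LINT z|lborel. q k z) = 0" for k
  unfolding q_def using tr if1 by simp
 have "(%k. \<integral>z. q k z \<partial>lborel) \<longlonglongrightarrow> (LINT z|lborel. g z)"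
 proof (rule integral_dominated_convergence[where w="%z. indicator (cball 0 (1 + norm x)) z * B"])
  show "integrable lborel (%z. indicator (cball 0 (1 + norm x)) z * B)"
   by (rule integrable_ball_bounded[of _ _ "1 + norm x" "\<bar>B\<bar>"]) auto
  show "AE z in lborel. (%k. q k z) \<longlonglongrightarrow> g z"
  proof (rule AE_I2)
   fix z
   have "((%t. (f (z + t *\<^sub>R x) - f z) / t) \<longlongrightarrow> g z) (at 0)"
    using der[of z 0] by (simp add: has_field_derivative_iff)
   moreover have "filterlim (%k. inverse (real (Suc k))) (at 0) sequentially"
    unfolding filterlim_at using LIMSEQ_inverse_real_of_nat by simp
   ultimately have "((%k. (f (z + inverse (real (Suc k)) *\<^sub>R x) - f z) / inverse (real (Suc k))) \<longlonglongrightarrow> g z)"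
    by (rule filterlim_compose)
   then show "(%k. q k z) \<longlonglongrightarrow> g z" by (simp add: q_def field_simps)
  qed
  show "AE z in lborel. norm (q k z) \<le> indicator (cball 0 (1 + norm x)) z * B" for k
  proof (rule AE_I2)
   fix z
   define h where "h = inverse (real (Suc k))"
   have h: "0 < h" "h \<le> 1" by (auto simp: h_def field_simps)
   show "norm (q k z) \<le> indicator (cball 0 (1 + norm x)) z * B"
   proof (cases "norm z \<le> 1 + norm x")
    case True
    obtain t where t: "0 < t" "t < h" "f (z + h *\<^sub>R x) - f (z + 0 *\<^sub>R x) = (h - 0) * g (z + t *\<^sub>R x)"
     using MVT2[of 0 h "%t. f (z + t *\<^sub>R x)" "%t. g (z + t *\<^sub>R x)"] der h by auto
    moreover have "q k z = real (Suc k) * (f (z + h *\<^sub>R x) - f z)" by (simp only: q_def h_def)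
    ultimately have "q k z = g (z + t *\<^sub>R x)" by (simp add: h_def)
    then show ?thesis using B True by simp
   next
    case False
    have "norm z - norm (h *\<^sub>R x) \<le> norm (z + h *\<^sub>R x)"
     using norm_triangle_ineq4[of "z + h *\<^sub>R x" "h *\<^sub>R x"] by simp
    moreover have "norm (h *\<^sub>R x) \<le> norm x" using h by (simp add: mult_left_le_one_le)
    ultimately have "norm (z + h *\<^sub>R x) \<ge> 1" using False by simp
    moreover have "norm z \<ge> 1" using False norm_ge_zero[of x] by linarith
    ultimately have "f (z + h *\<^sub>R x) = 0" "f z = 0" by (simp_all only: supp)
    moreover have "q k z = real (Suc k) * (f (z + h *\<^sub>R x) - f z)" by (simp only: q_def h_def)
    ultimately have "q k z = 0" by simp
    then show ?thesis using False by simp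
   qed
  qed
 qed auto
 then show ?thesis by (simp add: q0 LIMSEQ_const_iff)
qed

lemma max_zero_square_deriv: "((%t. (max 0 t)\<^sup>2) has_real_derivative 2 * max 0 t) (at t)" for t :: real
proof (cases "t > 0")
 case True
 have "((%t. t\<^sup>2) has_real_derivative 2 * max 0 t) (at t)"
  using True by (auto intro!: derivative_eq_intros)
 then show ?thesis
 proof (rule DERIV_cong_ev[THEN iffD1, rotated -1, OF _ refl _ refl])
  show "eventually (%x. x\<^sup>2 = (max 0 x)\<^sup>2) (nhds t)"
   using eventually_nhds_in_open[of "{0<..}" t] True by (auto elim!: eventually_mono)
 qed
next
 case False
 show ?thesis
 proof (cases "t = 0")
  case True
  have "((%y. ((max 0 y)\<^sup>2 - (max 0 0)\<^sup>2) / (y - 0)) \<longlongrightarrow> 0) (at (0::real))"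
  proof (rule Lim_null_comparison)
   show "eventually (%y. norm (((max 0 y)\<^sup>2 - (max 0 0)\<^sup>2) / (y - 0)) \<le> \<bar>y\<bar>) (at (0::real))"
    by (rule always_eventually) (auto simp: max_def power2_eq_square)
   show "((%y. \<bar>y\<bar>) \<longlongrightarrow> 0) (at (0::real))" by (auto intro!: tendsto_eq_intros)
  qed
  then show ?thesis using True by (simp add: has_field_derivative_iff)
 next
  case nz: False
  have "((%t. 0) has_real_derivative 2 * max 0 t) (at t)"
   using False by (auto intro!: derivative_eq_intros)
  then show ?thesis
  proof (rule DERIV_cong_ev[THEN iffD1, rotated -1, OF _ refl _ refl])
   show "eventually (%x. 0 = (max 0 x)\<^sup>2) (nhds t)"
    using eventually_nhds_in_open[of "{..<0}" t] False nz by (auto elim!: eventually_mono)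
  qed
 qed
qed

text \<open>
 The divergence theorem on the ball for \<open>P(z) (1 - |z|\<^sup>2)\<^sub>+\<^sup>2\<close>, where
 \<open>P z = (x \<bullet> z)\<^sup>i (y \<bullet> z)\<^sup>j\<close>: the radial factor is \<open>C\<^sup>1\<close> across the sphere.
\<close>

definition bimoment :: "'a::euclidean_space => 'a => nat => nat => real" where
 "bimoment x y i j = (LINT z|sphere_measure. (x \<bullet> z) ^ i * (y \<bullet> z) ^ j)"

text \<open>On the ball the radial factor expands in powers of |z|^2, so the integrand is a
  combination of homogeneous functions of degrees n, n + 2 and n + 4. All of them coincide with h on
  the sphere, and \<open>integral_ball_homogeneous\<close> evaluates each.\<close>

lemma ball_radial_integrals:
 fixes h :: "'a::euclidean_space => real"
 assumes cont: "contU h" and hom: "\<And>s z. s > 0 ==> h (s *\<^sub>R z) = s ^ n * h z"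
 defines "D \<equiv> real DIM('a) + real n"
 shows "integrable lborel (%z. h z * (max 0 (1 - z \<bullet> z))\<^sup>2)"
  and "integrable lborel (%z. h z * max 0 (1 - z \<bullet> z))"
  and "(LINT z|lborel. h z * (max 0 (1 - z \<bullet> z))\<^sup>2) = (1 / D - 2 / (D + 2) + 1 / (D + 4)) * (LINT x|sphere_measure. h x)"
  and "(LINT z|lborel. h z * max 0 (1 - z \<bullet> z)) = (1 / D - 1 / (D + 2)) * (LINT x|sphere_measure. h x)"
proof -
 let ?I = "%f. (LINT z|lborel. indicator (ball 0 1) z * f z)"
 define h2 where "h2 z = (z \<bullet> z) * h z" for z
 define h4 where "h4 z = (z \<bullet> z) * h2 z" for z
 have c: "contU h2" "contU h4"
  unfolding h2_def[abs_def] h4_def by (intro continuous_intros cont)+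
 have hom2: "h2 (s *\<^sub>R z) = s ^ (n + 2) * h2 z" if "s > 0" for s z
  using that by (simp add: h2_def hom power_add power2_eq_square)
 have hom4: "h4 (s *\<^sub>R z) = s ^ (n + 4) * h4 z" if "s > 0" for s z
  using hom2[OF that, of z] by (simp add: h4_def power_add power2_eq_square eval_nat_numeral)
 have sph: "(LINT x|sphere_measure. h2 x) = (LINT x|sphere_measure. h x)" "(LINT x|sphere_measure. h4 x) = (LINT x|sphere_measure. h x)"
  by (intro bi_cong refl; simp add: h2_def h4_def dot_square_norm)+
 have I: "?I h = (LINT x|sphere_measure. h x) / D" "?I h2 = (LINT x|sphere_measure. h x) / (D + 2)" "?I h4 = (LINT x|sphere_measure. h x) / (D + 4)"
  using integral_ball_homogeneous[OF cont hom] integral_ball_homogeneous[OF c(1) hom2] integral_ball_homogeneous[OF c(2) hom4]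
  by (simp_all add: sph D_def add_ac)
 have int: "integrable lborel (%z. indicator (ball 0 1) z * u z)" if "contU u" for u :: "'a => real"
 proof -
  have "bounded (u ` cball 0 1)"
   by (intro compact_imp_bounded compact_continuous_image continuous_on_subset[OF that]) auto
  then obtain B where "\<forall>x\<in>cball 0 1. \<bar>u x\<bar> \<le> B" by (auto simp: bounded_iff)
  then show ?thesis
   using borel_measurable_continuous_onI[OF that] by (intro integrable_ball_bounded[of _ _ 1 B]) auto
 qed
 note ii = int[OF cont] int[OF c(1)] int[OF c(2)]
 have ball_iff: "z \<in> ball 0 1 \<longleftrightarrow> z \<bullet> z < 1" for z :: 'a
 proof -
  have "-1 < norm z" using norm_ge_zero[of z] by linarith
  then show ?thesis by (simp add: dot_square_norm power2_less_1_iff)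
 qed
 have e2: "h z * (max 0 (1 - z \<bullet> z))\<^sup>2 = indicator (ball 0 1) z * h z - 2 * (indicator (ball 0 1) z * h2 z) + indicator (ball 0 1) z * h4 z" for z
 proof (cases "z \<in> ball 0 1")
  case True
  then have "max 0 (1 - z \<bullet> z) = 1 - z \<bullet> z" using ball_iff[of z] by simp
  then show ?thesis using True by (simp add: h2_def h4_def power2_eq_square algebra_simps)
 next
  case False
  then have "max 0 (1 - z \<bullet> z) = 0" using ball_iff[of z] by simp
  then show ?thesis using False by simp
 qed
 have e1: "h z * max 0 (1 - z \<bullet> z) = indicator (ball 0 1) z * h z - indicator (ball 0 1) z * h2 z" for z
 proof (cases "z \<in> ball 0 1")
  case True
  then have "max 0 (1 - z \<bullet> z) = 1 - z \<bullet> z" using ball_iff[of z] by simp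
  then show ?thesis using True by (simp add: h2_def algebra_simps)
 next
  case False
  then have "max 0 (1 - z \<bullet> z) = 0" using ball_iff[of z] by simp
  then show ?thesis using False by simp
 qed
 show "integrable lborel (%z. h z * (max 0 (1 - z \<bullet> z))\<^sup>2)" unfolding e2 using ii by simp
 show "integrable lborel (%z. h z * max 0 (1 - z \<bullet> z))" unfolding e1 using ii by simp
 show "(LINT z|lborel. h z * (max 0 (1 - z \<bullet> z))\<^sup>2) = (1 / D - 2 / (D + 2) + 1 / (D + 4)) * (LINT x|sphere_measure. h x)"
 proof -
  have "(LINT z|lborel. indicator (ball 0 1) z * h z - 2 * (indicator (ball 0 1) z * h2 z) + indicator (ball 0 1) z * h4 z) = ?I h - 2 * ?I h2 + ?I h4"
   using ii by simp
  then show ?thesis unfolding e2 I by (simp add: algebra_simps)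
 qed
 show "(LINT z|lborel. h z * max 0 (1 - z \<bullet> z)) = (1 / D - 1 / (D + 2)) * (LINT x|sphere_measure. h x)"
 proof -
  have "(LINT z|lborel. indicator (ball 0 1) z * h z - indicator (ball 0 1) z * h2 z) = ?I h - ?I h2"
   using ii by simp
  then show ?thesis unfolding e1 I by (simp add: algebra_simps)
 qed
qed

text \<open>The derivative in direction x of the monomial times the squared cutoff w has two kinds
  of terms: the monomial loses a factor, or the cutoff contributes a factor x \<bullet> z. Their
  integrals cancel, which links total degree i + j + 1 to total degree i + j - 1.\<close>

lemma bimoment_rec:
 fixes x y :: "'a::euclidean_space"
 shows "(real DIM('a) + real i + real j - 1) * bimoment x y (Suc i) j
  = real i * (x \<bullet> x) * bimoment x y (i - 1) j + real j * (x \<bullet> y) * bimoment x y i (j - 1)"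
proof -
 define P where "P i j z = (x \<bullet> z) ^ i * (y \<bullet> z) ^ j" for i j and z :: 'a
 define w where "w z = max 0 (1 - z \<bullet> z)" for z :: 'a
 define Q where "Q z = real i * (x \<bullet> x) * P (i - 1) j z + real j * (x \<bullet> y) * P i (j - 1) z" for z
 have cP: "contU (P i j)" for i j unfolding P_def[abs_def] by (intro continuous_intros)
 have cw: "contU w" unfolding w_def[abs_def] by (intro continuous_intros)
 have hP: "P i j (s *\<^sub>R z) = s ^ (i + j) * P i j z" for i j s z
  by (simp add: P_def power_mult_distrib power_add mult_ac)
 define D where "D = real DIM('a) + real (i + j)"
 have "(1::nat) \<le> DIM('a)" using DIM_positive[where 'a='a] by (simp add: Suc_le_eq)
 then have DIM1: "1 \<le> real DIM('a)" by linarith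
 have D1: "D \<ge> 1" using DIM1 of_nat_0_le_iff[of "i + j", where 'a=real] unfolding D_def by linarith
 have dP: "((%t. P i j (z + t *\<^sub>R x)) has_real_derivative Q (z + t *\<^sub>R x)) (at t)" for z t
 proof -
  have lin: "((%t. v \<bullet> (z + t *\<^sub>R x)) has_real_derivative v \<bullet> x) (at t)" for v
   unfolding inner_add_right inner_scaleR_right by (auto intro!: derivative_eq_intros)
  show ?thesis
   unfolding P_def Q_def
   by (rule DERIV_cong[OF DERIV_mult[OF DERIV_power[OF lin] DERIV_power[OF lin]]])
    (simp only: inner_commute[of y x] One_nat_def mult_ac)
 qed
 have dw: "((%t. (w (z + t *\<^sub>R x))\<^sup>2) has_real_derivative 2 * w (z + t *\<^sub>R x) * (- 2 * (x \<bullet> (z + t *\<^sub>R x)))) (at t)" for z t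
 proof -
  have "((%t. 1 - (z + t *\<^sub>R x) \<bullet> (z + t *\<^sub>R x)) has_real_derivative - 2 * (x \<bullet> (z + t *\<^sub>R x))) (at t)"
  proof -
   have lin: "((%t. x \<bullet> z + t * (x \<bullet> x)) has_real_derivative x \<bullet> x) (at t)" by (auto intro!: derivative_eq_intros)
   have "(%t. 1 - (z + t *\<^sub>R x) \<bullet> (z + t *\<^sub>R x)) = (%t. 1 - z \<bullet> z - 2 * t * (x \<bullet> z) - t * t * (x \<bullet> x))"
    by (rule ext) (simp add: inner_add_left inner_add_right inner_commute[of z x] algebra_simps)
   moreover have "((%t. 1 - z \<bullet> z - 2 * t * (x \<bullet> z) - t * t * (x \<bullet> x)) has_real_derivative - 2 * (x \<bullet> (z + t *\<^sub>R x))) (at t)"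
    by (auto intro!: derivative_eq_intros simp: inner_add_right)
   ultimately show ?thesis by simp
  qed
  then show ?thesis
   unfolding w_def by (rule DERIV_chain2[OF max_zero_square_deriv])
 qed
 have sup: "w z = 0" if "norm z \<ge> 1" for z
  using that by (simp add: w_def dot_square_norm one_le_power)
 have z0: "(LINT z|lborel. Q z * (w z)\<^sup>2 - 4 * (P (Suc i) j z * w z)) = 0"
 proof (rule integral_directional_derivative[of "%z. P i j z * (w z)\<^sup>2" _ x])
  show "contU (%z. P i j z * (w z)\<^sup>2)" by (intro continuous_intros cP cw)
  show "contU (%z. Q z * (w z)\<^sup>2 - 4 * (P (Suc i) j z * w z))"
   unfolding Q_def[abs_def] by (intro continuous_intros cP cw)
  show "((%t. P i j (z + t *\<^sub>R x) * (w (z + t *\<^sub>R x))\<^sup>2) has_real_derivative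
   Q (z + t *\<^sub>R x) * (w (z + t *\<^sub>R x))\<^sup>2 - 4 * (P (Suc i) j (z + t *\<^sub>R x) * w (z + t *\<^sub>R x))) (at t)" for z t
   by (rule DERIV_cong[OF DERIV_mult[OF dP dw]]) (simp add: P_def algebra_simps)
 qed (auto simp: sup)
 have R: "integrable lborel (%z. P i j z * (w z)\<^sup>2)" "integrable lborel (%z. P i j z * w z)"
   "(LINT z|lborel. P i j z * (w z)\<^sup>2) = (1 / (real DIM('a) + real (i + j)) - 2 / (real DIM('a) + real (i + j) + 2) + 1 / (real DIM('a) + real (i + j) + 4)) * bimoment x y i j"
   "(LINT z|lborel. P i j z * w z) = (1 / (real DIM('a) + real (i + j)) - 1 / (real DIM('a) + real (i + j) + 2)) * bimoment x y i j" for i j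
  using ball_radial_integrals[OF cP[of i j] hP] by (auto simp: w_def bimoment_def P_def)
 have E: "real DIM('a) + real (Suc i + j) = D + 1" by (simp add: D_def)
 have e13: "D - 1 + 2 = D + 1" "D - 1 + 4 = D + 3" by simp_all
 \<comment> \<open>\<open>\<kappa>\<close> is the radial constant in degree i + j - 1. The constant
   in degree i + j + 1, with its factor 4, turns out to be \<open>\<kappa> * (D - 1)\<close>, so the
   radial profile drops out.\<close>
 define \<kappa> where "\<kappa> = 1 / (D - 1) - 2 / (D + 1) + 1 / (D + 3)"
 \<comment> \<open>For i = 0 the truncated exponent i - 1 has no meaning, but the factor
   \<open>real i\<close> removes the term; likewise for j in \<open>B\<close>.\<close>
 have A: "(LINT z|lborel. real i * (x \<bullet> x) * (P (i - 1) j z * (w z)\<^sup>2)) = real i * (x \<bullet> x) * (\<kappa> * bimoment x y (i - 1) j)"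
 proof (cases i)
  case (Suc k)
  then have "real DIM('a) + real (i - 1 + j) = D - 1" by (simp add: D_def)
  from R(3)[of "i - 1" j, unfolded this e13] show ?thesis by (simp add: \<kappa>_def)
 qed simp
 have B: "(LINT z|lborel. real j * (x \<bullet> y) * (P i (j - 1) z * (w z)\<^sup>2)) = real j * (x \<bullet> y) * (\<kappa> * bimoment x y i (j - 1))"
 proof (cases j)
  case (Suc k)
  then have "real DIM('a) + real (i + (j - 1)) = D - 1" by (simp add: D_def)
  from R(3)[of i "j - 1", unfolded this e13] show ?thesis by (simp add: \<kappa>_def)
 qed simp
 have C: "(LINT z|lborel. P (Suc i) j z * w z) = (1 / (D + 1) - 1 / (D + 3)) * bimoment x y (Suc i) j"
  using R(4)[of "Suc i" j] unfolding E by simp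
 have "(LINT z|lborel. Q z * (w z)\<^sup>2 - 4 * (P (Suc i) j z * w z))
  = (LINT z|lborel. (real i * (x \<bullet> x) * (P (i - 1) j z * (w z)\<^sup>2) + real j * (x \<bullet> y) * (P i (j - 1) z * (w z)\<^sup>2)) - 4 * (P (Suc i) j z * w z))"
  by (rule bi_cong) (auto simp: Q_def algebra_simps)
 also have "... = ((LINT z|lborel. real i * (x \<bullet> x) * (P (i - 1) j z * (w z)\<^sup>2)) + (LINT z|lborel. real j * (x \<bullet> y) * (P i (j - 1) z * (w z)\<^sup>2)))
  - (LINT z|lborel. 4 * (P (Suc i) j z * w z))"
  by (subst bi_diff, intro bi_int_add integrable_mult_right R,
   intro integrable_mult_right R, subst bi_add) (intro integrable_mult_right R refl)+
 also have "... = \<kappa> * (real i * (x \<bullet> x) * bimoment x y (i - 1) j + real j * (x \<bullet> y) * bimoment x y i (j - 1))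
   - 4 * ((1 / (D + 1) - 1 / (D + 3)) * bimoment x y (Suc i) j)"
  unfolding A B by (simp only: integral_mult_right_zero C) (simp add: algebra_simps)
 finally have eq: "\<kappa> * (real i * (x \<bullet> x) * bimoment x y (i - 1) j + real j * (x \<bullet> y) * bimoment x y i (j - 1))
   = 4 * (1 / (D + 1) - 1 / (D + 3)) * bimoment x y (Suc i) j" using z0 by simp
 show ?thesis
 proof (cases "D = 1")
  case True
  \<comment> \<open>D = 1 is dimension one with i = j = 0, where both sides of the recurrence carry
    the coefficient 0.\<close>
  then have "real (i + j) \<le> 0" using DIM1 unfolding D_def by linarith
  then have "i = 0" "j = 0" by simp_all
  then show ?thesis using True by (simp add: D_def)
 next
  case False
  with D1 have "D > 1" by simp
  have k: "4 * (1 / (D + 1) - 1 / (D + 3)) = \<kappa> * (D - 1)" "\<kappa> > 0"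
  proof -
   have k8: "\<kappa> = 8 / ((D - 1) * (D + 1) * (D + 3))"
   proof -
    have n: "D - 1 \<noteq> 0" "D + 1 \<noteq> 0" "D + 3 \<noteq> 0" using \<open>D > 1\<close> by auto
    have "\<kappa> = ((D + 1) * (D + 3) - 2 * ((D - 1) * (D + 3)) + (D - 1) * (D + 1)) / ((D - 1) * (D + 1) * (D + 3))"
    proof -
     have "1 / a - 2 / b + 1 / c = (b * c - 2 * (a * c) + a * b) / (a * b * c)" if "a \<noteq> 0" "b \<noteq> 0" "c \<noteq> 0" for a b c :: real
      using that by (simp add: field_simps)
     from this[OF n] show ?thesis unfolding \<kappa>_def .
    qed
    then show ?thesis by (simp add: algebra_simps)
   qed
   show "4 * (1 / (D + 1) - 1 / (D + 3)) = \<kappa> * (D - 1)"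
   proof -
    have "4 * (1 / b - 1 / (b + 2)) = 8 / (a * b * (b + 2)) * a" if "a \<noteq> 0" "b \<noteq> 0" "b + 2 \<noteq> 0" for a b :: real
    proof -
     have "4 * (1 / b - 1 / (b + 2)) = 8 / (b * (b + 2))" using that by (simp add: field_simps)
     then show ?thesis using that by (simp add: mult.assoc)
    qed
    from this[of "D - 1" "D + 1"] show ?thesis unfolding k8 using \<open>D > 1\<close> by (simp add: add.assoc)
   qed
   show "\<kappa> > 0" unfolding k8 using \<open>D > 1\<close> by simp
  qed
  have "real i * (x \<bullet> x) * bimoment x y (i - 1) j + real j * (x \<bullet> y) * bimoment x y i (j - 1) = (D - 1) * bimoment x y (Suc i) j"
   using eq k(2) unfolding k(1) by (simp add: mult.assoc)
  then show ?thesis by (simp add: D_def add_ac)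
 qed
qed

lemma bimoment_commute: "bimoment x y i j = bimoment y x j i"
 by (simp add: bimoment_def mult.commute)

text \<open>On unit vectors the recurrence lowers the total degree by two and multiplies by at most
  x \<bullet> y, so induction yields a polynomial; dimension at least 2 keeps its leading factor
  away from zero. If the exponent of x is 0, the roles of x and y are exchanged.\<close>

lemma bimoment_poly:
 assumes D: "DIM('a::euclidean_space) \<ge> 2"
 shows "\<exists>F. \<forall>x y :: 'a. norm x = 1 \<longrightarrow> norm y = 1 \<longrightarrow> bimoment x y i j = poly F (x \<bullet> y)"
proof (induction "i + j" arbitrary: i j rule: less_induct)
 case less
 define n where "n = i + j"
 note less = less[folded n_def]
 have step: "\<exists>F. \<forall>x y :: 'a. norm x = 1 \<longrightarrow> norm y = 1 \<longrightarrow> bimoment x y (Suc k) j = poly F (x \<bullet> y)" if kj: "Suc k + j = N" and N: "N = n" for k j N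
 proof -
  have "\<exists>F. real k = 0 \<or> (\<forall>x y :: 'a. norm x = 1 \<longrightarrow> norm y = 1 \<longrightarrow> bimoment x y (k - 1) j = poly F (x \<bullet> y))"
  proof (cases "k = 0")
   case False
   then show ?thesis using less[of "k - 1" j] kj N by auto
  qed simp
  then obtain F where F: "real k = 0 \<or> (\<forall>x y :: 'a. norm x = 1 \<longrightarrow> norm y = 1 \<longrightarrow> bimoment x y (k - 1) j = poly F (x \<bullet> y))"
   by blast
  have "\<exists>G. real j = 0 \<or> (\<forall>x y :: 'a. norm x = 1 \<longrightarrow> norm y = 1 \<longrightarrow> bimoment x y k (j - 1) = poly G (x \<bullet> y))"
  proof (cases "j = 0")
   case False
   then show ?thesis using less[of k "j - 1"] kj N by auto
  qed simp
  then obtain G where G: "real j = 0 \<or> (\<forall>x y :: 'a. norm x = 1 \<longrightarrow> norm y = 1 \<longrightarrow> bimoment x y k (j - 1) = poly G (x \<bullet> y))"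
   by blast
  define c where "c = real DIM('a) + real k + real j - 1"
  have c: "c \<noteq> 0" using D by (simp add: c_def)
  have "bimoment x y (Suc k) j = poly (smult (1 / c) (smult (real k) F + smult (real j) ([:0, 1:] * G))) (x \<bullet> y)"
   if xy: "norm x = 1" "norm y = 1" for x y :: 'a
  proof -
   have "x \<bullet> x = 1" using xy by (simp add: dot_square_norm)
   then have "c * bimoment x y (Suc k) j = real k * bimoment x y (k - 1) j + real j * (x \<bullet> y) * bimoment x y k (j - 1)"
    using bimoment_rec[of k j x y] by (simp add: c_def)
   also have "real k * bimoment x y (k - 1) j = real k * poly F (x \<bullet> y)" using F xy by auto
   also have "real j * (x \<bullet> y) * bimoment x y k (j - 1) = real j * (x \<bullet> y) * poly G (x \<bullet> y)" using G xy by auto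
   finally show ?thesis using c by (simp add: field_simps)
  qed
  then show ?thesis by blast
 qed
 consider "i = 0" "j = 0" | k where "i = Suc k" | k where "i = 0" "j = Suc k"
  by (metis not0_implies_Suc)
 then show ?case
 proof cases
  case 1
  then show ?thesis by (intro exI[of _ "[:bimoment (0::'a) 0 0 0:]"]) (simp add: bimoment_def)
 next
  case 2
  then show ?thesis using step[of k j n] by (simp add: n_def)
 next
  case 3
  then obtain F where "\<forall>x y :: 'a. norm x = 1 \<longrightarrow> norm y = 1 \<longrightarrow> bimoment x y (Suc k) 0 = poly F (x \<bullet> y)"
   using step[of k 0 n] by (auto simp: n_def)
  then show ?thesis using 3 by (intro exI[of _ F]) (auto simp: bimoment_commute[of _ _ 0] inner_commute)
 qed
qed

lemma continuous_sphere_integrable: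
 fixes u :: "'a::euclidean_space => real"
 assumes "contU u"
 shows "integrable sphere_measure u" "u \<in> borel_measurable sphere_measure"
proof -
 show m: "u \<in> borel_measurable sphere_measure"
  using borel_measurable_continuous_onI[OF assms] unfolding measurable_cong_sets[OF sets_sphere_measure refl]
  by (rule measurable_restrict_space1)
 have "bounded (u ` cball 0 1)"
  by (intro compact_imp_bounded compact_continuous_image continuous_on_subset[OF assms]) auto
 then obtain B where B: "\<forall>x\<in>cball 0 1. \<bar>u x\<bar> \<le> B" by (auto simp: bounded_iff)
 interpret finite_measure "sphere_measure :: 'a measure"
 proof
  obtain d where "DIM('a) = d + 1" using DIM_positive[where 'a='a] by (metis Suc_eq_plus1 gr0_implies_Suc)
  then show "emeasure (sphere_measure :: 'a measure) (space sphere_measure) \<noteq> \<infinity>"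
   using emeasure_sphere_measure_space[where 'a='a] by simp
 qed
 show "integrable sphere_measure u"
  by (rule integrable_const_bound[of _ B]) (use B m in auto)
qed

lemma poly_inner_continuous: "contU (%z. poly p (x \<bullet> z))"
 by (intro continuous_intros)

text \<open>Stands in for rotation invariance: the convolution of two zonal polynomials on the
  sphere is zonal. Applied to the kernel it makes the covariance a function of x \<bullet> y, and
  applied to the squared covariance it makes the row norm A independent of the point.\<close>

lemma sphere_poly_product:
 assumes D: "DIM('a::euclidean_space) \<ge> 2"
 shows "\<exists>F. \<forall>x y :: 'a. norm x = 1 \<longrightarrow> norm y = 1 \<longrightarrow> (LINT z|sphere_measure. poly p (x \<bullet> z) * poly q (y \<bullet> z)) = poly F (x \<bullet> y)"
proof -
 obtain F where F: "\<And>i j (x::'a) y. norm x = 1 ==> norm y = 1 ==> bimoment x y i j = poly (F i j) (x \<bullet> y)"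
  using bimoment_poly[OF D] by metis
 have "(LINT z|sphere_measure. poly p (x \<bullet> z) * poly q (y \<bullet> z))
   = poly (\<Sum>i\<le>degree p. \<Sum>j\<le>degree q. smult (coeff p i * coeff q j) (F i j)) (x \<bullet> y)"
  if xy: "norm x = 1" "norm y = 1" for x y :: 'a
 proof -
  have I: "integrable sphere_measure (%z. (coeff p i * coeff q j) * ((x \<bullet> z) ^ i * (y \<bullet> z) ^ j))" for i j
   by (intro continuous_sphere_integrable(1) continuous_intros)
  have "(LINT z|sphere_measure. poly p (x \<bullet> z) * poly q (y \<bullet> z))
   = (LINT z|sphere_measure. (\<Sum>i\<le>degree p. \<Sum>j\<le>degree q. (coeff p i * coeff q j) * ((x \<bullet> z) ^ i * (y \<bullet> z) ^ j)))"
   unfolding poly_altdef sum_product by (intro bi_cong refl sum.cong) (simp add: mult_ac)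
  also have "... = (\<Sum>i\<le>degree p. \<integral>z. (\<Sum>j\<le>degree q. (coeff p i * coeff q j) * ((x \<bullet> z) ^ i * (y \<bullet> z) ^ j)) \<partial>sphere_measure)"
   by (intro bi_sum bi_int_sum I)
  also have "... = (\<Sum>i\<le>degree p. \<Sum>j\<le>degree q. \<integral>z. (coeff p i * coeff q j) * ((x \<bullet> z) ^ i * (y \<bullet> z) ^ j) \<partial>sphere_measure)"
   by (intro sum.cong refl bi_sum I)
  also have "... = (\<Sum>i\<le>degree p. \<Sum>j\<le>degree q. (coeff p i * coeff q j) * bimoment x y i j)"
   by (simp add: bimoment_def)
  finally show ?thesis by (simp add: poly_sum F[OF xy])
 qed
 then show ?thesis by blast
qed

section \<open>Gegenbauer polynomials\<close>

text \<open>\<open>I\<close> models integration of p(x \<bullet> z) over the sphere, which is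
  integration against (1 - t^2)^(\<alpha> - 1/2) dt up to a constant. \<open>ibp\<close> is
  integration by parts for that weight and carries all information about it.\<close>

locale gegenbauer_functional =
 fixes I :: "real poly => real" and \<alpha> \<mu> :: real
 assumes add: "I (p + q) = I p + I q" and smult: "I (smult c p) = c * I p" and one: "I 1 = \<mu>"
  and ibp: "(2 * \<alpha> + 1) * I ([:0, 1:] * p) = I ([:1, 0, -1:] * pderiv p)"
  and \<alpha>: "\<alpha> > 0"
begin

abbreviation C where "C \<equiv> gegenbauer \<alpha>"

lemma diff: "I (p - q) = I p - I q"
 using add[of p "smult (-1) q"] smult[of "-1" q] by simp

lemma recurrence: "smult (real l + 2) (C (Suc (Suc l))) = smult (2 * (real l + 1 + \<alpha>)) ([:0, 1:] * C (Suc l)) - smult (real l + 2 * \<alpha>) (C l)"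
 by (simp add: add_nonneg_eq_0_iff)

text \<open>Differentiating the three-term recurrence involves two consecutive derivatives, so the
  formulas for degrees l and l + 1 are carried through one induction. The factor 1 - t^2 is the one
  that \<open>ibp\<close> provides.\<close>

lemma derivative_aux:
 fixes t :: real
 shows "(1 - t\<^sup>2) * poly (pderiv (C l)) t = (real l + 2 * \<alpha>) * t * poly (C l) t - (real l + 1) * poly (C (Suc l)) t
  \<and> (1 - t\<^sup>2) * poly (pderiv (C (Suc l))) t = (real l + 2 * \<alpha>) * poly (C l) t - (real l + 1) * t * poly (C (Suc l)) t"
proof (induction l)
 case 0
 show ?case by (simp add: pderiv_pCons power2_eq_square algebra_simps)
next
 case (Suc l)
 define a b c a' b' c' where "a = poly (C l) t" and "b = poly (C (Suc l)) t" and "c = poly (C (Suc (Suc l))) t"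
  and "a' = poly (pderiv (C l)) t" and "b' = poly (pderiv (C (Suc l))) t" and "c' = poly (pderiv (C (Suc (Suc l)))) t"
 define r where "r = real l"
 have r: "r + 2 \<noteq> 0" by (simp add: r_def add_nonneg_eq_0_iff)
 have R: "(r + 2) * c = 2 * (r + 1 + \<alpha>) * (t * b) - (r + 2 * \<alpha>) * a"
  using arg_cong[OF recurrence[of l], of "%p. poly p t"] by (simp add: a_def b_def c_def r_def del: gegenbauer.simps)
 have R': "(r + 2) * c' = 2 * (r + 1 + \<alpha>) * (b + t * b') - (r + 2 * \<alpha>) * a'"
  using arg_cong[OF recurrence[of l], of "%p. poly (pderiv p) t"]
  by (simp add: a'_def b_def b'_def c'_def r_def pderiv_smult pderiv_diff pderiv_mult pderiv_pCons del: gegenbauer.simps)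
   (simp add: algebra_simps del: gegenbauer.simps)
 have 1: "(1 - t\<^sup>2) * a' = (r + 2 * \<alpha>) * t * a - (r + 1) * b"
  and 2: "(1 - t\<^sup>2) * b' = (r + 2 * \<alpha>) * a - (r + 1) * t * b"
  using Suc.IH by (simp_all add: a_def b_def a'_def b'_def r_def del: gegenbauer.simps)
 have B: "(1 - t\<^sup>2) * b' = (r + 1 + 2 * \<alpha>) * t * b - (r + 2) * c"
  using 2 R by (simp add: algebra_simps)
 have "(r + 2) * ((1 - t\<^sup>2) * c') = 2 * (r + 1 + \<alpha>) * ((1 - t\<^sup>2) * b + t * ((1 - t\<^sup>2) * b')) - (r + 2 * \<alpha>) * ((1 - t\<^sup>2) * a')"
  using arg_cong[OF R', of "%u. (1 - t\<^sup>2) * u"] by (simp add: algebra_simps)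
 also have "... = 2 * (r + 1 + \<alpha>) * ((1 - t\<^sup>2) * b + t * ((r + 2 * \<alpha>) * a - (r + 1) * t * b)) - (r + 2 * \<alpha>) * ((r + 2 * \<alpha>) * t * a - (r + 1) * b)"
  unfolding 1 2 ..
 also have "... = (r + 2) * ((r + 1 + 2 * \<alpha>) * b) - (r + 2) * (t * (2 * (r + 1 + \<alpha>) * (t * b) - (r + 2 * \<alpha>) * a))"
  by (simp add: power2_eq_square algebra_simps)
 also have "... = (r + 2) * ((r + 1 + 2 * \<alpha>) * b - (r + 2) * t * c)"
  unfolding R[symmetric] by (simp add: algebra_simps)
 finally have "(1 - t\<^sup>2) * c' = (r + 1 + 2 * \<alpha>) * b - (r + 2) * t * c"
  using r by simp
 with B show ?case
  by (simp add: a_def b_def c_def b'_def c'_def r_def add_ac del: gegenbauer.simps)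
qed

lemma derivative: "[:1, 0, -1:] * pderiv (C l) = smult (real l + 2 * \<alpha>) ([:0, 1:] * C l) - smult (real l + 1) (C (Suc l))"
proof (rule poly_eq_poly_eq_iff[THEN iffD1], rule ext)
 fix t
 show "poly ([:1, 0, -1:] * pderiv (C l)) t = poly (smult (real l + 2 * \<alpha>) ([:0, 1:] * C l) - smult (real l + 1) (C (Suc l))) t"
  using derivative_aux[of t l] by (simp add: power2_eq_square algebra_simps del: gegenbauer.simps)
qed

text \<open>Inserting \<open>derivative\<close> into \<open>ibp\<close> for C k gives relation
  \<open>E\<close>. From degree 3 on, \<open>E\<close> and the recurrence form two homogeneous
  linear equations for I (C l) and the integral x of t times the previous polynomial, with only the
  zero solution.\<close>

lemma I_C: "l \<ge> 1 ==> I (C l) = 0"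
proof (induction l rule: less_induct)
 case (less l)
 have E: "(2 * \<alpha> + 1) * I ([:0, 1:] * C k) = (real k + 2 * \<alpha>) * I ([:0, 1:] * C k) - (real k + 1) * I (C (Suc k))" for k
  using ibp[of "C k"] unfolding derivative diff smult .
 consider "l = 1" | "l = 2" | k where "l = Suc (Suc (Suc k))"
 proof -
  have "l = 1 \<or> l = 2 \<or> (\<exists>k. l = Suc (Suc (Suc k)))" using less.prems by presburger
  then show ?thesis using that by blast
 qed
 then show ?case
 proof cases
  case 1
  have "C 1 = smult (2 * \<alpha>) ([:0, 1:] * C 0)" by simp
  from arg_cong[OF this, of I] have "I (C 1) = 2 * \<alpha> * I ([:0, 1:] * C 0)" by (simp only: smult)
  moreover have "(2 * \<alpha> + 1) * I ([:0, 1:] * C 0) = 2 * \<alpha> * I ([:0, 1:] * C 0) - I (C 1)" using E[of 0] by simp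
  ultimately have "(2 * \<alpha> + 1) * I ([:0, 1:] * C 0) = 0" by simp
  then show ?thesis using \<open>I (C 1) = 2 * \<alpha> * I ([:0, 1:] * C 0)\<close> \<alpha> 1 by simp
 next
  case 2
  have "2 * I (C (Suc 1)) = 0" using E[of 1] by (simp add: algebra_simps del: gegenbauer.simps)
  then show ?thesis using 2 by (simp add: numeral_2_eq_2 del: gegenbauer.simps)
 next
  case (3 k)
  define x where "x = I ([:0, 1:] * C (Suc (Suc k)))"
  have IC: "I (C (Suc k)) = 0" using less.IH[of "Suc k"] 3 by simp
  have "(real (Suc k) + 2) * I (C l) = 2 * (real (Suc k) + 1 + \<alpha>) * x"
   using arg_cong[OF recurrence[of "Suc k"], of I] IC unfolding smult diff x_def 3 by simp
  moreover have "(2 * \<alpha> + 1) * x = (real (Suc (Suc k)) + 2 * \<alpha>) * x - (real (Suc (Suc k)) + 1) * I (C l)"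
   using E[of "Suc (Suc k)"] unfolding x_def 3 .
  ultimately have *: "(real k + 3) * I (C l) = 2 * (real k + 2 + \<alpha>) * x" "(real k + 3) * I (C l) = (real k + 1) * x"
   by (simp_all add: algebra_simps)
  then have "(real k + 3 + 2 * \<alpha>) * x = 0" by (simp add: algebra_simps)
  moreover have "real k + 3 + 2 * \<alpha> > 0" using \<alpha> by (simp add: add_nonneg_pos)
  ultimately have "x = 0" by simp
  then have "(real k + 3) * I (C l) = 0" using *(2) by simp
  moreover have "real k + 3 > 0" by (simp add: add_nonneg_pos)
  ultimately show ?thesis by simp
 qed
qed

lemma times_t: "smult (2 * (real l + 1 + \<alpha>)) ([:0, 1:] * C (Suc l)) = smult (real l + 2) (C (Suc (Suc l))) + smult (real l + 2 * \<alpha>) (C l)"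
 unfolding recurrence by simp

lemma I_times_t:
 "2 * (real l + 1 + \<alpha>) * I (p * ([:0, 1:] * C (Suc l))) = (real l + 2) * I (p * C (Suc (Suc l))) + (real l + 2 * \<alpha>) * I (p * C l)"
proof -
 have "I (p * smult (2 * (real l + 1 + \<alpha>)) ([:0, 1:] * C (Suc l))) = I (p * (smult (real l + 2) (C (Suc (Suc l))) + smult (real l + 2 * \<alpha>) (C l)))"
  unfolding times_t ..
 then show ?thesis by (simp only: mult_smult_right distrib_left smult add)
qed

text \<open>Multiplication by t is symmetric for \<open>I\<close>. The recurrence expresses C m
  through t times its predecessor; the t is moved over to C l, where it only reaches the neighbours
  of l.\<close>

lemma orthogonal: "m < l ==> I (C m * C l) = 0"
proof (induction m arbitrary: l rule: less_induct)
 case (less m)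
 have tz: "I (C k * ([:0, 1:] * C l)) = 0" if "k < m" "Suc k < l" for k
 proof -
  obtain l' where l: "l = Suc l'" using \<open>Suc k < l\<close> by (cases l) auto
  have "I (C k * C (Suc l)) = 0" "I (C k * C l') = 0" using that l by (auto intro!: less.IH simp del: gegenbauer.simps)
  then have "2 * (real l' + 1 + \<alpha>) * I (C k * ([:0, 1:] * C l)) = 0"
   using I_times_t[of l' "C k"] unfolding l by (simp del: gegenbauer.simps)
  moreover have "real l' + 1 + \<alpha> > 0" using \<alpha> by (simp add: add_nonneg_pos)
  ultimately show ?thesis by simp
 qed
 consider "m = 0" | "m = 1" | k where "m = Suc (Suc k)" by (metis One_nat_def not0_implies_Suc)
 then show ?case
 proof cases
  case 1
  then show ?thesis using I_C[of l] less.prems by simp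
 next
  case 2
  have e: "C 1 * C l = smult (2 * \<alpha>) (C 0 * ([:0, 1:] * C l))" by simp
  have "I (C 0 * ([:0, 1:] * C l)) = 0" by (rule tz) (use 2 less.prems in auto)
  then show ?thesis unfolding 2 e smult by simp
 next
  case (3 k)
  have "smult (real k + 2) (C m) * C l = smult (2 * (real k + 1 + \<alpha>)) (C (Suc k) * ([:0, 1:] * C l)) - smult (real k + 2 * \<alpha>) (C k * C l)"
   unfolding 3 recurrence
   by (simp only: left_diff_distrib right_diff_distrib mult_smult_left mult_smult_right mult_ac)
  from arg_cong[OF this, of I]
  have "(real k + 2) * I (C m * C l) = 2 * (real k + 1 + \<alpha>) * I (C (Suc k) * ([:0, 1:] * C l)) - (real k + 2 * \<alpha>) * I (C k * C l)"
   by (simp only: mult_smult_left smult diff)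
  also have "I (C (Suc k) * ([:0, 1:] * C l)) = 0" by (rule tz) (use 3 less.prems in auto)
  also have "I (C k * C l) = 0" by (rule less.IH) (use 3 less.prems in auto)
  finally have "(real k + 2) * I (C m * C l) = 0" by simp
  moreover have "real k + 2 > 0" by (simp add: add_nonneg_pos)
  ultimately show ?thesis by simp
 qed
qed

text \<open>The mixed integral x of C l and t C (l + 1) is evaluated twice: by expanding t C (l +
  1), and by moving t to C l and expanding there.\<close>

lemma norm_rec: "(real l + 1) * I (C (Suc l) * C (Suc l)) = (real l + \<alpha>) * (real l + 2 * \<alpha>) / (real l + 1 + \<alpha>) * I (C l * C l)"
proof -
 define x where "x = I (C l * ([:0, 1:] * C (Suc l)))"
 have p: "real l + 1 + \<alpha> > 0" using \<alpha> by (simp add: add_nonneg_pos)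
 have 1: "2 * (real l + 1 + \<alpha>) * x = (real l + 2 * \<alpha>) * I (C l * C l)"
  using I_times_t[of l "C l"] orthogonal[of l "Suc (Suc l)"] by (simp add: x_def del: gegenbauer.simps)
 have 2: "(real l + 1) * I (C (Suc l) * C (Suc l)) = 2 * (real l + \<alpha>) * x"
 proof (cases l)
  case 0
  have "C (Suc 0) * C (Suc 0) = smult (2 * \<alpha>) (C 0 * ([:0, 1:] * C (Suc 0)))" by simp
  from arg_cong[OF this, of I] have "I (C (Suc 0) * C (Suc 0)) = 2 * \<alpha> * I (C 0 * ([:0, 1:] * C (Suc 0)))" by (simp only: smult)
  then show ?thesis using 0 by (simp add: x_def del: gegenbauer.simps)
 next
  case (Suc k)
  have "I (C (Suc l) * C k) = 0" using orthogonal[of k "Suc l"] Suc by (simp add: mult.commute)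
  then have 3: "2 * (real k + 1 + \<alpha>) * I (C (Suc l) * ([:0, 1:] * C (Suc k))) = (real k + 2) * I (C (Suc l) * C (Suc (Suc k)))"
   using I_times_t[of k "C (Suc l)"] by (simp only: mult_zero_right add_0_right)
  have 4: "C (Suc l) * ([:0, 1:] * C (Suc k)) = C l * ([:0, 1:] * C (Suc l))" unfolding Suc by (simp only: mult_ac)
  define z where "z = I (C (Suc l) * C (Suc l))"
  have "2 * (real k + 1 + \<alpha>) * x = (real k + 2) * z"
   using 3[unfolded 4] unfolding x_def z_def Suc .
  then have "(real l + 1) * z = 2 * (real l + \<alpha>) * x" by (simp add: Suc add_ac)
  then show ?thesis by (simp only: z_def)
 qed
 define h where "h = I (C l * C l)"
 have "2 * x = (real l + 2 * \<alpha>) * h / (real l + 1 + \<alpha>)"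
  using 1[folded h_def] p by (simp add: field_simps)
 then have "(real l + \<alpha>) * (2 * x) = (real l + \<alpha>) * ((real l + 2 * \<alpha>) * h / (real l + 1 + \<alpha>))" by simp
 then show ?thesis unfolding 2 h_def[symmetric] by (simp add: mult_ac)
qed

lemma norm_C: "I (C l * C l) = \<mu> * (\<alpha> / (real l + \<alpha>)) * (pochhammer (2 * \<alpha>) l / fact l)"
proof (induction l)
 case 0
 show ?case using one \<alpha> by simp
next
 case (Suc l)
 have p: "real l + 1 + \<alpha> > 0" "real l + \<alpha> > 0" "real l + 1 > 0" using \<alpha> by (simp_all add: add_nonneg_pos)
 have "I (C (Suc l) * C (Suc l)) = (real l + \<alpha>) * (real l + 2 * \<alpha>) / (real l + 1 + \<alpha>) * I (C l * C l) / (real l + 1)"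
  unfolding norm_rec[of l, symmetric] using p by (simp del: gegenbauer.simps)
 also have "... = \<mu> * (\<alpha> / (real (Suc l) + \<alpha>)) * (pochhammer (2 * \<alpha>) (Suc l) / fact (Suc l))"
  unfolding Suc pochhammer_Suc using p by (simp add: divide_simps) (simp add: algebra_simps)
 finally show ?case .
qed

end

section \<open>Hermite polynomials\<close>

text \<open>Polynomial form of \<open>hermite\<close>. The step operator z - d/dz is the adjoint of
  d/dz under the Gaussian law, so orthogonality and generating function follow by induction on
  q.\<close>

fun hermp :: "nat => real poly" where
 "hermp 0 = 1"
| "hermp (Suc q) = [:0, 1:] * hermp q - pderiv (hermp q)"

lemma poly_hermp_Suc: "poly (hermp (Suc q)) z = z * poly (hermp q) z - poly (pderiv (hermp q)) z"
 by simp

lemma pderiv_hermp: "pderiv (hermp q) = smult (real q) (hermp (q - 1))"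
proof (induction q)
 case (Suc q)
 have "pderiv (hermp (Suc q)) = hermp q + ([:0, 1:] * pderiv (hermp q) - pderiv (pderiv (hermp q)))"
  by (simp add: pderiv_diff pderiv_mult pderiv_pCons)
 also have "[:0, 1:] * pderiv (hermp q) - pderiv (pderiv (hermp q)) = smult (real q) (hermp q)"
 proof (cases q)
  case (Suc k)
  then show ?thesis unfolding Suc.IH by (simp add: pderiv_smult smult_diff_right)
 qed simp
 finally show ?case by (simp add: smult_add_left)
qed simp

lemma hermite_eq: "hermite q x = poly (hermp q) x"
proof -
 have "(deriv ^^ q) (%t. exp (- (t\<^sup>2 / 2))) = (%t. (-1) ^ q * poly (hermp q) t * exp (- (t\<^sup>2 / 2)))"
 proof (induction q)
  case (Suc q)
  have "deriv (%t. (-1) ^ q * poly (hermp q) t * exp (- (t\<^sup>2 / 2))) t = (-1) ^ Suc q * poly (hermp (Suc q)) t * exp (- (t\<^sup>2 / 2))" for t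
   by (rule DERIV_imp_deriv) (auto intro!: derivative_eq_intros poly_DERIV simp: algebra_simps)
  then have "deriv (%t. (-1) ^ q * poly (hermp q) t * exp (- (t\<^sup>2 / 2))) = (%t. (-1) ^ Suc q * poly (hermp (Suc q)) t * exp (- (t\<^sup>2 / 2)))"
   by (rule ext)
  then show ?case by (simp only: funpow.simps o_apply Suc)
 qed simp
 then have "hermite q x = ((-1) ^ q * (-1) ^ q) * (exp (x\<^sup>2 / 2) * exp (- (x\<^sup>2 / 2))) * poly (hermp q) x"
  by (simp add: hermite_def mult_ac)
 also have "(-1) ^ q * (-1) ^ q = (1 :: real)" by (simp add: power_mult_distrib[symmetric])
 also have "exp (x\<^sup>2 / 2) * exp (- (x\<^sup>2 / 2)) = 1" by (simp add: exp_minus_inverse)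
 finally show ?thesis by simp
qed

lemma exp_bounded_poly: "exp_bounded (poly p)"
 unfolding poly_altdef[abs_def] by (intro exp_bounded_sum exp_bounded_mult exp_bounded_const exp_bounded_power)

lemma poly_borel [measurable]: "poly p \<in> borel_measurable borel" for p :: "real poly"
 by (intro borel_measurable_continuous_onI continuous_intros)

text \<open>Gaussian integration by parts for the product of \<open>hermp q\<close> and u.\<close>

lemma gauss_hermp_step:
 assumes u: "\<And>z. (u has_real_derivative u' z) (at z)" and cu: "contU u'"
  and bd: "exp_bounded u" "exp_bounded u'"
 shows "(LINT z|gauss. poly (hermp (Suc q)) z * u z) = (LINT z|gauss. poly (hermp q) z * u' z)"
proof -
 have contu: "contU u" using u by (meson DERIV_isCont continuous_at_imp_continuous_on)
 have [measurable]: "u \<in> borel_measurable borel" "u' \<in> borel_measurable borel"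
  using contu cu by (auto intro: borel_measurable_continuous_onI)
 let ?H = "poly (hermp q)" and ?H' = "poly (pderiv (hermp q))"
 have "(LINT z|gauss. ?H' z * u z + u' z * ?H z) = (LINT z|gauss. z * (?H z * u z))"
  by (rule gauss_ibp[OF DERIV_mult[OF poly_DERIV u]])
   (intro continuous_intros contu cu exp_bounded_add exp_bounded_mult exp_bounded_poly bd)+
 moreover have i: "integrable gauss (%z. ?H' z * u z)" "integrable gauss (%z. u' z * ?H z)" "integrable gauss (%z. z * (?H z * u z))"
  by (intro exp_bounded_integrable exp_bounded_mult exp_bounded_poly exp_bounded_id bd; measurable)+
 moreover have "(LINT z|gauss. poly (hermp (Suc q)) z * u z) = (LINT z|gauss. z * (?H z * u z) - ?H' z * u z)"
  unfolding poly_hermp_Suc by (simp only: left_diff_distrib mult.assoc)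
 ultimately have "(LINT z|gauss. poly (hermp (Suc q)) z * u z) = (LINT z|gauss. u' z * ?H z)"
  by (simp only: bi_add bi_diff)
 then show ?thesis by (simp only: mult.commute)
qed

lemma gauss_hermp_mult: "(LINT z|gauss. poly (hermp p) z * poly (hermp q) z) = (if p = q then fact p else 0)"
proof (induction p arbitrary: q)
 case 0
 show ?case
 proof (cases q)
  case 0
  interpret prob_space gauss by (rule prob_space_gauss)
  show ?thesis using 0 prob_space by simp
 next
  case (Suc k)
  have "(LINT z|gauss. poly (hermp (Suc k)) z * 1) = (LINT z|gauss. poly (hermp k) z * 0)"
   by (rule gauss_hermp_step) (auto intro!: derivative_eq_intros exp_bounded_const)
  then show ?thesis using Suc by (simp del: hermp.simps(2))
 qed
next
 case (Suc p)
 have "(LINT z|gauss. poly (hermp (Suc p)) z * poly (hermp q) z) = (LINT z|gauss. poly (hermp p) z * poly (pderiv (hermp q)) z)"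
  by (rule gauss_hermp_step) (auto intro!: poly_DERIV exp_bounded_poly continuous_intros)
 also have "... = real q * (LINT z|gauss. poly (hermp p) z * poly (hermp (q - 1)) z)"
  unfolding pderiv_hermp by (simp add: mult.left_commute)
 also have "... = (if Suc p = q then fact (Suc p) else 0)"
  unfolding Suc by (cases q) auto
 finally show ?case .
qed

lemma gauss_hermp_exp: "(LINT z|gauss. poly (hermp q) z * exp (t * z)) = t ^ q * exp (t\<^sup>2 / 2)"
proof (induction q)
 case 0
 show ?case by (simp add: gauss_exp)
next
 case (Suc q)
 have "(LINT z|gauss. poly (hermp (Suc q)) z * exp (t * z)) = (LINT z|gauss. poly (hermp q) z * (t * exp (t * z)))"
  by (rule gauss_hermp_step)
   (auto intro!: derivative_eq_intros continuous_intros exp_bounded_exp exp_bounded_mult exp_bounded_const)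
 then show ?case using Suc by (simp add: mult.left_commute del: hermp.simps)
qed

text \<open>\<open>P\<close> below bounds \<open>H\<^sub>q\<close> by a moment of a shifted Gaussian, obtained by changing all signs in the recurrence.\<close>

lemma hermp_le_moment: "\<bar>poly (hermp q) z\<bar> \<le> (LINT w|gauss. (\<bar>z\<bar> + w) ^ q)"
proof -
 interpret prob_space gauss by (rule prob_space_gauss)
 define P where "P q = (LINT w|gauss. (\<bar>z\<bar> + w) ^ q)" for q
 have eb: "exp_bounded (%w. (\<bar>z\<bar> + w) ^ q)" for q
  by (intro exp_bounded_pow exp_bounded_add exp_bounded_const exp_bounded_id)
 have P: "P (Suc q) = \<bar>z\<bar> * P q + real q * P (q - 1)" for q
 proof -
  have i: "integrable gauss (%w. (\<bar>z\<bar> + w) ^ q)" "integrable gauss (%w. w * (\<bar>z\<bar> + w) ^ q)"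
   by (intro exp_bounded_integrable eb exp_bounded_mult exp_bounded_id; measurable)+
  have "(LINT w|gauss. real q * (\<bar>z\<bar> + w) ^ (q - 1)) = (LINT w|gauss. w * (\<bar>z\<bar> + w) ^ q)"
   by (rule gauss_ibp) (auto intro!: derivative_eq_intros continuous_intros eb exp_bounded_mult exp_bounded_const)
  moreover have "P (Suc q) = \<bar>z\<bar> * P q + (LINT w|gauss. w * (\<bar>z\<bar> + w) ^ q)"
   using i by (simp add: P_def distrib_right)
  ultimately show ?thesis by (simp add: P_def)
 qed
 have "\<bar>poly (hermp q) z\<bar> \<le> P q \<and> \<bar>poly (hermp (Suc q)) z\<bar> \<le> P (Suc q)"
 proof (induction q)
  case 0
  have "P 0 = 1" using prob_space by (simp add: P_def)
  then show ?case using P[of 0] by simp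
 next
  case (Suc q)
  have "\<bar>poly (hermp (Suc (Suc q))) z\<bar> = \<bar>z * poly (hermp (Suc q)) z - real (Suc q) * poly (hermp q) z\<bar>"
   unfolding poly_hermp_Suc[of "Suc q"] pderiv_hermp by simp
  also have "... \<le> \<bar>z\<bar> * \<bar>poly (hermp (Suc q)) z\<bar> + real (Suc q) * \<bar>poly (hermp q) z\<bar>"
   by (rule order_trans[OF abs_triangle_ineq4]) (simp add: abs_mult)
  also have "... \<le> \<bar>z\<bar> * P (Suc q) + real (Suc q) * P q"
   using Suc by (intro add_mono mult_left_mono) auto
  also have "... = P (Suc (Suc q))" using P[of "Suc q"] by simp
  finally show ?case using Suc by simp
 qed
 then show ?thesis by (simp add: P_def)
qed

text \<open>In the moment bound, scaled by s, the q-th power is at most q! times an exponential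
  whose Gaussian integral is explicit. The factor 2 comes from bounding exp |s w| by exp (s w) + exp
  (- s w).\<close>

lemma hermp_exp_bound:
 assumes s: "s > 0"
 shows "\<bar>poly (hermp q) z\<bar> * s ^ q \<le> 2 * fact q * exp (s * \<bar>z\<bar> + s\<^sup>2 / 2)"
proof -
 have "\<bar>poly (hermp q) z\<bar> * s ^ q \<le> (LINT w|gauss. (\<bar>z\<bar> + w) ^ q) * s ^ q"
  using hermp_le_moment[of q z] s by (intro mult_right_mono) auto
 also have "... = (LINT w|gauss. (s * (\<bar>z\<bar> + w)) ^ q)" by (simp add: power_mult_distrib mult.commute)
 also have "... \<le> (LINT w|gauss. (fact q * exp (s * \<bar>z\<bar>)) * (exp (s * w) + exp ((-s) * w)))"
 proof (rule integral_mono)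
  show "integrable gauss (%w. (s * (\<bar>z\<bar> + w)) ^ q)"
   by (intro exp_bounded_integrable exp_bounded_pow exp_bounded_mult exp_bounded_add exp_bounded_const exp_bounded_id) measurable
  show "integrable gauss (%w. (fact q * exp (s * \<bar>z\<bar>)) * (exp (s * w) + exp ((-s) * w)))"
   by (intro integrable_mult_right bi_int_add gauss_exp(1))
  fix w
  have "(s * (\<bar>z\<bar> + w)) ^ q \<le> \<bar>s * (\<bar>z\<bar> + w)\<bar> ^ q" by (metis abs_ge_self power_abs)
  also have "... \<le> fact q * exp \<bar>s * (\<bar>z\<bar> + w)\<bar>" by (rule power_le_fact_exp)
  also have "... \<le> fact q * (exp (s * \<bar>z\<bar>) * (exp (s * w) + exp ((-s) * w)))"
  proof (rule mult_left_mono)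
   have "\<bar>s * (\<bar>z\<bar> + w)\<bar> \<le> s * \<bar>z\<bar> + \<bar>s * w\<bar>"
    using s abs_triangle_ineq[of "s * \<bar>z\<bar>" "s * w"] by (simp add: distrib_left abs_mult)
   then have "exp \<bar>s * (\<bar>z\<bar> + w)\<bar> \<le> exp (s * \<bar>z\<bar>) * exp \<bar>s * w\<bar>"
    unfolding exp_add[symmetric] by simp
   also have "exp \<bar>s * w\<bar> \<le> exp (s * w) + exp ((-s) * w)" by (cases "s * w \<ge> 0") auto
   finally show "exp \<bar>s * (\<bar>z\<bar> + w)\<bar> \<le> exp (s * \<bar>z\<bar>) * (exp (s * w) + exp ((-s) * w))" by simp
  qed simp
  finally show "(s * (\<bar>z\<bar> + w)) ^ q \<le> (fact q * exp (s * \<bar>z\<bar>)) * (exp (s * w) + exp ((-s) * w))"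
   by (simp only: mult.assoc)
 qed
 also have "... = (fact q * exp (s * \<bar>z\<bar>)) * (exp (s\<^sup>2 / 2) + exp (s\<^sup>2 / 2))"
  using gauss_exp[of s] gauss_exp[of "-s"] by simp
 also have "... = 2 * fact q * exp (s * \<bar>z\<bar> + s\<^sup>2 / 2)" by (simp add: exp_add)
 finally show ?thesis .
qed

lemma sqrt_fact_le: "sqrt (fact q) \<le> sqrt (real q) ^ q"
proof -
 have "(fact q :: real) \<le> of_nat (q ^ q)" by (rule fact_le_power)
 then have "sqrt (fact q) \<le> sqrt (real q ^ q)" by simp
 then show ?thesis by (simp add: real_sqrt_power)
qed

text \<open>With s = sqrt q, the factor s^q cancels one sqrt (q!) by \<open>sqrt_fact_le\<close>.
  What remains is sqrt (q!), the size of the norm of the polynomial, up to a geometric factor. The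
  term s |z| is split by the arithmetic-geometric mean inequality into a multiple of q and
  \<epsilon> z^2.\<close>

lemma hermp_gauss_bound:
 assumes \<epsilon>: "\<epsilon> > 0"
 shows "\<bar>poly (hermp q) z\<bar> \<le> 2 * sqrt (fact q) * exp (1 / 2 + 1 / (4 * \<epsilon>)) ^ q * exp (\<epsilon> * z\<^sup>2)"
proof (cases "q = 0")
 case True
 then show ?thesis using \<epsilon> by (simp add: order_trans[of 1 "exp (\<epsilon> * z\<^sup>2)"])
next
 case False
 define s where "s = sqrt (real q)"
 have s: "s > 0" "s\<^sup>2 = real q" using False by (auto simp: s_def)
 have ag: "s * \<bar>z\<bar> \<le> real q / (4 * \<epsilon>) + \<epsilon> * z\<^sup>2"
 proof -
  have "0 \<le> (s - 2 * \<epsilon> * \<bar>z\<bar>)\<^sup>2" by simp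
  also have "... = s\<^sup>2 - 4 * \<epsilon> * (s * \<bar>z\<bar>) + 4 * \<epsilon> * (\<epsilon> * z\<^sup>2)"
   by (simp add: power2_diff power_mult_distrib power2_eq_square[of \<epsilon>] algebra_simps)
  finally have "4 * \<epsilon> * (s * \<bar>z\<bar>) \<le> real q + 4 * \<epsilon> * (\<epsilon> * z\<^sup>2)" unfolding s(2) by simp
  then have "4 * \<epsilon> * (s * \<bar>z\<bar>) \<le> 4 * \<epsilon> * (real q / (4 * \<epsilon>) + \<epsilon> * z\<^sup>2)" using \<epsilon> by (simp add: distrib_left)
  then show ?thesis using \<epsilon> by simp
 qed
 have "\<bar>poly (hermp q) z\<bar> * s ^ q \<le> 2 * fact q * exp (s * \<bar>z\<bar> + s\<^sup>2 / 2)" by (rule hermp_exp_bound[OF s(1)])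
 also have "... \<le> 2 * fact q * exp (real q * (1 / 2 + 1 / (4 * \<epsilon>)) + \<epsilon> * z\<^sup>2)"
  using ag by (intro mult_left_mono) (auto simp: s(2) algebra_simps)
 also have "(fact q :: real) = sqrt (fact q) * sqrt (fact q)" by simp
 also have "2 * (sqrt (fact q) * sqrt (fact q)) * exp (real q * (1 / 2 + 1 / (4 * \<epsilon>)) + \<epsilon> * z\<^sup>2)
   \<le> 2 * (sqrt (fact q) * s ^ q) * exp (real q * (1 / 2 + 1 / (4 * \<epsilon>)) + \<epsilon> * z\<^sup>2)"
  using sqrt_fact_le[of q] by (intro mult_right_mono mult_left_mono) (auto simp: s_def)
 also have "... = (2 * sqrt (fact q) * exp (1 / 2 + 1 / (4 * \<epsilon>)) ^ q * exp (\<epsilon> * z\<^sup>2)) * s ^ q"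
  by (simp only: exp_add exp_of_nat_mult mult_ac)
 finally show ?thesis using s(1) by (simp only: mult_le_cancel_right_pos zero_less_power)
qed

section \<open>Partial sums of Hermite series and decay of their coefficients\<close>

definition hs :: "(nat => real) => nat => real poly" where
 "hs c N = (\<Sum>q\<le>N. smult (c q / fact q) (hermp q))"

lemma poly_hs: "poly (hs c N) z = (\<Sum>q\<le>N. c q / fact q * poly (hermp q) z)"
 by (simp add: hs_def poly_sum)

text \<open>Relative to the orthonormal Hermite system the coefficients are c q / sqrt (q!); they
  are required to decay faster than every geometric sequence. The class is stable under shifts and
  under multiplication or division by q, that is, under derivatives, the Ornstein-Uhlenbeck operator
  and its inverse.\<close>

definition rapid :: "(nat => real) => bool" where
 "rapid c \<longleftrightarrow> (\<forall>R>0. \<exists>B. \<forall>q. \<bar>c q\<bar> * R ^ q \<le> B * sqrt (fact q))"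

lemma rapidI:
 assumes "\<And>R. R \<ge> 1 ==> \<exists>B. \<forall>q. \<bar>c q\<bar> * R ^ q \<le> B * sqrt (fact q)"
 shows "rapid c"
 unfolding rapid_def
proof (intro allI impI)
 fix R :: real assume "R > 0"
 obtain B where B: "\<And>q. \<bar>c q\<bar> * max 1 R ^ q \<le> B * sqrt (fact q)" using assms[of "max 1 R"] by auto
 have "\<bar>c q\<bar> * R ^ q \<le> B * sqrt (fact q)" for q
  by (rule order_trans[OF mult_left_mono B]) (use \<open>R > 0\<close> in \<open>auto intro!: power_mono\<close>)
 then show "\<exists>B. \<forall>q. \<bar>c q\<bar> * R ^ q \<le> B * sqrt (fact q)" by blast
qed

lemma rapid_mono:
 assumes "rapid c" "\<And>q. \<bar>c' q\<bar> \<le> K * 2 ^ q * \<bar>c q\<bar>" "K \<ge> 0"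
 shows "rapid c'"
 unfolding rapid_def
proof (intro allI impI)
 fix R :: real assume R: "R > 0"
 then have "2 * R > 0" by simp
 then obtain B where B: "\<And>q. \<bar>c q\<bar> * (2 * R) ^ q \<le> B * sqrt (fact q)" using assms(1) unfolding rapid_def by blast
 have "\<bar>c' q\<bar> * R ^ q \<le> (K * B) * sqrt (fact q)" for q
 proof -
  have "\<bar>c' q\<bar> * R ^ q \<le> (K * 2 ^ q * \<bar>c q\<bar>) * R ^ q" using assms(2)[of q] R by (intro mult_right_mono) auto
  also have "... = K * (\<bar>c q\<bar> * (2 * R) ^ q)" by (simp add: power_mult_distrib)
  also have "... \<le> K * (B * sqrt (fact q))" by (rule mult_left_mono[OF B assms(3)])
  finally show ?thesis by simp
 qed
 then show "\<exists>B. \<forall>q. \<bar>c' q\<bar> * R ^ q \<le> B * sqrt (fact q)" by blast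
qed

text \<open>The factor sqrt (q + 1) between consecutive factorials is absorbed by doubling
  R.\<close>

lemma rapid_shift: assumes "rapid c" shows "rapid (%q. c (Suc q))"
 unfolding rapid_def
proof (intro allI impI)
 fix R :: real assume R: "R > 0"
 then have "2 * R > 0" by simp
 then obtain B where B: "\<And>q. \<bar>c q\<bar> * (2 * R) ^ q \<le> B * sqrt (fact q)" using assms unfolding rapid_def by blast
 have B0: "B \<ge> 0" using B[of 0] by simp
 have "\<bar>c (Suc q)\<bar> * R ^ q \<le> (B / R) * sqrt (fact q)" for q
 proof -
  have "sqrt (real (Suc q)) \<le> 2 ^ Suc q"
  proof -
   have "real (Suc q) \<le> 2 ^ Suc q" using less_exp[of "Suc q"] by (metis less_imp_le of_nat_le_iff of_nat_numeral of_nat_power)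
   moreover have "sqrt (real (Suc q)) \<le> real (Suc q)" by (rule real_le_lsqrt) (simp_all add: power2_eq_square)
   ultimately show ?thesis by linarith
  qed
  then have "B * (sqrt (real (Suc q)) * sqrt (fact q)) \<le> B * (2 ^ Suc q * sqrt (fact q))"
   using B0 by (intro mult_left_mono mult_right_mono) auto
  moreover have "\<bar>c (Suc q)\<bar> * (2 * R) ^ Suc q \<le> B * (sqrt (real (Suc q)) * sqrt (fact q))"
   using B[of "Suc q"] by (simp add: real_sqrt_mult[symmetric])
  ultimately have "\<bar>c (Suc q)\<bar> * (2 * R) ^ Suc q \<le> B * (2 ^ Suc q * sqrt (fact q))" by linarith
  then have "2 ^ Suc q * (\<bar>c (Suc q)\<bar> * (R * R ^ q)) \<le> 2 ^ Suc q * (B * sqrt (fact q))"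
   by (simp only: power_mult_distrib power_Suc mult_ac)
  then have "\<bar>c (Suc q)\<bar> * (R * R ^ q) \<le> B * sqrt (fact q)" by (rule mult_left_le_imp_le) simp
  then show ?thesis using R by (simp add: field_simps)
 qed
 then show "\<exists>B. \<forall>q. \<bar>c (Suc q)\<bar> * R ^ q \<le> B * sqrt (fact q)" by blast
qed

text \<open>Taking R twice the geometric factor of \<open>hermp_gauss_bound\<close> dominates the
  series by a geometric one of ratio 1/2, uniformly in N. Since \<epsilon> is arbitrary, this
  controls moments of every order.\<close>

lemma rapid_hs_bound:
 assumes "rapid c" and \<epsilon>: "\<epsilon> > 0"
 shows "\<exists>B. \<forall>N z. \<bar>poly (hs c N) z\<bar> \<le> B * exp (\<epsilon> * z\<^sup>2)"
proof -
 define R where "R = exp (1 / 2 + 1 / (4 * \<epsilon>))"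
 have R: "R > 0" by (simp add: R_def)
 then have "2 * R > 0" by simp
 then obtain B where B: "\<And>q. \<bar>c q\<bar> * (2 * R) ^ q \<le> B * sqrt (fact q)" using assms(1) unfolding rapid_def by blast
 have B0: "B \<ge> 0" using B[of 0] by simp
 have t: "\<bar>c q / fact q * poly (hermp q) z\<bar> \<le> (2 * B * exp (\<epsilon> * z\<^sup>2)) * (1 / 2) ^ q" for q z
 proof -
  have "\<bar>c q\<bar> * \<bar>poly (hermp q) z\<bar> \<le> \<bar>c q\<bar> * (2 * sqrt (fact q) * R ^ q * exp (\<epsilon> * z\<^sup>2))"
   unfolding R_def by (intro mult_left_mono hermp_gauss_bound \<epsilon>) auto
  also have "... = (\<bar>c q\<bar> * (2 * R) ^ q) * ((1 / 2) ^ q * (2 * sqrt (fact q) * exp (\<epsilon> * z\<^sup>2)))"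
   by (simp add: power_mult_distrib power_one_over)
  also have "... \<le> (B * sqrt (fact q)) * ((1 / 2) ^ q * (2 * sqrt (fact q) * exp (\<epsilon> * z\<^sup>2)))"
   by (intro mult_right_mono B) auto
  also have "... = fact q * ((2 * B * exp (\<epsilon> * z\<^sup>2)) * (1 / 2) ^ q)"
   by (simp add: mult_ac)
  finally show ?thesis by (simp add: abs_mult field_simps)
 qed
 have "\<bar>poly (hs c N) z\<bar> \<le> 4 * B * exp (\<epsilon> * z\<^sup>2)" for N z
 proof -
  have "\<bar>poly (hs c N) z\<bar> \<le> (\<Sum>q\<le>N. \<bar>c q / fact q * poly (hermp q) z\<bar>)"
   unfolding poly_hs by (rule sum_abs)
  also have "... \<le> (\<Sum>q\<le>N. (2 * B * exp (\<epsilon> * z\<^sup>2)) * (1 / 2) ^ q)" by (intro sum_mono t)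
  also have "... = (2 * B * exp (\<epsilon> * z\<^sup>2)) * (\<Sum>q\<le>N. (1 / 2) ^ q)" by (simp add: sum_distrib_left)
  also have "... \<le> (2 * B * exp (\<epsilon> * z\<^sup>2)) * 2"
  proof (rule mult_left_mono)
   have "(\<Sum>q\<le>N. (1 / 2) ^ q) = (2 - (1 / 2) ^ N :: real)"
    by (induction N) auto
   then show "(\<Sum>q\<le>N. (1 / 2) ^ q) \<le> (2::real)" by simp
  qed (use B0 in auto)
  finally show ?thesis by simp
 qed
 then show ?thesis by blast
qed

lemma gauss_exp_square: "integrable gauss (%z. exp (z\<^sup>2 / 4))"
proof -
 have eq: "std_normal_density z * exp (z\<^sup>2 / 4) = sqrt 2 * normal_density 0 (sqrt 2) z" for z
 proof -
  have "exp (- z\<^sup>2 / 2) * exp (z\<^sup>2 / 4) = exp (- z\<^sup>2 / 4)" unfolding exp_add[symmetric] by simp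
  then have "1 / sqrt (2 * pi) * exp (- z\<^sup>2 / 2) * exp (z\<^sup>2 / 4) = 1 / sqrt (2 * pi) * exp (- z\<^sup>2 / 4)"
   by (simp only: mult.assoc)
  moreover have "sqrt (2 * pi * (sqrt 2)\<^sup>2) = sqrt (2 * pi) * sqrt 2" by (simp add: real_sqrt_mult)
  ultimately show ?thesis by (simp add: normal_density_def)
 qed
 show ?thesis by (subst integrable_density) (auto simp: eq)
qed

lemma rapid_moments:
 assumes "rapid c" and "m \<ge> 1"
 shows "\<exists>B\<ge>0. \<forall>N. (LINT z|gauss. poly (hs c N) z ^ (2 * m)) \<le> B"
proof -
 \<comment> \<open>Chosen so that the power 2 m of the bound is a multiple of exp (z^2 / 4), which
   is still integrable against the Gaussian density.\<close>
 define \<epsilon> where "\<epsilon> = 1 / (8 * real m)"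
 have \<epsilon>: "\<epsilon> > 0" "real (2 * m) * \<epsilon> = 1 / 4" using assms(2) by (auto simp: \<epsilon>_def field_simps)
 obtain B where B: "\<And>N z. \<bar>poly (hs c N) z\<bar> \<le> B * exp (\<epsilon> * z\<^sup>2)" using rapid_hs_bound[OF assms(1) \<epsilon>(1)] by blast
 have "(LINT z|gauss. poly (hs c N) z ^ (2 * m)) \<le> (LINT z|gauss. B ^ (2 * m) * exp (z\<^sup>2 / 4))" for N
 proof (rule integral_mono)
  show "integrable gauss (%z. poly (hs c N) z ^ (2 * m))"
   by (intro exp_bounded_integrable exp_bounded_pow exp_bounded_poly) measurable
  show "integrable gauss (%z. B ^ (2 * m) * exp (z\<^sup>2 / 4))" by (intro integrable_mult_right gauss_exp_square)
  fix z
  have "poly (hs c N) z ^ (2 * m) = \<bar>poly (hs c N) z\<bar> ^ (2 * m)" by (simp add: power_even_abs)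
  also have "... \<le> (B * exp (\<epsilon> * z\<^sup>2)) ^ (2 * m)" by (intro power_mono B) simp
  also have "... = B ^ (2 * m) * exp (real (2 * m) * (\<epsilon> * z\<^sup>2))" by (simp only: power_mult_distrib exp_of_nat_mult)
  also have "real (2 * m) * (\<epsilon> * z\<^sup>2) = z\<^sup>2 / 4" using \<epsilon>(2) by (simp only: mult.assoc[symmetric])
  finally show "poly (hs c N) z ^ (2 * m) \<le> B ^ (2 * m) * exp (z\<^sup>2 / 4)" .
 qed
 moreover have "B ^ (2 * m) * exp (z\<^sup>2 / 4) \<ge> 0" for z by simp
 ultimately show ?thesis
  by (intro exI[of _ "\<integral>z. B ^ (2 * m) * exp (z\<^sup>2 / 4) \<partial>gauss"]) simp
qed

lemma pderiv_sum_set: "finite A ==> pderiv (sum f A) = (\<Sum>i\<in>A. pderiv (f i :: real poly))"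
 by (induction A rule: finite_induct) (auto simp: pderiv_add)

text \<open>Differentiation shifts the coefficients, because the factor q from
  \<open>pderiv_hermp\<close> turns q! into (q - 1)!.\<close>

lemma pderiv_hs: "pderiv (hs c (Suc N)) = hs (%q. c (Suc q)) N"
proof -
 have "pderiv (hs c (Suc N)) = (\<Sum>q\<le>Suc N. smult (c q / fact q * real q) (hermp (q - 1)))"
  unfolding hs_def by (simp add: pderiv_sum_set pderiv_smult pderiv_hermp del: sum.atMost_Suc)
 also have "... = (\<Sum>q\<le>N. smult (c (Suc q) / fact (Suc q) * real (Suc q)) (hermp q))"
  by (subst sum.atMost_Suc_shift) simp
 also have "... = hs (%q. c (Suc q)) N"
  unfolding hs_def by (intro sum.cong refl arg_cong2[where f = smult]) simp
 finally show ?thesis .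
qed

lemma L2_gauss_poly: "L2 gauss (poly p)"
 unfolding L2_def by (auto intro!: exp_bounded_integrable exp_bounded_pow exp_bounded_poly)

lemma gauss_poly_integrable: "integrable gauss (poly p)"
 by (intro exp_bounded_integrable exp_bounded_poly) measurable

lemma integral_hs:
 assumes "\<And>q. integrable M (%z. f z * poly (hermp q) (g z))"
 shows "(LINT z|M. f z * poly (hs c N) (g z)) = (\<Sum>q\<le>N. c q / fact q * (LINT z|M. f z * poly (hermp q) (g z)))"
proof -
 have "(LINT z|M. f z * poly (hs c N) (g z)) = (LINT z|M. (\<Sum>q\<le>N. c q / fact q * (f z * poly (hermp q) (g z))))"
  by (simp only: poly_hs sum_distrib_left mult.left_commute)
 also have "... = (\<Sum>q\<le>N. \<integral>z. c q / fact q * (f z * poly (hermp q) (g z)) \<partial>M)"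
  by (intro bi_sum integrable_mult_right assms)
 finally show ?thesis by (simp only: integral_mult_right_zero)
qed

lemma hs_hermp_inner: "(LINT z|gauss. poly (hermp q) z * poly (hs c N) z) = (if q \<le> N then c q else 0)"
proof -
 have "(LINT z|gauss. poly (hermp q) z * poly (hs c N) z) = (\<Sum>p\<le>N. c p / fact p * (if q = p then fact q else 0))"
  by (subst integral_hs) (auto simp: gauss_hermp_mult intro!: L2_mult_integrable L2_gauss_poly)
 also have "... = (\<Sum>p\<le>N. if p = q then c p else 0)" by (intro sum.cong) auto
 finally show ?thesis by simp
qed

lemma hs_norm: "(LINT z|gauss. (poly (hs c N) z)\<^sup>2) = (\<Sum>q\<le>N. (c q)\<^sup>2 / fact q)"
proof -
 have "(LINT z|gauss. poly (hs c N) z * poly (hs c N) z) = (\<Sum>q\<le>N. c q / fact q * (if q \<le> N then c q else 0))"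
  by (subst integral_hs) (auto simp: hs_hermp_inner mult.commute[of "poly (hs c N) _"] intro!: L2_mult_integrable L2_gauss_poly)
 then show ?thesis by (simp add: power2_eq_square)
qed

lemma hs_diff: "M \<le> N ==> hs c N - hs c M = hs (%q. if M < q then c q else 0) N"
proof (induction N rule: dec_induct)
 case base
 have "hs (%q. if M < q then c q else 0) M = 0" unfolding hs_def by (rule sum.neutral) auto
 then show ?case by simp
next
 case (step N)
 have s: "hs c (Suc N) = hs c N + smult (c (Suc N) / fact (Suc N)) (hermp (Suc N))" for c by (simp add: hs_def)
 have "hs c (Suc N) - hs c M = (hs c N - hs c M) + smult (c (Suc N) / fact (Suc N)) (hermp (Suc N))"
  unfolding s[of c] by (rule diff_add_eq[symmetric])
 then show ?case unfolding step.IH s[of "%q. if M < q then c q else 0"] using step.hyps by simp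
qed

lemma hs_converges:
 assumes "summable (%q. (c q)\<^sup>2 / fact q)"
 shows "\<exists>\<psi>. L2 gauss \<psi> \<and> Lp_tendsto gauss 2 (%N. poly (hs c N)) \<psi>"
proof (rule L2_complete[OF L2_gauss_poly])
 fix e :: real assume "e > 0"
 then obtain N0 where N0: "\<And>m n. m \<ge> N0 ==> norm (\<Sum>q=m..<n. (c q)\<^sup>2 / fact q) < e"
  using assms unfolding summable_Cauchy by blast
 have le: "(LINT z|gauss. (poly (hs c n) z - poly (hs c m) z)\<^sup>2) < e" if "N0 \<le> m" "m \<le> n" for m n
 proof -
  have "(LINT z|gauss. (poly (hs c n) z - poly (hs c m) z)\<^sup>2) = (\<Sum>q\<le>n. (if m < q then c q else 0)\<^sup>2 / fact q)"
   unfolding poly_diff[symmetric] hs_diff[OF that(2)] by (rule hs_norm)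
  also have "... = (\<Sum>q\<in>{Suc m..<Suc n}. (c q)\<^sup>2 / fact q)"
   by (rule sum.mono_neutral_cong_right) auto
  also have "... \<le> norm (\<Sum>q=Suc m..<Suc n. (c q)\<^sup>2 / fact q)" by (metis abs_ge_self real_norm_def)
  also have "... < e" using that by (intro N0) auto
  finally show ?thesis .
 qed
 have "(LINT z|gauss. (poly (hs c m) z - poly (hs c n) z)\<^sup>2) < e" if "N0 \<le> m" "N0 \<le> n" for m n
  using le[of m n] le[of n m] that by (cases "m \<le> n") (auto simp: power2_commute)
 then show "\<exists>N0. \<forall>m\<ge>N0. \<forall>n\<ge>N0. (LINT z|gauss. (poly (hs c m) z - poly (hs c n) z)\<^sup>2) < e" by blast
qed

lemma hermite_coeff_eq: "hermite_coeff \<phi> q = (LINT z|gauss. poly (hermp q) z * \<phi> z)"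
 by (simp add: hermite_coeff_def hermite_eq mult.commute)

lemma hs_limit_coeff:
 assumes "L2 gauss \<psi>" "Lp_tendsto gauss 2 (%N. poly (hs c N)) \<psi>"
 shows "hermite_coeff \<psi> q = c q"
proof (rule LIMSEQ_unique)
 show "(%N. \<integral>z. poly (hermp q) z * poly (hs c N) z \<partial>gauss) \<longlonglongrightarrow> hermite_coeff \<psi> q"
  unfolding hermite_coeff_eq by (rule L2_tendsto_inner[OF L2_gauss_poly L2_gauss_poly Lp_tendsto_const L2_gauss_poly assms])
 show "(%N. \<integral>z. poly (hermp q) z * poly (hs c N) z \<partial>gauss) \<longlonglongrightarrow> c q"
  unfolding hs_hermp_inner by (rule tendsto_eventually) (rule eventually_sequentiallyI[of q], simp)
qed

lemma hermite_bessel: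
 assumes \<phi>: "L2 gauss \<phi>"
 shows "summable (%q. (hermite_coeff \<phi> q)\<^sup>2 / fact q)"
proof (rule summableI_nonneg_bounded)
 let ?b = "hermite_coeff \<phi>"
 fix n
 have i: "integrable gauss (%z. \<phi> z * poly p z)" for p by (intro L2_mult_integrable \<phi> L2_gauss_poly)
 have "(LINT z|gauss. \<phi> z * poly (hs ?b n) z) = (\<Sum>q\<le>n. (?b q)\<^sup>2 / fact q)"
  by (subst integral_hs[OF i]) (simp add: hermite_coeff_eq mult.commute[of "\<phi> _"] power2_eq_square)
 moreover have "0 \<le> (LINT z|gauss. (\<phi> z - poly (hs ?b n) z)\<^sup>2)" by simp
 moreover have "(LINT z|gauss. (\<phi> z - poly (hs ?b n) z)\<^sup>2)
   = (LINT z|gauss. (\<phi> z)\<^sup>2 - 2 * (\<phi> z * poly (hs ?b n) z) + (poly (hs ?b n) z)\<^sup>2)"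
  by (simp add: power2_diff algebra_simps)
 moreover have "... = (LINT z|gauss. (\<phi> z)\<^sup>2) - 2 * (LINT z|gauss. \<phi> z * poly (hs ?b n) z) + (LINT z|gauss. (poly (hs ?b n) z)\<^sup>2)"
  using L2_integrable_square[OF \<phi>] L2_integrable_square[OF L2_gauss_poly] i by simp
 ultimately have "(\<Sum>q\<le>n. (?b q)\<^sup>2 / fact q) \<le> (LINT z|gauss. (\<phi> z)\<^sup>2)" unfolding hs_norm by simp
 moreover have "(\<Sum>q<n. (?b q)\<^sup>2 / fact q) \<le> (\<Sum>q\<le>n. (?b q)\<^sup>2 / fact q)" by (rule sum_mono2) auto
 ultimately show "(\<Sum>q<n. (?b q)\<^sup>2 / fact q) \<le> (LINT z|gauss. (\<phi> z)\<^sup>2)" by simp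
qed simp

lemma hermite_orthogonal_zero:
 assumes \<eta>: "L2 gauss \<eta>" and o: "\<And>q. hermite_coeff \<eta> q = 0"
 shows "AE z in gauss. \<eta> z = 0"
proof -
 interpret prob_space gauss by (rule prob_space_gauss)
 have i: "integrable gauss (%z. \<eta> z * poly p z)" for p by (intro L2_mult_integrable \<eta> L2_gauss_poly)
 have mono0: "(LINT z|gauss. \<eta> z * poly (monom 1 n * hermp q) z) = 0" for n q
 proof (induction n arbitrary: q)
  case 0
  then show ?case using o[of q] by (simp add: hermite_coeff_eq mult.commute)
 next
  case (Suc n)
  have "z * poly (hermp q) z = poly (hermp (Suc q)) z + real q * poly (hermp (q - 1)) z" for z
   unfolding poly_hermp_Suc pderiv_hermp by simp
  then have "\<eta> z * poly (monom 1 (Suc n) * hermp q) z = \<eta> z * poly (monom 1 n * hermp (Suc q)) z + real q * (\<eta> z * poly (monom 1 n * hermp (q - 1)) z)" for z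
   by (simp only: poly_mult poly_monom power_Suc mult.assoc mult.left_commute[of z] mult_1 distrib_left)
    (simp only: mult.left_commute[of "real q"])
  then have "(LINT z|gauss. \<eta> z * poly (monom 1 (Suc n) * hermp q) z) =
   (LINT z|gauss. \<eta> z * poly (monom 1 n * hermp (Suc q)) z) + real q * (LINT z|gauss. \<eta> z * poly (monom 1 n * hermp (q - 1)) z)"
   using i by (simp del: poly_mult hermp.simps)
  then show ?case unfolding Suc by simp
 qed
 have mono: "(LINT z|gauss. \<eta> z * z ^ n) = 0" for n using mono0[of n 0] by (simp add: poly_monom)
 have \<eta>i: "integrable gauss \<eta>" using i[of 1] by simp
 \<comment> \<open>One statement for cosine and sine, whose coefficients are at most 1 / n! in
   absolute value. The partial sums are dominated by exp (t z) + exp (- t z), which is square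
   integrable.\<close>
 have ser: "(LINT z|gauss. \<eta> z * f (t * z)) = 0"
  if a: "\<And>n. \<bar>a n\<bar> \<le> 1 / fact n" and f: "\<And>x. (%n. a n * x ^ n) sums f x" for a :: "nat => real" and f t
 proof -
  have [measurable]: "f \<in> borel_measurable borel"
   by (rule borel_measurable_LIMSEQ_real[OF f[unfolded sums_def]]) measurable
  have [measurable]: "\<eta> \<in> borel_measurable borel" using \<eta> by (simp add: L2_def)
  have "(%N. \<integral>z. \<eta> z * (\<Sum>n<N. a n * (t * z) ^ n) \<partial>gauss) \<longlonglongrightarrow> (LINT z|gauss. \<eta> z * f (t * z))"
  proof (rule integral_dominated_convergence)
   have "L2 gauss (%z. exp (t * z) + exp (- t * z))"
    unfolding L2_def by (intro conjI exp_bounded_integrable exp_bounded_pow exp_bounded_add exp_bounded_exp; measurable)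
   from L2_mult_integrable[OF \<eta> this]
   show "integrable gauss (%z. \<bar>\<eta> z * (exp (t * z) + exp (- t * z))\<bar>)" by (rule integrable_abs)
   show "AE z in gauss. (%N. \<eta> z * (\<Sum>n<N. a n * (t * z) ^ n)) \<longlonglongrightarrow> \<eta> z * f (t * z)"
    by (intro AE_I2 tendsto_intros f[unfolded sums_def])
   fix N
   show "AE z in gauss. norm (\<eta> z * (\<Sum>n<N. a n * (t * z) ^ n)) \<le> \<bar>\<eta> z * (exp (t * z) + exp (- t * z))\<bar>"
   proof (rule AE_I2)
    fix z
    have "\<bar>\<Sum>n<N. a n * (t * z) ^ n\<bar> \<le> (\<Sum>n<N. \<bar>a n * (t * z) ^ n\<bar>)" by (rule sum_abs)
    also have "... \<le> (\<Sum>n<N. \<bar>t * z\<bar> ^ n /\<^sub>R fact n)"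
    proof (rule sum_mono)
     fix n
     have "\<bar>a n\<bar> * \<bar>t * z\<bar> ^ n \<le> 1 / fact n * \<bar>t * z\<bar> ^ n" by (intro mult_right_mono a) simp
     then show "\<bar>a n * (t * z) ^ n\<bar> \<le> \<bar>t * z\<bar> ^ n /\<^sub>R fact n" by (simp add: abs_mult power_abs divide_inverse mult_ac)
    qed
    also have "... \<le> exp \<bar>t * z\<bar>" unfolding exp_def by (intro sum_le_suminf summable_exp_generic) auto
    also have "... \<le> exp (t * z) + exp (- t * z)" by (cases "t * z \<ge> 0") auto
    also have "... \<le> \<bar>exp (t * z) + exp (- t * z)\<bar>" by simp
    finally show "norm (\<eta> z * (\<Sum>n<N. a n * (t * z) ^ n)) \<le> \<bar>\<eta> z * (exp (t * z) + exp (- t * z))\<bar>"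
     unfolding real_norm_def abs_mult by (intro mult_left_mono) auto
   qed
  qed measurable
  moreover have "(LINT z|gauss. \<eta> z * (\<Sum>n<N. a n * (t * z) ^ n)) = 0" for N
  proof -
   have im: "integrable gauss (%z. \<eta> z * z ^ n)" for n using i[of "monom 1 n"] by (simp add: poly_monom)
   have "(LINT z|gauss. \<eta> z * (\<Sum>n<N. a n * (t * z) ^ n)) = (LINT z|gauss. (\<Sum>n<N. (a n * t ^ n) * (\<eta> z * z ^ n)))"
    by (simp add: sum_distrib_left power_mult_distrib mult_ac)
   also have "... = (\<Sum>n<N. \<integral>z. (a n * t ^ n) * (\<eta> z * z ^ n) \<partial>gauss)"
    by (intro bi_sum integrable_mult_right im)
   finally show ?thesis by (simp only: integral_mult_right_zero mono) simp
  qed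
  ultimately show ?thesis by (simp add: LIMSEQ_const_iff)
 qed
 have c: "(LINT z|gauss. \<eta> z * cos (t * z)) = 0" for t
 proof (rule ser[of cos_coeff])
  show "(%n. cos_coeff n * x ^ n) sums cos x" for x using cos_converges[of x] by (simp only: real_scaleR_def)
 qed (simp add: cos_coeff_def)
 have s: "(LINT z|gauss. \<eta> z * sin (t * z)) = 0" for t
 proof (rule ser[of sin_coeff])
  show "(%n. sin_coeff n * x ^ n) sums sin x" for x using sin_converges[of x] by (simp only: real_scaleR_def)
 qed (simp add: sin_coeff_def)
 have A: "(LINT z|gauss. \<eta> z * indicator A z) = 0" if "A \<in> sets borel" for A
  by (rule signed_char_unique[OF prob_space_gauss _ \<eta>i c s that]) simp
 have [measurable]: "\<eta> \<in> borel_measurable borel" using \<eta> by (simp add: L2_def)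
 have z: "AE z in gauss. a * (\<eta> z * indicator A z) = 0" if "A \<in> sets borel" "\<And>z. z \<in> A ==> a * \<eta> z \<ge> 0" for A a
 proof (rule integral_nonneg_eq_0_iff_AE[THEN iffD1])
  show "integrable gauss (%z. a * (\<eta> z * indicator A z))"
   using that by (intro integrable_mult_right integrable_real_mult_indicator \<eta>i) simp
  show "(LINT z|gauss. a * (\<eta> z * indicator A z)) = 0" using A[OF that(1)] by (simp only: integral_mult_right_zero mult_zero_right)
 qed (use that(2) in \<open>auto simp: indicator_def\<close>)
 have "AE z in gauss. 1 * (\<eta> z * indicator {z. \<eta> z > 0} z) = 0" by (rule z) auto
 moreover have "AE z in gauss. (-1) * (\<eta> z * indicator {z. \<eta> z < 0} z) = 0" by (rule z) auto
 ultimately show ?thesis by eventually_elim (auto simp: indicator_def split: if_splits)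
qed

text \<open>Bessel's inequality makes the partial sums converge. Their limit has the coefficients of
  \<phi>, so by completeness it is \<phi>.\<close>

lemma hermite_expansion:
 assumes \<phi>: "L2 gauss \<phi>"
 shows "Lp_tendsto gauss 2 (%N. poly (hs (hermite_coeff \<phi>) N)) \<phi>"
proof -
 obtain \<psi> where \<psi>: "L2 gauss \<psi>" "Lp_tendsto gauss 2 (%N. poly (hs (hermite_coeff \<phi>) N)) \<psi>"
  using hs_converges[OF hermite_bessel[OF \<phi>]] by blast
 have "hermite_coeff (%z. \<phi> z - \<psi> z) q = hermite_coeff \<phi> q - hermite_coeff \<psi> q" for q
  unfolding hermite_coeff_eq right_diff_distrib
  by (intro bi_diff L2_mult_integrable L2_gauss_poly \<phi> \<psi>)
 then have "AE z in gauss. \<phi> z - \<psi> z = 0"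
  using hs_limit_coeff[OF \<psi>] by (intro hermite_orthogonal_zero L2_diff \<phi> \<psi>) simp
 then have "AE z in gauss. \<psi> z = \<phi> z" by eventually_elim simp
 with \<psi>(2) show ?thesis by (subst Lp_tendsto_cong[symmetric]) auto
qed

lemma hermite_series_spec:
 assumes "summable (%q. (c q)\<^sup>2 / fact q)"
 shows "L2 gauss (hermite_series c)" "Lp_tendsto gauss 2 (%N. poly (hs c N)) (hermite_series c)"
proof -
 have eq: "(%N z. \<Sum>q\<le>N. c q / fact q * hermite q z) = (%N. poly (hs c N))"
  by (intro ext) (simp add: poly_hs hermite_eq)
 show "L2 gauss (hermite_series c)" "Lp_tendsto gauss 2 (%N. poly (hs c N)) (hermite_series c)"
  using someI_ex[OF hs_converges[OF assms]] unfolding hermite_series_def eq by auto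
qed

text \<open>One smooth approximant at finite distance suffices: it has all moments by polynomial
  growth, and \<phi> differs from it by a function in the same Lebesgue space.\<close>

lemma gauss_sobolev_moment:
 assumes "gauss_sobolev 0 (real (2 * m)) \<phi>" and m: "m \<ge> 1"
 shows "\<phi> \<in> borel_measurable borel" "integrable gauss (%z. \<phi> z ^ (2 * m))"
proof -
 from assms obtain f \<psi> where f\<psi>: "(\<forall>N. smooth_poly_growth_1 (f N)) \<and> \<psi> 0 = \<phi> \<and>
   (\<forall>j\<le>0. \<psi> j \<in> borel_measurable gauss \<and> Lp_tendsto gauss (real (2 * m)) (%N. (deriv ^^ j) (f N)) (\<psi> j))"
  unfolding gauss_sobolev_def by (elim exE)
 have f: "smooth_poly_growth_1 (f N)" for N using f\<psi> by simp
 have \<psi>: "\<psi> 0 = \<phi>" "\<psi> 0 \<in> borel_measurable gauss" "Lp_tendsto gauss (real (2 * m)) (%N. (deriv ^^ 0) (f N)) (\<psi> 0)"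
  using f\<psi> by auto
 show [measurable]: "\<phi> \<in> borel_measurable borel" using \<psi> by simp
 have "(%N. \<integral>\<^sup>+z. ennreal (\<bar>f N z - \<phi> z\<bar> powr real (2 * m)) \<partial>gauss) \<longlonglongrightarrow> 0" using \<psi> by (simp add: Lp_tendsto_def)
 then have "eventually (%N. (\<integral>\<^sup>+z. ennreal (\<bar>f N z - \<phi> z\<bar> powr real (2 * m)) \<partial>gauss) < 1) sequentially"
  by (rule order_tendstoD) simp
 then obtain N where N: "(\<integral>\<^sup>+z. ennreal (\<bar>f N z - \<phi> z\<bar> powr real (2 * m)) \<partial>gauss) < 1"
  by (auto simp: eventually_sequentially)
 have s: "(\<forall>x. f N differentiable (at x))" "\<exists>C k. \<forall>x. \<bar>f N x\<bar> \<le> C * (1 + \<bar>x\<bar>) ^ k"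
  using f[of N, unfolded smooth_poly_growth_1_def, rule_format, of 0] by auto
 have "contU (f N)"
  using s(1) by (simp add: continuous_on_eq_continuous_at differentiable_imp_continuous_within)
 then have [measurable]: "f N \<in> borel_measurable borel" by (rule borel_measurable_continuous_onI)
 obtain C k where C: "\<And>x. \<bar>f N x\<bar> \<le> C * (1 + \<bar>x\<bar>) ^ k" using s(2) by blast
 have "exp_bounded (f N)"
  by (rule exp_bounded_mono[OF _ C])
   (intro exp_bounded_mult exp_bounded_const exp_bounded_pow exp_bounded_add exp_bounded_abs exp_bounded_id)
 then have fi: "integrable gauss (%z. f N z ^ (2 * m))" by (intro exp_bounded_integrable exp_bounded_pow) measurable
 have e: "ennreal (\<bar>x\<bar> powr real (2 * m)) \<ge> ennreal (x ^ (2 * m))" for x :: real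
  using m powr_realpow[of "\<bar>x\<bar>" "2 * m"] by (cases "x = 0") (simp_all add: power_even_abs)
 have di: "integrable gauss (%z. (f N z - \<phi> z) ^ (2 * m))"
 proof (rule integrableI_nonneg)
  have "(\<integral>\<^sup>+z. ennreal ((f N z - \<phi> z) ^ (2 * m)) \<partial>gauss) \<le> (\<integral>\<^sup>+z. ennreal (\<bar>f N z - \<phi> z\<bar> powr real (2 * m)) \<partial>gauss)"
   by (intro nn_integral_mono e)
  then show "(\<integral>\<^sup>+z. ennreal ((f N z - \<phi> z) ^ (2 * m)) \<partial>gauss) < \<infinity>"
   using N ennreal_one_less_top unfolding infinity_ennreal_def by (blast intro: order_le_less_trans order_less_trans)
 qed (auto simp: power_mult)
 show "integrable gauss (%z. \<phi> z ^ (2 * m))"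
 proof (rule bi_int_bound)
  show "integrable gauss (%z. 2 ^ (2 * m) * (f N z ^ (2 * m) + (f N z - \<phi> z) ^ (2 * m)))"
   by (intro integrable_mult_right bi_int_add fi di)
  have "norm (x ^ (2 * m)) \<le> norm (2 ^ (2 * m) * (y ^ (2 * m) + (y - x) ^ (2 * m)))" for x y :: real
  proof -
   have "\<bar>x\<bar> \<le> \<bar>y\<bar> + \<bar>y - x\<bar>" by linarith
   also have "... \<le> 2 * max \<bar>y\<bar> \<bar>y - x\<bar>" by (simp add: max_def)
   finally have "\<bar>x\<bar> \<le> 2 * max \<bar>y\<bar> \<bar>y - x\<bar>" .
   then have "\<bar>x\<bar> ^ (2 * m) \<le> 2 ^ (2 * m) * max \<bar>y\<bar> \<bar>y - x\<bar> ^ (2 * m)"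
    using power_mono[of "\<bar>x\<bar>" "2 * max \<bar>y\<bar> \<bar>y - x\<bar>" "2 * m"] by (simp only: power_mult_distrib abs_ge_zero)
   also have "max \<bar>y\<bar> \<bar>y - x\<bar> ^ (2 * m) \<le> \<bar>y\<bar> ^ (2 * m) + \<bar>y - x\<bar> ^ (2 * m)" by (simp add: max_def)
   finally show ?thesis by (simp add: power_even_abs)
  qed
  then show "AE z in gauss. norm (\<phi> z ^ (2 * m)) \<le> norm (2 ^ (2 * m) * (f N z ^ (2 * m) + (f N z - \<phi> z) ^ (2 * m)))" by blast
 qed measurable
qed

text \<open>A Hermite coefficient is at most the Laplace transform, because all coefficients are nonnegative;
 the transform is controlled by the $L^{2m}$ norm, and the optimal argument is of order $\sqrt q$.\<close>

lemma hermite_coeff_rapid: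
 assumes \<phi>: "L2 gauss \<phi>" and nn: "\<And>q. hermite_coeff \<phi> q \<ge> 0"
  and mom: "\<And>m. m \<ge> 1 ==> integrable gauss (%z. \<phi> z ^ (2 * m))"
 shows "rapid (hermite_coeff \<phi>)"
proof (rule rapidI)
 fix R :: real assume "R \<ge> 1"
 let ?c = "hermite_coeff \<phi>"
 \<comment> \<open>The order of the moment is matched to R: k = 2 m - 1 \<ge> (R e)^2 is what the
   last estimate consumes.\<close>
 obtain m :: nat where m: "real m \<ge> (R * exp 1)\<^sup>2" "m \<ge> 1"
  by (metis One_nat_def Suc_leI max.bounded_iff max.cobounded2 of_nat_max reals_Archimedean2 less_imp_le linorder_not_less of_nat_0_less_iff zero_less_one le_max_iff_disj)
 define k where "k = real (2 * m - 1)"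
 have k: "k \<ge> 1" "k \<ge> (R * exp 1)\<^sup>2" "real (2 * m) = k + 1" using m by (auto simp: k_def of_nat_diff)
 define s where "s = (k + 1) / k"
 have [measurable]: "\<phi> \<in> borel_measurable borel" using \<phi> by (simp add: L2_def)
 \<comment> \<open>A form of Young's inequality with conjugate exponents k + 1 and s, by cases on
   whether \<phi> z reaches exp (\<beta> / k).\<close>
 have pt: "\<phi> z * exp \<beta> \<le> \<phi> z ^ (2 * m) + exp (s * \<beta>)" for z \<beta>
 proof (cases "exp (\<beta> / k) \<le> \<phi> z")
  case True
  have "exp \<beta> = exp (\<beta> / k) ^ (2 * m - 1)"
   using k(1) unfolding exp_of_nat_mult[symmetric] k_def[symmetric] by simp
  also have "... \<le> \<phi> z ^ (2 * m - 1)" by (rule power_mono[OF True]) simp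
  finally have "\<phi> z * exp \<beta> \<le> \<phi> z * \<phi> z ^ (2 * m - 1)"
   using True exp_gt_zero[of "\<beta> / k"] by (intro mult_left_mono) linarith+
  also have "... = \<phi> z ^ (2 * m)" using m(2) by (cases m) auto
  finally show ?thesis using exp_gt_zero[of "s * \<beta>"] by linarith
 next
  case False
  then have "\<phi> z * exp \<beta> \<le> exp (\<beta> / k) * exp \<beta>" by (intro mult_right_mono) auto
  also have "... = exp (s * \<beta>)" using k(1) unfolding exp_add[symmetric] by (simp add: s_def field_simps)
  finally show ?thesis by (simp add: power_mult add_increasing)
 qed
 define B where "B = (LINT z|gauss. \<phi> z ^ (2 * m))"
 have B0: "B \<ge> 0" by (simp add: B_def power_mult)
 \<comment> \<open>Multiplying by exp (- t^2 / 2) normalizes the Laplace transform to the series of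
   c q t^q / q!, and nonnegativity keeps a single term below the sum. The exponent t^2 / k is the
   gain from the high moment.\<close>
 have key: "?c q * t ^ q \<le> (B + 1) * exp (t\<^sup>2 / k) * fact q" if t: "t \<ge> 0" for q t
 proof -
  have e: "L2 gauss (%z. exp (t * z))" unfolding L2_def by (auto intro!: exp_bounded_integrable exp_bounded_pow exp_bounded_exp)
  have "(%N. \<integral>z. exp (t * z) * poly (hs ?c N) z \<partial>gauss) \<longlonglongrightarrow> (LINT z|gauss. exp (t * z) * \<phi> z)"
   by (rule L2_tendsto_inner[OF e e Lp_tendsto_const L2_gauss_poly \<phi> hermite_expansion[OF \<phi>]])
  moreover have eN: "(LINT z|gauss. exp (t * z) * poly (hs ?c N) z) = (\<Sum>q\<le>N. ?c q / fact q * (t ^ q * exp (t\<^sup>2 / 2)))" for N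
   by (subst integral_hs[OF L2_mult_integrable[OF e L2_gauss_poly]]) (simp only: mult.commute[of "exp (t * _)"] gauss_hermp_exp)
  have "?c q / fact q * (t ^ q * exp (t\<^sup>2 / 2)) \<le> (LINT z|gauss. exp (t * z) * poly (hs ?c N) z)" if "q \<le> N" for N
   unfolding eN using that nn t by (intro member_le_sum) auto
  ultimately have "?c q / fact q * (t ^ q * exp (t\<^sup>2 / 2)) \<le> (LINT z|gauss. exp (t * z) * \<phi> z)"
   by (intro LIMSEQ_le_const) blast+
  then have "exp (- (t\<^sup>2 / 2)) * (?c q / fact q * (t ^ q * exp (t\<^sup>2 / 2))) \<le> exp (- (t\<^sup>2 / 2)) * (LINT z|gauss. exp (t * z) * \<phi> z)"
   by (intro mult_left_mono) auto
  also have "exp (- (t\<^sup>2 / 2)) * (?c q / fact q * (t ^ q * exp (t\<^sup>2 / 2))) = ?c q / fact q * t ^ q"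
   by (simp add: exp_minus)
  also have "exp (- (t\<^sup>2 / 2)) * (LINT z|gauss. exp (t * z) * \<phi> z) = (LINT z|gauss. exp (- (t\<^sup>2 / 2)) * (exp (t * z) * \<phi> z))"
   by simp
  also have "... \<le> (LINT z|gauss. \<phi> z ^ (2 * m) + exp (- (s * (t\<^sup>2 / 2))) * exp ((s * t) * z))"
  proof (rule integral_mono)
   show "integrable gauss (%z. exp (- (t\<^sup>2 / 2)) * (exp (t * z) * \<phi> z))"
    by (intro integrable_mult_right L2_mult_integrable e \<phi>)
   show "integrable gauss (%z. \<phi> z ^ (2 * m) + exp (- (s * (t\<^sup>2 / 2))) * exp ((s * t) * z))"
    by (intro bi_int_add integrable_mult_right mom m gauss_exp)
   fix z
   show "exp (- (t\<^sup>2 / 2)) * (exp (t * z) * \<phi> z) \<le> \<phi> z ^ (2 * m) + exp (- (s * (t\<^sup>2 / 2))) * exp ((s * t) * z)"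
    using pt[of z "- (t\<^sup>2 / 2) + t * z"] unfolding distrib_left exp_add by (simp add: mult_ac)
  qed
  also have "... = B + exp (- (s * (t\<^sup>2 / 2))) * exp ((s * t)\<^sup>2 / 2)"
   using mom[OF m(2)] gauss_exp[of "s * t"] by (simp add: B_def)
  also have "exp (- (s * (t\<^sup>2 / 2))) * exp ((s * t)\<^sup>2 / 2) = exp (s * (s - 1) / 2 * t\<^sup>2)"
   unfolding exp_add[symmetric] by (rule arg_cong[of _ _ exp]) (simp add: power2_eq_square algebra_simps)
  also have "... \<le> exp (t\<^sup>2 / k)"
  proof -
   have s1: "s - 1 = 1 / k" using k(1) by (simp add: s_def field_simps)
   have "s \<le> 2" using k(1) by (simp add: s_def field_simps)
   then have "s * (s - 1) / 2 \<le> 1 / k" unfolding s1 using k(1) by (simp add: field_simps)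
   then have "s * (s - 1) / 2 * t\<^sup>2 \<le> 1 / k * t\<^sup>2" by (rule mult_right_mono) simp
   then show ?thesis by simp
  qed
  also have "B + exp (t\<^sup>2 / k) \<le> (B + 1) * exp (t\<^sup>2 / k)"
  proof -
   have "B * 1 \<le> B * exp (t\<^sup>2 / k)" using k(1) by (intro mult_left_mono B0) simp
   then show ?thesis by (simp add: distrib_right)
  qed
  finally show ?thesis by (simp add: field_simps)
 qed
 have "\<bar>?c q\<bar> * R ^ q \<le> (B + 1) * sqrt (fact q)" for q
 proof (cases "q = 0")
  case True
  then show ?thesis using key[of 0 0] nn[of 0] by simp
 next
  case False
  \<comment> \<open>Then t^2 / k = q, and t^q supplies (sqrt q)^q (R e)^q. This pays for exp q, for
    one factor sqrt (q!) and for R^q.\<close>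
  define t where "t = sqrt (real q) * sqrt k"
  have t: "t \<ge> 0" "t\<^sup>2 / k = real q" using k(1) by (auto simp: t_def power_mult_distrib)
  have "R * exp 1 \<le> sqrt k" using k(2) \<open>R \<ge> 1\<close> by (simp add: real_le_rsqrt)
  then have "(R * exp 1) ^ q \<le> sqrt k ^ q" using \<open>R \<ge> 1\<close> by (intro power_mono) auto
  then have "?c q * (sqrt (real q) ^ q * (R * exp 1) ^ q) \<le> ?c q * t ^ q"
   unfolding t_def power_mult_distrib[of "sqrt (real q)"] using nn by (intro mult_left_mono) auto
  also have "... \<le> (B + 1) * exp (real q) * fact q" using key[OF t(1), of q] by (simp only: t(2))
  also have "... = exp (real q) * ((B + 1) * sqrt (fact q) * sqrt (fact q))" by simp
  also have "... \<le> exp (real q) * ((B + 1) * sqrt (fact q) * sqrt (real q) ^ q)"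
   using B0 by (intro mult_left_mono sqrt_fact_le) auto
  finally have "(exp (real q) * sqrt (real q) ^ q) * (?c q * R ^ q) \<le> (exp (real q) * sqrt (real q) ^ q) * ((B + 1) * sqrt (fact q))"
   by (simp add: power_mult_distrib mult_ac exp_of_nat_mult[of q 1, simplified])
  then have "?c q * R ^ q \<le> (B + 1) * sqrt (fact q)"
   by (rule mult_left_le_imp_le) (use False in simp)
  then show ?thesis using nn by simp
 qed
 then show "\<exists>B. \<forall>q. \<bar>?c q\<bar> * R ^ q \<le> B * sqrt (fact q)" by blast
qed

text \<open>\<open>hermite_coeff_rapid\<close> applies to the series with absolute values, whose
  coefficients are nonnegative. That series omits orders 0 and 1; they are restored by enlarging the
  constant.\<close>

lemma assumption_A_rapid:
 assumes \<phi>: "L2 gauss \<phi>" and A: "assumption_A \<phi>"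
 shows "rapid (hermite_coeff \<phi>)"
proof -
 define c where "c q = (if q \<ge> 2 then \<bar>hermite_coeff \<phi> q\<bar> else 0)" for q
 have sc: "summable (%q. (c q)\<^sup>2 / fact q)"
  by (rule summable_comparison_test'[OF hermite_bessel[OF \<phi>], of 0]) (auto simp: c_def)
 note h = hermite_series_spec[OF sc]
 have r: "gauss_regular (hermite_series c)" using A unfolding assumption_A_def c_def[abs_def] by simp
 have hc: "hermite_coeff (hermite_series c) = c" by (rule ext) (rule hs_limit_coeff[OF h])
 have "rapid c"
 proof (subst hc[symmetric], rule hermite_coeff_rapid[OF h(1)])
  show "hermite_coeff (hermite_series c) q \<ge> 0" for q unfolding hc by (simp add: c_def)
  fix m :: nat assume "m \<ge> 1"
  then have "gauss_sobolev 0 (real (2 * m)) (hermite_series c)" using r unfolding gauss_regular_def by simp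
  then show "integrable gauss (%z. hermite_series c z ^ (2 * m))" using \<open>m \<ge> 1\<close> by (rule gauss_sobolev_moment)
 qed
 show ?thesis unfolding rapid_def
 proof (intro allI impI)
  fix R :: real assume R: "R > 0"
  let ?b = "hermite_coeff \<phi>"
  obtain B where B: "\<And>q. \<bar>c q\<bar> * R ^ q \<le> B * sqrt (fact q)" using \<open>rapid c\<close> R unfolding rapid_def by blast
  have "\<bar>?b q\<bar> * R ^ q \<le> (B + \<bar>?b 0\<bar> + \<bar>?b 1\<bar> * R) * sqrt (fact q)" for q
  proof -
   have B0: "B \<ge> 0" using B[of 0] by (simp add: c_def)
   consider "q = 0" | "q = 1" | "q \<ge> 2" by linarith
   then show ?thesis
   proof cases
    case 3
    have "\<bar>?b q\<bar> * R ^ q \<le> B * sqrt (fact q)" using B[of q] 3 by (simp add: c_def)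
    also have "... \<le> (B + \<bar>?b 0\<bar> + \<bar>?b 1\<bar> * R) * sqrt (fact q)" using R by (intro mult_right_mono) auto
    finally show ?thesis .
   qed (use B0 R in auto)
  qed
  then show "\<exists>B. \<forall>q. \<bar>?b q\<bar> * R ^ q \<le> B * sqrt (fact q)" by blast
 qed
qed

lemma rapid_summable:
 assumes "rapid c" shows "summable (%q. (c q)\<^sup>2 / fact q)"
proof -
 obtain B where B: "\<And>q. \<bar>c q\<bar> * 2 ^ q \<le> B * sqrt (fact q)" using assms unfolding rapid_def by (meson zero_less_numeral)
 have le: "(c q)\<^sup>2 / fact q \<le> B\<^sup>2 * (1 / 4) ^ q" for q
 proof -
  have "(\<bar>c q\<bar> * 2 ^ q)\<^sup>2 \<le> (B * sqrt (fact q))\<^sup>2" by (rule power_mono[OF B]) simp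
  moreover have "((2::real) ^ q)\<^sup>2 = 4 ^ q" by (simp only: power_even_eq[symmetric] power_mult) simp
  ultimately have "(c q)\<^sup>2 * 4 ^ q \<le> B\<^sup>2 * fact q" by (simp add: power_mult_distrib)
  then show ?thesis by (simp add: field_simps power_one_over)
 qed
 show ?thesis
 proof (rule summable_comparison_test'[of "%q. B\<^sup>2 * (1 / 4) ^ q" 0])
  show "summable (%q. B\<^sup>2 * (1 / 4) ^ q)" by (intro summable_mult summable_geometric) simp
  show "norm ((c q)\<^sup>2 / fact q) \<le> B\<^sup>2 * (1 / 4) ^ q" for q using le[of q] by (simp only: real_norm_def abs_of_nonneg divide_nonneg_nonneg zero_le_power2 fact_ge_zero)
 qed
qed

section \<open>The harmonic kernel on the sphere\<close>

lemma sphere_moment_rec: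
 fixes x :: "'a::euclidean_space"
 assumes "norm x = 1"
 shows "(real DIM('a) + real n - 1) * (LINT z|sphere_measure. (x \<bullet> z) ^ Suc n) = real n * (LINT z|sphere_measure. (x \<bullet> z) ^ (n - 1))"
 using bimoment_rec[of n 0 x x] assms by (simp add: bimoment_def dot_square_norm)

text \<open>\<open>bimoment_rec\<close> with j = 0 is \<open>ibp\<close> for monomials. The defect L
  is additive and every polynomial is a sum of monomials, so L vanishes identically.\<close>

lemma gegenbauer_functional_sphere:
 fixes x :: "'a::euclidean_space"
 assumes d: "d \<ge> 2" "DIM('a) = d + 1" and x: "norm x = 1"
 shows "gegenbauer_functional (%p. \<integral>z. poly p (x \<bullet> z) \<partial>sphere_measure) ((real d - 1) / 2) (sphere_mass d)"
proof -
 define I where "I p = (\<integral>z. poly p (x \<bullet> z) \<partial>(sphere_measure :: 'a measure))" for p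
 have int: "integrable sphere_measure (%z. poly p (x \<bullet> z))" for p
  by (rule continuous_sphere_integrable(1)[OF poly_inner_continuous])
 have add: "I (p + q) = I p + I q" for p q using int by (simp add: I_def)
 have smult: "I (smult c p) = c * I p" for c p by (simp add: I_def)
 define m where "m n = (\<integral>z. (x \<bullet> z) ^ n \<partial>(sphere_measure :: 'a measure))" for n
 have Im: "I (monom a n) = a * m n" for a n by (simp add: I_def m_def poly_monom)
 define L where "L p = real d * I ([:0, 1:] * p) - I ([:1, 0, -1:] * pderiv p)" for p
 have L_add: "L (p + q) = L p + L q" for p q
  unfolding L_def distrib_left add pderiv_add by (simp only: add_diff_add)
 have L0: "L 0 = 0" using smult[of 0 0] by (simp add: L_def)
 have L_sum: "L (\<Sum>i\<in>A. f i) = (\<Sum>i\<in>A. L (f i))" if "finite A" for A and f :: "nat => real poly"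
  using that by (induction A rule: finite_induct) (auto simp: L0 L_add)
 have Lm: "L (monom a n) = 0" for a n
 proof (cases n)
  case 0
  have "m 1 = 0"
  proof -
   have "(real DIM('a) + real 0 - 1) * m 1 = 0" using sphere_moment_rec[OF x, of 0] by (simp add: m_def)
   then show ?thesis using d by simp
  qed
  have 1: "[:0, 1:] * monom a 0 = monom a 1" by (simp add: monom_altdef)
  have 2: "pderiv (monom a 0) = 0" by (simp add: pderiv_monom)
  show ?thesis unfolding L_def 0 1 2 using \<open>m 1 = 0\<close> Im[of a 1] smult[of 0 0] by simp
 next
  case (Suc k)
  have 1: "[:0, 1:] * monom a n = monom a (Suc n)" by (simp add: monom_Suc)
  have 2: "pderiv (monom a n) = monom (real n * a) k" by (simp add: pderiv_monom Suc)
  have 3: "[:1, 0, -1:] * monom b k = monom b k + smult (-1) (monom b (Suc n))" for b :: real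
   by (simp only: mult_pCons_left monom_Suc Suc smult_pCons smult_1_left smult_0_left mult_zero_left) simp
  have "(real d + real n) * m (Suc n) = real n * m k"
   using sphere_moment_rec[OF x, of n] d Suc by (simp add: m_def add_ac)
  then have "real d * m (Suc n) = real n * (m k - m (Suc n))" by (simp add: algebra_simps)
  then have "a * (real d * m (Suc n)) = a * (real n * (m k - m (Suc n)))" by simp
  then show ?thesis
   unfolding L_def 1 2 3 add smult Im by (simp add: algebra_simps)
 qed
 have L: "L p = 0" for p
 proof -
  have "L p = L (\<Sum>i\<le>degree p. monom (coeff p i) i)" by (simp only: poly_as_sum_of_monoms)
  also have "... = 0" by (simp add: L_sum Lm)
  finally show ?thesis .
 qed
 show ?thesis
  unfolding I_def[symmetric]
 proof
  have d1: "2 * ((real d - 1) / 2) + 1 = real d" by (simp add: field_simps)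
  show "I 1 = sphere_mass d"
   using emeasure_sphere_measure_space[OF d(2)] by (simp add: I_def measure_def sphere_mass_def)
  show "(2 * ((real d - 1) / 2) + 1) * I ([:0, 1:] * p) = I ([:1, 0, -1:] * pderiv p)" for p
   using L[of p] unfolding L_def d1 by linarith
  show "(real d - 1) / 2 > 0" using d by simp
 qed (rule add smult)+
qed

lemma sphere_mass_pos: "sphere_mass d > 0"
proof -
 have "Gamma ((real d + 1) / 2) > 0" by (intro Gamma_real_pos) simp
 then show ?thesis by (simp add: sphere_mass_def)
qed

text \<open>The quotient of pochhammer symbol and factorial is the value at 1 of the Gegenbauer
  polynomial, the quantity that has to cancel in \<open>harmonic_kernel_norm\<close>.\<close>

lemma harmonic_dim_eq:
 assumes "d \<ge> 2" "l \<ge> 1"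
 shows "harmonic_dim d l = (2 * real l + real d - 1) / (real d - 1) * (pochhammer (real d - 1) l / fact l)"
proof -
 have p: "pochhammer (real d - 1) l / fact l = real ((l + d - 2) choose l)"
 proof -
  have "real ((l + d - 2) choose l) = (real (l + d - 2)) gchoose l" by (rule binomial_gbinomial)
  also have "... = pochhammer (real (l + d - 2) - real l + 1) l / fact l" by (rule gbinomial_pochhammer')
  also have "real (l + d - 2) - real l + 1 = real d - 1" using assms by (simp add: of_nat_diff)
  finally show ?thesis by simp
 qed
 obtain k where l: "l = Suc k" using assms by (cases l) auto
 have "Suc k * ((l + d - 2) choose Suc k) = (l + d - 2 - k) * ((l + d - 2) choose k)"
  by (simp only: binomial_absorption binomial_absorb_comp)
 moreover have "l + d - 2 - k = d - 1" "l - 1 = k" using assms l by simp_all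
 ultimately have "l * ((l + d - 2) choose l) = (d - 1) * ((l + d - 2) choose (l - 1))" by (simp only: l[symmetric])
 from arg_cong[OF this, of real] have "real l * real ((l + d - 2) choose l) = real ((l + d - 2) choose (l - 1)) * (real d - 1)"
  using assms by (simp add: of_nat_diff mult.commute)
 then have "real ((l + d - 2) choose (l - 1)) / real l = real ((l + d - 2) choose l) / (real d - 1)"
  using assms by (simp add: field_simps)
 then have "(2 * real l + real d - 1) * (real ((l + d - 2) choose (l - 1)) / real l) = (2 * real l + real d - 1) * (real ((l + d - 2) choose l) / (real d - 1))" by simp
 then show ?thesis unfolding p harmonic_dim_def by simp
qed

lemma harmonic_kernel_commute: "harmonic_kernel d l x z = harmonic_kernel d l z x"
 by (simp add: harmonic_kernel_def inner_commute)

text \<open>Dimension over mass, the inverse square of the value at 1 and the Gegenbauer norm from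
  \<open>norm_C\<close> multiply to one. The vanishing mean is \<open>I_C\<close>. These give unit
  variance of the field and, later, mean zero of the coefficient functions.\<close>

lemma harmonic_kernel_norm:
 fixes x :: "'a::euclidean_space"
 assumes d: "d \<ge> 2" "DIM('a) = d + 1" and l: "l \<ge> 1" and x: "norm x = 1"
 shows "(LINT z|sphere_measure. (harmonic_kernel d l x z)\<^sup>2) = 1"
  and "(LINT z|sphere_measure. harmonic_kernel d l x z) = 0"
proof -
 interpret gegenbauer_functional "%p. \<integral>z. poly p (x \<bullet> z) \<partial>sphere_measure" "(real d - 1) / 2" "sphere_mass d"
  by (rule gegenbauer_functional_sphere[OF d x])
 define c1 where "c1 = poly (C l) 1"
 define P where "P = pochhammer (real d - 1) l / fact l"
 have e: "2 * ((real d - 1) / 2) = real d - 1" by simp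
 have c1: "c1 = P" using poly_gegenbauer_1[of "(real d - 1) / 2" l] unfolding e c1_def P_def .
 have P: "P > 0" unfolding P_def using d by (intro divide_pos_pos pochhammer_pos) auto
 have G: "gegenbauer_sphere d l = smult (1 / P) (C l)"
  using c1 by (simp add: gegenbauer_sphere_def Let_def c1_def)
 have nn: "harmonic_dim d l / sphere_mass d \<ge> 0"
  using sphere_mass_pos[of d] P d unfolding harmonic_dim_eq[OF d(1) l] P_def[symmetric] by (intro divide_nonneg_pos mult_nonneg_nonneg) auto
 have "(LINT z|sphere_measure. (harmonic_kernel d l x z)\<^sup>2)
   = (LINT z|sphere_measure. (harmonic_dim d l / sphere_mass d) * (1 / P)\<^sup>2 * poly (C l * C l) (x \<bullet> z))"
  unfolding harmonic_kernel_def G poly_smult power_mult_distrib real_sqrt_pow2[OF nn] poly_mult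
  by (simp only: power2_eq_square mult.assoc)
 also have "... = (harmonic_dim d l / sphere_mass d) * (1 / P)\<^sup>2 * (LINT z|sphere_measure. poly (C l * C l) (x \<bullet> z))"
  by (rule integral_mult_right_zero)
 also have "... = (harmonic_dim d l / sphere_mass d) * (1 / P)\<^sup>2 * (sphere_mass d * (((real d - 1) / 2) / (real l + (real d - 1) / 2)) * P)"
  unfolding norm_C e P_def ..
 also have "... = 1"
 proof -
  have h: "((real d - 1) / 2) / (real l + (real d - 1) / 2) = (real d - 1) / (2 * real l + real d - 1)"
  proof -
   have "real l + (real d - 1) / 2 = (2 * real l + real d - 1) / 2" by (simp add: field_simps)
   then show ?thesis by simp
  qed
  moreover have "2 * real l + real d - 1 > 0" "real d - 1 > 0" using d by auto
  ultimately show ?thesis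
   unfolding harmonic_dim_eq[OF d(1) l] P_def[symmetric] h using P sphere_mass_pos[of d]
   by (simp add: power2_eq_square)
 qed
 finally show "(LINT z|sphere_measure. (harmonic_kernel d l x z)\<^sup>2) = 1" .
 have "(LINT z|sphere_measure. harmonic_kernel d l x z) = sqrt (harmonic_dim d l / sphere_mass d) * ((1 / P) * (LINT z|sphere_measure. poly (C l) (x \<bullet> z)))"
  unfolding harmonic_kernel_def G by (simp only: integral_mult_right_zero poly_smult)
 then show "(LINT z|sphere_measure. harmonic_kernel d l x z) = 0" using I_C[OF l] by simp
qed

lemma harmonic_kernel_correlation:
 assumes d: "d \<ge> 2" "DIM('a::euclidean_space) = d + 1"
 shows "\<exists>F. \<forall>x y :: 'a. norm x = 1 \<longrightarrow> norm y = 1 \<longrightarrow>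
   (LINT z|sphere_measure. harmonic_kernel d l x z * harmonic_kernel d l y z) = poly F (x \<bullet> y)"
proof -
 define c where "c = sqrt (harmonic_dim d l / sphere_mass d)"
 have "DIM('a) \<ge> 2" using d by simp
 from sphere_poly_product[OF this, of "smult c (gegenbauer_sphere d l)" "smult c (gegenbauer_sphere d l)"]
 show ?thesis unfolding harmonic_kernel_def c_def[symmetric] by (simp only: poly_smult)
qed

lemma sphere_poly_integral_const:
 assumes "DIM('a::euclidean_space) \<ge> 2"
 shows "\<exists>A. \<forall>x :: 'a. norm x = 1 \<longrightarrow> (LINT z|sphere_measure. poly p (x \<bullet> z)) = A"
proof -
 obtain F where F: "\<forall>x y :: 'a. norm x = 1 \<longrightarrow> norm y = 1 \<longrightarrow> (LINT z|sphere_measure. poly p (x \<bullet> z) * poly 1 (y \<bullet> z)) = poly F (x \<bullet> y)"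
  using sphere_poly_product[OF assms, of p 1] by blast
 have "(LINT z|sphere_measure. poly p (x \<bullet> z)) = poly F 1" if "norm x = 1" for x :: 'a
  using F[rule_format, OF that that] that by (simp add: dot_square_norm)
 then show ?thesis by blast
qed

section \<open>Fields with a finite expansion\<close>

text \<open>On each eigenspace the field is a finite combination \<open>T x = (\<Sum>i<r. a i x * wiener M W (e i))\<close> of independent
 standard Gaussian variables; everything below depends on the degree only through \<open>A\<close>, the squared norm of
 a row of the covariance kernel.\<close>

locale frame = white_noise_space M W d
 for M :: "'w measure" and W :: "'a::euclidean_space set => 'w => real" and d :: nat +
 fixes r :: nat and e a :: "nat => 'a => real" and A :: real
 assumes e_L2: "L2 S (e i)"
  and e_on: "i < r ==> j < r ==> (LINT x|S. e i x * e j x) = (if i = j then 1 else 0)"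
  and a_cont: "contU (a i)"
  and a_norm: "norm x = 1 ==> (\<Sum>i<r. (a i x)\<^sup>2) = 1"
  and a_int: "i < r ==> (LINT x|S. a i x) = 0"
  and a_A: "norm x = 1 ==> (LINT y|S. (\<Sum>i<r. a i x * a i y)\<^sup>2) = A"
begin

abbreviation \<mu> :: real where "\<mu> \<equiv> sphere_mass d"

definition \<xi> :: "'w => nat => real" where "\<xi> om = (%i. wi (e i) om)"

definition lin :: "(nat => real) => 'a => real" where "lin v x = (\<Sum>i<r. a i x * v i)"

text \<open>The functional of the field read in Gaussian coordinates v. The weight \<alpha> is there
  because each partial derivative in v multiplies the integrand by a coefficient function
  \<open>a i\<close>, collected in \<open>mon\<close>.\<close>

definition sph :: "(real => real) => ('a => real) => (nat => real) => real" where
 "sph \<psi> \<alpha> v = (LINT x|S. \<psi> (lin v x) * \<alpha> x)"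

definition mon :: "nat list => 'a => real" where "mon is x = (\<Prod>i\<leftarrow>is. a i x)"

lemma mon_simps [simp]: "mon [] = (%x. 1)" "mon (i # is) = (%x. a i x * mon is x)"
 by (auto simp: mon_def)

lemma mon_cont: "contU (mon is)"
 by (induction "is") (auto intro!: continuous_intros a_cont)

lemma lin_cont: "contU (lin v)"
 unfolding lin_def[abs_def] by (intro continuous_intros a_cont)

lemma poly_lin_cont: "contU (%x. poly p (lin v x))"
 by (intro continuous_intros lin_cont)

lemmas cint = continuous_sphere_integrable(1)

lemma S_mass: "measure S (space S) = \<mu>"
 using emeasure_sphere_measure_space[OF dim] sphere_mass_pos[of d] by (simp add: measure_def)

lemma sph_add:
 assumes "contU \<alpha>"
 shows "sph (poly (p + q)) \<alpha> v = sph (poly p) \<alpha> v + sph (poly q) \<alpha> v"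
 unfolding sph_def poly_add distrib_right
 by (intro bi_add cint continuous_intros poly_lin_cont assms)

text \<open>Splitting off one factor \<open>lin v x\<close> exposes the coordinates v i. Along this
  recursion on the polynomial, both polynomiality in v and the partial derivatives are obtained by
  induction.\<close>

lemma sph_pCons:
 assumes \<alpha>: "contU \<alpha>"
 shows "sph (poly (pCons c q)) \<alpha> v = c * (LINT x|S. \<alpha> x) + (\<Sum>i<r. v i * sph (poly q) (%x. a i x * \<alpha> x) v)"
proof -
 have "poly (pCons c q) (lin v x) * \<alpha> x = c * \<alpha> x + (\<Sum>i<r. v i * (poly q (lin v x) * (a i x * \<alpha> x)))" for x
 proof -
  have "lin v x * poly q (lin v x) * \<alpha> x = (\<Sum>i<r. a i x * v i) * (poly q (lin v x) * \<alpha> x)" by (simp add: lin_def)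
  also have "... = (\<Sum>i<r. v i * (poly q (lin v x) * (a i x * \<alpha> x)))"
   unfolding sum_distrib_right by (intro sum.cong refl) (simp only: mult_ac)
  finally show ?thesis by (simp add: distrib_right)
 qed
 then have "sph (poly (pCons c q)) \<alpha> v = (LINT x|S. c * \<alpha> x + (\<Sum>i<r. v i * (poly q (lin v x) * (a i x * \<alpha> x))))"
  by (simp only: sph_def)
 also have "... = (LINT x|S. c * \<alpha> x) + (LINT x|S. (\<Sum>i<r. v i * (poly q (lin v x) * (a i x * \<alpha> x))))"
  by (intro bi_add cint continuous_intros poly_lin_cont a_cont \<alpha>)
 also have "(LINT x|S. (\<Sum>i<r. v i * (poly q (lin v x) * (a i x * \<alpha> x)))) = (\<Sum>i<r. \<integral>x. v i * (poly q (lin v x) * (a i x * \<alpha> x)) \<partial>S)"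
  by (intro bi_sum cint continuous_intros poly_lin_cont a_cont \<alpha>)
 finally show ?thesis by (simp only: integral_mult_right_zero sph_def)
qed

lemma sph_zero: "sph (poly 0) \<alpha> v = 0" by (simp add: sph_def)

lemma sph_polyfun: "contU \<alpha> ==> polyfun r (sph (poly p) \<alpha>)"
proof (induction p arbitrary: \<alpha>)
 case 0
 show ?case unfolding sph_zero[abs_def] by (rule polyfun_const)
next
 case (pCons c q)
 have "polyfun r (%v. c * (LINT x|S. \<alpha> x) + (\<Sum>i<r. v i * sph (poly q) (%x. a i x * \<alpha> x) v))"
  by (intro polyfun_add polyfun_const polyfun_sum polyfun_mult polyfun_var pCons.IH continuous_intros a_cont pCons.prems) simp
 then show ?case using sph_pCons[OF pCons.prems, of c q] by presburger
qed

lemma sph_has_partial: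
 assumes i: "i < r"
 shows "contU \<alpha> ==> ((%t. sph (poly p) \<alpha> (v(i := t))) has_real_derivative sph (poly (pderiv p)) (%x. a i x * \<alpha> x) (v(i := t))) (at t)"
proof (induction p arbitrary: \<alpha>)
 case 0
 then show ?case by (simp add: sph_def)
next
 case (pCons c q)
 let ?F = "%j. sph (poly q) (%x. a j x * \<alpha> x)" and ?F' = "%j. sph (poly (pderiv q)) (%x. a i x * (a j x * \<alpha> x))"
 have F: "((%t. ?F j (v(i := t))) has_real_derivative ?F' j (v(i := t))) (at t)" for j
  by (rule pCons.IH) (intro continuous_intros a_cont pCons.prems)
 have id: "((%t. (v(i := t)) j) has_real_derivative (if j = i then 1 else 0)) (at t)" for j
  by (cases "j = i") (auto intro!: derivative_eq_intros)
 have "((%t. c * (LINT x|S. \<alpha> x) + (\<Sum>j<r. (v(i := t)) j * ?F j (v(i := t)))) has_real_derivative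
   0 + (\<Sum>j<r. (if j = i then 1 else 0) * ?F j (v(i := t)) + ?F' j (v(i := t)) * (v(i := t)) j)) (at t)"
  by (intro DERIV_add DERIV_const DERIV_sum DERIV_mult F id)
 also have "(%t. c * (LINT x|S. \<alpha> x) + (\<Sum>j<r. (v(i := t)) j * ?F j (v(i := t)))) = (%t. sph (poly (pCons c q)) \<alpha> (v(i := t)))"
  by (simp only: sph_pCons[OF pCons.prems])
 also have "0 + (\<Sum>j<r. (if j = i then 1 else 0) * ?F j (v(i := t)) + ?F' j (v(i := t)) * (v(i := t)) j)
  = sph (poly (pderiv (pCons c q))) (%x. a i x * \<alpha> x) (v(i := t))"
 proof -
  have "(\<Sum>j<r. (if j = i then 1 else 0) * ?F j (v(i := t))) = (\<Sum>j<r. if j = i then ?F j (v(i := t)) else 0)"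
   by (intro sum.cong) auto
  also have "... = ?F i (v(i := t))" using i by simp
  finally have 1: "(\<Sum>j<r. (if j = i then 1 else 0) * ?F j (v(i := t))) = ?F i (v(i := t))" .
  have c: "contU (%x. a i x * \<alpha> x)" by (intro continuous_intros a_cont pCons.prems)
  have "sph (poly (pCons 0 (pderiv q))) (%x. a i x * \<alpha> x) (v(i := t)) = (\<Sum>j<r. ?F' j (v(i := t)) * (v(i := t)) j)"
   unfolding sph_pCons[OF c] by (simp only: mult_zero_left add_0_left mult.left_commute[of "a i _"] mult.commute[of "(v(i := t)) _"])
  then show ?thesis unfolding pderiv_pCons sph_add[OF c] sum.distrib 1 by simp
 qed
 finally show ?case .
qed

lemma sph_partial:
 assumes "i < r" "contU \<alpha>"
 shows "partial_deriv i (sph (poly p) \<alpha>) = sph (poly (pderiv p)) (%x. a i x * \<alpha> x)"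
proof (rule partial_deriv_eqI)
 fix v
 from sph_has_partial[OF assms, of p v "v i"]
 show "((%t. sph (poly p) \<alpha> (v(i := t))) has_real_derivative sph (poly (pderiv p)) (%x. a i x * \<alpha> x) v) (at (v i))" by simp
qed

lemma sph_partials:
 "set is \<subseteq> {..<r} ==> partial_derivs is (sph (poly p) (%x. 1)) = sph (poly ((pderiv ^^ length is) p)) (mon is)"
 by (induction "is") (auto simp: sph_partial mon_cont)

text \<open>Squared tensor norm of the k-th derivative in the orthonormal system e, where \<psi> is
  already the k-th derivative of the integrand. By \<open>mon_words\<close> the sum over words
  amounts to a double integral over the sphere with kernel \<rho>^k.\<close>

definition Nsum :: "nat => (real => real) => (nat => real) => real" where
 "Nsum k \<psi> v = (\<Sum>is\<in>words r k. (sph \<psi> (mon is) v)\<^sup>2)"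

lemma Nsum_nonneg: "Nsum k \<psi> v \<ge> 0" unfolding Nsum_def by (intro sum_nonneg) simp

lemma Nsum_polyfun: "polyfun r (Nsum k (poly p))"
 unfolding Nsum_def[abs_def] by (intro polyfun_sum polyfun_pow sph_polyfun mon_cont)

lemma Nsum_Suc: "Nsum (Suc k) \<psi> v = (\<Sum>is\<in>words r k. \<Sum>j<r. (sph \<psi> (%x. a j x * mon is x) v)\<^sup>2)"
 unfolding Nsum_def sum_words_Suc by (subst sum.swap) simp

lemma mon_words: "(\<Sum>is\<in>words r k. mon is x * mon is y) = (\<Sum>i<r. a i x * a i y) ^ k"
proof (induction k)
 case (Suc k)
 have "(\<Sum>is\<in>words r (Suc k). mon is x * mon is y) = (\<Sum>i<r. (a i x * a i y) * (\<Sum>is\<in>words r k. mon is x * mon is y))"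
  unfolding sum_words_Suc sum_distrib_left by (intro sum.cong refl) simp
 then show ?case unfolding Suc by (simp add: sum_distrib_right)
qed simp

abbreviation \<rho> :: "'a => 'a => real" where "\<rho> x y \<equiv> (\<Sum>i<r. a i x * a i y)"

lemma \<rho>_le: assumes "norm x = 1" "norm y = 1" shows "\<bar>\<rho> x y\<bar> \<le> 1"
proof -
 have "(\<rho> x y)\<^sup>2 \<le> (\<Sum>i<r. (a i x)\<^sup>2) * (\<Sum>i<r. (a i y)\<^sup>2)" by (rule Cauchy_Schwarz_ineq_sum)
 then show ?thesis unfolding a_norm[OF assms(1)] a_norm[OF assms(2)] by (simp add: abs_square_le_1)
qed

lemma \<rho>_square_integral:
 assumes u: "contU u"
 shows "(LINT y|S. u y * (\<rho> x y)\<^sup>2) = (\<Sum>i<r. \<Sum>j<r. a i x * a j x * (LINT y|S. u y * (a i y * a j y)))"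
proof -
 have "u y * (\<rho> x y)\<^sup>2 = (\<Sum>i<r. \<Sum>j<r. a i x * a j x * (u y * (a i y * a j y)))" for y
  unfolding power2_eq_square sum_product unfolding sum_distrib_left by (intro sum.cong refl) (simp only: mult_ac)
 then have "(LINT y|S. u y * (\<rho> x y)\<^sup>2) = (LINT y|S. (\<Sum>i<r. \<Sum>j<r. a i x * a j x * (u y * (a i y * a j y))))" by simp
 also have "... = (\<Sum>i<r. \<integral>y. (\<Sum>j<r. a i x * a j x * (u y * (a i y * a j y))) \<partial>S)"
  by (intro bi_sum cint continuous_intros a_cont u)
 also have "... = (\<Sum>i<r. \<Sum>j<r. \<integral>y. a i x * a j x * (u y * (a i y * a j y)) \<partial>S)"
  by (intro sum.cong refl bi_sum cint continuous_intros a_cont u)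
 finally show ?thesis by (simp only: integral_mult_right_zero)
qed

text \<open>The kernel has finite rank, so Fubini is an interchange of finite sums; the symmetry of
  \<rho> then lets the row norm A be taken at y instead of x.\<close>

lemma \<rho>_square_symmetric:
 assumes u: "contU u"
 shows "(LINT x|S. (LINT y|S. u y * (\<rho> x y)\<^sup>2)) = A * (LINT x|S. u x)"
proof -
 have double: "(LINT x|S. f x * (\<Sum>i<r. \<Sum>j<r. a i x * a j x * c i j)) = (\<Sum>i<r. \<Sum>j<r. (LINT x|S. f x * (a i x * a j x)) * c i j)"
  if f: "contU f" for f c
 proof -
  have "(LINT x|S. f x * (\<Sum>i<r. \<Sum>j<r. a i x * a j x * c i j)) = (LINT x|S. (\<Sum>i<r. \<Sum>j<r. f x * (a i x * a j x) * c i j))"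
   by (simp only: sum_distrib_left mult.assoc)
  also have "... = (\<Sum>i<r. \<integral>x. (\<Sum>j<r. f x * (a i x * a j x) * c i j) \<partial>S)"
   by (intro bi_sum cint continuous_intros a_cont f)
  also have "... = (\<Sum>i<r. \<Sum>j<r. \<integral>x. f x * (a i x * a j x) * c i j \<partial>S)"
   by (intro sum.cong refl bi_sum cint continuous_intros a_cont f)
  finally show ?thesis by (simp only: integral_mult_left_zero)
 qed
 have "(LINT x|S. (LINT y|S. u y * (\<rho> x y)\<^sup>2)) = (LINT x|S. 1 * (\<Sum>i<r. \<Sum>j<r. a i x * a j x * (LINT y|S. u y * (a i y * a j y))))"
  unfolding \<rho>_square_integral[OF u] by simp
 also have "... = (\<Sum>i<r. \<Sum>j<r. (LINT x|S. 1 * (a i x * a j x)) * (LINT y|S. u y * (a i y * a j y)))"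
  by (rule double) simp
 also have "... = (LINT x|S. u x * (\<Sum>i<r. \<Sum>j<r. a i x * a j x * (LINT y|S. 1 * (a i y * a j y))))"
  unfolding double[OF u] by (simp only: mult.commute[of "\<integral>x. u x * _ x \<partial>S"])
 also have "... = (LINT x|S. u x * (LINT y|S. 1 * (\<rho> x y)\<^sup>2))"
  by (subst \<rho>_square_integral) simp_all
 also have "... = (LINT x|S. u x * A)"
  by (intro bi_cong refl) (simp add: a_A)
 finally show ?thesis by (simp add: mult.commute)
qed

text \<open>A \<mu> is the sum of squared entries of the Gram matrix G of the functions a i, whose
  trace is \<mu> > 0.\<close>

lemma A_pos: "A > 0"
proof (rule ccontr)
 assume "\<not> A > 0"
 define G where "G i j = (LINT x|S. a i x * a j x)" for i j
 have "A * \<mu> = (LINT x|S. (LINT y|S. 1 * (\<rho> x y)\<^sup>2))" using S_mass by (subst \<rho>_square_symmetric) simp_all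
 also have "... = (LINT x|S. (\<Sum>i<r. \<Sum>j<r. a i x * a j x * G i j))"
  by (subst \<rho>_square_integral) (simp_all add: G_def)
 also have "... = (\<Sum>i<r. \<integral>x. (\<Sum>j<r. a i x * a j x * G i j) \<partial>S)"
  by (intro bi_sum cint continuous_intros a_cont)
 also have "... = (\<Sum>i<r. \<Sum>j<r. \<integral>x. a i x * a j x * G i j \<partial>S)"
  by (intro sum.cong refl bi_sum cint continuous_intros a_cont)
 also have "... = (\<Sum>i<r. \<Sum>j<r. (G i j)\<^sup>2)"
  by (simp only: integral_mult_left_zero G_def power2_eq_square)
 finally have "(\<Sum>i<r. \<Sum>j<r. (G i j)\<^sup>2) \<le> 0"
  using \<open>\<not> A > 0\<close> sphere_mass_pos[of d] mult_nonpos_nonneg[of A \<mu>] by linarith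
 then have "(\<Sum>i<r. \<Sum>j<r. (G i j)\<^sup>2) = 0" by (rule antisym) (intro sum_nonneg zero_le_power2)
 then have G0: "G i i = 0" if "i < r" for i
 proof -
  have "(\<Sum>j<r. (G i j)\<^sup>2) = 0" using sum_nonneg_0[OF _ _ \<open>(\<Sum>i<r. \<Sum>j<r. (G i j)\<^sup>2) = 0\<close>, of i] that by (simp add: sum_nonneg)
  from sum_nonneg_0[OF _ _ this, of i] show ?thesis using that by simp
 qed
 have "\<mu> = (LINT x|S. (\<Sum>i<r. (a i x)\<^sup>2))"
  unfolding S_mass[symmetric] using a_norm by (subst bi_cong[of _ _ _ "%_. 1"]) auto
 also have "... = (\<Sum>i<r. G i i)"
  unfolding G_def power2_eq_square by (intro bi_sum cint continuous_intros a_cont)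
 finally show False using G0 sphere_mass_pos[of d] by simp
qed

text \<open>A Schur-type estimate: |\<rho>|^k \<le> \<rho>^2, and h x h y is at most half the sum of
  the squares. Each half leaves one variable free, whose integral of \<rho>^2 is A.\<close>

lemma Nsum_ge_2:
 assumes k: "k \<ge> 2"
 shows "Nsum k (poly p) v \<le> A * (LINT x|S. (poly p (lin v x))\<^sup>2)"
proof -
 define h where "h x = poly p (lin v x)" for x
 have hc: "contU h" unfolding h_def by (rule poly_lin_cont)
 define w where "w is = (LINT y|S. h y * mon is y)" for "is"
 have "Nsum k (poly p) v = (\<Sum>is\<in>words r k. \<integral>x. h x * mon is x * w is \<partial>S)"
  unfolding Nsum_def sph_def h_def[symmetric] w_def[symmetric]
  by (simp only: power2_eq_square integral_mult_left_zero w_def)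
 also have "... = (LINT x|S. (\<Sum>is\<in>words r k. h x * mon is x * w is))"
  by (intro bi_sum[symmetric] cint continuous_intros hc mon_cont)
 also have "... \<le> (LINT x|S. 1 / 2 * ((h x)\<^sup>2 * A) + 1 / 2 * (LINT y|S. (h y)\<^sup>2 * (\<rho> x y)\<^sup>2))"
 proof (rule integral_mono)
  show "integrable S (%x. \<Sum>is\<in>words r k. h x * mon is x * w is)"
   by (intro cint continuous_intros hc mon_cont)
  have c2: "contU (%y. (h y)\<^sup>2)" by (intro continuous_intros hc)
  show "integrable S (%x. 1 / 2 * ((h x)\<^sup>2 * A) + 1 / 2 * (LINT y|S. (h y)\<^sup>2 * (\<rho> x y)\<^sup>2))"
   unfolding \<rho>_square_integral[OF c2] by (intro cint continuous_intros hc a_cont)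
  fix x assume "x \<in> space S"
  then have x: "norm x = 1" by simp
  have "(\<Sum>is\<in>words r k. h x * mon is x * w is) = (\<Sum>is\<in>words r k. \<integral>y. h x * mon is x * (h y * mon is y) \<partial>S)"
   by (simp only: w_def integral_mult_right_zero)
  also have "... = (LINT y|S. (\<Sum>is\<in>words r k. h x * mon is x * (h y * mon is y)))"
   by (intro bi_sum[symmetric] cint continuous_intros hc mon_cont)
  also have "... = (LINT y|S. h x * h y * \<rho> x y ^ k)"
   unfolding mon_words[symmetric] sum_distrib_left by (simp only: mult_ac)
  also have "... \<le> (LINT y|S. 1 / 2 * ((h x)\<^sup>2 * (\<rho> x y)\<^sup>2) + 1 / 2 * ((h y)\<^sup>2 * (\<rho> x y)\<^sup>2))"
  proof (rule integral_mono)
   fix y assume "y \<in> space S"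
   then have y: "norm y = 1" by simp
   have "\<bar>\<rho> x y\<bar> ^ k \<le> \<bar>\<rho> x y\<bar> ^ 2" by (rule power_decreasing[OF k _ \<rho>_le[OF x y]]) simp
   then have rk: "\<bar>\<rho> x y ^ k\<bar> \<le> (\<rho> x y)\<^sup>2" by (simp add: power_abs)
   have "h x * h y * \<rho> x y ^ k \<le> \<bar>h x * h y\<bar> * \<bar>\<rho> x y ^ k\<bar>" by (metis abs_ge_self abs_mult)
   also have "... \<le> (1 / 2 * ((h x)\<^sup>2 + (h y)\<^sup>2)) * (\<rho> x y)\<^sup>2"
   proof (rule mult_mono[OF _ rk])
    have "0 \<le> (\<bar>h x\<bar> - \<bar>h y\<bar>)\<^sup>2" by simp
    then show "\<bar>h x * h y\<bar> \<le> 1 / 2 * ((h x)\<^sup>2 + (h y)\<^sup>2)" by (simp add: power2_diff abs_mult)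
   qed simp_all
   finally show "h x * h y * \<rho> x y ^ k \<le> 1 / 2 * ((h x)\<^sup>2 * (\<rho> x y)\<^sup>2) + 1 / 2 * ((h y)\<^sup>2 * (\<rho> x y)\<^sup>2)"
    by (simp only: distrib_left distrib_right mult.assoc)
  qed (intro cint continuous_intros hc a_cont)+
  also have "... = 1 / 2 * ((h x)\<^sup>2 * (LINT y|S. (\<rho> x y)\<^sup>2)) + 1 / 2 * (LINT y|S. (h y)\<^sup>2 * (\<rho> x y)\<^sup>2)"
   by (subst bi_add) (intro cint continuous_intros hc a_cont, intro cint continuous_intros hc a_cont, simp only: integral_mult_right_zero)
  finally show "(\<Sum>is\<in>words r k. h x * mon is x * w is) \<le> 1 / 2 * ((h x)\<^sup>2 * A) + 1 / 2 * (LINT y|S. (h y)\<^sup>2 * (\<rho> x y)\<^sup>2)"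
   unfolding a_A[OF x] .
 qed
 also have "... = 1 / 2 * ((LINT x|S. (h x)\<^sup>2) * A) + 1 / 2 * (LINT x|S. (LINT y|S. (h y)\<^sup>2 * (\<rho> x y)\<^sup>2))"
 proof (subst bi_add)
  have c2: "contU (%y. (h y)\<^sup>2)" by (intro continuous_intros hc)
  show "integrable S (%x. 1 / 2 * (LINT y|S. (h y)\<^sup>2 * (\<rho> x y)\<^sup>2))"
   unfolding \<rho>_square_integral[OF c2] by (intro cint continuous_intros hc a_cont)
 qed (intro cint continuous_intros hc, simp only: integral_mult_right_zero integral_mult_left_zero)
 also have "... = A * (LINT x|S. (h x)\<^sup>2)"
  by (subst \<rho>_square_symmetric) (intro continuous_intros hc, simp)
 finally show ?thesis by (simp only: h_def)
qed

section \<open>The law of the field, and Fubini over sphere and probability space\<close>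

lemma wiener_e_moments: "polyfun r f ==> all_moments M (%om. f (\<xi> om))"
 unfolding \<xi>_def by (rule smooth_functional_all_moments[OF polyfun_spg]) (auto intro: e_L2)

lemma lin_law: assumes x: "norm x = 1" shows "distr M borel (%om. lin (\<xi> om) x) = gauss"
proof -
 let ?g = "%y. \<Sum>i<r. a i x * e i y"
 have g: "L2 S ?g" by (intro L2_sum L2_cmult e_L2)
 have "(LINT y|S. (?g y)\<^sup>2) = (LINT y|S. (\<Sum>i<r. \<Sum>j<r. a i x * a j x * (e i y * e j y)))"
  unfolding power2_eq_square sum_product by (simp only: mult_ac)
 also have "... = (\<Sum>i<r. \<integral>y. (\<Sum>j<r. a i x * a j x * (e i y * e j y)) \<partial>S)"
  by (intro bi_sum bi_int_sum integrable_mult_right L2_mult_integrable e_L2)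
 also have "... = (\<Sum>i<r. \<Sum>j<r. \<integral>y. a i x * a j x * (e i y * e j y) \<partial>S)"
  by (intro sum.cong refl bi_sum integrable_mult_right L2_mult_integrable e_L2)
 also have "... = (\<Sum>i<r. \<Sum>j<r. if j = i then (a i x)\<^sup>2 else 0)"
  unfolding integral_mult_right_zero by (intro sum.cong refl) (auto simp: e_on power2_eq_square)
 also have "... = 1" using a_norm[OF x] by simp
 finally have n: "(LINT y|S. (?g y)\<^sup>2) = 1" .
 have ae: "AE om in M. wi ?g om = (\<Sum>i<r. a i x * wi (e i) om)"
  by (rule wiener_lincomb[OF g e_L2]) auto
 have [measurable]: "wi (e i) \<in> borel_measurable M" "wi ?g \<in> borel_measurable M" for i
  using wiener_L2[OF e_L2] wiener_L2[OF g] by (auto simp: L2_def)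
 have "distr M borel (%om. lin (\<xi> om) x) = distr M borel (wi ?g)"
  by (rule distr_cong_AE) (use ae in \<open>auto simp: lin_def \<xi>_def elim: eventually_mono\<close>)
 then show ?thesis using wiener_unit_law[OF g n] by simp
qed

lemma \<xi>_measurable [measurable]: "(%om. \<xi> om i) \<in> borel_measurable M"
 using wiener_L2[OF e_L2] by (auto simp: L2_def \<xi>_def)

lemma a_measurable [measurable]: "a i \<in> borel_measurable S"
 by (rule continuous_sphere_integrable(2)[OF a_cont])

lemma lin_expectation:
 fixes f :: "real => real"
 assumes x: "norm x = 1" and [measurable]: "f \<in> borel_measurable borel"
 shows "integrable M (%om. f (lin (\<xi> om) x)) \<longleftrightarrow> integrable gauss f" "(LINT om|M. f (lin (\<xi> om) x)) = (LINT z|gauss. f z)"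
proof -
 have [measurable]: "(%om. lin (\<xi> om) x) \<in> borel_measurable M" unfolding lin_def by measurable
 show "integrable M (%om. f (lin (\<xi> om) x)) \<longleftrightarrow> integrable gauss f"
  using integrable_distr_eq[of "%om. lin (\<xi> om) x" M borel f] unfolding lin_law[OF x] by simp
 show "(LINT om|M. f (lin (\<xi> om) x)) = (LINT z|gauss. f z)"
  unfolding lin_law[OF x, symmetric] by (rule integral_distr[symmetric]) simp_all
qed

lemma lin_measurable [measurable]: "(%p. lin (\<xi> (snd p)) (fst p)) \<in> borel_measurable (S \<Otimes>\<^sub>M M)"
 unfolding lin_def by measurable

sublocale SM: pair_sigma_finite S M ..

text \<open>At every point of the sphere the field is standard Gaussian, so integrability on the
  product reduces to one-dimensional integrability of \<psi> and boundedness of the continuous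
  weight.\<close>

lemma sph_fubini:
 assumes \<psi>[measurable]: "\<psi> \<in> borel_measurable borel" and i: "integrable gauss \<psi>" and \<alpha>: "contU \<alpha>"
 shows "integrable (S \<Otimes>\<^sub>M M) (%(x, om). \<psi> (lin (\<xi> om) x) * \<alpha> x)"
  and "AE om in M. integrable S (%x. \<psi> (lin (\<xi> om) x) * \<alpha> x)"
  and "integrable M (%om. sph \<psi> \<alpha> (\<xi> om))"
  and "(LINT om|M. sph \<psi> \<alpha> (\<xi> om)) = (LINT z|gauss. \<psi> z) * (LINT x|S. \<alpha> x)"
proof -
 have [measurable]: "\<alpha> \<in> borel_measurable S" by (rule continuous_sphere_integrable(2)[OF \<alpha>])
 let ?f = "%p. \<psi> (lin (\<xi> (snd p)) (fst p)) * \<alpha> (fst p)"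
 have m: "?f \<in> borel_measurable (S \<Otimes>\<^sub>M M)" by measurable
 have il: "integrable M (%om. \<psi> (lin (\<xi> om) x))" if "norm x = 1" for x using lin_expectation(1)[OF that \<psi>] i by simp
 have "integrable (S \<Otimes>\<^sub>M M) ?f"
 proof (rule SM.Fubini_integrable[OF m])
  have "integrable S (%x. (LINT z|gauss. \<bar>\<psi> z\<bar>) * \<bar>\<alpha> x\<bar>)" by (intro cint continuous_intros \<alpha>)
  also have "?this \<longleftrightarrow> integrable S (%x. \<integral>om. norm (?f (x, om)) \<partial>M)"
  proof (rule bi_int_cong[OF refl])
   fix x assume "x \<in> space S"
   then have x: "norm x = 1" by simp
   show "(LINT z|gauss. \<bar>\<psi> z\<bar>) * \<bar>\<alpha> x\<bar> = (LINT om|M. norm (?f (x, om)))"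
    using lin_expectation(2)[OF x, of "%z. \<bar>\<psi> z\<bar>"] by (simp add: abs_mult)
  qed
  finally show "integrable S (%x. \<integral>om. norm (?f (x, om)) \<partial>M)" .
  show "AE x in S. integrable M (%om. ?f (x, om))" by (intro AE_I2) (simp add: il)
 qed
 then show 1: "integrable (S \<Otimes>\<^sub>M M) (%(x, om). \<psi> (lin (\<xi> om) x) * \<alpha> x)" by (simp add: case_prod_unfold)
 show "AE om in M. integrable S (%x. \<psi> (lin (\<xi> om) x) * \<alpha> x)" by (rule SM.AE_integrable_snd[OF 1])
 show "integrable M (%om. sph \<psi> \<alpha> (\<xi> om))" unfolding sph_def by (rule SM.integrable_snd[OF 1])
 have "(LINT om|M. sph \<psi> \<alpha> (\<xi> om)) = (LINT x|S. (LINT om|M. \<psi> (lin (\<xi> om) x) * \<alpha> x))"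
  unfolding sph_def by (rule SM.Fubini_integral[OF 1])
 also have "... = (LINT x|S. (LINT z|gauss. \<psi> z) * \<alpha> x)"
  by (intro bi_cong refl) (simp add: lin_expectation(2))
 finally show "(LINT om|M. sph \<psi> \<alpha> (\<xi> om)) = (LINT z|gauss. \<psi> z) * (LINT x|S. \<alpha> x)" by simp
qed

text \<open>Cauchy-Schwarz on the sphere for fixed om, then \<open>sph_fubini\<close> for the square
  of \<psi>. The resulting continuity in \<psi> transports approximation in the Gaussian
  \<open>L2\<close> space to the functionals.\<close>

lemma sph_L2:
 assumes \<psi>: "L2 gauss \<psi>" and \<alpha>: "contU \<alpha>"
 shows "L2 M (%om. sph \<psi> \<alpha> (\<xi> om))"
  and "(LINT om|M. (sph \<psi> \<alpha> (\<xi> om))\<^sup>2) \<le> (\<mu> * (LINT x|S. (\<alpha> x)\<^sup>2)) * (LINT z|gauss. (\<psi> z)\<^sup>2)"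
proof -
 interpret g: prob_space gauss by (rule prob_space_gauss)
 have [measurable]: "\<psi> \<in> borel_measurable borel" using \<psi> by (simp add: L2_def)
 have [measurable]: "\<alpha> \<in> borel_measurable S" by (rule continuous_sphere_integrable(2)[OF \<alpha>])
 have i2: "integrable gauss (%z. (\<psi> z)\<^sup>2)" by (rule L2_integrable_square[OF \<psi>])
 note f = sph_fubini[OF _ i2, of "%x. 1"]
 have i1: "integrable gauss \<psi>"
  using L2_mult_integrable[OF \<psi>, of "%_. 1"] by (simp add: L2_def)
 note m = sph_fubini(3)[OF _ i1 \<alpha>]
 have \<alpha>2: "L2 S \<alpha>" unfolding L2_def by (auto intro!: cint continuous_intros \<alpha>)
 have "AE om in M. integrable S (%x. (\<psi> (lin (\<xi> om) x))\<^sup>2 * 1)" by (rule f(2)) auto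
 then have le: "AE om in M. (sph \<psi> \<alpha> (\<xi> om))\<^sup>2 \<le> (LINT x|S. (\<alpha> x)\<^sup>2) * sph (%z. (\<psi> z)\<^sup>2) (%x. 1) (\<xi> om)"
 proof eventually_elim
  case (elim om)
  have [measurable]: "(%x. lin (\<xi> om) x) \<in> borel_measurable S" by (rule continuous_sphere_integrable(2)[OF lin_cont])
  have "L2 S (%x. \<psi> (lin (\<xi> om) x))" using elim unfolding L2_def by simp
  from L2_Cauchy_Schwarz[OF this \<alpha>2] show ?case by (simp add: sph_def mult.commute)
 qed
 have ir: "integrable M (%om. (LINT x|S. (\<alpha> x)\<^sup>2) * sph (%z. (\<psi> z)\<^sup>2) (%x. 1) (\<xi> om))"
  by (intro integrable_mult_right f(3)) auto
 have [measurable]: "(%om. sph \<psi> \<alpha> (\<xi> om)) \<in> borel_measurable M" using m by auto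
 have isq: "integrable M (%om. (sph \<psi> \<alpha> (\<xi> om))\<^sup>2)"
  by (rule bi_int_bound[OF ir]) (use le in \<open>auto elim!: eventually_mono\<close>)
 then show "L2 M (%om. sph \<psi> \<alpha> (\<xi> om))" by (simp add: L2_def)
 have "(LINT om|M. (sph \<psi> \<alpha> (\<xi> om))\<^sup>2) \<le> (LINT om|M. (LINT x|S. (\<alpha> x)\<^sup>2) * sph (%z. (\<psi> z)\<^sup>2) (%x. 1) (\<xi> om))"
  by (rule integral_mono_AE[OF isq ir le])
 also have "... = (LINT x|S. (\<alpha> x)\<^sup>2) * ((LINT z|gauss. (\<psi> z)\<^sup>2) * (LINT x|S. 1))"
  by (subst integral_mult_right_zero, subst f(4)) auto
 also have "(LINT x|S. 1) = \<mu>" using S_mass by simp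
 finally show "(LINT om|M. (sph \<psi> \<alpha> (\<xi> om))\<^sup>2) \<le> (\<mu> * (LINT x|S. (\<alpha> x)\<^sup>2)) * (LINT z|gauss. (\<psi> z)\<^sup>2)"
  by (simp only: mult_ac)
qed

end

text \<open>Convexity in tangent form. The defect in degree m + 1 is x times the defect in degree m
  plus a nonnegative multiple of (x - c)^2.\<close>

lemma power_tangent:
 fixes x c :: real
 assumes "x \<ge> 0" "c \<ge> 0"
 shows "x ^ Suc m \<ge> c ^ Suc m + real (Suc m) * c ^ m * (x - c)"
proof (induction m)
 case (Suc m)
 have "x * (x ^ Suc m - (c ^ Suc m + real (Suc m) * c ^ m * (x - c))) + real (Suc m) * c ^ m * (x - c)\<^sup>2 \<ge> 0"
  using assms Suc by (intro add_nonneg_nonneg mult_nonneg_nonneg) auto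
 moreover have "x * (x ^ Suc m - (c ^ Suc m + real (Suc m) * c ^ m * (x - c))) + real (Suc m) * c ^ m * (x - c)\<^sup>2
   = x ^ Suc (Suc m) - (c ^ Suc (Suc m) + real (Suc (Suc m)) * c ^ Suc m * (x - c))"
  by (simp add: algebra_simps power2_eq_square)
 ultimately show ?case by linarith
qed simp

text \<open>Jensen's inequality for an unnormalized measure: the tangent at the mean c is
  integrated.\<close>

lemma (in finite_measure) integral_power_le:
 assumes f: "integrable M f" "integrable M (%x. f x ^ Suc m)" "\<And>x. x \<in> space M ==> f x \<ge> 0" and p: "measure M (space M) > 0"
 shows "(LINT x|M. f x) ^ Suc m \<le> measure M (space M) ^ m * (LINT x|M. f x ^ Suc m)"
proof -
 define u where "u = measure M (space M)"
 define c where "c = (LINT x|M. f x) / u"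
 have u: "u > 0" using p by (simp add: u_def)
 have c: "c \<ge> 0" unfolding c_def using u f(3) by (intro divide_nonneg_pos integral_nonneg) auto
 have cu: "(LINT x|M. f x) = c * u" using u by (simp add: c_def)
 have "(LINT x|M. c ^ Suc m + (real (Suc m) * c ^ m) * (f x - c)) \<le> (LINT x|M. f x ^ Suc m)"
  by (rule integral_mono) (use f power_tangent[OF _ c] in \<open>auto simp del: power_Suc of_nat_Suc intro!: integrable_mult_right bi_int_add bi_int_diff\<close>)
 also have "(LINT x|M. c ^ Suc m + (real (Suc m) * c ^ m) * (f x - c)) = (LINT x|M. c ^ Suc m) + (real (Suc m) * c ^ m) * ((LINT x|M. f x) - (LINT x|M. c))"
  by (subst bi_add) (auto simp: f(1) simp del: power_Suc of_nat_Suc)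
 also have "... = c ^ Suc m * u" unfolding cu by (simp add: u_def)
 finally have "u ^ m * (c ^ Suc m * u) \<le> u ^ m * (LINT x|M. f x ^ Suc m)" using u by (intro mult_left_mono) auto
 then show ?thesis unfolding cu u_def[symmetric] by (simp add: power_mult_distrib mult_ac)
qed

text \<open>Pointwise, either 2 c Y \<le> X and the product costs at most half of X^(n+1), or X < 2
  c Y and it is bounded by Y alone. As the moments of X are finite, the half can be absorbed on the
  left.\<close>

lemma (in prob_space) young_absorb:
 assumes N: "all_moments M X" "\<And>om. X om \<ge> 0" and B: "all_moments M Y" "\<And>om. Y om \<ge> 0"
  and le: "(LINT om|M. X om ^ Suc n) \<le> c * (LINT om|M. X om ^ n * Y om)" and c: "c \<ge> 0"
 shows "(LINT om|M. X om ^ Suc n) \<le> (2 * c) ^ Suc n * (LINT om|M. Y om ^ Suc n)"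
proof -
 note iX = all_moments_integrable_power[OF N(1), of "Suc n"] and iY = all_moments_integrable_power[OF B(1), of "Suc n"]
 have iXY: "integrable M (%om. X om ^ n * Y om)"
  by (intro all_moments_integrable all_moments_mult all_moments_pow N B finite_measure_axioms)
 have pt: "x ^ n * (c * y) \<le> 1 / 2 * x ^ Suc n + 1 / 2 * ((2 * c) ^ Suc n * y ^ Suc n)" if "x \<ge> 0" "y \<ge> 0" for x y :: real
 proof (cases "2 * (c * y) \<le> x")
  case True
  then have "x ^ n * (2 * (c * y)) \<le> x ^ n * x" using that by (intro mult_left_mono) auto
  moreover have "0 \<le> (2 * c) ^ Suc n * y ^ Suc n" using that c by simp
  moreover have "x ^ n * (2 * (c * y)) = 2 * (x ^ n * (c * y))" "x ^ n * x = x ^ Suc n" by simp_all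
  ultimately show ?thesis by linarith
 next
  case False
  then have "x ^ n \<le> (2 * (c * y)) ^ n" using that by (intro power_mono) auto
  then have "x ^ n * (2 * (c * y)) \<le> (2 * (c * y)) ^ n * (2 * (c * y))" using that c by (intro mult_right_mono) auto
  also have "... = (2 * c) ^ Suc n * y ^ Suc n" by (simp add: power_mult_distrib mult_ac)
  finally show ?thesis using that zero_le_power[of x "Suc n"] by linarith
 qed
 have "c * (LINT om|M. X om ^ n * Y om) = (LINT om|M. X om ^ n * (c * Y om))"
  by (simp only: integral_mult_right_zero[symmetric] mult.left_commute)
 also have "... \<le> (LINT om|M. 1 / 2 * X om ^ Suc n + 1 / 2 * ((2 * c) ^ Suc n * Y om ^ Suc n))"
 proof (rule integral_mono)
  show "integrable M (%om. X om ^ n * (c * Y om))"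
   using integrable_mult_right[OF iXY, of c] by (simp only: mult.left_commute)
 qed (intro bi_int_add integrable_mult_right iX iY, intro pt N B)
 also have "... = 1 / 2 * (LINT om|M. X om ^ Suc n) + 1 / 2 * ((2 * c) ^ Suc n * (LINT om|M. Y om ^ Suc n))"
  by (subst bi_add) (intro integrable_mult_right iX iY, intro integrable_mult_right iX iY, simp only: integral_mult_right_zero)
 finally show ?thesis using le by linarith
qed

section \<open>Moment bounds for truncated functionals, uniform in the frame\<close>

context frame
begin

text \<open>Jensen on the sphere moves the power inside the surface integral, where only the
  Gaussian law at single points matters.\<close>

lemma square_integral_moment:
 "(LINT om|M. (LINT x|S. (poly p (lin (\<xi> om) x))\<^sup>2) ^ Suc n) \<le> \<mu> ^ Suc n * (LINT z|gauss. poly p z ^ (2 * Suc n))"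
proof -
 have sq: "(LINT x|S. (poly p (lin v x))\<^sup>2) = sph (poly (p\<^sup>2)) (%x. 1) v" for v by (simp add: sph_def)
 have pw: "(LINT x|S. (poly p (lin v x))\<^sup>2 ^ Suc n) = sph (poly (p ^ (2 * Suc n))) (%x. 1) v" for v
  by (simp only: sph_def power_mult poly_power mult_1_right)
 have c1: "contU (%x::'a. 1 :: real)" by simp
 have "(LINT om|M. (LINT x|S. (poly p (lin (\<xi> om) x))\<^sup>2) ^ Suc n) \<le> (LINT om|M. \<mu> ^ n * sph (poly (p ^ (2 * Suc n))) (%x. 1) (\<xi> om))"
 proof (rule integral_mono)
  show "integrable M (%om. (LINT x|S. (poly p (lin (\<xi> om) x))\<^sup>2) ^ Suc n)"
   unfolding sq by (intro all_moments_integrable_power wiener_e_moments sph_polyfun c1)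
  show "integrable M (%om. \<mu> ^ n * sph (poly (p ^ (2 * Suc n))) (%x. 1) (\<xi> om))"
   by (intro integrable_mult_right all_moments_integrable wiener_e_moments sph_polyfun c1)
  fix om
  show "(LINT x|S. (poly p (lin (\<xi> om) x))\<^sup>2) ^ Suc n \<le> \<mu> ^ n * sph (poly (p ^ (2 * Suc n))) (%x. 1) (\<xi> om)"
   unfolding pw[symmetric] S_mass[symmetric]
   by (rule S.integral_power_le) (intro cint continuous_intros lin_cont, intro cint continuous_intros lin_cont, simp, simp only: S_mass sphere_mass_pos)
 qed
 also have "... = \<mu> ^ n * ((LINT z|gauss. poly (p ^ (2 * Suc n)) z) * (LINT x|S. 1))"
  unfolding integral_mult_right_zero by (subst sph_fubini(4)) (auto intro!: gauss_poly_integrable simp del: power_Suc mult_Suc_right)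
 also have "(LINT x|S. 1) = \<mu>" using S_mass by simp
 also have "\<mu> ^ n * ((LINT z|gauss. poly (p ^ (2 * Suc n)) z) * \<mu>) = \<mu> ^ Suc n * (LINT z|gauss. poly p z ^ (2 * Suc n))"
  by (simp only: poly_power power_Suc mult_ac)
 finally show ?thesis .
qed

lemma Nsum_moment_ge_2:
 assumes k: "k \<ge> 2"
 shows "(LINT om|M. Nsum k (poly p) (\<xi> om) ^ Suc n) \<le> (\<mu> * A) ^ Suc n * (LINT z|gauss. poly p z ^ (2 * Suc n))"
proof -
 have sq: "(LINT x|S. (poly p (lin v x))\<^sup>2) = sph (poly (p\<^sup>2)) (%x. 1) v" for v by (simp add: sph_def)
 have "(LINT om|M. Nsum k (poly p) (\<xi> om) ^ Suc n) \<le> (LINT om|M. A ^ Suc n * (LINT x|S. (poly p (lin (\<xi> om) x))\<^sup>2) ^ Suc n)"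
 proof (rule integral_mono)
  show "integrable M (%om. Nsum k (poly p) (\<xi> om) ^ Suc n)"
   by (intro all_moments_integrable_power wiener_e_moments Nsum_polyfun)
  show "integrable M (%om. A ^ Suc n * (LINT x|S. (poly p (lin (\<xi> om) x))\<^sup>2) ^ Suc n)"
   unfolding sq by (intro integrable_mult_right all_moments_integrable_power wiener_e_moments sph_polyfun) simp
  show "Nsum k (poly p) (\<xi> om) ^ Suc n \<le> A ^ Suc n * (LINT x|S. (poly p (lin (\<xi> om) x))\<^sup>2) ^ Suc n" for om
   unfolding power_mult_distrib[symmetric] by (intro power_mono Nsum_ge_2 k Nsum_nonneg)
 qed
 also have "... = A ^ Suc n * (LINT om|M. (LINT x|S. (poly p (lin (\<xi> om) x))\<^sup>2) ^ Suc n)" by (rule integral_mult_right_zero)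
 also have "... \<le> A ^ Suc n * (\<mu> ^ Suc n * (LINT z|gauss. poly p z ^ (2 * Suc n)))"
  using A_pos by (intro mult_left_mono square_integral_moment) simp
 finally show ?thesis by (simp only: power_mult_distrib mult_ac)
qed

text \<open>\<open>wiener_ibp\<close> in direction e j against the constant functional 1, taken as a
  functional of zero variables.\<close>

lemma \<xi>_ibp:
 assumes F: "polyfun r F" and j: "j < r"
 shows "(LINT om|M. \<xi> om j * F (\<xi> om)) = (LINT om|M. partial_deriv j F (\<xi> om))"
proof -
 have s: "(\<Sum>i<r. partial_deriv i F (\<xi> om) * (LINT x|S. e i x * e j x)) = partial_deriv j F (\<xi> om)" for om
 proof -
  have "(\<Sum>i<r. partial_deriv i F (\<xi> om) * (LINT x|S. e i x * e j x)) = (\<Sum>i<r. if i = j then partial_deriv i F (\<xi> om) else 0)"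
   using j by (intro sum.cong refl) (simp add: e_on)
  then show ?thesis using j by simp
 qed
 have "(LINT om|M. (\<Sum>i<r. partial_deriv i F (%i. wi (e i) om) * (LINT x|S. e i x * e j x)) * 1)
  = (LINT om|M. F (%i. wi (e i) om) * (1 * wi (e j) om - (\<Sum>i<0. partial_deriv i (%_. 1) (%i. wi (e i) om) * (LINT x|S. e i x * e j x))))"
  by (rule wiener_ibp[OF polyfun_spg[OF F] polyfun_spg[OF polyfun_const]]) (auto intro: e_L2)
 then show ?thesis unfolding \<xi>_def[symmetric] s by (simp add: \<xi>_def mult.commute)
qed

text \<open>Moments of the vector \<open>w = \<delta>X\<close>, where \<open>\<delta>\<close> is the adjoint of the gradient.\<close>

lemma divergence_moment:
 fixes w :: "'i => (nat => real) => real" and X :: "'i => nat => (nat => real) => real"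
 assumes I: "finite I" and w: "\<And>i. i \<in> I ==> polyfun r (w i)" and X: "\<And>i j. i \<in> I ==> polyfun r (X i j)"
  and div: "\<And>i v. i \<in> I ==> w i v = (\<Sum>j<r. v j * X i j v) - (\<Sum>j<r. partial_deriv j (X i j) v)"
 defines "Q \<equiv> %v. \<Sum>i\<in>I. (w i v)\<^sup>2"
 defines "B \<equiv> %v. ((\<Sum>i\<in>I. \<Sum>j<r. (X i j v)\<^sup>2) + (\<Sum>i\<in>I. \<Sum>j<r. (partial_deriv j (w i) v)\<^sup>2)) / 2"
 shows "(LINT om|M. Q (\<xi> om) ^ Suc n) \<le> real (2 * n + 1) * (LINT om|M. Q (\<xi> om) ^ n * B (\<xi> om))"
proof -
 have Qp: "polyfun r Q" unfolding Q_def by (intro polyfun_sum polyfun_pow w)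
 have Bp: "polyfun r B" unfolding B_def divide_inverse
  by (intro polyfun_mult polyfun_add polyfun_sum polyfun_pow polyfun_const X polyfun_partial w)
 \<comment> \<open>The moment of order n + 1 is the expectation of the sum of w i G i. Integrating
   the divergence w i by parts leaves X i j paired with the gradient of G i.\<close>
 define G where "G i v = w i v * Q v ^ n" for i v
 have Gp: "polyfun r (G i)" if "i \<in> I" for i unfolding G_def[abs_def] by (intro polyfun_mult polyfun_pow Qp w that)
 define Z where "Z j v = (\<Sum>i\<in>I. 2 * w i v * partial_deriv j (w i) v)" for j v
 have dQ: "((%t. Q (v(j := t))) has_real_derivative Z j (v(j := t))) (at t)" for j v t
  unfolding Q_def Z_def
  by (intro DERIV_sum) (auto intro!: derivative_eq_intros polyfun_partial(2) w)
 have dG: "partial_deriv j (G i) = (%v. partial_deriv j (w i) v * Q v ^ n + w i v * (real n * Q v ^ (n - 1) * Z j v))"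
  if "i \<in> I" for i j
 proof (rule partial_deriv_eqI)
  fix v
  have "((%t. w i (v(j := t)) * Q (v(j := t)) ^ n) has_real_derivative
   partial_deriv j (w i) (v(j := v j)) * Q (v(j := v j)) ^ n + real n * (Z j (v(j := v j)) * Q (v(j := v j)) ^ (n - Suc 0)) * w i (v(j := v j))) (at (v j))"
   by (intro DERIV_mult polyfun_partial(2)[OF w[OF that]] DERIV_power dQ)
  then show "((%t. G i (v(j := t))) has_real_derivative partial_deriv j (w i) v * Q v ^ n + w i v * (real n * Q v ^ (n - 1) * Z j v)) (at (v j))"
   unfolding G_def by (simp add: mult_ac)
 qed
 have dXG: "partial_deriv j (%v. X i j v * G i v) = (%v. partial_deriv j (X i j) v * G i v + X i j v * partial_deriv j (G i) v)"
  if "i \<in> I" for i j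
 proof (rule partial_deriv_eqI)
  fix v
  from DERIV_mult[OF polyfun_partial(2)[OF X[OF that, of j], where i = j and x = v and t = "v j"]
   polyfun_partial(2)[OF Gp[OF that], where i = j and x = v and t = "v j"]]
  show "((%t. X i j (v(j := t)) * G i (v(j := t))) has_real_derivative partial_deriv j (X i j) v * G i v + X i j v * partial_deriv j (G i) v) (at (v j))"
   by (simp add: mult_ac)
 qed
 note int = all_moments_integrable[OF wiener_e_moments]
 have step: "(LINT om|M. w i (\<xi> om) * G i (\<xi> om)) = (LINT om|M. (\<Sum>j<r. X i j (\<xi> om) * partial_deriv j (G i) (\<xi> om)))" if i: "i \<in> I" for i
 proof -
  have XG: "polyfun r (%v. X i j v * G i v)" for j by (intro polyfun_mult X Gp i)
  have p1: "polyfun r (%v. v j * (X i j v * G i v))" if "j < r" for j by (intro polyfun_mult polyfun_var X Gp i that)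
  have p2: "polyfun r (%v. partial_deriv j (X i j) v * G i v)" for j by (intro polyfun_mult polyfun_partial X Gp i)
  have p3: "polyfun r (%v. X i j v * partial_deriv j (G i) v)" for j by (intro polyfun_mult polyfun_partial X Gp i)
  have "(LINT om|M. w i (\<xi> om) * G i (\<xi> om)) = (LINT om|M. (\<Sum>j<r. \<xi> om j * (X i j (\<xi> om) * G i (\<xi> om))) - (\<Sum>j<r. partial_deriv j (X i j) (\<xi> om) * G i (\<xi> om)))"
   unfolding div[OF i] by (simp only: left_diff_distrib sum_distrib_right mult.assoc)
  also have "... = (LINT om|M. (\<Sum>j<r. \<xi> om j * (X i j (\<xi> om) * G i (\<xi> om)))) - (LINT om|M. (\<Sum>j<r. partial_deriv j (X i j) (\<xi> om) * G i (\<xi> om)))"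
   by (intro bi_diff bi_int_sum int[OF p1] int[OF p2]) auto
  also have "(LINT om|M. (\<Sum>j<r. \<xi> om j * (X i j (\<xi> om) * G i (\<xi> om)))) = (\<Sum>j<r. \<integral>om. \<xi> om j * (X i j (\<xi> om) * G i (\<xi> om)) \<partial>M)"
   by (intro bi_sum int[OF p1]) simp
  also have "... = (\<Sum>j<r. \<integral>om. partial_deriv j (X i j) (\<xi> om) * G i (\<xi> om) + X i j (\<xi> om) * partial_deriv j (G i) (\<xi> om) \<partial>M)"
   by (intro sum.cong refl) (simp only: \<xi>_ibp[OF XG] lessThan_iff dXG[OF i])
  also have "... = (\<Sum>j<r. \<integral>om. partial_deriv j (X i j) (\<xi> om) * G i (\<xi> om) \<partial>M) + (\<Sum>j<r. \<integral>om. X i j (\<xi> om) * partial_deriv j (G i) (\<xi> om) \<partial>M)"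
   unfolding sum.distrib[symmetric] by (intro sum.cong refl bi_add int[OF p2] int[OF p3])
  also have "(\<Sum>j<r. \<integral>om. partial_deriv j (X i j) (\<xi> om) * G i (\<xi> om) \<partial>M) = (LINT om|M. (\<Sum>j<r. partial_deriv j (X i j) (\<xi> om) * G i (\<xi> om)))"
   by (intro bi_sum[symmetric] int[OF p2])
  also have "(\<Sum>j<r. \<integral>om. X i j (\<xi> om) * partial_deriv j (G i) (\<xi> om) \<partial>M) = (LINT om|M. (\<Sum>j<r. X i j (\<xi> om) * partial_deriv j (G i) (\<xi> om)))"
   by (intro bi_sum[symmetric] int[OF p3])
  finally show ?thesis by simp
 qed
 \<comment> \<open>The gradient of Q^n carries n Q^(n-1) times twice the sum of w times its
   gradient. Cauchy-Schwarz in i restores one factor Q, so this part contributes 2 n and the direct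
   term 1.\<close>
 have pt: "(\<Sum>i\<in>I. \<Sum>j<r. X i j v * partial_deriv j (G i) v) \<le> real (2 * n + 1) * (Q v ^ n * B v)" for v
 proof -
  have Q0: "Q v \<ge> 0" unfolding Q_def by (intro sum_nonneg) simp
  define D where "D i j = partial_deriv j (w i) v" for i j
  have hm: "x * y \<le> (x\<^sup>2 + y\<^sup>2) / 2" for x y :: real using sum_squares_bound[of x y] by simp
  have B_eq: "B v = (\<Sum>i\<in>I. \<Sum>j<r. ((X i j v)\<^sup>2 + (D i j)\<^sup>2) / 2)"
   unfolding B_def D_def by (simp only: sum_divide_distrib[symmetric] sum.distrib)
  have 1: "(\<Sum>i\<in>I. \<Sum>j<r. X i j v * D i j) \<le> B v"
   unfolding B_eq by (intro sum_mono hm)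
  have cs: "(\<Sum>i\<in>I. Y i j * w i v)\<^sup>2 \<le> (\<Sum>i\<in>I. (Y i j)\<^sup>2) * Q v" for Y :: "'i => nat => real" and j
   unfolding Q_def by (rule Cauchy_Schwarz_ineq_sum)
  have 2: "(\<Sum>j<r. (\<Sum>i\<in>I. X i j v * w i v) * (\<Sum>i\<in>I. D i j * w i v)) \<le> B v * Q v"
  proof -
   have "(\<Sum>j<r. (\<Sum>i\<in>I. X i j v * w i v) * (\<Sum>i\<in>I. D i j * w i v))
     \<le> (\<Sum>j<r. ((\<Sum>i\<in>I. (X i j v)\<^sup>2) * Q v + (\<Sum>i\<in>I. (D i j)\<^sup>2) * Q v) / 2)"
   proof (rule sum_mono)
    fix j
    show "(\<Sum>i\<in>I. X i j v * w i v) * (\<Sum>i\<in>I. D i j * w i v) \<le> ((\<Sum>i\<in>I. (X i j v)\<^sup>2) * Q v + (\<Sum>i\<in>I. (D i j)\<^sup>2) * Q v) / 2"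
     by (rule order_trans[OF hm divide_right_mono[OF add_mono[OF cs cs]]]) simp
   qed
   also have "... = (\<Sum>j<r. \<Sum>i\<in>I. ((X i j v)\<^sup>2 + (D i j)\<^sup>2) / 2) * Q v"
    unfolding sum_distrib_right by (intro sum.cong refl) (simp add: sum.distrib sum_divide_distrib[symmetric] sum_distrib_right[symmetric] distrib_right add_divide_distrib)
   also have "... = B v * Q v" unfolding B_eq by (subst sum.swap) simp
   finally show ?thesis .
  qed
  have "(\<Sum>i\<in>I. \<Sum>j<r. X i j v * partial_deriv j (G i) v)
    = (\<Sum>i\<in>I. \<Sum>j<r. Q v ^ n * (X i j v * D i j) + (real n * Q v ^ (n - 1)) * (X i j v * w i v * Z j v))"
   by (intro sum.cong refl) (simp add: dG D_def algebra_simps)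
  also have "... = Q v ^ n * (\<Sum>i\<in>I. \<Sum>j<r. X i j v * D i j) + (real n * Q v ^ (n - 1)) * (\<Sum>i\<in>I. \<Sum>j<r. X i j v * w i v * Z j v)"
   by (simp only: sum.distrib sum_distrib_left)
  also have "(\<Sum>i\<in>I. \<Sum>j<r. X i j v * w i v * Z j v) = 2 * (\<Sum>j<r. (\<Sum>i\<in>I. X i j v * w i v) * (\<Sum>i\<in>I. D i j * w i v))"
  proof -
   have "Z j v = 2 * (\<Sum>i\<in>I. D i j * w i v)" for j
    unfolding Z_def D_def sum_distrib_left by (intro sum.cong refl) (simp only: mult_ac)
   then have "(\<Sum>i\<in>I. \<Sum>j<r. X i j v * w i v * Z j v) = (\<Sum>j<r. \<Sum>i\<in>I. X i j v * w i v * (2 * (\<Sum>i\<in>I. D i j * w i v)))"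
    by (subst sum.swap) simp
   also have "... = (\<Sum>j<r. 2 * ((\<Sum>i\<in>I. X i j v * w i v) * (\<Sum>i\<in>I. D i j * w i v)))"
   proof (rule sum.cong[OF refl])
    have "(\<Sum>i\<in>I. X i j v * w i v * (2 * s)) = 2 * ((\<Sum>i\<in>I. X i j v * w i v) * s)" for s j
     by (simp add: sum_distrib_left sum_distrib_right mult_ac)
    then show "(\<Sum>i\<in>I. X i j v * w i v * (2 * (\<Sum>i\<in>I. D i j * w i v))) = 2 * ((\<Sum>i\<in>I. X i j v * w i v) * (\<Sum>i\<in>I. D i j * w i v))" for j .
   qed
   finally show ?thesis by (simp only: sum_distrib_left)
  qed
  also have "Q v ^ n * (\<Sum>i\<in>I. \<Sum>j<r. X i j v * D i j) + (real n * Q v ^ (n - 1)) * (2 * (\<Sum>j<r. (\<Sum>i\<in>I. X i j v * w i v) * (\<Sum>i\<in>I. D i j * w i v)))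
    \<le> Q v ^ n * B v + (real n * Q v ^ (n - 1)) * (2 * (B v * Q v))"
   using 1 2 Q0 by (intro add_mono mult_left_mono) auto
  also have "... = real (2 * n + 1) * (Q v ^ n * B v)"
  proof (cases n)
   case (Suc k)
   then show ?thesis by (simp add: algebra_simps)
  qed simp
  finally show ?thesis .
 qed
 have "Q v ^ Suc n = (\<Sum>i\<in>I. w i v * G i v)" for v
  by (simp add: Q_def G_def power2_eq_square sum_distrib_right sum_distrib_left mult_ac)
 then have "(LINT om|M. Q (\<xi> om) ^ Suc n) = (LINT om|M. (\<Sum>i\<in>I. w i (\<xi> om) * G i (\<xi> om)))" by simp
 also have "... = (\<Sum>i\<in>I. \<integral>om. w i (\<xi> om) * G i (\<xi> om) \<partial>M)"
  by (intro bi_sum int[of "%v. w _ v * G _ v"] polyfun_mult w Gp)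
 also have "... = (\<Sum>i\<in>I. \<integral>om. (\<Sum>j<r. X i j (\<xi> om) * partial_deriv j (G i) (\<xi> om)) \<partial>M)"
  by (intro sum.cong refl step)
 also have "... = (LINT om|M. (\<Sum>i\<in>I. \<Sum>j<r. X i j (\<xi> om) * partial_deriv j (G i) (\<xi> om)))"
  by (intro bi_sum[symmetric] int[of "%v. \<Sum>j<r. X _ j v * partial_deriv j (G _) v"] polyfun_sum polyfun_mult X polyfun_partial Gp)
 also have "... \<le> (LINT om|M. real (2 * n + 1) * (Q (\<xi> om) ^ n * B (\<xi> om)))"
  by (intro integral_mono pt int[of "%v. \<Sum>i\<in>I. \<Sum>j<r. X i j v * partial_deriv j (G i) v"] int[of "%v. real (2 * n + 1) * (Q v ^ n * B v)"]
   polyfun_sum polyfun_mult polyfun_pow polyfun_const X polyfun_partial Gp Qp Bp)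
 also have "... = real (2 * n + 1) * (LINT om|M. Q (\<xi> om) ^ n * B (\<xi> om))" by (rule integral_mult_right_zero)
 finally show ?thesis .
qed

text \<open>\<open>divergence_moment\<close> with the vector field built from \<chi>' and the
  coefficient functions: since the squares of the a j sum to one (\<open>sq\<close>), its trace term
  is the integral of \<chi>''. Both the field and the gradient of the functional are sums of order k
  + 1, and \<open>young_absorb\<close> removes the power of the left side.\<close>

lemma Nsum_moment_step:
 assumes p: "p = pCons 0 \<chi>' - pderiv \<chi>'"
 shows "(LINT om|M. Nsum k (poly p) (\<xi> om) ^ Suc n) \<le> (2 * real (2 * n + 1)) ^ Suc n *
  ((LINT om|M. Nsum (Suc k) (poly \<chi>') (\<xi> om) ^ Suc n) + (LINT om|M. Nsum (Suc k) (poly (pderiv p)) (\<xi> om) ^ Suc n))"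
proof -
 define X where "X is j = sph (poly \<chi>') (%x. a j x * mon is x)" for "is" j
 define B where "B v = (Nsum (Suc k) (poly \<chi>') v + Nsum (Suc k) (poly (pderiv p)) v) / 2" for v
 have ac: "contU (%x. a j x * mon is x)" for j "is" by (intro continuous_intros a_cont mon_cont)
 have dX: "partial_deriv j (X is j) = sph (poly (pderiv \<chi>')) (%x. a j x * (a j x * mon is x))" if "j < r" for j "is"
  unfolding X_def by (rule sph_partial[OF that ac])
 have sq: "(\<Sum>j<r. sph (poly (pderiv \<chi>')) (%x. a j x * (a j x * mon is x)) v) = sph (poly (pderiv \<chi>')) (mon is) v" for "is" v
 proof -
  have "(\<Sum>j<r. sph (poly (pderiv \<chi>')) (%x. a j x * (a j x * mon is x)) v) = (LINT x|S. (\<Sum>j<r. poly (pderiv \<chi>') (lin v x) * (a j x * (a j x * mon is x))))"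
   unfolding sph_def by (intro bi_sum[symmetric] cint continuous_intros lin_cont a_cont mon_cont)
  also have "... = sph (poly (pderiv \<chi>')) (mon is) v"
   unfolding sph_def
  proof (intro bi_cong refl)
   fix x assume "x \<in> space S"
   then have "(\<Sum>j<r. (a j x)\<^sup>2) = 1" by (intro a_norm) simp
   moreover have "(\<Sum>j<r. poly (pderiv \<chi>') (lin v x) * (a j x * (a j x * mon is x))) = (\<Sum>j<r. (a j x)\<^sup>2) * (poly (pderiv \<chi>') (lin v x) * mon is x)"
    unfolding sum_distrib_right by (intro sum.cong refl) (simp only: power2_eq_square mult_ac)
   ultimately show "(\<Sum>j<r. poly (pderiv \<chi>') (lin v x) * (a j x * (a j x * mon is x))) = poly (pderiv \<chi>') (lin v x) * mon is x" by simp
  qed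
  finally show ?thesis .
 qed
 have "sph (poly (p + pderiv \<chi>')) (mon is) v = (\<Sum>j<r. v j * X is j v)" for "is" v
  unfolding p X_def by (simp add: sph_pCons[OF mon_cont])
 then have div: "sph (poly p) (mon is) v = (\<Sum>j<r. v j * X is j v) - (\<Sum>j<r. partial_deriv j (X is j) v)" for "is" v
  unfolding sph_add[OF mon_cont] by (simp add: dX sq algebra_simps)
 have BB: "((\<Sum>is\<in>words r k. \<Sum>j<r. (X is j v)\<^sup>2) + (\<Sum>is\<in>words r k. \<Sum>j<r. (partial_deriv j (sph (poly p) (mon is)) v)\<^sup>2)) / 2 = B v" for v
  unfolding B_def Nsum_Suc X_def by (simp add: sph_partial[OF _ mon_cont])
 have main: "(LINT om|M. Nsum k (poly p) (\<xi> om) ^ Suc n) \<le> real (2 * n + 1) * (LINT om|M. Nsum k (poly p) (\<xi> om) ^ n * B (\<xi> om))"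
  using divergence_moment[OF finite_words, of r k "%is. sph (poly p) (mon is)" X n]
  unfolding BB Nsum_def[symmetric] using sph_polyfun[OF mon_cont] sph_polyfun[OF ac] div by (simp add: X_def)
 have B0: "B v \<ge> 0" for v unfolding B_def using Nsum_nonneg by simp
 have Bp: "polyfun r B" unfolding B_def[abs_def] divide_inverse by (intro polyfun_mult polyfun_add polyfun_const Nsum_polyfun)
 have "(LINT om|M. Nsum k (poly p) (\<xi> om) ^ Suc n) \<le> (2 * real (2 * n + 1)) ^ Suc n * (LINT om|M. B (\<xi> om) ^ Suc n)"
  by (rule young_absorb[OF wiener_e_moments[OF Nsum_polyfun] Nsum_nonneg wiener_e_moments[OF Bp] B0 main]) simp
 also have "... \<le> (2 * real (2 * n + 1)) ^ Suc n * (LINT om|M. Nsum (Suc k) (poly \<chi>') (\<xi> om) ^ Suc n + Nsum (Suc k) (poly (pderiv p)) (\<xi> om) ^ Suc n)"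
 proof (rule mult_left_mono[OF integral_mono])
  show "integrable M (%om. B (\<xi> om) ^ Suc n)" by (intro all_moments_integrable_power wiener_e_moments Bp)
  show "integrable M (%om. Nsum (Suc k) (poly \<chi>') (\<xi> om) ^ Suc n + Nsum (Suc k) (poly (pderiv p)) (\<xi> om) ^ Suc n)"
   by (intro bi_int_add all_moments_integrable_power wiener_e_moments Nsum_polyfun)
  fix om
  have mx: "((x + y) / 2) ^ Suc n \<le> x ^ Suc n + y ^ Suc n" if "x \<ge> 0" "y \<ge> 0" for x y :: real
  proof -
   have "((x + y) / 2) ^ Suc n \<le> max x y ^ Suc n" using that by (intro power_mono) auto
   also have "... \<le> x ^ Suc n + y ^ Suc n" using zero_le_power[OF that(1), of "Suc n"] zero_le_power[OF that(2), of "Suc n"]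
    by (cases "x \<le> y") (simp_all add: max_def del: power_Suc)
   finally show ?thesis .
  qed
  show "B (\<xi> om) ^ Suc n \<le> Nsum (Suc k) (poly \<chi>') (\<xi> om) ^ Suc n + Nsum (Suc k) (poly (pderiv p)) (\<xi> om) ^ Suc n"
   unfolding B_def by (intro mx Nsum_nonneg)
 qed simp
 also have "(LINT om|M. Nsum (Suc k) (poly \<chi>') (\<xi> om) ^ Suc n + Nsum (Suc k) (poly (pderiv p)) (\<xi> om) ^ Suc n)
  = (LINT om|M. Nsum (Suc k) (poly \<chi>') (\<xi> om) ^ Suc n) + (LINT om|M. Nsum (Suc k) (poly (pderiv p)) (\<xi> om) ^ Suc n)"
  by (intro bi_add all_moments_integrable_power wiener_e_moments Nsum_polyfun)
 finally show ?thesis .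
qed

end

text \<open>Differentiation on Hermite coefficients.\<close>

definition shift :: "(nat => real) => nat => real" where "shift c q = c (Suc q)"

text \<open>Inverse of the number operator on coefficients. At q = 0 division by zero returns 0, so
  the constant term is discarded.\<close>

definition ninv :: "(nat => real) => nat => real" where "ninv c q = c q / real q"

lemma rapid_shift': "rapid c ==> rapid (shift c)" using rapid_shift[of c] by (simp add: shift_def[abs_def])

lemma rapid_ninv: "rapid c ==> rapid (ninv c)"
proof (erule rapid_mono[where K = 1])
 show "\<bar>ninv c q\<bar> \<le> 1 * 2 ^ q * \<bar>c q\<bar>" for q
 proof (cases q)
  case (Suc k)
  have "\<bar>ninv c q\<bar> \<le> \<bar>c q\<bar>" using Suc by (simp add: ninv_def field_simps mult_left_le)
  also have "... \<le> 2 ^ q * \<bar>c q\<bar>" using mult_right_mono[of 1 "2 ^ q" "\<bar>c q\<bar>"] by simp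
  finally show ?thesis by simp
 qed (simp add: ninv_def)
qed simp

lemma pderiv_hs_Suc: "pderiv (hs c (Suc N)) = hs (shift c) N"
 by (simp add: pderiv_hs shift_def[abs_def])

text \<open>The polynomial \<open>hs (ninv c) N\<close> solves the Ornstein--Uhlenbeck equation with right-hand side \<open>- hs c N\<close>.\<close>

lemma hs_divergence:
 assumes "c 0 = 0"
 shows "hs c (Suc N) = pCons 0 (hs (shift (ninv c)) N) - pderiv (hs (shift (ninv c)) N)"
proof (induction N)
 case 0
 show ?case using assms by (simp add: hs_def shift_def ninv_def)
next
 case (Suc N)
 have h: "hs c (Suc N) = hs c N + smult (c (Suc N) / fact (Suc N)) (hermp (Suc N))" for c N by (simp add: hs_def)
 have "smult (c (Suc (Suc N)) / fact (Suc (Suc N))) (hermp (Suc (Suc N))) = smult (shift (ninv c) (Suc N) / fact (Suc N)) ([:0, 1:] * hermp (Suc N) - pderiv (hermp (Suc N)))"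
  unfolding shift_def ninv_def hermp.simps(2)[of "Suc N"] by simp
 then show ?case unfolding h[of _ "Suc N"] h[of _ N] Suc[unfolded h[of _ N]]
  unfolding pderiv_add pderiv_smult by (simp add: algebra_simps smult_diff_right del: hermp.simps)
qed

text \<open>One integration by parts replaces c by the two sequences \<open>shift (ninv c)\<close>
  and \<open>shift c\<close>, coming from \<chi>' and from the derivative, and costs the factor K.
  Order 1 needs one use and order 0 two. Only n, k, c and N enter, no quantity of the field; hence
  the final bound is uniform in the degree.\<close>

definition mconst :: "nat => nat => (nat => real) => nat => real" where
 "mconst n k c N = (let G = (%c N. \<integral>z. poly (hs c N) z ^ (2 * Suc n) \<partial>gauss); K = (2 * real (2 * n + 1)) ^ Suc n;
  H = (%c N. K * (G (shift (ninv c)) N + G (shift c) N)) in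
  if k = 0 then K * (H (shift (ninv c)) N + H (shift c) N) else if k = 1 then H c N else G c N)"

lemma mconst_bounded:
 assumes c: "rapid c" shows "\<exists>C\<ge>0. \<forall>N. mconst n k c N \<le> C"
proof -
 define G where "G c N = (LINT z|gauss. poly (hs c N) z ^ (2 * Suc n))" for c N
 define K where "K = (2 * real (2 * n + 1)) ^ Suc n"
 have K: "K \<ge> 0" by (simp add: K_def)
 have add: "\<exists>C\<ge>0. \<forall>N. K * (F N + F' N) \<le> C" if "\<exists>C\<ge>0. \<forall>N::nat. F N \<le> C" "\<exists>C\<ge>0. \<forall>N. F' N \<le> C" for F F' :: "nat => real"
 proof -
  from that(1) obtain C1 where C1: "C1 \<ge> 0 \<and> (\<forall>N. F N \<le> C1)" by (elim exE)
  from that(2) obtain C2 where C2: "C2 \<ge> 0 \<and> (\<forall>N. F' N \<le> C2)" by (elim exE)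
  have "K * (F N + F' N) \<le> K * (C1 + C2)" for N using C1 C2 K by (intro mult_left_mono add_mono) simp_all
  moreover have "K * (C1 + C2) \<ge> 0" using C1 C2 K by simp
  ultimately show ?thesis by blast
 qed
 have G: "\<exists>C\<ge>0. \<forall>N. G c N \<le> C" if "rapid c" for c using rapid_moments[OF that, of "Suc n"] by (simp add: G_def)
 have H: "\<exists>C\<ge>0. \<forall>N. K * (G (shift (ninv c)) N + G (shift c) N) \<le> C" if "rapid c" for c
  by (intro add G rapid_shift' rapid_ninv that)
 have "\<exists>C\<ge>0. \<forall>N. K * (K * (G (shift (ninv (shift (ninv c)))) N + G (shift (shift (ninv c))) N) + K * (G (shift (ninv (shift c))) N + G (shift (shift c)) N)) \<le> C"
  by (rule add; rule H) (intro rapid_shift' rapid_ninv c)+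
 then show ?thesis using H[OF c] G[OF c] unfolding mconst_def Let_def G_def[symmetric] K_def[symmetric]
  by (cases "k = 0"; cases "k = 1") simp_all
qed

text \<open>Each integration by parts raises the order by one and shortens the truncation by one,
  until order 2 is reached with truncation N. This explains the index
  \<open>Suc (Suc N) - k\<close>.\<close>

lemma (in frame) Nsum_moment:
 assumes "k = 0 ==> c 0 = 0"
 shows "(LINT om|M. Nsum k (poly (hs c (Suc (Suc N) - k))) (\<xi> om) ^ Suc n) \<le> (\<mu> * A) ^ Suc n * mconst n k c (if k \<le> 2 then N else Suc (Suc N) - k)"
proof -
 define G where "G c N = (LINT z|gauss. poly (hs c N) z ^ (2 * Suc n))" for c N
 define K where "K = (2 * real (2 * n + 1)) ^ Suc n"
 have K: "K \<ge> 0" by (simp add: K_def)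
 define E where "E k p = (LINT om|M. Nsum k (poly p) (\<xi> om) ^ Suc n)" for k p
 have E2: "E k (hs c N) \<le> (\<mu> * A) ^ Suc n * G c N" if "k \<ge> 2" for k c N
  unfolding E_def G_def by (rule Nsum_moment_ge_2[OF that])
 have step: "E k (hs c (Suc N)) \<le> K * (E (Suc k) (hs (shift (ninv c)) N) + E (Suc k) (hs (shift c) N))" if "c 0 = 0" for k c N
  unfolding E_def K_def pderiv_hs_Suc[symmetric, of c] by (rule Nsum_moment_step[OF hs_divergence[of c N, OF that]])
 have E1: "E 1 (hs c (Suc N)) \<le> (\<mu> * A) ^ Suc n * (K * (G (shift (ninv c)) N + G (shift c) N))" for c N
 proof -
  \<comment> \<open>\<open>hs_divergence\<close> asks for a vanishing constant term. At order 1 the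
    constant may be dropped because each a i has integral zero.\<close>
  define c0 where "c0 q = (if q = 0 then 0 else c q)" for q
  have c0: "shift (ninv c0) = shift (ninv c)" "shift c0 = shift c" by (auto simp: shift_def ninv_def c0_def)
  have "hs c M = hs c0 M + [:c 0:]" for M
  proof (induction M)
   case (Suc M)
   have h: "hs c (Suc M) = hs c M + smult (c (Suc M) / fact (Suc M)) (hermp (Suc M))" for c by (simp add: hs_def)
   show ?case unfolding h Suc by (simp add: c0_def)
  qed (simp add: hs_def c0_def)
  then have "sph (poly (hs c M)) (mon [i]) v = sph (poly (hs c0 M)) (mon [i]) v" if "i < r" for i v M
   using a_int[OF that] sph_add[OF mon_cont, of "hs c0 M" "[:c 0:]" "[i]" v] by (simp add: sph_def)
  then have "Nsum 1 (poly (hs c M)) v = Nsum 1 (poly (hs c0 M)) v" for v M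
   unfolding Nsum_def by (intro sum.cong refl) (auto simp: words_def length_Suc_conv)
  then have "E 1 (hs c (Suc N)) = E 1 (hs c0 (Suc N))" by (simp add: E_def)
  also have "... \<le> K * (E (Suc 1) (hs (shift (ninv c)) N) + E (Suc 1) (hs (shift c) N))"
   unfolding c0[symmetric] by (rule step) (simp add: c0_def)
  also have "K * (E (Suc 1) (hs (shift (ninv c)) N) + E (Suc 1) (hs (shift c) N))
   \<le> K * ((\<mu> * A) ^ Suc n * G (shift (ninv c)) N + (\<mu> * A) ^ Suc n * G (shift c) N)"
   using K by (intro mult_left_mono add_mono E2) auto
  finally show ?thesis by (simp only: distrib_left mult_ac)
 qed
 have E0: "E 0 (hs c (Suc (Suc N))) \<le> (\<mu> * A) ^ Suc n * (K * (K * (G (shift (ninv (shift (ninv c)))) N + G (shift (shift (ninv c))) N) + K * (G (shift (ninv (shift c))) N + G (shift (shift c)) N)))"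
  if "c 0 = 0"
 proof -
  have "E 0 (hs c (Suc (Suc N))) \<le> K * (E 1 (hs (shift (ninv c)) (Suc N)) + E 1 (hs (shift c) (Suc N)))"
   using step[of c 0 "Suc N", OF that] by simp
  also have "... \<le> K * ((\<mu> * A) ^ Suc n * (K * (G (shift (ninv (shift (ninv c)))) N + G (shift (shift (ninv c))) N))
    + (\<mu> * A) ^ Suc n * (K * (G (shift (ninv (shift c))) N + G (shift (shift c)) N)))"
   using K by (intro mult_left_mono add_mono E1) auto
  finally show ?thesis by (simp only: distrib_left mult_ac)
 qed
 consider "k = 0" | "k = 1" | "k \<ge> 2" by linarith
 then show ?thesis
 proof cases
  case 1
  then show ?thesis using E0 assms unfolding mconst_def Let_def G_def[symmetric] K_def[symmetric] E_def[symmetric] by simp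
 next
  case 2
  then show ?thesis using E1[of c N] unfolding mconst_def Let_def G_def[symmetric] K_def[symmetric] E_def[symmetric] by simp
 next
  case 3
  then show ?thesis using E2[OF 3, of c "Suc (Suc N) - k"] unfolding mconst_def Let_def G_def[symmetric] K_def[symmetric] E_def[symmetric]
   by (cases "k = 2") auto
 qed
qed

text \<open>Finite-rank functions of two variables. The class Q of second factors is a parameter
  because it is the continuous functions for the harmonic kernel, and the polynomials in Gaussian
  coordinates for Hermite polynomials of the field.\<close>

inductive separated :: "(('y => real) => bool) => ('x::topological_space => 'y => real) => bool" for Q where
 separated_0: "separated Q (%x y. 0)"
| separated_add: "contU f ==> Q g ==> separated Q F ==> separated Q (%x y. f x * g y + F x y)"

lemma separated_sum_ex:
 assumes "separated Q F"
 shows "\<exists>(n::nat) \<alpha> \<beta>. (\<forall>k<n. contU (\<alpha> k) \<and> Q (\<beta> k)) \<and> (\<forall>x y. F x y = (\<Sum>k<n. \<alpha> k x * \<beta> k y))"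
 using assms
proof induction
 case separated_0
 show ?case by (intro exI[of _ 0]) simp
next
 case (separated_add f g F)
 then obtain n :: nat and \<alpha> \<beta> where IH: "\<And>k. k < n ==> contU (\<alpha> k) \<and> Q (\<beta> k)" "\<And>x y. F x y = (\<Sum>k<n. \<alpha> k x * \<beta> k y)" by blast
 show ?case
  by (intro exI[of _ "Suc n"] exI[of _ "\<alpha>(n := f)"] exI[of _ "\<beta>(n := g)"])
   (use IH separated_add in \<open>auto simp: less_Suc_eq\<close>)
qed

lemma separated_plus:
 assumes "separated Q F" "separated Q G" shows "separated Q (%x y. F x y + G x y)"
 using assms(1)
proof induction
 case separated_0
 show ?case using assms(2) by simp
next
 case (separated_add f g F)
 from separated.separated_add[OF separated_add(1,2,4)] show ?case by (simp add: add.assoc)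
qed

lemma separated_mult:
 assumes "separated Q F" "contU f" "\<And>h. Q h ==> Q (%y. g y * h y)" shows "separated Q (%x y. f x * g y * F x y)"
 using assms(1)
proof induction
 case separated_0
 show ?case using separated.separated_0 by simp
next
 case (separated_add f' g' F)
 have "separated Q (%x y. (f x * f' x) * (g y * g' y) + f x * g y * F x y)"
  using separated_add by (intro separated.separated_add continuous_intros assms(2,3)) auto
 then show ?case by (simp add: distrib_left mult_ac)
qed

lemma separated_poly:
 assumes Q1: "\<And>c. Q (%y. c)" and f: "\<And>i. i \<in> I ==> contU (f i)"
  and g: "\<And>i h. i \<in> I ==> Q h ==> Q (%y. g i y * h y)" and I: "finite I"
 shows "separated Q (%x y. poly p (\<Sum>i\<in>I. f i x * g i y))"
proof (induction p)
 case 0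
 show ?case using separated_0 by simp
next
 case (pCons c p)
 have "separated Q (%x y. \<Sum>i\<in>J. f i x * g i y * poly p (\<Sum>i\<in>I. f i x * g i y))" if "J \<subseteq> I" for J
  using finite_subset[OF that I] that
 proof (induction J rule: finite_induct)
  case empty
  show ?case using separated_0 by simp
 next
  case (insert j J)
  have "separated Q (%x y. f j x * g j y * poly p (\<Sum>i\<in>I. f i x * g i y))"
   using insert by (intro separated_mult pCons.IH f g) auto
  with insert show ?case by (simp add: separated_plus)
 qed
 from separated_add[OF _ Q1 this[OF order_refl], of "%_. 1" c]
 show ?case by (simp add: sum_distrib_right)
qed

text \<open>A polynomial in x \<bullet> y has finite rank. Gram-Schmidt on the right factors of the
  kernel gives e, and recombining the left factors gives the continuous a. The frame conditions then
  restate unit norm, mean zero and zonality of the kernel.\<close>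

lemma (in white_noise_space) frame_exists:
 assumes d: "d \<ge> 2" and l: "l \<ge> 1"
 shows "\<exists>r e a A. frame M W d r e a A \<and>
  (\<forall>x. norm x = 1 \<longrightarrow> (AE om in M. wi (harmonic_kernel d l x) om = (\<Sum>i<r. a i x * wi (e i) om)))"
proof -
 define K :: "'a => 'a => real" where "K = harmonic_kernel d l"
 have Kc: "contU (K x)" for x unfolding K_def harmonic_kernel_def[abs_def] by (intro continuous_intros)
 have cL2: "contU f ==> L2 S f" for f :: "'a => real"
  unfolding L2_def by (auto intro!: continuous_sphere_integrable continuous_intros)
 have "separated (contU) K"
 proof -
  have "separated (contU) (%x y::'a. poly (smult (sqrt (harmonic_dim d l / sphere_mass d)) (gegenbauer_sphere d l)) (\<Sum>b\<in>Basis. (x \<bullet> b) * (y \<bullet> b)))"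
   by (rule separated_poly) (auto intro!: continuous_intros)
  then show ?thesis unfolding K_def harmonic_kernel_def[abs_def] by (simp add: euclidean_inner[symmetric])
 qed
 then obtain n :: nat and \<alpha> \<beta> where \<alpha>\<beta>: "\<And>k. k < n ==> contU (\<alpha> k)" "\<And>k. k < n ==> contU (\<beta> k)"
   and K: "\<And>x y. K x y = (\<Sum>k<n. \<alpha> k x * \<beta> k y)" using separated_sum_ex by blast
 have \<beta>L: "L2 S (\<beta> k)" if "k < n" for k by (rule cL2[OF \<alpha>\<beta>(2)[OF that]])
 obtain r :: nat and e' B where e': "\<forall>i<r. L2 S (e' i)"
   "\<forall>i<r. \<forall>j<r. (LINT x|S. e' i x * e' j x) = (if i = j then 1 else 0)" "\<forall>k<n. AE x in S. \<beta> k x = (\<Sum>i<r. B k i * e' i x)"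
  by (rule gram_schmidt_obtain[of n S \<beta>, OF \<beta>L]) (assumption, rule that)
 \<comment> \<open>Extended by zero beyond r, since \<open>frame\<close> asks for square
   integrability at every index.\<close>
 define e where "e i = (if i < r then e' i else (%_. 0))" for i
 define a where "a i x = (\<Sum>k<n. \<alpha> k x * B k i)" for i x
 have eL: "L2 S (e i)" for i using e'(1) by (simp add: e_def L2_zero)
 have eo: "(LINT x|S. e i x * e j x) = (if i = j then 1 else 0)" if "i < r" "j < r" for i j using e'(2) that by (simp add: e_def)
 have ac: "contU (a i)" for i unfolding a_def by (intro continuous_intros \<alpha>\<beta>) auto
 have "AE y in S. \<forall>k<n. \<beta> k y = (\<Sum>i<r. B k i * e i y)"
  using e'(3) by (intro AE_all_countable[THEN iffD2] allI) (auto simp: e_def AE_conj_iff intro: eventually_mono)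
 then have Ke: "AE y in S. K x y = (\<Sum>i<r. a i x * e i y)" for x
 proof eventually_elim
  case (elim y)
  have "K x y = (\<Sum>k<n. \<Sum>i<r. \<alpha> k x * B k i * e i y)" unfolding K using elim by (simp add: sum_distrib_left mult.assoc)
  also have "... = (\<Sum>i<r. a i x * e i y)" unfolding a_def sum_distrib_right by (rule sum.swap)
  finally show ?case .
 qed
 have lin: "(LINT y|S. (\<Sum>i<r. u i * e i y) * f y) = (\<Sum>i<r. u i * (LINT y|S. e i y * f y))" if "L2 S f" for u f
 proof -
  have "(LINT y|S. (\<Sum>i<r. u i * e i y) * f y) = (LINT y|S. (\<Sum>i<r. u i * (e i y * f y)))" by (simp only: sum_distrib_right mult.assoc)
  also have "... = (\<Sum>i<r. \<integral>y. u i * (e i y * f y) \<partial>S)"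
   by (intro bi_sum integrable_mult_right L2_mult_integrable eL that)
  finally show ?thesis by (simp only: integral_mult_right_zero)
 qed
 have coef: "(LINT y|S. (\<Sum>i<r. u i * e i y) * e j y) = u j" if "j < r" for u j
 proof -
  have "(LINT y|S. (\<Sum>i<r. u i * e i y) * e j y) = (\<Sum>i<r. if i = j then u i else 0)"
   unfolding lin[OF eL] using that by (intro sum.cong refl) (simp add: eo)
  then show ?thesis using that by simp
 qed
 have [measurable]: "K x \<in> borel_measurable S" "e i \<in> borel_measurable S" for x i
  using continuous_sphere_integrable(2)[OF Kc] eL by (auto simp: L2_def)
 have Kl: "L2 S (%y. \<Sum>i<r. u i * e i y)" for u by (intro L2_sum L2_cmult eL)
 have corr: "(LINT z|S. K x z * K y z) = (\<Sum>i<r. a i x * a i y)" for x y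
 proof -
  have "(LINT z|S. K x z * K y z) = (LINT z|S. (\<Sum>i<r. a i x * e i z) * (\<Sum>i<r. a i y * e i z))"
   by (rule integral_cong_AE) (measurable, use Ke[of x] Ke[of y] in eventually_elim, simp)
  also have "... = (\<Sum>i<r. a i x * (LINT z|S. (\<Sum>i<r. a i y * e i z) * e i z))"
   unfolding lin[OF Kl] by (simp only: mult.commute[of "e _ _"])
  finally show ?thesis by (simp add: coef)
 qed
 have x1: "(LINT z|S. K x z * K x z) = 1" "(LINT z|S. K z x) = 0" if "norm x = 1" for x
  using harmonic_kernel_norm[OF d dim l that] unfolding K_def harmonic_kernel_commute[of d l _ x] by (simp_all add: power2_eq_square)
 obtain F where F: "\<And>x y. norm x = 1 ==> norm y = 1 ==> (\<Sum>i<r. a i x * a i y) = poly F (x \<bullet> y)"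
  using harmonic_kernel_correlation[OF d dim, of l] unfolding K_def[symmetric] corr by blast
 have "DIM('a) \<ge> 2" using d dim by simp
 then obtain A where A: "\<And>x::'a. norm x = 1 ==> (LINT z|S. poly (F\<^sup>2) (x \<bullet> z)) = A"
  using sphere_poly_integral_const[of "F\<^sup>2"] by blast
 \<comment> \<open>Integrating the kernel in its first variable gives zero, so the combination of
   the e i with the means of a i vanishes almost everywhere; pairing with e j isolates one
   mean.\<close>
 have aint: "(LINT x|S. a j x) = 0" if "j < r" for j
 proof -
  define m where "m k = (LINT x|S. \<alpha> k x)" for k
  have ia: "(LINT x|S. a i x) = (\<Sum>k<n. m k * B k i)" for i
   unfolding a_def m_def by (subst bi_sum) (auto intro!: continuous_sphere_integrable continuous_intros \<alpha>\<beta>)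
  have "(\<Sum>k<n. m k * \<beta> k z) = (LINT x|S. K x z)" for z
   unfolding K m_def by (subst bi_sum) (auto intro!: continuous_sphere_integrable continuous_intros \<alpha>\<beta>)
  then have z: "(\<Sum>k<n. m k * \<beta> k z) = 0" if "norm z = 1" for z using x1(2)[OF that] by simp
  have "AE y in S. (\<Sum>i<r. (LINT x|S. a i x) * e i y) = 0"
   using \<open>AE y in S. \<forall>k<n. \<beta> k y = (\<Sum>i<r. B k i * e i y)\<close> AE_space
  proof eventually_elim
   case (elim y)
   have "(\<Sum>k<n. m k * \<beta> k y) = (\<Sum>k<n. \<Sum>i<r. m k * B k i * e i y)" using elim(1) by (simp add: sum_distrib_left mult.assoc)
   also have "... = (\<Sum>i<r. (LINT x|S. a i x) * e i y)" unfolding ia sum_distrib_right by (rule sum.swap)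
   finally show ?case using z elim(2) by simp
  qed
  then have "(LINT y|S. (\<Sum>i<r. (LINT x|S. a i x) * e i y) * e j y) = (LINT y|S. 0)"
   by (intro integral_cong_AE) (auto elim!: eventually_mono)
  then show ?thesis unfolding coef[OF that] by simp
 qed
 have "frame M W d r e a A"
 proof
  show "L2 S (e i)" for i by (rule eL)
  show "i < r ==> j < r ==> (LINT x|S. e i x * e j x) = (if i = j then 1 else 0)" for i j by (rule eo)
  show "contU (a i)" for i by (rule ac)
  show "i < r ==> (LINT x|S. a i x) = 0" for i by (rule aint)
  show "(\<Sum>i<r. (a i x)\<^sup>2) = 1" if "norm x = 1" for x
   using corr[of x x] x1(1)[OF that] by (simp add: power2_eq_square)
  show "(LINT y|S. (\<Sum>i<r. a i x * a i y)\<^sup>2) = A" if x: "norm x = 1" for x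
   using A[OF x] by (subst bi_cong[OF refl, of _ _ "%z. poly (F\<^sup>2) (x \<bullet> z)"]) (simp_all add: F x)
 qed
 moreover have "AE om in M. wi (harmonic_kernel d l x) om = (\<Sum>i<r. a i x * wi (e i) om)" for x
  by (rule wiener_lincomb[OF _ eL]) (use Ke[of x] cL2[OF Kc] in \<open>auto simp: K_def\<close>)
 ultimately show ?thesis by blast
qed

section \<open>Limits of truncations and their Malliavin derivatives\<close>

context frame
begin

lemma gauss_L2_integrable: assumes "L2 gauss \<psi>" shows "integrable gauss \<psi>"
proof -
 interpret g: prob_space gauss by (rule prob_space_gauss)
 show ?thesis using L2_mult_integrable[OF assms, of "%_. 1"] by (simp add: L2_def)
qed

lemma sph_lincomb:
 assumes "L2 gauss \<psi>" "L2 gauss \<psi>'" "contU \<alpha>"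
 shows "AE om in M. sph (%z. s * \<psi> z + t * \<psi>' z) \<alpha> (\<xi> om) = s * sph \<psi> \<alpha> (\<xi> om) + t * sph \<psi>' \<alpha> (\<xi> om)"
proof -
 have i: "AE om in M. integrable S (%x. f (lin (\<xi> om) x) * \<alpha> x)" if "L2 gauss f" for f
  using that by (intro sph_fubini(2) gauss_L2_integrable assms) (auto simp: L2_def)
 show ?thesis using i[OF assms(1)] i[OF assms(2)]
 proof eventually_elim
  case (elim om)
  have "sph (%z. s * \<psi> z + t * \<psi>' z) \<alpha> (\<xi> om) = (LINT x|S. s * (\<psi> (lin (\<xi> om) x) * \<alpha> x) + t * (\<psi>' (lin (\<xi> om) x) * \<alpha> x))"
   unfolding sph_def by (simp only: distrib_right mult.assoc)
  also have "... = (LINT x|S. s * (\<psi> (lin (\<xi> om) x) * \<alpha> x)) + (LINT x|S. t * (\<psi>' (lin (\<xi> om) x) * \<alpha> x))"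
   by (intro bi_add integrable_mult_right elim)
  finally show ?case by (simp only: integral_mult_right_zero sph_def)
 qed
qed

lemma sph_tendsto:
 assumes u: "\<And>N. L2 gauss (u N)" and \<psi>: "L2 gauss \<psi>" and l: "Lp_tendsto gauss 2 u \<psi>" and \<alpha>: "contU \<alpha>"
 shows "Lp_tendsto M 2 (%N om. sph (u N) \<alpha> (\<xi> om)) (%om. sph \<psi> \<alpha> (\<xi> om))"
proof (rule L2_tendsto_zero_of_norm)
 let ?b = "%N. (\<mu> * (LINT x|S. (\<alpha> x)\<^sup>2)) * (LINT z|gauss. (u N z - \<psi> z)\<^sup>2)"
 show "L2 M (%om. sph (u N) \<alpha> (\<xi> om))" "L2 M (%om. sph \<psi> \<alpha> (\<xi> om))" for N by (rule sph_L2(1)[OF u \<alpha>] sph_L2(1)[OF \<psi> \<alpha>])+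
 then have [measurable]: "(%om. sph (u N) \<alpha> (\<xi> om)) \<in> borel_measurable M" "(%om. sph \<psi> \<alpha> (\<xi> om)) \<in> borel_measurable M" for N by (auto simp: L2_def)
 show "(LINT om|M. (sph (u N) \<alpha> (\<xi> om) - sph \<psi> \<alpha> (\<xi> om))\<^sup>2) \<le> ?b N" for N
 proof -
  have d: "L2 gauss (%z. u N z - \<psi> z)" by (intro L2_diff u \<psi>)
  have [measurable]: "(%om. sph (%z. u N z - \<psi> z) \<alpha> (\<xi> om)) \<in> borel_measurable M" using sph_L2(1)[OF d \<alpha>] by (simp add: L2_def)
  have "(LINT om|M. (sph (u N) \<alpha> (\<xi> om) - sph \<psi> \<alpha> (\<xi> om))\<^sup>2) = (LINT om|M. (sph (%z. u N z - \<psi> z) \<alpha> (\<xi> om))\<^sup>2)"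
   by (rule integral_cong_AE) (use sph_lincomb[OF u[of N] \<psi> \<alpha>, of 1 "-1"] in \<open>auto elim!: eventually_mono\<close>)
  also have "... \<le> ?b N" by (rule sph_L2(2)[OF d \<alpha>])
  finally show ?thesis .
 qed
 show "?b \<longlonglongrightarrow> 0" using tendsto_mult_left[OF l[unfolded Lp_tendsto_2_iff[OF u \<psi>]]] by simp
qed

definition hlim :: "(nat => real) => (real => real) => bool" where
 "hlim c \<psi> \<longleftrightarrow> L2 gauss \<psi> \<and> Lp_tendsto gauss 2 (%N. poly (hs c N)) \<psi>"

lemma hlim_sph_tendsto:
 assumes "hlim c \<psi>" "contU \<alpha>"
 shows "Lp_tendsto M 2 (%N om. sph (poly (hs c (N + m))) \<alpha> (\<xi> om)) (%om. sph \<psi> \<alpha> (\<xi> om))"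
proof -
 have "Lp_tendsto M 2 (%N om. sph (poly (hs c N)) \<alpha> (\<xi> om)) (%om. sph \<psi> \<alpha> (\<xi> om))"
  using assms unfolding hlim_def by (intro sph_tendsto L2_gauss_poly) auto
 then show ?thesis unfolding Lp_tendsto_def by (rule LIMSEQ_ignore_initial_segment)
qed

lemma pderiv_funpow_hs: "(pderiv ^^ k) (hs c (N + k)) = hs ((shift ^^ k) c) N"
proof (induction k arbitrary: N c)
 case (Suc k)
 have "(pderiv ^^ Suc k) (hs c (N + Suc k)) = (pderiv ^^ k) (pderiv (hs c (Suc (N + k))))" by (simp only: funpow_Suc_right o_apply add_Suc_right)
 then show ?case unfolding pderiv_hs_Suc Suc by (simp only: funpow_Suc_right o_apply)
qed simp

definition tens :: "nat list => (nat => 'a) => real" where "tens is y = (\<Prod>j<length is. e (is ! j) (y j))"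

lemma tens_L2: "is \<in> words r k ==> L2 (Sk k) (tens is)"
 unfolding tens_def[abs_def] words_def by (auto intro!: tensor_L2 e_L2)

lemma tens_inner:
 assumes "is \<in> words r k" "js \<in> words r k"
 shows "(LINT y|(Sk k). tens is y * tens js y) = (if is = js then 1 else 0)"
proof -
 have len: "length is = k" "length js = k" using assms by (auto simp: words_def)
 have "(LINT y|(Sk k). tens is y * tens js y) = (\<Prod>j<k. if is ! j = js ! j then 1 else 0)"
  unfolding tens_def len by (subst tensor_inner(2)) (auto intro!: e_L2 prod.cong e_on words_nth[OF assms(1)] words_nth[OF assms(2)])
 also have "... = (if is = js then 1 else 0)"
 proof (cases "is = js")
  case False
  then obtain j where "j < k" "is ! j \<noteq> js ! j" using len nth_equalityI by metis
  then show ?thesis using False by (simp add: prod_zero_iff) blast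
 qed simp
 finally show ?thesis .
qed

definition DS :: "nat => (real => real) => 'w \<times> (nat => 'a) => real" where
 "DS k \<psi> p = (\<Sum>is\<in>words r k. sph \<psi> (mon is) (\<xi> (fst p)) * tens is (snd p))"

lemma tensor_norm_DS: "tensor_norm k (%y. DS k \<psi> (om, y)) = sqrt (Nsum k \<psi> (\<xi> om))"
proof -
 let ?w = "%is. sph \<psi> (mon is) (\<xi> om)"
 have i: "integrable (Sk k) (%y. ?w is * ?w js * (tens is y * tens js y))" if "is \<in> words r k" "js \<in> words r k" for "is" js
  by (intro integrable_mult_right L2_mult_integrable tens_L2 that)
 have "(LINT y|(Sk k). (DS k \<psi> (om, y))\<^sup>2) = (LINT y|(Sk k). (\<Sum>is\<in>words r k. \<Sum>js\<in>words r k. ?w is * ?w js * (tens is y * tens js y)))"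
  unfolding DS_def power2_eq_square sum_product fst_conv snd_conv by (simp only: mult_ac)
 also have "... = (\<Sum>is\<in>words r k. \<integral>y. (\<Sum>js\<in>words r k. ?w is * ?w js * (tens is y * tens js y)) \<partial>Sk k)"
  by (intro bi_sum bi_int_sum i)
 also have "... = (\<Sum>is\<in>words r k. \<Sum>js\<in>words r k. \<integral>y. ?w is * ?w js * (tens is y * tens js y) \<partial>Sk k)"
  by (intro sum.cong refl bi_sum i)
 also have "... = (\<Sum>is\<in>words r k. \<Sum>js\<in>words r k. if js = is then (?w is)\<^sup>2 else 0)"
  unfolding integral_mult_right_zero by (intro sum.cong refl) (simp add: tens_inner power2_eq_square)
 also have "... = Nsum k \<psi> (\<xi> om)" by (simp add: Nsum_def)
 finally show ?thesis by (simp add: tensor_norm_def)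
qed

text \<open>Truncations are smooth functionals in the fixed coordinates e. They and their k-th
  derivatives converge in \<open>L2\<close>, the latter one word at a time because the tensors do
  not vary with N.\<close>

lemma has_malliavin_deriv_sph:
 assumes c: "hlim c \<psi>" and ck: "hlim ((shift ^^ k) c) \<psi>'"
 shows "has_malliavin_deriv M W k (%om. sph \<psi> (%x. 1) (\<xi> om)) (DS k \<psi>')"
proof -
 have L: "L2 gauss \<psi>" "L2 gauss \<psi>'" using c ck by (auto simp: hlim_def)
 have sL: "L2 M (%om. sph f (mon is) (\<xi> om))" if "L2 gauss f" for f "is" by (rule sph_L2(1)[OF that mon_cont])
 have prodL: "L2 (M \<Otimes>\<^sub>M Sk k) (%p. sph f (mon is) (\<xi> (fst p)) * tens is (snd p))" if "L2 gauss f" "is \<in> words r k" for f "is"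
  by (rule L2_product[OF sL[OF that(1)] tens_L2[OF that(2)]])
 \<comment> \<open>Truncating at N + k makes the k-th derivative of the integrand exactly the N-th
   partial sum of the shifted series.\<close>
 let ?f = "%N. sph (poly (hs c (N + k))) (%x. 1)"
 have deriv: "smooth_functional_deriv M W k r e (?f N) = (%p. DS k (poly (hs ((shift ^^ k) c) N)) p)" for N
  unfolding smooth_functional_deriv_eq DS_def
 proof (intro ext sum.cong refl)
  fix p :: "'w \<times> (nat => 'a)" and "is" assume "is \<in> words r k"
  then have "set is \<subseteq> {..<r}" "length is = k" by (auto simp: words_def)
  then show "partial_derivs is (?f N) (%j. wi (e j) (fst p)) * (\<Prod>j<k. e (is ! j) (snd p j))
   = sph (poly (hs ((shift ^^ k) c) N)) (mon is) (\<xi> (fst p)) * tens is (snd p)"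
   by (simp add: sph_partials pderiv_funpow_hs tens_def \<xi>_def)
 qed
 have tm: "Lp_tendsto (M \<Otimes>\<^sub>M Sk k) 2 (%N p. sph (poly (hs ((shift ^^ k) c) N)) (mon is) (\<xi> (fst p)) * tens is (snd p))
   (%p. sph \<psi>' (mon is) (\<xi> (fst p)) * tens is (snd p))" if "is": "is \<in> words r k" for "is"
 proof (rule L2_tendsto_zero_of_norm)
  let ?u = "%N om. sph (poly (hs ((shift ^^ k) c) N)) (mon is) (\<xi> om)" and ?v = "%om. sph \<psi>' (mon is) (\<xi> om)"
  show "L2 (M \<Otimes>\<^sub>M Sk k) (%p. ?u N (fst p) * tens is (snd p))" for N by (rule prodL[OF L2_gauss_poly "is"])
  show "L2 (M \<Otimes>\<^sub>M Sk k) (%p. ?v (fst p) * tens is (snd p))" by (rule prodL[OF L(2) "is"])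
  show "(LINT p|(M \<Otimes>\<^sub>M Sk k). (?u N (fst p) * tens is (snd p) - ?v (fst p) * tens is (snd p))\<^sup>2) \<le> (LINT om|M. (?u N om - ?v om)\<^sup>2) * (LINT y|(Sk k). (tens is y)\<^sup>2)" for N
   unfolding left_diff_distrib[symmetric] power_mult_distrib
   by (subst product_integral_mult(2)[OF sigma_finite_measure_axioms sf_Sk])
    (intro L2_integrable_square L2_diff sL L2_gauss_poly L tens_L2 "is" order_refl)+
  have "(%N. \<integral>om. (?u N om - ?v om)\<^sup>2 \<partial>M) \<longlonglongrightarrow> 0"
   using hlim_sph_tendsto[OF ck mon_cont, of 0 "is"] by (subst (asm) Lp_tendsto_2_iff) (auto intro: sL L2_gauss_poly L)
  from tendsto_mult_right[OF this, of "\<integral>y. (tens is y)\<^sup>2 \<partial>Sk k"]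
  show "(%N. (LINT om|M. (?u N om - ?v om)\<^sup>2) * (LINT y|(Sk k). (tens is y)\<^sup>2)) \<longlonglongrightarrow> 0" by simp
 qed
 have lim: "Lp_tendsto (M \<Otimes>\<^sub>M Sk k) 2 (%N. smooth_functional_deriv M W k r e (?f N)) (DS k \<psi>')"
  unfolding deriv DS_def[abs_def] by (rule L2_tendsto_sum) (intro prodL L2_gauss_poly L tm; assumption)+
 have "L2 (M \<Otimes>\<^sub>M Sk k) (DS k \<psi>')" unfolding DS_def[abs_def] by (intro L2_sum prodL L)
 moreover have "L2 M (%om. sph \<psi> (%x. 1) (\<xi> om))" using sL[OF L(1), of "[]"] by simp
 moreover have "Lp_tendsto M 2 (%N. smooth_functional M W e (?f N)) (%om. sph \<psi> (%x. 1) (\<xi> om))"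
  using hlim_sph_tendsto[OF c, of "%x. 1" k] unfolding smooth_functional_def[abs_def] \<xi>_def by simp
 moreover have "spg r (?f N)" for N by (intro polyfun_spg sph_polyfun) simp
 ultimately show ?thesis unfolding has_malliavin_deriv_def
  by (intro conjI exI[of _ "%_. r"] exI[of _ "%_. e"] exI[of _ ?f]) (use lim e_L2 in auto)
qed

text \<open>The bounds for truncations pass to the limit by Fatou's lemma along an almost surely
  convergent subsequence.\<close>

lemma Nsum_limit_moment:
 assumes ck: "hlim c \<psi>" and k0: "k = 0 ==> c 0 = 0" and C: "\<And>N. mconst n k c N \<le> C"
 shows "(\<integral>\<^sup>+om. ennreal (Nsum k \<psi> (\<xi> om) ^ Suc n) \<partial>M) \<le> ennreal ((\<mu> * A) ^ Suc n * C)"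
proof -
 have L: "L2 gauss \<psi>" using ck by (simp add: hlim_def)
 let ?p = "%N. poly (hs c (N + 2))"
 let ?u = "%N is om. sph (?p N) (mon is) (\<xi> om)" and ?v = "%is om. sph \<psi> (mon is) (\<xi> om)"
 have uL: "L2 M (?u N is)" for N "is" by (rule sph_L2(1)[OF L2_gauss_poly mon_cont])
 have vL: "L2 M (?v is)" for "is" by (rule sph_L2(1)[OF L mon_cont])
 \<comment> \<open>One Euclidean distance for all words together, so that a single subsequence
   serves every component.\<close>
 define h where "h N om = sqrt (\<Sum>is\<in>words r k. (?u N is om - ?v is om)\<^sup>2)" for N om
 have h2: "(h N om)\<^sup>2 = (\<Sum>is\<in>words r k. (?u N is om - ?v is om)\<^sup>2)" for N om
  unfolding h_def by (intro real_sqrt_pow2 sum_nonneg) simp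
 have [measurable]: "?u N is \<in> borel_measurable M" "?v is \<in> borel_measurable M" for N "is" using uL vL by (auto simp: L2_def)
 have hL: "L2 M (h N)" for N
  unfolding L2_def h2 by (intro conjI bi_int_sum L2_integrable_square L2_diff uL vL) (unfold h_def[abs_def], measurable)
 have "Lp_tendsto M 2 h (%_. 0)"
 proof (subst Lp_tendsto_2_iff[OF hL L2_zero])
  have "(%N. \<Sum>is\<in>words r k. \<integral>om. (?u N is om - ?v is om)\<^sup>2 \<partial>M) \<longlonglongrightarrow> (\<Sum>is\<in>words r k. 0)"
  proof (rule tendsto_sum)
   show "(%N. \<integral>om. (?u N is om - ?v is om)\<^sup>2 \<partial>M) \<longlonglongrightarrow> 0" for "is"
    using hlim_sph_tendsto[OF ck mon_cont, of 2 "is"] by (subst (asm) Lp_tendsto_2_iff[OF uL vL])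
  qed
  moreover have "(LINT om|M. (h N om - 0)\<^sup>2) = (\<Sum>is\<in>words r k. \<integral>om. (?u N is om - ?v is om)\<^sup>2 \<partial>M)" for N
   unfolding diff_zero h2 by (intro bi_sum L2_integrable_square L2_diff uL vL)
  ultimately show "(%N. \<integral>om. (h N om - 0)\<^sup>2 \<partial>M) \<longlonglongrightarrow> 0" by simp
 qed
 from L2_tendsto_AE_subseq[OF hL L2_zero this] obtain \<sigma> where \<sigma>: "AE om in M. (%n. h (\<sigma> n) om) \<longlonglongrightarrow> 0" by blast
 have ae: "AE om in M. ennreal (Nsum k \<psi> (\<xi> om) ^ Suc n) = liminf (%i. ennreal (Nsum k (?p (\<sigma> i)) (\<xi> om) ^ Suc n))"
  using \<sigma>
 proof eventually_elim
  case (elim om)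
  have "(%i. ?u (\<sigma> i) is om) \<longlonglongrightarrow> ?v is om" if "is": "is \<in> words r k" for "is"
  proof -
   have "\<bar>?u (\<sigma> i) is om - ?v is om\<bar> \<le> h (\<sigma> i) om" for i
    unfolding h_def by (rule real_le_rsqrt, unfold power2_abs, rule member_le_sum[of "is" "words r k" "%is. (?u (\<sigma> i) is om - ?v is om)\<^sup>2"])
     (use "is" in simp_all)
   then have "(%i. ?u (\<sigma> i) is om - ?v is om) \<longlonglongrightarrow> 0"
    by (intro Lim_null_comparison[OF _ elim]) auto
   then show ?thesis by (simp add: LIM_zero_iff)
  qed
  then have "(%i. ennreal (Nsum k (?p (\<sigma> i)) (\<xi> om) ^ Suc n)) \<longlonglongrightarrow> ennreal (Nsum k \<psi> (\<xi> om) ^ Suc n)"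
   unfolding Nsum_def by (intro tendsto_intros)
  from lim_imp_Liminf[OF _ this] show ?case by simp
 qed
 have m: "integrable M (%om. Nsum k (?p N) (\<xi> om) ^ Suc n)" for N
  by (intro all_moments_integrable_power wiener_e_moments Nsum_polyfun)
 have "(\<integral>\<^sup>+om. ennreal (Nsum k \<psi> (\<xi> om) ^ Suc n) \<partial>M) = (\<integral>\<^sup>+om. liminf (%i. ennreal (Nsum k (?p (\<sigma> i)) (\<xi> om) ^ Suc n)) \<partial>M)"
  by (rule nn_integral_cong_AE[OF ae])
 also have "... \<le> liminf (%i. \<integral>\<^sup>+om. ennreal (Nsum k (?p (\<sigma> i)) (\<xi> om) ^ Suc n) \<partial>M)"
  by (rule nn_integral_liminf) (use m in measurable)
 also have "... \<le> liminf (%i. ennreal ((\<mu> * A) ^ Suc n * C))"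
 proof (intro Liminf_mono always_eventually allI)
  fix i
  have "(\<integral>\<^sup>+om. ennreal (Nsum k (?p (\<sigma> i)) (\<xi> om) ^ Suc n) \<partial>M) = ennreal (LINT om|M. Nsum k (?p (\<sigma> i)) (\<xi> om) ^ Suc n)"
   by (intro nn_integral_eq_integral m AE_I2) (simp add: Nsum_nonneg)
  also have "... \<le> ennreal ((\<mu> * A) ^ Suc n * C)"
  proof (rule ennreal_leI)
   \<comment> \<open>\<open>Nsum_moment\<close> taken at \<sigma> i + k lands on the truncation
     \<sigma> i + 2 for every order k.\<close>
   have ik: "Suc (Suc (\<sigma> i + k)) - k = \<sigma> i + 2" by simp
   have "(LINT om|M. Nsum k (?p (\<sigma> i)) (\<xi> om) ^ Suc n) \<le> (\<mu> * A) ^ Suc n * mconst n k c (if k \<le> 2 then \<sigma> i + k else \<sigma> i + 2)"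
    using Nsum_moment[of k c "\<sigma> i + k" n, OF k0] unfolding ik .
   also have "... \<le> (\<mu> * A) ^ Suc n * C" using A_pos sphere_mass_pos[of d] by (intro mult_left_mono C) simp
   finally show "(LINT om|M. Nsum k (?p (\<sigma> i)) (\<xi> om) ^ Suc n) \<le> (\<mu> * A) ^ Suc n * C" .
  qed
  finally show "(\<integral>\<^sup>+om. ennreal (Nsum k (?p (\<sigma> i)) (\<xi> om) ^ Suc n) \<partial>M) \<le> ennreal ((\<mu> * A) ^ Suc n * C)" .
 qed
 finally show ?thesis by (simp add: Liminf_const)
qed

end

section \<open>Hermite polynomials of Wiener integrals and orthogonality of the chaoses\<close>

lemma polyfun_poly_var: "i < m ==> polyfun m (%v. poly P (v i))"
proof (induction P)
 case (pCons c P)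
 then show ?case by (simp) (intro polyfun_add polyfun_const polyfun_mult polyfun_var pCons)
qed (simp add: polyfun_const)

lemma partial_deriv_poly_var: "partial_deriv i (%v. poly P (v i)) = (%v. poly (pderiv P) (v i))"
 by (rule partial_deriv_eqI) (auto intro!: poly_DERIV)

context white_noise_space
begin

lemma poly_wiener_moments: "L2 S g ==> all_moments M (%om. poly P (wi g om))"
 using smooth_functional_all_moments[OF polyfun_spg[OF polyfun_poly_var[of 0 1 P]], of "%_. g"] by simp

text \<open>Integration by parts in direction g: the derivative of the first factor combines with z
  times it to the next Hermite polynomial, and the derivative of the second factor lowers its degree
  and contributes the inner product of g and h.\<close>

lemma hermite_wiener_inner:
 assumes g: "L2 S g" "(LINT x|S. (g x)\<^sup>2) = 1" and h: "L2 S h" "(LINT x|S. (h x)\<^sup>2) = 1"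
 shows "(LINT om|M. poly (hermp p) (wi g om) * poly (hermp q) (wi h om)) = (if p = q then fact p * (LINT x|S. h x * g x) ^ p else 0)"
proof (induction p arbitrary: q)
 case 0
 have [measurable]: "wi h \<in> borel_measurable M" using wiener_L2[OF h(1)] by (simp add: L2_def)
 have "(LINT om|M. poly (hermp q) (wi h om)) = (LINT z|gauss. poly (hermp 0) z * poly (hermp q) z)"
  unfolding wiener_unit_law[OF h, symmetric] by (subst integral_distr) simp_all
 also have "... = (if q = 0 then 1 else 0)" unfolding gauss_hermp_mult by simp
 finally show ?case by simp
next
 case (Suc p)
 let ?F = "%P (v :: nat => real). poly P (v 0)"
 have spg: "spg 1 (?F P)" for P by (intro polyfun_spg polyfun_poly_var) simp
 note m = all_moments_integrable[OF all_moments_mult[OF poly_wiener_moments[OF g(1)] poly_wiener_moments[OF h(1)]]]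
 have gg: "(LINT x|S. g x * g x) = 1" using g(2) by (simp add: power2_eq_square)
 let ?c = "\<integral>x. h x * g x \<partial>S"
 have "(LINT om|M. poly (pderiv (hermp p)) (wi g om) * poly (hermp q) (wi h om))
  = (LINT om|M. poly (hermp p) (wi g om) * (poly (hermp q) (wi h om) * wi g om - poly (pderiv (hermp q)) (wi h om) * ?c))"
  using wiener_ibp[OF spg[of "hermp p"] spg[of "hermp q"], of "%_. g" "%_. h" g] g(1) h(1)
  by (simp add: gg partial_deriv_poly_var)
 also have "... = (LINT om|M. poly ([:0, 1:] * hermp p) (wi g om) * poly (hermp q) (wi h om)
   - ?c * (poly (hermp p) (wi g om) * poly (pderiv (hermp q)) (wi h om)))"
  by (intro bi_cong refl) (simp add: algebra_simps)
 also have "... = (LINT om|M. poly ([:0, 1:] * hermp p) (wi g om) * poly (hermp q) (wi h om))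
   - ?c * (LINT om|M. poly (hermp p) (wi g om) * poly (pderiv (hermp q)) (wi h om))"
  by (subst bi_diff) (intro m integrable_mult_right | simp only: integral_mult_right_zero)+
 finally have 1: "(LINT om|M. poly ([:0, 1:] * hermp p) (wi g om) * poly (hermp q) (wi h om))
   - (LINT om|M. poly (pderiv (hermp p)) (wi g om) * poly (hermp q) (wi h om))
   = ?c * (LINT om|M. poly (hermp p) (wi g om) * poly (pderiv (hermp q)) (wi h om))" by simp
 have "(LINT om|M. poly (hermp (Suc p)) (wi g om) * poly (hermp q) (wi h om))
  = ?c * (LINT om|M. poly (hermp p) (wi g om) * poly (pderiv (hermp q)) (wi h om))"
  unfolding 1[symmetric] hermp.simps poly_diff left_diff_distrib by (intro bi_diff m)
 also have "... = ?c * (real q * (LINT om|M. poly (hermp p) (wi g om) * poly (hermp (q - 1)) (wi h om)))"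
  unfolding pderiv_hermp poly_smult by (simp only: mult.left_commute integral_mult_right_zero)
 also have "... = (if Suc p = q then fact (Suc p) * ?c ^ Suc p else 0)" unfolding Suc by (cases q) auto
 finally show ?case .
qed

lemma chaos_orthogonal:
 assumes F: "wiener_chaos M W p F" and G: "wiener_chaos M W q G" and "p \<noteq> q"
 shows "(LINT om|M. F om * G om) = 0"
proof -
 from conjunct2[OF F[unfolded wiener_chaos_def]] obtain m :: "nat => nat" and c g where F0: "(\<forall>N i. i < m N \<longrightarrow> L2 S (g N i) \<and> (LINT y|S. (g N i y)\<^sup>2) = 1) \<and>
   Lp_tendsto M 2 (%N om. \<Sum>i<m N. c N i * hermite p (wi (g N i) om)) F" by (elim exE)
 from conjunct2[OF G[unfolded wiener_chaos_def]] obtain m' :: "nat => nat" and c' g' where G0: "(\<forall>N i. i < m' N \<longrightarrow> L2 S (g' N i) \<and> (LINT y|S. (g' N i y)\<^sup>2) = 1) \<and>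
   Lp_tendsto M 2 (%N om. \<Sum>i<m' N. c' N i * hermite q (wi (g' N i) om)) G" by (elim exE)
 note mF = conjunct1[OF F[unfolded wiener_chaos_def]] conjunct1[OF F0, rule_format] conjunct2[OF F0]
 note mG = conjunct1[OF G[unfolded wiener_chaos_def]] conjunct1[OF G0, rule_format] conjunct2[OF G0]
 let ?u = "%N om. \<Sum>i<m N. c N i * hermite p (wi (g N i) om)" and ?v = "%N om. \<Sum>i<m' N. c' N i * hermite q (wi (g' N i) om)"
 have hL: "L2 M (%om. hermite k (wi f om))" if "L2 S f" for k f
  unfolding hermite_eq by (rule all_moments_L2[OF poly_wiener_moments[OF that]])
 have uL: "L2 M (?u N)" "L2 M (?v N)" for N using mF(2) mG(2) by (auto intro!: L2_sum L2_cmult hL)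
 have "(%N. \<integral>om. ?u N om * ?v N om \<partial>M) \<longlonglongrightarrow> (LINT om|M. F om * G om)"
  by (rule L2_tendsto_inner[OF uL(1) mF(1,3) uL(2) mG(1,3)])
 moreover have "(LINT om|M. ?u N om * ?v N om) = 0" for N
 proof -
  let ?t = "%i j om. (c N i * c' N j) * (hermite p (wi (g N i) om) * hermite q (wi (g' N j) om))"
  have i: "integrable M (?t i j)" if "i < m N" "j < m' N" for i j
   using mF(2)[OF that(1)] mG(2)[OF that(2)] by (intro integrable_mult_right L2_mult_integrable hL) auto
  have "(LINT om|M. ?u N om * ?v N om) = (LINT om|M. (\<Sum>i<m N. \<Sum>j<m' N. ?t i j om))"
   unfolding sum_product by (simp only: mult_ac)
  also have "... = (\<Sum>i<m N. \<integral>om. (\<Sum>j<m' N. ?t i j om) \<partial>M)"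
   by (intro bi_sum bi_int_sum i) auto
  also have "... = (\<Sum>i<m N. \<Sum>j<m' N. \<integral>om. ?t i j om \<partial>M)"
   by (intro sum.cong refl bi_sum i) auto
  also have "... = 0"
   unfolding integral_mult_right_zero hermite_eq
   using mF(2)[of _ N] mG(2)[of _ N] \<open>p \<noteq> q\<close> by (intro sum.neutral ballI) (simp add: hermite_wiener_inner)
  finally show ?thesis .
 qed
 ultimately show ?thesis by (simp add: LIMSEQ_const_iff)
qed

end

section \<open>Chaos expansion and Ornstein-Uhlenbeck operator of sphere functionals\<close>

context frame
begin

abbreviation X :: "nat => 'w => real" where "X q om \<equiv> sph (poly (hermp q)) (%x. 1) (\<xi> om)"

lemma X_L2: "L2 M (X q)" by (rule sph_L2(1)[OF L2_gauss_poly]) simp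

lemma X_norm_le: "(LINT om|M. (X q om)\<^sup>2) \<le> \<mu>\<^sup>2 * fact q"
 using sph_L2(2)[OF L2_gauss_poly, of "%x. 1" "hermp q"] gauss_hermp_mult[of q q] S_mass by (simp add: power2_eq_square)

lemma sph_hs: "sph (poly (hs c N)) (%x. 1) v = (\<Sum>p\<le>N. c p / fact p * sph (poly (hermp p)) (%x. 1) v)"
 using integral_hs[of S "%x. 1" "lin v" c N] by (simp add: sph_def cint poly_lin_cont)

text \<open>The element of H whose Wiener integral is almost surely the field at x.\<close>

definition dir :: "'a => 'a => real" where "dir x y = (\<Sum>i<r. a i x * e i y)"

lemma dir_L2: "L2 S (dir x)" unfolding dir_def[abs_def] by (intro L2_sum L2_cmult e_L2)

lemma dir_inner: "(LINT z|S. dir x z * dir y z) = \<rho> x y"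
proof -
 have "(LINT z|S. dir x z * dir y z) = (LINT z|S. (\<Sum>i<r. \<Sum>j<r. a i x * a j y * (e i z * e j z)))"
  unfolding dir_def sum_product by (simp only: mult_ac)
 also have "... = (\<Sum>i<r. \<integral>z. (\<Sum>j<r. a i x * a j y * (e i z * e j z)) \<partial>S)"
  by (intro bi_sum bi_int_sum integrable_mult_right L2_mult_integrable e_L2)
 also have "... = (\<Sum>i<r. \<Sum>j<r. \<integral>z. a i x * a j y * (e i z * e j z) \<partial>S)"
  by (intro sum.cong refl bi_sum integrable_mult_right L2_mult_integrable e_L2)
 also have "... = (\<Sum>i<r. \<Sum>j<r. if j = i then a i x * a j y else 0)"
  unfolding integral_mult_right_zero by (intro sum.cong refl) (auto simp: e_on)
 finally show ?thesis by simp
qed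

lemma dir_norm: "norm x = 1 ==> (LINT z|S. (dir x z)\<^sup>2) = 1"
 using dir_inner[of x x] a_norm[of x] by (simp add: power2_eq_square)

lemma wiener_dir: "AE om in M. wi (dir x) om = lin (\<xi> om) x"
 using wiener_lincomb[OF dir_L2 e_L2, of "{..<r}" x "%i. a i x"] by (simp add: dir_def lin_def \<xi>_def)

text \<open>The chaos is closed, so it contains the limit of Riemann sums of \<open>H\<^sub>q(T x)\<close>.\<close>

lemma X_chaos: "wiener_chaos M W q (%om. s * X q om)"
proof -
 \<comment> \<open>Separating variables writes the surface integral as a finite combination of fixed
   random variables P k with scalar weights, the integrals of f k. Only these scalars have to be
   approximated by sums.\<close>
 have "separated (polyfun r) (%x v. poly (hermp q) (\<Sum>i<r. a i x * v i))"
  by (rule separated_poly) (auto intro: polyfun.intros a_cont)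
 then obtain n :: nat and f P where fP: "\<And>k. k < n ==> contU (f k)" "\<And>k. k < n ==> polyfun r (P k)"
   "\<And>x v. poly (hermp q) (lin v x) = (\<Sum>k<n. f k x * P k v)" using separated_sum_ex unfolding lin_def by blast
 obtain b :: 'a where b: "norm b = 1" using norm_Basis SOME_Basis by blast
 have "(%x. x) \<in> borel_measurable S" by (subst measurable_cong_sets[OF sets_sphere_measure refl]) (rule measurable_restrict_space1, simp)
 from borel_measurable_implies_sequence_metric[OF this, of 0]
 obtain F where F: "\<And>i. simple_function S (F i)" "\<And>x. x \<in> space S ==> (%i. F i x) \<longlonglongrightarrow> x" by blast
 \<comment> \<open>Sample points must be unit vectors for \<open>dir\<close> to have norm one.
   \<open>sgn\<close> projects the approximants to the sphere, and b replaces the origin, which at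
   each point is met for finitely many N only.\<close>
 define t where "t N x = (if F N x = 0 then b else sgn (F N x))" for N x
 have ts: "simple_function S (t N)" for N unfolding t_def by (rule simple_function_compose1[OF F(1)])
 have tn: "norm (t N x) = 1" for N x by (simp add: t_def b norm_sgn)
 have tl: "(%N. t N x) \<longlonglongrightarrow> x" if "x \<in> space S" for x
 proof -
  have x: "norm x = 1" "x \<noteq> 0" using that by auto
  have "eventually (%N. F N x \<noteq> 0) sequentially" using tendsto_imp_eventually_ne[OF F(2)[OF that] x(2)] .
  then have "eventually (%N. sgn (F N x) = t N x) sequentially" by eventually_elim (simp add: t_def)
  moreover have "(%N. sgn (F N x)) \<longlonglongrightarrow> sgn x" by (rule tendsto_sgn[OF F(2)[OF that] x(2)])
  ultimately show ?thesis using x(1) by (simp add: sgn_div_norm tendsto_cong)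
 qed
 define Y where "Y N = t N ` sphere 0 1" for N
 have Yf: "finite (Y N)" for N using simple_functionD(1)[OF ts, of N] by (simp add: Y_def)
 obtain h where h: "\<And>N. bij_betw (h N) {0..<card (Y N)} (Y N)" using ex_bij_betw_nat_finite[OF Yf] by metis
 define wt where "wt N y = measure S (t N -` {y} \<inter> sphere 0 1)" for N y
 have hY: "h N i \<in> Y N" if "i < card (Y N)" for N i using bij_betwE[OF h] that by auto
 have Y1: "norm y = 1" if "y \<in> Y N" for y N using that tn by (auto simp: Y_def)
 have intf: "(\<Sum>y\<in>Y N. wt N y * f k y) = (LINT x|S. f k (t N x))" for N k
 proof -
  have ms: "t N -` {y} \<inter> sphere 0 1 \<in> sets S" for y using simple_functionD(2)[OF ts, of N "{y}"] by simp
  have "(LINT x|S. f k (t N x)) = (LINT x|S. (\<Sum>y\<in>Y N. f k y * indicator (t N -` {y} \<inter> sphere 0 1) x))"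
  proof (rule bi_cong[OF refl])
   fix x assume x: "x \<in> space S"
   have "(\<Sum>y\<in>Y N. f k y * indicator (t N -` {y} \<inter> sphere 0 1) x) = (\<Sum>y\<in>Y N. if y = t N x then f k y else 0)"
    using x by (intro sum.cong refl) (auto simp: indicator_def)
   then show "f k (t N x) = (\<Sum>y\<in>Y N. f k y * indicator (t N -` {y} \<inter> sphere 0 1) x)" using x Yf by (simp add: Y_def)
  qed
  also have "... = (\<Sum>y\<in>Y N. \<integral>x. f k y * indicator (t N -` {y} \<inter> sphere 0 1) x \<partial>S)"
   using ms by (intro bi_sum integrable_mult_right) (auto simp: integrable_indicator_iff S.emeasure_finite less_top[symmetric])
  also have "... = (\<Sum>y\<in>Y N. wt N y * f k y)"
   using ms by (intro sum.cong refl) (simp add: wt_def sets.Int_space_eq2)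
  finally show ?thesis by simp
 qed
 have conv: "(%N. \<integral>x. f k (t N x) \<partial>S) \<longlonglongrightarrow> (LINT x|S. f k x)" if k: "k < n" for k
 proof -
  have "compact (f k ` sphere 0 1)" by (intro compact_continuous_image continuous_on_subset[OF fP(1)[OF k]]) auto
  then obtain B where B: "\<And>x. norm x = 1 ==> \<bar>f k x\<bar> \<le> B" using compact_imp_bounded bounded_iff by (metis imageI mem_sphere_0 real_norm_def)
  show ?thesis
  proof (rule integral_dominated_convergence[where w = "%_. B"])
   show "f k \<in> borel_measurable S" by (rule continuous_sphere_integrable(2)[OF fP(1)[OF k]])
   show "(%x. f k (t N x)) \<in> borel_measurable S" for N by (intro borel_measurable_simple_function simple_function_compose1[OF ts])
   show "AE x in S. (%N. f k (t N x)) \<longlonglongrightarrow> f k x"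
   proof (rule AE_I2)
    fix x assume "x \<in> space S"
    moreover have "isCont (f k) x" using fP(1)[OF k] by (simp add: continuous_on_eq_continuous_at)
    ultimately show "(%N. f k (t N x)) \<longlonglongrightarrow> f k x" using tl isCont_tendsto_compose by blast
   qed
  qed (auto simp: B tn)
 qed
 let ?R = "%N om. \<Sum>i<card (Y N). (s * wt N (h N i)) * hermite q (wi (dir (h N i)) om)"
 have PL: "L2 M (%om. P k (\<xi> om))" if "k < n" for k by (rule all_moments_L2[OF wiener_e_moments[OF fP(2)[OF that]]])
 have Req: "AE om in M. ?R N om = (\<Sum>k<n. (s * (LINT x|S. f k (t N x))) * P k (\<xi> om))" for N
 proof -
  have "AE om in M. \<forall>y\<in>Y N. wi (dir y) om = lin (\<xi> om) y"
   using wiener_dir by (intro AE_finite_allI Yf) auto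
  then show ?thesis
  proof eventually_elim
   case (elim om)
   have "?R N om = (\<Sum>y\<in>Y N. (s * wt N y) * hermite q (wi (dir y) om))"
    using sum.reindex_bij_betw[OF h, of "%y. (s * wt N y) * hermite q (wi (dir y) om)" N] by (simp add: atLeast0LessThan)
   also have "... = (\<Sum>y\<in>Y N. \<Sum>k<n. (s * (wt N y * f k y)) * P k (\<xi> om))"
    using elim by (intro sum.cong refl) (simp add: hermite_eq fP(3) sum_distrib_left mult_ac)
   also have "... = (\<Sum>k<n. (s * (\<Sum>y\<in>Y N. wt N y * f k y)) * P k (\<xi> om))"
    unfolding sum_distrib_left sum_distrib_right by (rule sum.swap)
   finally show ?case unfolding intf .
  qed
 qed
 have Xeq: "s * X q om = (\<Sum>k<n. (s * (LINT x|S. f k x)) * P k (\<xi> om))" for om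
 proof -
  have "X q om = (\<Sum>k<n. \<integral>x. f k x * P k (\<xi> om) \<partial>S)"
   unfolding sph_def fP(3) mult_1_right by (intro bi_sum cint continuous_intros fP) auto
  then show ?thesis by (simp only: integral_mult_left_zero sum_distrib_left mult.assoc)
 qed
 have "Lp_tendsto M 2 (%N om. \<Sum>k<n. (s * (LINT x|S. f k (t N x))) * P k (\<xi> om)) (%om. \<Sum>k<n. (s * (LINT x|S. f k x)) * P k (\<xi> om))"
 proof (rule L2_tendsto_sum)
  fix k assume "k \<in> {..<n}"
  then have k: "k < n" by simp
  show "L2 M (%om. (s * (LINT x|S. f k (t N x))) * P k (\<xi> om))" "L2 M (%om. (s * (LINT x|S. f k x)) * P k (\<xi> om))" for N
   by (intro L2_cmult PL k)+
  then show "Lp_tendsto M 2 (%N om. (s * (LINT x|S. f k (t N x))) * P k (\<xi> om)) (%om. (s * (LINT x|S. f k x)) * P k (\<xi> om))"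
  proof (rule L2_tendsto_zero_of_norm)
   let ?d = "%N. s * (LINT x|S. f k (t N x)) - s * (LINT x|S. f k x)"
   show "(LINT om|M. ((s * (LINT x|S. f k (t N x))) * P k (\<xi> om) - (s * (LINT x|S. f k x)) * P k (\<xi> om))\<^sup>2) \<le> (?d N)\<^sup>2 * (LINT om|M. (P k (\<xi> om))\<^sup>2)" for N
    unfolding left_diff_distrib[symmetric] power_mult_distrib integral_mult_right_zero ..
   have "?d \<longlonglongrightarrow> s * (LINT x|S. f k x) - s * (LINT x|S. f k x)" by (intro tendsto_intros conv k)
   then have "(%N. (?d N)\<^sup>2 * (LINT om|M. (P k (\<xi> om))\<^sup>2)) \<longlonglongrightarrow> 0\<^sup>2 * (LINT om|M. (P k (\<xi> om))\<^sup>2)" by (intro tendsto_mult_right tendsto_power) simp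
   then show "(%N. (?d N)\<^sup>2 * (LINT om|M. (P k (\<xi> om))\<^sup>2)) \<longlonglongrightarrow> 0" by simp
  qed
 qed
 then have "Lp_tendsto M 2 ?R (%om. s * X q om)"
  by (rule Lp_tendsto_cong[OF Req AE_I2[OF Xeq], THEN iffD2])
 moreover have "L2 S (dir (h N i)) \<and> (LINT y|S. (dir (h N i) y)\<^sup>2) = 1" if "i < card (Y N)" for N i
  using dir_L2 dir_norm[OF Y1[OF hY[OF that]]] by simp
 ultimately show ?thesis unfolding wiener_chaos_def
  by (intro conjI L2_cmult X_L2 exI[of _ "%N. card (Y N)"] exI[of _ "%N i. s * wt N (h N i)"] exI[of _ "%N i. dir (h N i)"]) simp_all
qed

text \<open>Against the q-th chaos only the q-th term of a truncation survives; truncating at N + q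
  makes sure that it is present.\<close>

lemma chaos_inner:
 assumes c: "hlim c \<psi>" and K: "wiener_chaos M W q K"
 shows "(LINT om|M. sph \<psi> (%x. 1) (\<xi> om) * K om) = (LINT om|M. (c q / fact q * X q om) * K om)"
proof (rule LIMSEQ_unique)
 have KL: "L2 M K" using K by (simp add: wiener_chaos_def)
 have \<psi>L: "L2 M (%om. sph \<psi> (%x. 1) (\<xi> om))" using c by (intro sph_L2(1)) (auto simp: hlim_def)
 show "(%N. \<integral>om. sph (poly (hs c (N + q))) (%x. 1) (\<xi> om) * K om \<partial>M) \<longlonglongrightarrow> (LINT om|M. sph \<psi> (%x. 1) (\<xi> om) * K om)"
  by (intro L2_tendsto_inner KL Lp_tendsto_const \<psi>L hlim_sph_tendsto c sph_L2(1) L2_gauss_poly continuous_on_const)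
 have "(LINT om|M. sph (poly (hs c (N + q))) (%x. 1) (\<xi> om) * K om) = (LINT om|M. (c q / fact q * X q om) * K om)" for N
 proof -
  have "(LINT om|M. sph (poly (hs c (N + q))) (%x. 1) (\<xi> om) * K om) = (LINT om|M. (\<Sum>p\<le>N + q. (c p / fact p * X p om) * K om))"
   unfolding sph_hs sum_distrib_right ..
  also have "... = (\<Sum>p\<le>N + q. \<integral>om. (c p / fact p * X p om) * K om \<partial>M)"
   by (intro bi_sum L2_mult_integrable L2_cmult X_L2 KL)
  also have "... = (\<Sum>p\<le>N + q. if p = q then (LINT om|M. (c p / fact p * X p om) * K om) else 0)"
   using chaos_orthogonal[OF X_chaos K] by (intro sum.cong refl) auto
  finally show ?thesis by simp
 qed
 then show "(%N. \<integral>om. sph (poly (hs c (N + q))) (%x. 1) (\<xi> om) * K om \<partial>M) \<longlonglongrightarrow> (LINT om|M. (c q / fact q * X q om) * K om)" by simp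
qed

text \<open>The multiple of X q has the defining property of the projection, so the choice is of the
  intended kind. Candidate and chosen element both lie in the chaos and their difference is
  orthogonal to each of them, hence zero.\<close>

lemma chaos_proj_eq:
 assumes c: "hlim c \<psi>" and F: "L2 M F" "AE om in M. F om = sph \<psi> (%x. 1) (\<xi> om)"
 shows "L2 M (chaos_proj M W q F)" "AE om in M. chaos_proj M W q F om = c q / fact q * X q om"
proof -
 let ?G = "%om. c q / fact q * X q om"
 have GL: "L2 M ?G" by (intro L2_cmult X_L2)
 have \<psi>L: "L2 M (%om. sph \<psi> (%x. 1) (\<xi> om))" using c by (intro sph_L2(1)) (auto simp: hlim_def)
 have FK: "(LINT om|M. F om * K om) = (LINT om|M. ?G om * K om)" if K: "wiener_chaos M W q K" for K
 proof -
  have [measurable]: "K \<in> borel_measurable M" "F \<in> borel_measurable M" "(%om. sph \<psi> (%x. 1) (\<xi> om)) \<in> borel_measurable M"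
   using K F \<psi>L by (auto simp: wiener_chaos_def L2_def)
  have "(LINT om|M. F om * K om) = (LINT om|M. sph \<psi> (%x. 1) (\<xi> om) * K om)"
   by (rule integral_cong_AE) (use F(2) in \<open>auto elim: eventually_mono\<close>)
  then show ?thesis unfolding chaos_inner[OF c K] .
 qed
 let ?P = "%G. wiener_chaos M W q G \<and> (\<forall>K. wiener_chaos M W q K \<longrightarrow> (LINT om|M. (F om - G om) * K om) = 0)"
 have split: "(LINT om|M. (F om - G om) * K om) = (LINT om|M. F om * K om) - (LINT om|M. G om * K om)" if "L2 M G" "L2 M K" for G K
  unfolding left_diff_distrib by (intro bi_diff L2_mult_integrable F that)
 have "?P ?G"
 proof (intro conjI allI impI X_chaos)
  fix K assume K: "wiener_chaos M W q K"
  then show "(LINT om|M. (F om - ?G om) * K om) = 0" using split[OF GL, of K] FK[OF K] by (simp add: wiener_chaos_def)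
 qed
 then have P: "?P (chaos_proj M W q F)" unfolding chaos_proj_def by (rule someI[of ?P ?G])
 let ?Q = "chaos_proj M W q F"
 show QL: "L2 M ?Q" using P by (simp add: wiener_chaos_def)
 have z: "(LINT om|M. (?G om - ?Q om) * K om) = 0" if K: "wiener_chaos M W q K" for K
 proof -
  have KL: "L2 M K" using K by (simp add: wiener_chaos_def)
  have "(LINT om|M. (F om - ?Q om) * K om) = 0" by (rule conjunct2[OF P, rule_format, OF K])
  then have "(LINT om|M. ?G om * K om) = (LINT om|M. ?Q om * K om)" unfolding split[OF QL KL] FK[OF K] by simp
  then show ?thesis unfolding left_diff_distrib
   by (subst bi_diff) (intro L2_mult_integrable GL QL KL, intro L2_mult_integrable GL QL KL, simp)
 qed
 have "(LINT om|M. (?G om - ?Q om)\<^sup>2) = (LINT om|M. (?G om - ?Q om) * ?G om) - (LINT om|M. (?G om - ?Q om) * ?Q om)"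
  unfolding power2_eq_square right_diff_distrib[of "?G _ - ?Q _"]
  by (intro bi_diff L2_mult_integrable L2_diff GL QL)
 also have "... = 0" by (simp only: z[OF X_chaos] z[OF conjunct1[OF P]] diff_self)
 finally have "AE om in M. ?G om - ?Q om = 0" by (intro L2_norm_zero_AE L2_diff GL QL)
 then show "AE om in M. ?Q om = ?G om" by eventually_elim simp
qed

text \<open>The series in \<open>ou_dom\<close> converges because c is rapid, and measurability
  follows by writing F as a limit of truncations along a subsequence. The partial sums defining the
  operator agree almost surely with truncations for the coefficients - q c q, which identifies the
  chosen limit.\<close>

lemma sph_ou:
 assumes c: "hlim c \<psi>" "rapid c" and F: "L2 M F" "AE om in M. F om = sph \<psi> (%x. 1) (\<xi> om)"
  and c': "hlim (%q. - (real q * c q)) \<psi>'"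
 shows "ou_dom M W F" and "L2 M (ou_operator M W F)" and "AE om in M. ou_operator M W F om = sph \<psi>' (%x. 1) (\<xi> om)"
proof -
 have c1: "contU (%x::'a. 1::real)" by simp
 have \<psi>L: "L2 gauss \<psi>" "L2 gauss \<psi>'" using c(1) c' by (auto simp: hlim_def)
 note pr = chaos_proj_eq[OF c(1) F]
 have [measurable]: "chaos_proj M W q F \<in> borel_measurable M" "X q \<in> borel_measurable M" for q using pr(1) X_L2 by (auto simp: L2_def)
 have "summable (%q. (real q)\<^sup>2 * (LINT om|M. (chaos_proj M W q F om)\<^sup>2))"
 proof (rule summable_comparison_test'[of "%q. \<mu>\<^sup>2 * ((real q * c q)\<^sup>2 / fact q)" 0])
  have "rapid (%q. real q * c q)"
  proof (rule rapid_mono[OF c(2), of _ 1])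
   show "\<bar>real q * c q\<bar> \<le> 1 * 2 ^ q * \<bar>c q\<bar>" for q
    using of_nat_less_two_power[of q, where 'a = real] by (simp add: abs_mult mult_right_mono)
  qed simp
  then show "summable (%q. \<mu>\<^sup>2 * ((real q * c q)\<^sup>2 / fact q))" by (intro summable_mult rapid_summable)
  fix q
  have "(LINT om|M. (chaos_proj M W q F om)\<^sup>2) = (LINT om|M. (c q / fact q)\<^sup>2 * (X q om)\<^sup>2)"
   by (rule integral_cong_AE) (measurable, use pr(2)[of q] in eventually_elim, simp add: power_mult_distrib power_divide)
  also have "... \<le> (c q / fact q)\<^sup>2 * (\<mu>\<^sup>2 * fact q)"
   unfolding integral_mult_right_zero by (intro mult_left_mono X_norm_le) simp
  finally have "(real q)\<^sup>2 * (LINT om|M. (chaos_proj M W q F om)\<^sup>2) \<le> (real q)\<^sup>2 * ((c q / fact q)\<^sup>2 * (\<mu>\<^sup>2 * fact q))" by (rule mult_left_mono) simp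
  also have "... = \<mu>\<^sup>2 * ((real q * c q)\<^sup>2 / fact q)" by (simp add: power_mult_distrib power_divide power2_eq_square[of "fact q"])
  finally show "norm ((real q)\<^sup>2 * (LINT om|M. (chaos_proj M W q F om)\<^sup>2)) \<le> \<mu>\<^sup>2 * ((real q * c q)\<^sup>2 / fact q)" by simp
 qed
 moreover have "\<exists>F'\<in>borel_measurable (wiener_sigma M W). AE om in M. F om = F' om"
 proof -
  have wm: "wi g \<in> borel_measurable (wiener_sigma M W)" if "L2 S g" for g
  proof (rule measurableI)
   fix B :: "real set" assume B: "B \<in> sets borel"
   have sub: "{wi g -` B \<inter> space M | g B. L2 S g \<and> B \<in> sets borel} \<subseteq> Pow (space M)" by auto
   show "wi g -` B \<inter> space (wiener_sigma M W) \<in> sets (wiener_sigma M W)"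
    unfolding wiener_sigma_def space_measure_of[OF sub] sets_measure_of[OF sub] using that B by (intro sigma_sets.Basic) blast
  qed simp
  let ?u = "%N om. sph (poly (hs c N)) (%x. 1) (\<xi> om)"
  have um: "?u N \<in> borel_measurable (wiener_sigma M W)" for N
   unfolding \<xi>_def by (rule smooth_functional_measurable[OF polyfun_spg[OF sph_polyfun[OF c1]]]) (intro wm e_L2)
  have "Lp_tendsto M 2 ?u (%om. sph \<psi> (%x. 1) (\<xi> om))" using hlim_sph_tendsto[OF c(1) c1, of 0] by simp
  from L2_tendsto_AE_subseq[OF sph_L2(1)[OF L2_gauss_poly c1] sph_L2(1)[OF \<psi>L(1) c1] this] obtain \<sigma> where
   \<sigma>: "AE om in M. (%n. ?u (\<sigma> n) om) \<longlonglongrightarrow> sph \<psi> (%x. 1) (\<xi> om)" by blast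
  show ?thesis
  proof (rule bexI[of _ "%om. lim (%n. ?u (\<sigma> n) om)"])
   show "AE om in M. F om = lim (%n. ?u (\<sigma> n) om)" using \<sigma> F(2) by eventually_elim (simp add: limI)
   show "(%om. lim (%n. ?u (\<sigma> n) om)) \<in> borel_measurable (wiener_sigma M W)" by (rule borel_measurable_lim_metric) (rule um)
  qed
 qed
 ultimately show "ou_dom M W F" unfolding ou_dom_def using F(1) by blast
 let ?s = "%N om. - (\<Sum>q=1..N. real q * chaos_proj M W q F om)"
 have sL: "L2 M (?s N)" for N using L2_cmult[OF L2_sum[of "{1..N}" M "%q om. real q * chaos_proj M W q F om"], of "-1"] by (simp add: L2_cmult pr(1))
 have ae: "AE om in M. ?s N om = sph (poly (hs (%q. - (real q * c q)) (N + 0))) (%x. 1) (\<xi> om)" for N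
 proof -
  have "AE om in M. \<forall>q\<in>{1..N}. chaos_proj M W q F om = c q / fact q * X q om" using pr(2) by (intro AE_finite_allI) auto
  then show ?thesis
  proof eventually_elim
   case (elim om)
   then have "?s N om = (\<Sum>q=1..N. - (real q * c q) / fact q * X q om)" by (simp add: sum_negf[symmetric] mult.assoc)
   also have "... = (\<Sum>q\<le>N. - (real q * c q) / fact q * X q om)" by (rule sum.mono_neutral_left) (auto simp: Suc_le_eq)
   finally show ?case unfolding sph_hs by simp
  qed
 qed
 from hlim_sph_tendsto[OF c' c1, of 0]
 have lim: "Lp_tendsto M 2 ?s (%om. sph \<psi>' (%x. 1) (\<xi> om))"
  by (rule Lp_tendsto_cong[OF ae AE_I2[OF refl], THEN iffD2])
 have \<psi>'L: "L2 M (%om. sph \<psi>' (%x. 1) (\<xi> om))" by (rule sph_L2(1)[OF \<psi>L(2) c1])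
 have "L2 M (ou_operator M W F) \<and> Lp_tendsto M 2 ?s (ou_operator M W F)"
  unfolding ou_operator_def
  by (rule someI[of "%G. L2 M G \<and> Lp_tendsto M 2 ?s G" "%om. sph \<psi>' (%x. 1) (\<xi> om)"]) (rule conjI[OF \<psi>'L lim])
 then show "L2 M (ou_operator M W F)" "AE om in M. ou_operator M W F om = sph \<psi>' (%x. 1) (\<xi> om)"
  using L2_limit_unique[OF sL _ _ \<psi>'L lim] by auto
qed

lemma sph_fubini_mult:
 assumes \<psi>: "L2 gauss \<psi>" and Z: "L2 M Z"
 shows "(LINT om|M. sph \<psi> (%x. 1) (\<xi> om) * Z om) = (LINT x|S. (LINT om|M. \<psi> (lin (\<xi> om) x) * Z om))"
proof -
 have [measurable]: "\<psi> \<in> borel_measurable borel" "Z \<in> borel_measurable M" using \<psi> Z by (auto simp: L2_def)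
 have i1: "integrable (S \<Otimes>\<^sub>M M) (%(x, om). (\<psi> (lin (\<xi> om) x))\<^sup>2 * 1)"
  by (rule sph_fubini(1)) (auto intro: L2_integrable_square[OF \<psi>])
 have i2: "integrable (S \<Otimes>\<^sub>M M) (%(x, om). (Z om)\<^sup>2)"
  using product_integral_mult(1)[OF S.sigma_finite_measure_axioms sigma_finite_measure_axioms, of "%x. 1" "%om. (Z om)\<^sup>2"] L2_integrable_square[OF Z]
  by (simp add: case_prod_unfold)
 have "integrable (S \<Otimes>\<^sub>M M) (%(x, om). \<psi> (lin (\<xi> om) x) * Z om)"
 proof (rule bi_int_bound[OF bi_int_add[OF i1 i2]])
  have "(%p. \<psi> (lin (\<xi> (snd p)) (fst p)) * Z (snd p)) \<in> borel_measurable (S \<Otimes>\<^sub>M M)" by measurable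
  then show "(%(x, om). \<psi> (lin (\<xi> om) x) * Z om) \<in> borel_measurable (S \<Otimes>\<^sub>M M)" by (simp add: case_prod_unfold)
  have le: "\<bar>x * y\<bar> \<le> x\<^sup>2 + y\<^sup>2" for x y :: real
   using sum_squares_bound[of "\<bar>x\<bar>" "\<bar>y\<bar>"] mult_nonneg_nonneg[OF abs_ge_zero abs_ge_zero, of x y] unfolding abs_mult power2_abs by linarith
  show "AE p in S \<Otimes>\<^sub>M M. norm (case p of (x, om) => \<psi> (lin (\<xi> om) x) * Z om) \<le> norm ((case p of (x, om) => (\<psi> (lin (\<xi> om) x))\<^sup>2 * 1) + (case p of (x, om) => (Z om)\<^sup>2))"
   by (rule AE_I2) (use le in \<open>auto simp: case_prod_unfold intro: order_trans\<close>)
 qed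
 from SM.Fubini_integral[OF this] show ?thesis unfolding sph_def by (simp only: mult_1_right integral_mult_left_zero)
qed

text \<open>Two applications of Fubini reduce to the correlation of second Hermite polynomials,
  which is 2 \<rho>^2; its double integral over the sphere is 2 \<mu> A.\<close>

lemma X2_norm: "(LINT om|M. (X 2 om)\<^sup>2) = 2 * \<mu> * A"
proof -
 let ?h = "poly (hermp 2)"
 have hL: "L2 M (%om. ?h (lin (\<xi> om) x))" if "norm x = 1" for x
  using lin_expectation(1)[OF that, of "%z. (?h z)\<^sup>2"] L2_integrable_square[OF L2_gauss_poly] unfolding L2_def by (auto simp: lin_def)
 have in2: "(LINT om|M. ?h (lin (\<xi> om) x) * ?h (lin (\<xi> om) y)) = 2 * (1 * (\<rho> x y)\<^sup>2)" if x: "norm x = 1" and y: "norm y = 1" for x y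
 proof -
  have [measurable]: "wi (dir x) \<in> borel_measurable M" for x using wiener_L2[OF dir_L2] by (simp add: L2_def)
  have "(LINT om|M. ?h (lin (\<xi> om) x) * ?h (lin (\<xi> om) y)) = (LINT om|M. ?h (wi (dir x) om) * ?h (wi (dir y) om))"
   by (rule integral_cong_AE) (simp add: lin_def, simp, use wiener_dir[of x] wiener_dir[of y] in eventually_elim, simp)
  also have "... = fact 2 * (LINT z|S. dir y z * dir x z) ^ 2"
   by (subst hermite_wiener_inner[OF dir_L2 dir_norm[OF x] dir_L2 dir_norm[OF y]]) simp
  finally show ?thesis unfolding dir_inner by (simp add: mult.commute[of "a _ y"] fact_numeral)
 qed
 have "(LINT om|M. (X 2 om)\<^sup>2) = (LINT x|S. (LINT om|M. ?h (lin (\<xi> om) x) * X 2 om))"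
  unfolding power2_eq_square by (rule sph_fubini_mult[OF L2_gauss_poly X_L2])
 also have "... = (LINT x|S. 2 * A)"
 proof (rule bi_cong[OF refl])
  fix x assume "x \<in> space S"
  then have x: "norm x = 1" by simp
  have "(LINT om|M. ?h (lin (\<xi> om) x) * X 2 om) = (LINT y|S. (LINT om|M. ?h (lin (\<xi> om) y) * ?h (lin (\<xi> om) x)))"
   using sph_fubini_mult[OF L2_gauss_poly hL[OF x], of "hermp 2"] by (simp add: mult.commute)
  also have "... = (LINT y|S. 2 * (1 * (\<rho> x y)\<^sup>2))"
   by (intro bi_cong refl) (subst in2, auto simp: x mult.commute)
  also have "... = 2 * A" using a_A[OF x] by simp
  finally show "(LINT om|M. ?h (lin (\<xi> om) x) * X 2 om) = 2 * A" .
 qed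
 also have "... = 2 * \<mu> * A" using S_mass by simp
 finally show ?thesis .
qed

end

section \<open>Scaling of the constants and the final estimates\<close>

lemma hs_cmult: "hs (%q. s * c q) N = smult s (hs c N)"
 unfolding hs_def by (induction N) (simp_all add: smult_add_right)

lemma hs_minus_const: "hs (%q. if q = 0 then 0 else c q) N = hs c N - [:c 0:]"
proof (induction N)
 case (Suc N)
 have h: "hs c (Suc N) = hs c N + smult (c (Suc N) / fact (Suc N)) (hermp (Suc N))" for c by (simp add: hs_def)
 show ?case unfolding h Suc by simp
qed (simp add: hs_def)

lemma shift_funpow: "(shift ^^ k) c q = c (q + k)"
 by (induction k arbitrary: q) (auto simp: shift_def)

lemma rapid_shift_funpow: "rapid c ==> rapid ((shift ^^ k) c)"
 by (induction k) (auto intro: rapid_shift')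

lemma rapid_le:
 assumes "rapid c" and le: "\<And>q. \<bar>c' q\<bar> \<le> K * \<bar>c q\<bar>" and K: "K \<ge> 0"
 shows "rapid c'"
proof (rule rapid_mono[OF assms(1) _ K])
 show "\<bar>c' q\<bar> \<le> K * 2 ^ q * \<bar>c q\<bar>" for q
 proof -
  have "\<bar>c q\<bar> \<le> 2 ^ q * \<bar>c q\<bar>" using mult_right_mono[of 1 "2 ^ q" "\<bar>c q\<bar>"] by simp
  from order_trans[OF le mult_left_mono[OF this K]] show ?thesis by (simp only: mult.assoc)
 qed
qed

lemma rapid_cmult: "rapid c ==> rapid (%q. s * c q)"
 by (rule rapid_le[where K = "\<bar>s\<bar>"]) (auto simp: abs_mult)

text \<open>Homogeneity of degree 2 (n + 1) in the coefficients: the scaling that lets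
  standardization cancel (\<mu> A)^(n + 1).\<close>

lemma mconst_cmult: "mconst n k (%q. s * c q) N = s ^ (2 * Suc n) * mconst n k c N"
proof -
 have sh: "shift (%q. s * c q) = (%q. s * shift c q)" "ninv (%q. s * c q) = (%q. s * ninv c q)" for c
  by (auto simp: shift_def ninv_def)
 show ?thesis unfolding mconst_def Let_def sh hs_cmult poly_smult power_mult_distrib integral_mult_right_zero
  by (simp add: algebra_simps del: power_Suc mult_Suc_right)
qed

context frame
begin

text \<open>The tensor norm is the square root of \<open>Nsum\<close>. Bounding its power n + 1 by 1
  plus the full power n + 1 of \<open>Nsum\<close> covers odd exponents as well, and produces the
  summand 1.\<close>

lemma malliavin_bound:
 assumes c: "hlim c \<psi>" "rapid c" "c 0 = 0" and F: "F \<in> borel_measurable M" "AE om in M. F om = sph \<psi> (%x. 1) (\<xi> om)"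
  and C: "\<And>N. mconst n k ((shift ^^ k) c) N \<le> C" "C \<ge> 0"
 shows "malliavin_dom M W k F" and "malliavin_moment M W k (Suc n) F \<le> ennreal (1 + (\<mu> * A) ^ Suc n * C)"
proof -
 define \<psi>' where "\<psi>' = hermite_series ((shift ^^ k) c)"
 have h: "hlim ((shift ^^ k) c) \<psi>'"
  unfolding hlim_def \<psi>'_def by (intro conjI hermite_series_spec rapid_summable rapid_shift_funpow c)
 have "AE om in M. sph \<psi> (%x. 1) (\<xi> om) = F om" using F(2) by eventually_elim simp
 then have D: "has_malliavin_deriv M W k F (DS k \<psi>')" by (rule has_malliavin_deriv_cong[OF has_malliavin_deriv_sph[OF c(1) h] _ F(1)])
 then show "malliavin_dom M W k F" unfolding malliavin_dom_def by blast
 have [measurable]: "(%om. sph \<psi>' (mon is) (\<xi> om)) \<in> borel_measurable M" for "is"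
  using sph_L2(1)[OF _ mon_cont, of \<psi>'] h by (simp add: hlim_def L2_def)
 have [measurable]: "(%om. Nsum k \<psi>' (\<xi> om)) \<in> borel_measurable M" unfolding Nsum_def by measurable
 have "malliavin_moment M W k (Suc n) F = (\<integral>\<^sup>+om. ennreal (sqrt (Nsum k \<psi>' (\<xi> om)) ^ Suc n) \<partial>M)"
  unfolding malliavin_moment_eq[OF D] tensor_norm_DS ..
 also have "... \<le> (\<integral>\<^sup>+om. 1 + ennreal (Nsum k \<psi>' (\<xi> om) ^ Suc n) \<partial>M)"
 proof (rule nn_integral_mono)
  fix om
  have le: "sqrt x ^ Suc n \<le> 1 + x ^ Suc n" if "x \<ge> 0" for x :: real
  proof (cases "x \<le> 1")
   case True
   then have "sqrt x ^ Suc n \<le> 1" using that by (intro power_le_one) auto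
   moreover have "0 \<le> x ^ Suc n" using that by simp
   ultimately show ?thesis by linarith
  next
   case False
   then have "sqrt x \<le> x" using real_le_lsqrt[of x x] self_le_power[of x 2] by simp
   then have "sqrt x ^ Suc n \<le> x ^ Suc n" using that by (intro power_mono) auto
   then show ?thesis by linarith
  qed
  have "ennreal (sqrt (Nsum k \<psi>' (\<xi> om)) ^ Suc n) \<le> ennreal (1 + Nsum k \<psi>' (\<xi> om) ^ Suc n)"
   by (intro ennreal_leI le Nsum_nonneg)
  then show "ennreal (sqrt (Nsum k \<psi>' (\<xi> om)) ^ Suc n) \<le> 1 + ennreal (Nsum k \<psi>' (\<xi> om) ^ Suc n)"
   using Nsum_nonneg[of k \<psi>' "\<xi> om"] by (simp add: ennreal_plus[symmetric] ennreal_1[symmetric] del: ennreal_1 ennreal_plus power_Suc)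
 qed
 also have "... = 1 + (\<integral>\<^sup>+om. ennreal (Nsum k \<psi>' (\<xi> om) ^ Suc n) \<partial>M)"
  by (subst nn_integral_add) (auto simp: emeasure_space_1)
 also have "... \<le> 1 + ennreal ((\<mu> * A) ^ Suc n * C)"
  by (intro add_left_mono Nsum_limit_moment[OF h _ C(1)]) (simp add: shift_funpow c)
 also have "... = ennreal (1 + (\<mu> * A) ^ Suc n * C)"
  using C(2) A_pos sphere_mass_pos[of d] by (subst ennreal_plus) auto
 finally show "malliavin_moment M W k (Suc n) F \<le> ennreal (1 + (\<mu> * A) ^ Suc n * C)" .
qed

lemma hlim_standard:
 assumes \<phi>: "L2 gauss \<phi>"
 shows "hlim (%q. s * (if q = 0 then 0 else hermite_coeff \<phi> q)) (%z. s * (\<phi> z - hermite_coeff \<phi> 0))"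
proof -
 interpret g: prob_space gauss by (rule prob_space_gauss)
 let ?b = "hermite_coeff \<phi>"
 have k: "L2 gauss (%z. ?b 0)" by (simp add: L2_def)
 have "Lp_tendsto gauss 2 (%N z. poly (hs ?b N) z - ?b 0) (%z. \<phi> z - ?b 0)"
  by (rule L2_tendsto_sub[OF L2_gauss_poly \<phi> hermite_expansion[OF \<phi>] k k Lp_tendsto_const])
 from L2_tendsto_cmult[OF L2_diff[OF L2_gauss_poly k] L2_diff[OF \<phi> k] this, of s]
 moreover have "(%N. poly (hs (%q. s * (if q = 0 then 0 else ?b q)) N)) = (%N z. s * (poly (hs ?b N) z - ?b 0))"
  by (intro ext) (simp add: hs_cmult hs_minus_const)
 ultimately show ?thesis unfolding hlim_def by (intro conjI L2_cmult L2_diff \<phi> k) simp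
qed

text \<open>The factor s is the reciprocal standard deviation. The variance is bounded below by
  testing the centred functional against X 2: their inner product and the norm of X 2 are explicit,
  and Cauchy-Schwarz gives the inequality for s.\<close>

lemma standardized_sph:
 assumes \<phi>: "L2 gauss \<phi>" and b: "hermite_coeff \<phi> 2 \<noteq> 0"
  and T: "(%(x, om). T x om) \<in> borel_measurable (S \<Otimes>\<^sub>M M)" "\<And>x. norm x = 1 ==> AE om in M. T x om = lin (\<xi> om) x"
 defines "F \<equiv> standardized M (sphere_functional \<phi> T)"
 shows "\<exists>s. s\<^sup>2 * ((hermite_coeff \<phi> 2)\<^sup>2 / 2 * (\<mu> * A)) \<le> 1 \<and> L2 M F \<and> (AE om in M. F om = sph (%z. s * (\<phi> z - hermite_coeff \<phi> 0)) (%x. 1) (\<xi> om))"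
proof -
 interpret g: prob_space gauss by (rule prob_space_gauss)
 have c1: "contU (%x::'a. 1::real)" by simp
 let ?b = "hermite_coeff \<phi>"
 define X0 where "X0 = sphere_functional \<phi> T"
 have [measurable]: "\<phi> \<in> borel_measurable borel" using \<phi> by (simp add: L2_def)
 note T(1)[measurable]
 have Tm: "(%p. T (fst p) (snd p)) \<in> borel_measurable (S \<Otimes>\<^sub>M M)" using T(1) by (simp add: case_prod_unfold)
 have "(%(om, x). \<phi> (T x om)) \<in> borel_measurable (M \<Otimes>\<^sub>M S)"
  using measurable_compose[OF measurable_compose[OF measurable_pair_swap' Tm] \<open>\<phi> \<in> borel_measurable borel\<close>]
  by (simp add: case_prod_unfold)
 then have Xm[measurable]: "X0 \<in> borel_measurable M"
  unfolding X0_def sphere_functional_def[abs_def] by (rule S.borel_measurable_lebesgue_integral)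
 define Y where "Y om = sph \<phi> (%x. 1) (\<xi> om)" for om
 define Y0 where "Y0 om = sph (%z. \<phi> z - ?b 0) (%x. 1) (\<xi> om)" for om
 have k: "L2 gauss (%z. t)" for t :: real by (simp add: L2_def)
 have \<phi>0: "L2 gauss (%z. \<phi> z - ?b 0)" by (intro L2_diff \<phi> k)
 have YL: "L2 M Y" "L2 M Y0" unfolding Y_def[abs_def] Y0_def[abs_def] by (intro sph_L2(1) \<phi> \<phi>0 c1)+
 then have [measurable]: "Y \<in> borel_measurable M" "Y0 \<in> borel_measurable M" by (auto simp: L2_def)
 \<comment> \<open>T agrees with the finite expansion almost surely at each fixed point. Joint
   measurability allows the null sets to be exchanged, giving for almost every om agreement at
   almost every point.\<close>
 have XY: "AE om in M. X0 om = Y om"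
 proof -
  have "AE x in S. AE om in M. T x om = lin (\<xi> om) x" by (intro AE_I2 T(2)) simp
  then have "AE om in M. AE x in S. T x om = lin (\<xi> om) x"
  proof (subst (asm) SM.AE_commute)
   have "{p \<in> space (S \<Otimes>\<^sub>M M). T (fst p) (snd p) = lin (\<xi> (snd p)) (fst p)} \<in> sets (S \<Otimes>\<^sub>M M)"
    using Tm by measurable
   then show "{x \<in> space (S \<Otimes>\<^sub>M M). T (fst x) (snd x) = lin (\<xi> (snd x)) (fst x)} \<in> sets (S \<Otimes>\<^sub>M M)" .
  qed simp
  then show ?thesis
  proof (rule AE_mp[OF _ AE_I2], intro impI)
   fix om assume om: "om \<in> space M" and ae: "AE x in S. T x om = lin (\<xi> om) x"
   have [measurable]: "(%x. T x om) \<in> borel_measurable S" using measurable_compose[OF measurable_Pair2'[OF om] Tm] by simp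
   have [measurable]: "(%x. lin (\<xi> om) x) \<in> borel_measurable S" by (rule continuous_sphere_integrable(2)[OF lin_cont])
   have "AE x in S. \<phi> (T x om) = \<phi> (lin (\<xi> om) x)" using ae by (rule eventually_mono) simp
   then show "X0 om = Y om" unfolding X0_def sphere_functional_def Y_def sph_def mult_1_right
    by (intro integral_cong_AE) measurable
  qed
 qed
 have EX: "expectation X0 = ?b 0 * \<mu>"
 proof -
  have "expectation X0 = (LINT om|M. Y om)" by (rule integral_cong_AE[OF _ _ XY]) measurable
  also have "... = ?b 0 * \<mu>"
   unfolding Y_def by (subst sph_fubini(4)) (use S_mass gauss_L2_integrable[OF \<phi>] in \<open>auto simp: hermite_coeff_eq\<close>)
  finally show ?thesis .
 qed
 have X0Y0: "AE om in M. X0 om - expectation X0 = Y0 om"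
  using XY sph_lincomb[OF \<phi> k[of "?b 0"] c1, of 1 "-1"]
 proof eventually_elim
  case (elim om)
  have "sph (%z. ?b 0) (%x. 1) (\<xi> om) = ?b 0 * \<mu>" using S_mass by (simp add: sph_def)
  then show ?case using elim unfolding EX Y_def Y0_def by simp
 qed
 define V where "V = (LINT om|M. (Y0 om)\<^sup>2)"
 have V: "variance X0 = V" unfolding V_def
  by (rule integral_cong_AE) (measurable, use X0Y0 in eventually_elim, simp)
 have pos: "\<mu> * A > 0" using A_pos sphere_mass_pos[of d] by simp
 have h1: "hlim (%q. if q = 0 then 0 else ?b q) (%z. \<phi> z - ?b 0)" using hlim_standard[OF \<phi>, of 1] by simp
 have "(LINT om|M. Y0 om * X 2 om) = ?b 2 / 2 * (LINT om|M. (X 2 om)\<^sup>2)"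
  unfolding Y0_def using chaos_inner[OF h1, of 2 "X 2"] X_chaos[of 2 1] by (simp add: fact_numeral power2_eq_square mult.assoc)
 then have "(LINT om|M. Y0 om * X 2 om) = ?b 2 * (\<mu> * A)" unfolding X2_norm by simp
 with L2_Cauchy_Schwarz[OF YL(2) X_L2[of 2]] have "(?b 2 * (\<mu> * A))\<^sup>2 \<le> V * (2 * \<mu> * A)" unfolding X2_norm V_def by simp
 then have "(\<mu> * A) * ((?b 2)\<^sup>2 / 2 * (\<mu> * A)) \<le> (\<mu> * A) * V" by (simp add: power2_eq_square algebra_simps)
 then have Vge: "(?b 2)\<^sup>2 / 2 * (\<mu> * A) \<le> V" using pos by (simp only: mult_le_cancel_left_pos)
 have "(?b 2)\<^sup>2 / 2 * (\<mu> * A) > 0" using pos b by simp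
 then have Vp: "V > 0" using Vge by linarith
 define s where "s = 1 / sqrt V"
 have s2: "s\<^sup>2 * V = 1" using Vp by (simp add: s_def power_divide)
 have "s\<^sup>2 * ((?b 2)\<^sup>2 / 2 * (\<mu> * A)) \<le> s\<^sup>2 * V" by (intro mult_left_mono Vge) simp
 moreover have Fs: "AE om in M. F om = s * Y0 om"
  using X0Y0 unfolding F_def standardized_def X0_def[symmetric] V by eventually_elim (simp add: s_def)
 moreover have "AE om in M. F om = sph (%z. s * (\<phi> z - ?b 0)) (%x. 1) (\<xi> om)"
  using Fs by eventually_elim (simp only: sph_def Y0_def integral_mult_right_zero mult.assoc)
 moreover have "F \<in> borel_measurable M" unfolding F_def standardized_def[abs_def] X0_def[symmetric] by measurable
 moreover from this Fs have "L2 M F" by (intro L2_cong_AE[OF L2_cmult[OF YL(2)], of s]) (auto elim: eventually_mono)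
 ultimately show ?thesis unfolding s2 by blast
qed

end

theorem proposition3p3:
  fixes d :: nat
    and M :: "'w measure"
    and W :: "'a::euclidean_space set \<Rightarrow> 'w \<Rightarrow> real"
    and T :: "nat \<Rightarrow> 'a \<Rightarrow> 'w \<Rightarrow> real"
    and \<phi> :: "real \<Rightarrow> real"
  assumes "d \<ge> 2" and "DIM('a) = d + 1"
    and "prob_space M" and "white_noise M W"
    and "\<And>l. l \<ge> 1 \<Longrightarrow> harmonic_field M W d l (T l)"
    and "L2 gauss \<phi>" and "assumption_A \<phi>"
  shows "\<forall>k n. n \<ge> 1 \<longrightarrow> (\<exists>C>0.
    (\<forall>l. even l \<and> l \<ge> 2 \<longrightarrow>
       malliavin_dom M W k (standardized M (sphere_functional \<phi> (T l))) \<and>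
       ou_dom M W (standardized M (sphere_functional \<phi> (T l))) \<and>
       malliavin_dom M W k (ou_operator M W (standardized M (sphere_functional \<phi> (T l))))) \<and>
    (SUP l\<in>{l. even l \<and> l \<ge> 2}.
       malliavin_moment M W k n (standardized M (sphere_functional \<phi> (T l)))) \<le> ennreal C \<and>
    (SUP l\<in>{l. even l \<and> l \<ge> 2}.
       malliavin_moment M W k n (ou_operator M W (standardized M (sphere_functional \<phi> (T l)))))
      \<le> ennreal C)"
proof (intro allI impI)
 fix k n :: nat assume "n \<ge> 1"
 then obtain m where n: "n = Suc m" by (cases n) auto
 interpret w: white_noise_space M W d
  using assms(2-4) by (simp add: white_noise_space_def white_noise_space_axioms_def)
 let ?b = "hermite_coeff \<phi>" and ?\<mu> = "sphere_mass d"
 define c where "c q = (if q = 0 then 0 else ?b q)" for q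
 \<comment> \<open>Coefficients of the Ornstein-Uhlenbeck operator applied to the centred
   \<phi>.\<close>
 define c' where "c' q = - (real q * c q)" for q
 have b: "?b 2 \<noteq> 0" using assms(7) by (simp add: assumption_A_def)
 have "rapid ?b" by (rule assumption_A_rapid[OF assms(6,7)])
 then have rc: "rapid c" by (rule rapid_le[where K = 1]) (auto simp: c_def)
 then have rc': "rapid c'"
 proof (rule rapid_mono[where K = 1])
  show "\<bar>c' q\<bar> \<le> 1 * 2 ^ q * \<bar>c q\<bar>" for q
   using of_nat_less_two_power[of q, where 'a = real] by (simp add: c'_def abs_mult mult_right_mono)
 qed simp
 have ex: "\<exists>C\<ge>0. \<forall>N. mconst m k ((shift ^^ k) c) N \<le> C" if "rapid c" for c
  by (intro mconst_bounded rapid_shift_funpow that)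
 from ex[OF rc] obtain C0 where C0: "C0 \<ge> 0" "\<And>N. mconst m k ((shift ^^ k) c) N \<le> C0" by blast
 from ex[OF rc'] obtain C1 where C1: "C1 \<ge> 0" "\<And>N. mconst m k ((shift ^^ k) c') N \<le> C1" by blast
 define \<beta> where "\<beta> = (?b 2)\<^sup>2 / 2"
 have \<beta>: "\<beta> > 0" using b by (simp add: \<beta>_def)
 \<comment> \<open>The 1 comes from \<open>malliavin_bound\<close>, 1 / \<beta> bounds s^2 \<mu> A,
   and C0 and C1 belong to the functional and to its image under the Ornstein-Uhlenbeck
   operator.\<close>
 define C where "C = 1 + (1 / \<beta>) ^ Suc m * (C0 + C1)"
 have main: "malliavin_dom M W k F \<and> ou_dom M W F \<and> malliavin_dom M W k (ou_operator M W F) \<and>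
   malliavin_moment M W k n F \<le> ennreal C \<and> malliavin_moment M W k n (ou_operator M W F) \<le> ennreal C"
  if l: "l \<ge> 2" and F_def: "F = standardized M (sphere_functional \<phi> (T l))" for l F
 proof -
  have l1: "l \<ge> 1" using l by simp
  from w.frame_exists[OF assms(1) l1] obtain r e a A where fr: "frame M W d r e a A"
   and K: "\<And>x. norm x = 1 ==> AE om in M. wiener M W (harmonic_kernel d l x) om = (\<Sum>i<r. a i x * wiener M W (e i) om)" by blast
  interpret frame M W d r e a A by (rule fr)
  have hf: "harmonic_field M W d l (T l)" by (rule assms(5)[OF l1])
  have Tx: "AE om in M. T l x om = lin (\<xi> om) x" if x: "norm x = 1" for x
  proof -
   have "AE om in M. T l x om = wiener M W (harmonic_kernel d l x) om" using hf x by (simp add: harmonic_field_def)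
   then show ?thesis using K[OF x] by eventually_elim (simp add: lin_def \<xi>_def)
  qed
  have Tm: "(%(x, om). T l x om) \<in> borel_measurable (sphere_measure \<Otimes>\<^sub>M M)" using hf by (simp add: harmonic_field_def)
  from standardized_sph[OF assms(6) b Tm Tx] obtain s where s: "s\<^sup>2 * (\<beta> * (?\<mu> * A)) \<le> 1" and F: "L2 M F"
    "AE om in M. F om = sph (%z. s * (\<phi> z - ?b 0)) (%x. 1) (\<xi> om)" unfolding F_def \<beta>_def by blast
  let ?\<psi> = "%z. s * (\<phi> z - ?b 0)"
  have h: "hlim (%q. s * c q) ?\<psi>" unfolding c_def by (rule hlim_standard[OF assms(6)])
  define \<psi>' where "\<psi>' = hermite_series (%q. s * c' q)"
  have h': "hlim (%q. s * c' q) \<psi>'"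
   unfolding hlim_def \<psi>'_def by (intro conjI hermite_series_spec rapid_summable rapid_cmult rc')
  have "(%q. s * c' q) = (%q. - (real q * (s * c q)))" by (intro ext) (simp add: c'_def)
  with h' have h'': "hlim (%q. - (real q * (s * c q))) \<psi>'" by simp
  note ou = sph_ou[OF h rapid_cmult[OF rc] F h'']
  have pos: "?\<mu> * A > 0" using A_pos sphere_mass_pos[of d] by simp
  have shs: "(shift ^^ k) (%q. s * c q) = (%q. s * (shift ^^ k) c q)" for c by (auto simp: shift_funpow)
  \<comment> \<open>Serves both functionals. Scaling by s multiplies \<open>mconst\<close> by s^(2
    (m + 1)); together with (\<mu> A)^(m + 1) this is a power of s^2 \<mu> A \<le> 1 / \<beta>, so A
    and the degree disappear.\<close>
  have fin: "malliavin_dom M W k G \<and> malliavin_moment M W k n G \<le> ennreal C"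
   if "hlim (%q. s * f q) g" "rapid f" "f 0 = 0" "L2 M G" "AE om in M. G om = sph g (%x. 1) (\<xi> om)"
    "\<And>N. mconst m k ((shift ^^ k) f) N \<le> D" "D \<ge> 0" "D \<le> C0 + C1" for f g G D
  proof -
   have bd: "mconst m k ((shift ^^ k) (%q. s * f q)) N \<le> s ^ (2 * Suc m) * D" for N
    unfolding shs mconst_cmult by (intro mult_left_mono that(6)) (simp only: power_mult zero_le_power zero_le_power2)
   have nn: "s ^ (2 * Suc m) * D \<ge> 0" using that(7) by (simp only: power_mult zero_le_power zero_le_power2 mult_nonneg_nonneg)
   have Gm: "G \<in> borel_measurable M" using that(4) by (simp add: L2_def)
   have "(?\<mu> * A) ^ Suc m * (s ^ (2 * Suc m) * D) = (s\<^sup>2 * (?\<mu> * A)) ^ Suc m * D"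
    unfolding power_mult[of s 2 "Suc m"] by (simp only: power_mult_distrib mult_ac)
   also have "... \<le> (1 / \<beta>) ^ Suc m * D"
   proof (intro mult_right_mono power_mono that(7))
    show "s\<^sup>2 * (?\<mu> * A) \<le> 1 / \<beta>" using s \<beta> by (simp add: field_simps)
    show "0 \<le> s\<^sup>2 * (?\<mu> * A)" using pos by (intro mult_nonneg_nonneg[OF zero_le_power2]) simp
   qed
   also have "... \<le> (1 / \<beta>) ^ Suc m * (C0 + C1)" using \<beta> that(8) by (intro mult_left_mono) auto
   finally have "ennreal (1 + (?\<mu> * A) ^ Suc m * (s ^ (2 * Suc m) * D)) \<le> ennreal C" by (intro ennreal_leI) (simp add: C_def)
   with malliavin_bound[OF that(1) rapid_cmult[OF that(2)] _ Gm that(5) bd nn] that(3) show ?thesis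
    unfolding n by (auto intro: order_trans)
  qed
  have "malliavin_dom M W k F \<and> malliavin_moment M W k n F \<le> ennreal C"
   by (rule fin[OF h rc _ F C0(2) C0(1)]) (use C1 in \<open>auto simp: c_def\<close>)
  moreover have "malliavin_dom M W k (ou_operator M W F) \<and> malliavin_moment M W k n (ou_operator M W F) \<le> ennreal C"
   by (rule fin[OF h' rc' _ ou(2,3) C1(2) C1(1)]) (use C0 in \<open>auto simp: c'_def\<close>)
  ultimately show ?thesis using ou(1) by blast
 qed
 have "C > 0" using \<beta> C0(1) C1(1) unfolding C_def by (intro add_pos_nonneg mult_nonneg_nonneg) auto
 then show "\<exists>C>0.
  (\<forall>l. even l \<and> l \<ge> 2 \<longrightarrow>
   malliavin_dom M W k (standardized M (sphere_functional \<phi> (T l))) \<and>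
   ou_dom M W (standardized M (sphere_functional \<phi> (T l))) \<and>
   malliavin_dom M W k (ou_operator M W (standardized M (sphere_functional \<phi> (T l))))) \<and>
  (SUP l\<in>{l. even l \<and> l \<ge> 2}.
   malliavin_moment M W k n (standardized M (sphere_functional \<phi> (T l)))) \<le> ennreal C \<and>
  (SUP l\<in>{l. even l \<and> l \<ge> 2}.
   malliavin_moment M W k n (ou_operator M W (standardized M (sphere_functional \<phi> (T l)))))
   \<le> ennreal C"
  using main[OF _ refl] by (intro exI[of _ C] conjI SUP_least) auto
qed

end
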